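(* Let $n\geq 2$ and let $\phi:(0,\infty)\to\mathbb{R}$ be smooth. Let $u_0\in L^2(\mathbb{R}^n)$ be spherically symmetric and $k\in\mathbb{Z}$. (i) If $\phi$ satisfies (H1) and (H2), then for every $q$ with $\frac{2n}{n-1}<q\leq\infty$, $$\|S_\phi(t)P_k u_0\|_{L^q_{t,x}(\mathbb{R}\times\mathbb{R}^n)}\lesssim 2^{(\frac{n}{2}-\frac{n+m(k)}{q})k}\|u_0\|_{L^2}.$$ (ii) If $\phi$ satisfies (H1), (H2), (H3) and (H4), then for every $q$ with $\frac{4n+2}{2n-1}\leq q\leq 6$, $$\|S_\phi(t)P_k u_0\|_{L^q_{t,x}(\mathbb{R}\times\mathbb{R}^n)}\lesssim 2^{(\frac{n}{2}-\frac{n+m(k)}{q})k+(\frac14-\frac{1}{2q})(m(k)-\alpha(k))k}\|u_0\|_{L^2}.$$ Here the implicit constants depend on $n,q,\phi$ but not on $k$ or $u_0$. Moreover the ranges of $q$ are optimal in the sense that the estimate in (i) does not hold in general (i.e. not for every $\phi$ satisfying the hypotheses) when $q\leq\frac{2n}{n-1}$, and the estimate in (ii) does not hold in general when $q<\frac{4n+2}{2n-1}$.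
   Context: Let $\Phi:\mathbb{R}\to[0,1]$ be a smooth even function with support in $\{|x|\leq 2\}$ and $\Phi(x)=1$ for $|x|\leq 1$; put $\psi(x)=\Phi(x)-\Phi(2x)$. For $k\in\mathbb{Z}$, $P_k$ is the Littlewood–Paley projector $\widehat{P_kf}(\xi)=\psi(2^{-k}|\xi|)\hat f(\xi)$. $S_\phi(t)=e^{it\phi(\sqrt{-\Delta})}$ is the Fourier multiplier $\widehat{S_\phi(t)f}(\xi)=e^{it\phi(|\xi|)}\hat f(\xi)$. Hypotheses on $\phi$: (H1) there is $m_1>0$ with $|\phi'(r)|\sim r^{m_1-1}$ and $|\phi^{(\alpha)}(r)|\lesssim r^{m_1-\alpha}$ for all integers $\alpha\geq2$, for $r\geq1$; (H2) there is $m_2>0$ with $|\phi'(r)|\sim r^{m_2-1}$ and $|\phi^{(\alpha)}(r)|\lesssim r^{m_2-\alpha}$ for all integers $\alpha\geq2$, for $0<r<1$; (H3) there is $\alpha_1$ with $|\phi''(r)|\sim r^{\alpha_1-2}$ for $r\geq1$; (H4) there is $\alpha_2$ with $|\phi''(r)|\sim r^{\alpha_2-2}$ for $0<r<1$. Set $m(k)=m_1$, $\alpha(k)=\alpha_1$ for $k\geq0$ and $m(k)=m_2$, $\alpha(k)=\alpha_2$ for $k<0$. $A\lesssim B$ means $A\leq CB$ for a constant $C$, and $A\sim B$ means $A\lesssim B\lesssim A$. *)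

theory Defs
  imports "HOL-Analysis.Analysis"
begin

definition smooth_real_on :: "real set \<Rightarrow> (real \<Rightarrow> real) \<Rightarrow> bool" where
  "smooth_real_on S f \<longleftrightarrow> (\<forall>j::nat. \<forall>x\<in>S. ((deriv ^^ j) f) differentiable (at x))"

definition cutoff :: "(real \<Rightarrow> real) \<Rightarrow> bool" where
  "cutoff Phi \<longleftrightarrow> smooth_real_on UNIV Phi \<and> (\<forall>x. Phi (-x) = Phi x)
     \<and> (\<forall>x. 0 \<le> Phi x \<and> Phi x \<le> 1) \<and> (\<forall>x. 2 < \<bar>x\<bar> \<longrightarrow> Phi x = 0)
     \<and> (\<forall>x. \<bar>x\<bar> \<le> 1 \<longrightarrow> Phi x = 1)"

definition psi :: "(real \<Rightarrow> real) \<Rightarrow> real \<Rightarrow> real" where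
  "psi Phi x = Phi x - Phi (2 * x)"

text \<open>Hypotheses (H1)-(H4) on phi (only its values on (0,infinity) matter).\<close>
definition H1 :: "(real \<Rightarrow> real) \<Rightarrow> real \<Rightarrow> bool" where
  "H1 phi m1 \<longleftrightarrow> 0 < m1 \<and>
     (\<exists>c C. 0 < c \<and> 0 < C \<and> (\<forall>r\<ge>1. c * r powr (m1 - 1) \<le> \<bar>deriv phi r\<bar>
                                   \<and> \<bar>deriv phi r\<bar> \<le> C * r powr (m1 - 1))) \<and>
     (\<forall>a::nat. 2 \<le> a \<longrightarrow> (\<exists>C. \<forall>r\<ge>1. \<bar>(deriv ^^ a) phi r\<bar> \<le> C * r powr (m1 - real a)))"

definition H2 :: "(real \<Rightarrow> real) \<Rightarrow> real \<Rightarrow> bool" where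
  "H2 phi m2 \<longleftrightarrow> 0 < m2 \<and>
     (\<exists>c C. 0 < c \<and> 0 < C \<and> (\<forall>r. 0 < r \<and> r < 1 \<longrightarrow> c * r powr (m2 - 1) \<le> \<bar>deriv phi r\<bar>
                                   \<and> \<bar>deriv phi r\<bar> \<le> C * r powr (m2 - 1))) \<and>
     (\<forall>a::nat. 2 \<le> a \<longrightarrow> (\<exists>C. \<forall>r. 0 < r \<and> r < 1 \<longrightarrow> \<bar>(deriv ^^ a) phi r\<bar> \<le> C * r powr (m2 - real a)))"

definition H3 :: "(real \<Rightarrow> real) \<Rightarrow> real \<Rightarrow> bool" where
  "H3 phi a1 \<longleftrightarrow> (\<exists>c C. 0 < c \<and> 0 < C \<and> (\<forall>r\<ge>1. c * r powr (a1 - 2) \<le> \<bar>deriv (deriv phi) r\<bar>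
                                   \<and> \<bar>deriv (deriv phi) r\<bar> \<le> C * r powr (a1 - 2)))"

definition H4 :: "(real \<Rightarrow> real) \<Rightarrow> real \<Rightarrow> bool" where
  "H4 phi a2 \<longleftrightarrow> (\<exists>c C. 0 < c \<and> 0 < C \<and> (\<forall>r. 0 < r \<and> r < 1 \<longrightarrow> c * r powr (a2 - 2) \<le> \<bar>deriv (deriv phi) r\<bar>
                                   \<and> \<bar>deriv (deriv phi) r\<bar> \<le> C * r powr (a2 - 2)))"

definition sel :: "int \<Rightarrow> real \<Rightarrow> real \<Rightarrow> real" where
  "sel k a b = (if 0 \<le> k then a else b)"

definition L2 :: "('a::euclidean_space \<Rightarrow> complex) \<Rightarrow> bool" where
  "L2 u \<longleftrightarrow> u \<in> borel_measurable lborel \<and> integrable lborel (\<lambda>x. (norm (u x))\<^sup>2)"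

definition L2norm :: "('a::euclidean_space \<Rightarrow> complex) \<Rightarrow> real" where
  "L2norm u = sqrt (\<integral>x. (norm (u x))\<^sup>2 \<partial>lborel)"

definition radial :: "('a::euclidean_space \<Rightarrow> complex) \<Rightarrow> bool" where
  "radial u \<longleftrightarrow> (\<forall>x y. norm x = norm y \<longrightarrow> u x = u y)"

definition fourier_L1 :: "('a::euclidean_space \<Rightarrow> complex) \<Rightarrow> 'a \<Rightarrow> complex" where
  "fourier_L1 h \<xi> = (\<integral>x. exp (- (\<i> * complex_of_real (x \<bullet> \<xi>))) * h x \<partial>lborel)"

definition is_L2_fourier :: "('a::euclidean_space \<Rightarrow> complex) \<Rightarrow> ('a \<Rightarrow> complex) \<Rightarrow> bool" where
  "is_L2_fourier u g \<longleftrightarrow> L2 g \<and>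
     ((\<lambda>R::real. \<integral>\<^sup>+\<xi>. ennreal ((norm (g \<xi> - fourier_L1 (\<lambda>x. indicator (cball 0 R) x * u x) \<xi>))\<^sup>2) \<partial>lborel)
        \<longlongrightarrow> 0) at_top"

text \<open>(S_phi(t) P_k u0)(x), where g is the Fourier transform of u0.  Since psi(2^-k |xi|) g(xi)
  is integrable, this is given by the absolutely convergent inverse Fourier integral.\<close>
definition sol :: "(real \<Rightarrow> real) \<Rightarrow> (real \<Rightarrow> real) \<Rightarrow> int \<Rightarrow> ('a::euclidean_space \<Rightarrow> complex)
                    \<Rightarrow> real \<Rightarrow> 'a \<Rightarrow> complex" where
  "sol Phi phi k g t x = complex_of_real ((2 * pi) powr (- real DIM('a))) *
     (\<integral>\<xi>. exp (\<i> * complex_of_real (x \<bullet> \<xi> + t * phi (norm \<xi>)))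
            * complex_of_real (psi Phi (2 powr (- real_of_int k) * norm \<xi>)) * g \<xi> \<partial>lborel)"

definition recip :: "ereal \<Rightarrow> real" where
  "recip q = (if q = \<infinity> then 0 else 1 / real_of_ereal q)"

definition Lq_bound :: "ereal \<Rightarrow> (real \<Rightarrow> 'a::euclidean_space \<Rightarrow> complex) \<Rightarrow> real \<Rightarrow> bool" where
  "Lq_bound q w B \<longleftrightarrow>
     (if q = \<infinity> then (AE z in (lborel :: (real \<times> 'a) measure). norm (w (fst z) (snd z)) \<le> B)
      else 0 \<le> B \<and> (\<integral>\<^sup>+z. ennreal (norm (w (fst z) (snd z)) powr real_of_ereal q)
                   \<partial>(lborel :: (real \<times> 'a) measure)) \<le> ennreal (B powr real_of_ereal q))"

end

theory Submission imports Defs "HOL-Probability.Probability" begin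

text \<open>
  A radial datum reduces \<open>P_k S_phi\<close>, after rescaling to unit frequency and writing
  \<open>Phi s = phi (2^k s)\<close>, \<open>r = 2^k |x|\<close>, to the one-dimensional oscillatory integral
  \<open>V(t, r) = int_{1/2}^2 e^{i t Phi(s)} J(r s) h(s) ds\<close>, where \<open>J\<close> is a Bessel-type function of
  size \<open>(1 + l)^{-(n-1)/2}\<close>. For fixed \<open>r\<close>, Plancherel in \<open>t\<close> and the trivial sup bound give
  \<open>|V(., r)|_{L^q_t} <= C (1 + r)^{-(n-1)/2}\<close>, which is in \<open>L^q_x\<close> exactly when \<open>q > 2n/(n-1)\<close>.
  With curvature of \<open>phi\<close>, one keeps the oscillation \<open>e^{+-i r s}\<close> of \<open>J\<close>: van der Corput bounds the
  kernel \<open>int e^{i(t Phi(s) + R s)} ds\<close> by \<open>|R|^{-1/2}\<close>, Marcinkiewicz interpolation turns this into an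
  \<open>L^{q'}_t -> L^q_t\<close> bound, and a Stein--Weiss inequality in \<open>r\<close> yields the wider range of \<open>q\<close>.
  Gaussian data for \<open>phi(r) = r\<close> and \<open>phi(r) = r + sqrt r\<close> concentrate near the light cone
  \<open>|2^k t - r| <= 1/16\<close>, there \<open>|V|\<close> is at least a multiple of \<open>r^{-(n-1)/2}\<close>, up to \<open>r\<close> of
  order \<open>2^{k/2}\<close> in the second case; this rules out the remaining \<open>q\<close>.
\<close>

text \<open>Three points decide the form of the proof. (a) A transform \<open>g\<close> of a radial
  datum is determined only almost everywhere and need not be a function of
  \<open>norm \<xi>\<close>. The estimates are therefore proved for transforms of data cut off to
  balls, which are radial at every point, and pass to \<open>g\<close> as limits. (b) Plancherel
  takes the form of an L^2 bound for maps that expand distances. The expansion constant of the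
  phase, comparable to 2^(k m(k)), then carries the factor 2^(-k m(k)/q). (c) The weight exponent
  \<beta> = 3/2 - q/4 is forced by homogeneity: a bilinear form with kernel (r s)^(-\<beta>/q) |r -
  s|^(-(1/2 - 1/q)) can be bounded on L^p, 1/p = 1 - 1/q, only if 2 \<beta>/q + 1/2 - 1/q = 2/q.
  Radial decay supplies the weight r^((n-1)(1 - q/2)), which is at most r^(-\<beta>) for all r >= 1
  exactly when q >= (4n+2)/(2n-1). At q = 6 the exponent \<beta> vanishes and the argument stops,
  but 6 > 2n/(n-1) and part (i) takes over.\<close>

abbreviation nn_integral_lborel :: "('a::euclidean_space => ennreal) => ennreal" (binder "NNINT " 10)
  where "nn_integral_lborel \<equiv> nn_integral lborel"

section \<open>Gaussians and Plancherel\<close>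

lemma borel_measurable_cis [measurable]: "cis \<in> borel_measurable borel"
  by (intro borel_measurable_continuous_onI continuous_intros)

lemma borel_measurable_cnj [measurable]: "cnj \<in> borel_measurable borel"
  by (intro borel_measurable_continuous_onI continuous_intros)

text \<open>The characteristic function of the standard normal distribution, rescaled by
  \<open>e\<close>. Later \<open>e\<close> tends to 0 and the Gaussian serves as a convergence
  factor.\<close>

lemma gauss_1:
  fixes e t :: real assumes e: "0 < e"
  shows "integrable lborel (%x. cis (t * x) * of_real (exp (- (e * x)\<^sup>2 / 2)))"
    and "(LBINT x. cis (t * x) * of_real (exp (- (e * x)\<^sup>2 / 2))) = of_real (sqrt (2 * pi) / e * exp (- (t / e)\<^sup>2 / 2))"
proof -
  let ?f = "%t x. cis (t * x) * complex_of_real (exp (- x\<^sup>2 / 2))"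
  have i: "integrable lborel (?f t)" for t
  proof (rule Bochner_Integration.integrable_bound)
    show "integrable lborel (%x. sqrt (2 * pi) * std_normal_density x)"
      by (intro integrable_mult_right integrable_normal_density) simp
    show "AE x in lborel. norm (?f t x) <= norm (sqrt (2 * pi) * std_normal_density x)"
      by (auto simp: norm_mult std_normal_density_def)
  qed simp
  have v: "(LBINT x. ?f t x) = of_real (sqrt (2 * pi) * exp (- t\<^sup>2 / 2))" for t
  proof -
    have "complex_of_real (exp (- t\<^sup>2 / 2)) = char std_normal_distribution t"
      using fun_cong[OF char_std_normal_distribution, of t] by simp
    also have "... = (LBINT x. std_normal_density x *\<^sub>R iexp (t * x))"
      unfolding char_def by (subst integral_density) auto
    also have "... = (LBINT x. of_real (1 / sqrt (2 * pi)) * ?f t x)"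
      by (intro Bochner_Integration.integral_cong)
         (auto simp: std_normal_density_def scaleR_conv_of_real cis_conv_exp)
    also have "... = of_real (1 / sqrt (2 * pi)) * (LBINT x. ?f t x)" by simp
    finally show ?thesis by (simp add: field_simps)
  qed
  have eq: "cis (t * x) * complex_of_real (exp (- (e * x)\<^sup>2 / 2)) = ?f (t / e) (0 + e * x)" for x
    using e by simp
  show "integrable lborel (%x. cis (t * x) * of_real (exp (- (e * x)\<^sup>2 / 2)))"
    unfolding eq using lborel_integrable_real_affine[OF i[of "t/e"], of e 0] e by simp
  show "(LBINT x. cis (t * x) * of_real (exp (- (e * x)\<^sup>2 / 2))) = of_real (sqrt (2 * pi) / e * exp (- (t / e)\<^sup>2 / 2))"
    unfolding eq using lborel_integral_real_affine[of e "?f (t/e)" 0] v[of "t/e"] e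
    by (simp add: scaleR_conv_of_real field_simps)
qed

text \<open>Character and Gaussian both split into products over the coordinates, so this is a
  product of copies of \<open>gauss_1\<close>.\<close>

lemma gauss_n:
  fixes \<xi> :: "'a::euclidean_space" and e :: real assumes e: "0 < e"
  shows "integrable lborel (%x::'a. cis (x \<bullet> \<xi>) * of_real (exp (- (e * norm x)\<^sup>2 / 2)))"
    and "(LBINT x. cis (x \<bullet> \<xi>) * of_real (exp (- (e * norm x)\<^sup>2 / 2)))
       = of_real ((sqrt (2 * pi) / e) ^ DIM('a) * exp (- (norm \<xi> / e)\<^sup>2 / 2))"
proof -
  let ?g = "%b x. cis ((\<xi> \<bullet> b) * x) * complex_of_real (exp (- (e * x)\<^sup>2 / 2))"
  interpret product_sigma_finite "%_::'a. lborel :: real measure" by standard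
  have nrm: "(norm x)\<^sup>2 = (\<Sum>b\<in>Basis. (x \<bullet> b)\<^sup>2)" for x :: 'a
    by (simp add: norm_eq_sqrt_inner euclidean_inner[of x x] power2_eq_square sum_nonneg)
  have cis_sum: "cis (sum f A) = (\<Prod>i\<in>A. cis (f i))" if "finite A" for f :: "'a => real" and A
    using that by induction (auto simp: cis_mult[symmetric])
  have p: "cis ((\<Sum>b\<in>Basis. f b *\<^sub>R b) \<bullet> \<xi>) * complex_of_real (exp (- (e * norm (\<Sum>b\<in>Basis. f b *\<^sub>R b :: 'a))\<^sup>2 / 2))
     = (\<Prod>b\<in>Basis. ?g b (f b))" for f
  proof -
    have b: "(\<Sum>b\<in>Basis. f b *\<^sub>R b) \<bullet> (b::'a) = f b" if "b \<in> Basis" for b using that by simp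
    have 1: "(\<Sum>b\<in>Basis. f b *\<^sub>R b) \<bullet> \<xi> = (\<Sum>b\<in>Basis. (\<xi> \<bullet> b) * f b)"
      by (simp add: inner_sum_left inner_commute[of \<xi>] mult.commute)
    have 2: "- (e * norm (\<Sum>b\<in>Basis. f b *\<^sub>R b :: 'a))\<^sup>2 / 2 = (\<Sum>b\<in>Basis. - (e * f b)\<^sup>2 / 2)"
      unfolding power_mult_distrib nrm by (simp add: b sum_distrib_left sum_divide_distrib sum_negf)
    show ?thesis unfolding 1 2 by (simp add: cis_sum exp_sum prod.distrib)
  qed
  have m: "(%f. \<Sum>b\<in>Basis. f b *\<^sub>R b :: 'a) \<in> measurable (\<Pi>\<^sub>M b\<in>Basis. lborel) borel" by measurable
  have m2: "(%x::'a. cis (x \<bullet> \<xi>) * complex_of_real (exp (- (e * norm x)\<^sup>2 / 2))) \<in> borel_measurable borel" by measurable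
  show "integrable lborel (%x::'a. cis (x \<bullet> \<xi>) * of_real (exp (- (e * norm x)\<^sup>2 / 2)))"
    apply (subst lborel_eq)
    apply (subst integrable_distr_eq[OF m m2])
    unfolding p
    by (intro product_integrable_prod gauss_1 e) simp
  have "(LBINT x. cis (x \<bullet> \<xi>) * complex_of_real (exp (- (e * norm x)\<^sup>2 / 2))) = (\<Prod>b\<in>Basis. \<integral>x. ?g b x \<partial>lborel)"
    apply (subst lborel_eq)
    apply (subst integral_distr[OF m m2])
    unfolding p
    by (intro product_integral_prod gauss_1 e) simp
  also have "... = (\<Prod>b\<in>Basis. of_real (sqrt (2 * pi) / e * exp (- ((\<xi> \<bullet> b) / e)\<^sup>2 / 2)))"
    by (intro prod.cong refl gauss_1 e)
  also have "... = of_real (\<Prod>b\<in>(Basis :: 'a set). sqrt (2 * pi) / e * exp (- ((\<xi> \<bullet> b) / e)\<^sup>2 / 2))"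
    by (rule of_real_prod[symmetric])
  also have "(\<Prod>b\<in>(Basis :: 'a set). sqrt (2 * pi) / e * exp (- ((\<xi> \<bullet> b) / e)\<^sup>2 / 2)) = (sqrt (2 * pi) / e) ^ DIM('a) * exp (- (norm \<xi> / e)\<^sup>2 / 2)"
  proof -
    have "- (norm \<xi> / e)\<^sup>2 / 2 = (\<Sum>b\<in>Basis. - ((\<xi> \<bullet> b) / e)\<^sup>2 / 2)"
      unfolding power_divide nrm by (simp add: sum_divide_distrib sum_negf)
    then show ?thesis by (simp only: prod.distrib exp_sum[OF finite_Basis] prod_constant)
  qed
  finally show "(LBINT x. cis (x \<bullet> \<xi>) * of_real (exp (- (e * norm x)\<^sup>2 / 2)))
       = of_real ((sqrt (2 * pi) / e) ^ DIM('a) * exp (- (norm \<xi> / e)\<^sup>2 / 2))" .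
qed

lemma gauss_n_real:
  fixes e :: real assumes e: "0 < e"
  shows "integrable lborel (%x::'a::euclidean_space. exp (- (e * norm x)\<^sup>2 / 2))"
    and "(integral\<^sup>L lborel (%x::'a. exp (- (e * norm x)\<^sup>2 / 2))) = (sqrt (2 * pi) / e) ^ DIM('a)"
proof -
  show i: "integrable lborel (%x::'a. exp (- (e * norm x)\<^sup>2 / 2))"
    using integrable_Re[OF gauss_n(1)[OF e, of "0::'a"]] by (simp del: of_real_exp)
  have "complex_of_real (integral\<^sup>L lborel (%x::'a. exp (- (e * norm x)\<^sup>2 / 2))) = of_real ((sqrt (2 * pi) / e) ^ DIM('a))"
    using gauss_n(2)[OF e, of "0::'a"] by (simp only: integral_complex_of_real[symmetric]) simp
  then show "(integral\<^sup>L lborel (%x::'a. exp (- (e * norm x)\<^sup>2 / 2))) = (sqrt (2 * pi) / e) ^ DIM('a)"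
    by (simp only: of_real_eq_iff)
qed

lemma integrable_pair_mult:
  fixes f :: "'a::euclidean_space => complex" and g :: "'b::euclidean_space => complex"
  assumes f: "integrable lborel f" and g: "integrable lborel g"
  shows "integrable (lborel \<Otimes>\<^sub>M lborel) (%z. f (fst z) * g (snd z))"
proof (rule lborel_pair.Fubini_integrable)
  have [measurable]: "f \<in> borel_measurable borel" "g \<in> borel_measurable borel" using f g by auto
  show "(%z. f (fst z) * g (snd z)) \<in> borel_measurable (lborel \<Otimes>\<^sub>M lborel)" by measurable
  show "integrable lborel (%x. \<integral>y. norm (f (fst (x, y)) * g (snd (x, y))) \<partial>lborel)"
    using f by (simp add: norm_mult)
  show "AE x in lborel. integrable lborel (%y. f (fst (x, y)) * g (snd (x, y)))"
    using g by simp
qed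

text \<open>Writing the square as a double integral and integrating in \<open>\<xi>\<close> first
  produces the positive kernel \<open>G (\<Phi> x - \<Phi> y)\<close>. By \<open>lo\<close> it is
  dominated by a convolution kernel \<open>Q (x - y)\<close> whose mass does not depend on
  \<open>e\<close>, and Schur's test concludes. Expansion of distances thus replaces a change of
  variables.\<close>

lemma L2_bound_gauss:
  fixes \<Phi> :: "'a::euclidean_space => 'a" and H :: "'a => complex"
  assumes H: "integrable lborel H" and H2: "integrable lborel (%x. (norm (H x))\<^sup>2)"
    and \<Phi>[measurable]: "\<Phi> \<in> borel_measurable borel" and c: "0 < c" and e: "0 < e"
    and lo: "\<And>x y. H x \<noteq> 0 ==> H y \<noteq> 0 ==> c * norm (x - y) <= norm (\<Phi> x - \<Phi> y)"
  shows "(NNINT \<xi>. ennreal (exp (- (e * norm \<xi>)\<^sup>2 / 2) * (norm (LBINT x. cis (\<Phi> x \<bullet> \<xi>) * H x))\<^sup>2))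
     <= ennreal ((2 * pi / c) ^ DIM('a) * (LBINT x. (norm (H x))\<^sup>2))"
proof -
  have [measurable]: "H \<in> borel_measurable borel" using H by auto
  define h where "h \<xi> = (LBINT x. cis (\<Phi> x \<bullet> \<xi>) * H x)" for \<xi>
  define g where "g \<xi> = exp (- (e * norm \<xi>)\<^sup>2 / 2)" for \<xi> :: 'a
  have [measurable]: "g \<in> borel_measurable borel" unfolding g_def by measurable
  have gi: "integrable lborel g" unfolding g_def by (rule gauss_n_real(1)[OF e])
  have [measurable]: "h \<in> borel_measurable borel" unfolding h_def by measurable
  have hi: "integrable lborel (%x. cis (\<Phi> x \<bullet> \<xi>) * H x)" for \<xi>
    by (rule Bochner_Integration.integrable_bound[OF H]) (auto simp: norm_mult)
  let ?P = "lborel \<Otimes>\<^sub>M lborel :: ('a \<times> 'a) measure"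
  interpret P: sigma_finite_measure ?P by (simp add: lborel_prod sigma_finite_lborel)
  interpret T: pair_sigma_finite "lborel :: 'a measure" ?P ..
  let ?F = "%\<xi> z. cis (\<Phi> (fst z) \<bullet> \<xi>) * H (fst z) * cnj (cis (\<Phi> (snd z) \<bullet> \<xi>) * H (snd z))"
  have hh: "of_real ((norm (h \<xi>))\<^sup>2) = (\<integral>z. ?F \<xi> z \<partial>?P)" for \<xi>
  proof -
    have "(\<integral>z. ?F \<xi> z \<partial>?P) = (LBINT x. (LBINT y. ?F \<xi> (x, y)))"
      by (rule lborel_pair.integral_fst'[symmetric])
         (rule integrable_pair_mult[OF hi integrable_cnj[OF hi]])
    also have "... = h \<xi> * cnj (h \<xi>)" by (simp only: fst_conv snd_conv integral_mult_right_zero integral_mult_left_zero Bochner_Integration.integral_cnj h_def)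
    finally show ?thesis by (simp only: complex_norm_square)
  qed
  \<comment> \<open>This is what the Gaussian weight is for: without it the triple integral in
    \<open>\<xi>\<close>, \<open>x\<close> and \<open>y\<close> would in general not converge
    absolutely.\<close>
  have tri: "integrable (lborel \<Otimes>\<^sub>M ?P) (%(\<xi>, z). of_real (g \<xi>) * ?F \<xi> z)"
  proof (rule Bochner_Integration.integrable_bound)
    have "integrable ?P (%z. norm (H (fst z) * H (snd z)))" by (intro integrable_norm integrable_pair_mult H)
    then show "integrable (lborel \<Otimes>\<^sub>M ?P) (%(\<xi>, z). g \<xi> * norm (H (fst z) * H (snd z)))"
      using gi by (intro T.Fubini_integrable) (auto simp: norm_mult abs_mult)
    show "(%(\<xi>, z). of_real (g \<xi>) * ?F \<xi> z) \<in> borel_measurable (lborel \<Otimes>\<^sub>M ?P)" by measurable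
    show "AE x in lborel \<Otimes>\<^sub>M ?P. norm (case x of (\<xi>, z) => of_real (g \<xi>) * ?F \<xi> z)
       <= norm (case x of (\<xi>, z) => g \<xi> * norm (H (fst z) * H (snd z)))"
      by (auto simp: norm_mult abs_mult)
  qed
  define G where "G y = (sqrt (2 * pi) / e) ^ DIM('a) * exp (- (norm y / e)\<^sup>2 / 2)" for y :: 'a
  have inner: "(LBINT \<xi>. of_real (g \<xi>) * ?F \<xi> z) = H (fst z) * cnj (H (snd z)) * of_real (G (\<Phi> (fst z) - \<Phi> (snd z)))" for z
  proof -
    have "of_real (g \<xi>) * ?F \<xi> z = H (fst z) * cnj (H (snd z)) * (cis (\<xi> \<bullet> (\<Phi> (fst z) - \<Phi> (snd z))) * of_real (g \<xi>))" for \<xi>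
    proof -
      have "cis (\<xi> \<bullet> (\<Phi> (fst z) - \<Phi> (snd z))) = cis (\<Phi> (fst z) \<bullet> \<xi>) * cnj (cis (\<Phi> (snd z) \<bullet> \<xi>))"
        by (simp add: cis_cnj cis_mult inner_diff_right inner_commute)
      then show ?thesis by (simp add: mult_ac)
    qed
    then have "(LBINT \<xi>. of_real (g \<xi>) * ?F \<xi> z) = (LBINT \<xi>. H (fst z) * cnj (H (snd z)) * (cis (\<xi> \<bullet> (\<Phi> (fst z) - \<Phi> (snd z))) * of_real (g \<xi>)))"
      by presburger
    also have "... = H (fst z) * cnj (H (snd z)) * (LBINT \<xi>. cis (\<xi> \<bullet> (\<Phi> (fst z) - \<Phi> (snd z))) * of_real (g \<xi>))"
      by (rule integral_mult_right_zero)
    finally show ?thesis unfolding g_def gauss_n(2)[OF e] G_def .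
  qed
  let ?I = "(LBINT \<xi>. g \<xi> * (norm (h \<xi>))\<^sup>2)"
  have hb: "norm (h \<xi>) <= (LBINT x. norm (H x))" for \<xi>
    unfolding h_def using integral_norm_bound[of lborel "%x. cis (\<Phi> x \<bullet> \<xi>) * H x"] by (simp add: norm_mult)
  have Ii: "integrable lborel (%\<xi>. g \<xi> * (norm (h \<xi>))\<^sup>2)"
  proof (rule Bochner_Integration.integrable_bound)
    show "integrable lborel (%\<xi>. g \<xi> * (LBINT x. norm (H x))\<^sup>2)" using gi by simp
    show "AE \<xi> in lborel. norm (g \<xi> * (norm (h \<xi>))\<^sup>2) <= norm (g \<xi> * (LBINT x. norm (H x))\<^sup>2)"
      using hb by (auto simp: abs_mult intro!: mult_left_mono power_mono)
  qed measurable
  have "complex_of_real ?I = (LBINT \<xi>. of_real (g \<xi>) * (\<integral>z. ?F \<xi> z \<partial>?P))"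
    by (simp only: integral_complex_of_real[symmetric] of_real_mult hh)
  also have "... = (LBINT \<xi>. (\<integral>z. of_real (g \<xi>) * ?F \<xi> z \<partial>?P))"
    by (simp only: integral_mult_right_zero)
  also have "... = (\<integral>z. (LBINT \<xi>. of_real (g \<xi>) * ?F \<xi> z) \<partial>?P)"
    using T.Fubini_integral[OF tri] by simp
  also have "... = (\<integral>z. H (fst z) * cnj (H (snd z)) * of_real (G (\<Phi> (fst z) - \<Phi> (snd z))) \<partial>?P)"
    unfolding inner ..
  finally have Ieq: "complex_of_real ?I = ..." .
  have G0: "0 <= G y" for y using e by (simp add: G_def)
  have I0: "0 <= ?I" by (intro integral_nonneg_AE) (simp add: g_def)
  \<comment> \<open>In the mass of \<open>Q\<close> the powers of \<open>e\<close> cancel: each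
    coordinate contributes (sqrt (2 pi) / e) (sqrt (2 pi) e / c) = 2 pi / c.\<close>
  define Q where "Q y = (sqrt (2 * pi) / e) ^ DIM('a) * exp (- ((c / e) * norm y)\<^sup>2 / 2)" for y :: 'a
  have Q0: "0 <= Q y" for y using e by (simp add: Q_def)
  have [measurable]: "G \<in> borel_measurable borel" "Q \<in> borel_measurable borel" unfolding G_def Q_def by measurable
  have GQ: "G (\<Phi> x - \<Phi> y) <= Q (x - y)" if "H x \<noteq> 0" "H y \<noteq> 0" for x y
  proof -
    have "(c / e * norm (x - y))\<^sup>2 <= (norm (\<Phi> x - \<Phi> y) / e)\<^sup>2"
      using lo[OF that] c e by (intro power_mono) (auto simp: field_simps)
    then show ?thesis unfolding G_def Q_def using e by (intro mult_left_mono) auto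
  qed
  have Qi: "(NNINT y. ennreal (Q y)) = ennreal ((2 * pi / c) ^ DIM('a))"
  proof -
    have "(LBINT y. Q y) = (2 * pi / c) ^ DIM('a)"
      unfolding Q_def using gauss_n_real(2)[of "c / e", where 'a = 'a] c e
      by (simp add: power_mult_distrib[symmetric])
    moreover have "integrable lborel Q" unfolding Q_def using gauss_n_real(1)[of "c / e", where 'a = 'a] c e by simp
    ultimately show ?thesis using Q0 by (subst nn_integral_eq_integral) auto
  qed
  have Qt: "(NNINT y. ennreal (Q (x - y))) = ennreal ((2 * pi / c) ^ DIM('a))" for x
  proof -
    have "(NNINT y. ennreal (Q (x - y))) = (NNINT y. ennreal (Q (x + (- 1) *\<^sub>R y)))" by simp
    also have "... = (NNINT y. ennreal (Q y))"
      by (subst (2) lborel_affine[of "-1" x]) (simp_all add: nn_integral_density nn_integral_distr)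
    finally show ?thesis using Qi by simp
  qed
  have Qt': "(NNINT x. ennreal (Q (x - y))) = ennreal ((2 * pi / c) ^ DIM('a))" for y
    using Qt[of y] by (simp add: Q_def norm_minus_commute)
  let ?N = "%x. ennreal ((norm (H x))\<^sup>2)"
  let ?c = "ennreal ((2 * pi / c) ^ DIM('a))"
  have "ennreal ?I = ennreal (norm (complex_of_real ?I))" using I0 by simp
  also have "... <= (\<integral>\<^sup>+z. norm (H (fst z) * cnj (H (snd z)) * of_real (G (\<Phi> (fst z) - \<Phi> (snd z)))) \<partial>?P)"
    unfolding Ieq by (rule integral_norm_bound_ennreal) (rule T.integrable_snd[OF tri, unfolded prod.case inner])
  also have "... <= (\<integral>\<^sup>+z. ennreal (1/2) * (?N (fst z) * ennreal (Q (fst z - snd z)) + ?N (snd z) * ennreal (Q (fst z - snd z))) \<partial>?P)"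
  proof (rule nn_integral_mono)
    fix z :: "'a \<times> 'a"
    obtain x y where z: "z = (x, y)" by force
    have "norm (H x) * norm (H y) * G (\<Phi> x - \<Phi> y) <= (1/2) * (((norm (H x))\<^sup>2 + (norm (H y))\<^sup>2) * Q (x - y))"
    proof (cases "H x = 0 \<or> H y = 0")
      case True then show ?thesis using Q0[of "x - y"] by auto
    next
      case False
      have "norm (H x) * norm (H y) * G (\<Phi> x - \<Phi> y) <= ((1/2) * ((norm (H x))\<^sup>2 + (norm (H y))\<^sup>2)) * Q (x - y)"
        using GQ[of x y] False G0 sum_squares_bound[of "norm (H x)" "norm (H y)"] by (intro mult_mono[of "norm (H x) * norm (H y)"]) auto
      then show ?thesis by simp
    qed
    then have "ennreal (norm (H x) * norm (H y) * G (\<Phi> x - \<Phi> y)) <= ennreal ((1/2) * (((norm (H x))\<^sup>2 + (norm (H y))\<^sup>2) * Q (x - y)))"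
      by (rule ennreal_leI)
    also have "... = ennreal (1/2) * (?N x * ennreal (Q (x - y)) + ?N y * ennreal (Q (x - y)))"
      using Q0[of "x - y"] by (subst ennreal_mult) (auto simp: distrib_right ennreal_mult)
    finally show "ennreal (norm (H (fst z) * cnj (H (snd z)) * of_real (G (\<Phi> (fst z) - \<Phi> (snd z)))))
       <= ennreal (1/2) * (?N (fst z) * ennreal (Q (fst z - snd z)) + ?N (snd z) * ennreal (Q (fst z - snd z)))"
      using G0 by (simp add: z norm_mult)
  qed
  also have "... = ennreal (1/2) * ((\<integral>\<^sup>+z. ?N (fst z) * ennreal (Q (fst z - snd z)) \<partial>?P) + (\<integral>\<^sup>+z. ?N (snd z) * ennreal (Q (fst z - snd z)) \<partial>?P))"
    by (simp add: nn_integral_cmult nn_integral_add)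
  also have "(\<integral>\<^sup>+z. ?N (fst z) * ennreal (Q (fst z - snd z)) \<partial>?P) = (NNINT x. (NNINT y. ?N x * ennreal (Q (x - y))))"
    by (subst lborel.nn_integral_fst[symmetric]) auto
  also have "... = (NNINT x. ?N x) * ?c" by (simp add: nn_integral_cmult nn_integral_multc Qt)
  also have "(\<integral>\<^sup>+z. ?N (snd z) * ennreal (Q (fst z - snd z)) \<partial>?P) = (NNINT y. (NNINT x. ?N y * ennreal (Q (x - y))))"
    by (subst lborel_pair.nn_integral_snd[symmetric]) auto
  also have "... = (NNINT x. ?N x) * ?c" by (simp add: nn_integral_cmult nn_integral_multc Qt')
  also have "ennreal (1/2) * ((NNINT x. ?N x) * ?c + (NNINT x. ?N x) * ?c) = (NNINT x. ?N x) * ?c"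
  proof -
    have "ennreal (1/2) * (t + t) = t" for t
    proof -
      have "ennreal (1/2) * (t + t) = ennreal (1/2) * 2 * t" by (simp add: mult_2[symmetric] mult.assoc)
      also have "ennreal (1/2) * 2 = ennreal (1/2) * ennreal 2" by simp
      also have "... = 1" by (subst ennreal_mult[symmetric]) auto
      finally show ?thesis by simp
    qed
    then show ?thesis .
  qed
  also have "(NNINT x. ?N x) = ennreal (LBINT x. (norm (H x))\<^sup>2)"
    using H2 by (intro nn_integral_eq_integral) auto
  finally have "ennreal ?I <= ennreal ((2 * pi / c) ^ DIM('a) * (LBINT x. (norm (H x))\<^sup>2))"
    using c by (simp add: ennreal_mult mult.commute)
  moreover have "ennreal ?I = (NNINT \<xi>. ennreal (g \<xi> * (norm (h \<xi>))\<^sup>2))"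
    by (rule nn_integral_eq_integral[symmetric, OF Ii]) (simp add: g_def)
  ultimately show ?thesis by (simp add: g_def h_def)
qed

text \<open>The bound of \<open>L2_bound_gauss\<close> is uniform in \<open>e\<close>, so Fatou's
  lemma removes the Gaussian along \<open>e = 1 / real (Suc n)\<close>.\<close>

theorem L2_bound:
  fixes \<Phi> :: "'a::euclidean_space => 'a" and H :: "'a => complex"
  assumes H: "integrable lborel H" and H2: "integrable lborel (%x. (norm (H x))\<^sup>2)"
    and \<Phi>[measurable]: "\<Phi> \<in> borel_measurable borel" and c: "0 < c"
    and lo: "\<And>x y. H x \<noteq> 0 ==> H y \<noteq> 0 ==> c * norm (x - y) <= norm (\<Phi> x - \<Phi> y)"
  shows "(NNINT \<xi>. ennreal ((norm (LBINT x. cis (\<Phi> x \<bullet> \<xi>) * H x))\<^sup>2))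
     <= ennreal ((2 * pi / c) ^ DIM('a) * (LBINT x. (norm (H x))\<^sup>2))"
proof -
  have [measurable]: "H \<in> borel_measurable borel" using H by auto
  define h where "h \<xi> = (LBINT x. cis (\<Phi> x \<bullet> \<xi>) * H x)" for \<xi>
  have [measurable]: "h \<in> borel_measurable borel" unfolding h_def by measurable
  define F where "F n \<xi> = ennreal (exp (- ((1 / real (Suc n)) * norm \<xi>)\<^sup>2 / 2) * (norm (h \<xi>))\<^sup>2)" for n and \<xi> :: 'a
  have lim: "(%n. F n \<xi>) \<longlonglongrightarrow> ennreal ((norm (h \<xi>))\<^sup>2)" for \<xi>
  proof -
    have "(%n. exp (- ((1 / real (Suc n)) * norm \<xi>)\<^sup>2 / 2) * (norm (h \<xi>))\<^sup>2) \<longlonglongrightarrow> exp (- (0 * norm \<xi>)\<^sup>2 / 2) * (norm (h \<xi>))\<^sup>2"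
      by (intro tendsto_intros LIMSEQ_Suc[OF lim_1_over_n]) auto
    then show ?thesis unfolding F_def by (intro tendsto_ennrealI) simp
  qed
  have "(NNINT \<xi>. ennreal ((norm (h \<xi>))\<^sup>2)) = (NNINT \<xi>. liminf (%n. F n \<xi>))"
    by (intro nn_integral_cong) (simp add: lim_imp_Liminf[OF _ lim])
  also have "... <= liminf (%n. \<integral>\<^sup>+\<xi>. F n \<xi> \<partial>lborel)"
    by (rule nn_integral_liminf) (simp add: F_def)
  also have "... <= ennreal ((2 * pi / c) ^ DIM('a) * (LBINT x. (norm (H x))\<^sup>2))"
  proof (intro Liminf_le always_eventually allI)
    fix n show "(NNINT \<xi>. F n \<xi>) <= ennreal ((2 * pi / c) ^ DIM('a) * (LBINT x. (norm (H x))\<^sup>2))"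
      unfolding F_def h_def by (rule L2_bound_gauss[OF H H2 \<Phi> c _ lo]) auto
  qed simp
  finally show ?thesis by (simp add: h_def)
qed

section \<open>The radial Bessel function\<close>

text \<open>Poisson's integral: up to a constant, l^(-m/2) times the Bessel function of order m/2.
  In the applications \<open>m\<close> is the dimension minus two.\<close>

definition Jm :: "nat => real => real" where
  "Jm m l = integral {0..pi} (%t. cos (l * cos t) * sin t ^ m)"

definition Jm' :: "nat => real => real" where
  "Jm' m l = integral {0..pi} (%t. - cos t * sin (l * cos t) * sin t ^ m)"

definition Jm'' :: "nat => real => real" where
  "Jm'' m l = integral {0..pi} (%t. - (cos t)\<^sup>2 * cos (l * cos t) * sin t ^ m)"

lemma Jm_deriv: "(Jm m has_real_derivative Jm' m l) (at l)"
  unfolding Jm_def[abs_def] Jm'_def cbox_interval[symmetric]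
  by (rule leibniz_rule_field_derivative[where U = UNIV])
     (auto intro!: derivative_eq_intros integrable_continuous_interval continuous_intros simp: case_prod_unfold)

lemma Jm'_deriv: "(Jm' m has_real_derivative Jm'' m l) (at l)"
  unfolding Jm'_def[abs_def] Jm''_def cbox_interval[symmetric]
  by (rule leibniz_rule_field_derivative[where U = UNIV])
     (auto intro!: derivative_eq_intros integrable_continuous_interval continuous_intros simp: case_prod_unfold power2_eq_square)

text \<open>Bessel's equation. The combination of the three integrands is the derivative in
  \<open>t\<close> of \<open>sin (l * cos t) * sin t ^ (m + 1)\<close>, which vanishes at
  \<open>0\<close> and \<open>pi\<close>.\<close>

lemma Jm_ode: "l * (Jm'' m l + Jm m l) = - (real m + 1) * Jm' m l"
proof -
  let ?f = "%t. sin (l * cos t) * sin t ^ (m + 1)"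
  let ?g = "%t. (- l) * (- (cos t)\<^sup>2 * cos (l * cos t) * sin t ^ m + cos (l * cos t) * sin t ^ m)
     - (real m + 1) * (- cos t * sin (l * cos t) * sin t ^ m)"
  have "(?g has_integral (?f pi - ?f 0)) {0..pi}"
  proof (rule fundamental_theorem_of_calculus)
    fix t :: real
    have s: "1 - (cos t)\<^sup>2 = (sin t)\<^sup>2" by (simp add: sin_squared_eq)
    have e: "?g t = cos (l * cos t) * (- l * sin t) * sin t ^ (m + 1) + sin (l * cos t) * ((real m + 1) * sin t ^ m * cos t)"
    proof -
      have "?g t = - l * cos (l * cos t) * sin t ^ m * (1 - (cos t)\<^sup>2) + (real m + 1) * (cos t * sin (l * cos t) * sin t ^ m)"
        by (simp add: algebra_simps)
      then show ?thesis unfolding s by (simp add: algebra_simps power2_eq_square)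
    qed
    show "(?f has_vector_derivative ?g t) (at t within {0..pi})"
      unfolding has_real_derivative_iff_has_vector_derivative[symmetric] e
      by (rule derivative_eq_intros refl)+ (simp add: algebra_simps)
  qed simp
  moreover have "(?g has_integral ((- l) * (Jm'' m l + Jm m l) - (real m + 1) * Jm' m l)) {0..pi}"
    unfolding Jm_def Jm'_def Jm''_def
    by (intro has_integral_diff has_integral_mult_right has_integral_add integrable_integral
        integrable_continuous_interval continuous_intros)
  ultimately have "(- l) * (Jm'' m l + Jm m l) - (real m + 1) * Jm' m l = ?f pi - ?f 0"
    using has_integral_unique by blast
  then show ?thesis by (simp add: algebra_simps)
qed

text \<open>For these \<open>l\<close> the angle \<open>l * cos t\<close> stays within one radian of
  0, so the integrand is nonnegative, and it is positive at \<open>t = pi / 2\<close>. The value at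
  \<open>1/2\<close> starts the asymptotics with positive energy; the value at \<open>0\<close>
  enters the measure of the sphere, by which the polar formulas divide.\<close>

lemma Jm_pos: assumes "\<bar>l\<bar> <= 1" shows "0 < Jm m l"
proof -
  have le: "\<bar>l * cos t\<bar> <= 1" for t
    using assms abs_cos_le_one[of t] by (auto simp: abs_mult intro!: mult_le_one)
  have cp: "0 < cos (l * cos t)" for t
    using le[of t] pi_gt3 by (intro cos_gt_zero_pi) linarith+
  have int: "(%t. cos (l * cos t) * sin t ^ m) integrable_on {0..pi}"
    by (intro integrable_continuous_interval continuous_intros)
  have "0 <= Jm m l" unfolding Jm_def
    by (intro integral_nonneg integrable_continuous_interval continuous_intros)
       (auto intro!: mult_nonneg_nonneg less_imp_le[OF cp] zero_le_power sin_ge_zero)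
  moreover have "Jm m l \<noteq> 0"
  proof
    assume "Jm m l = 0"
    then have "((%t. cos (l * cos t) * sin t ^ m) has_integral 0) {0..pi}"
      using integrable_integral[OF int] unfolding Jm_def by simp
    then have "cos (l * cos (pi/2)) * sin (pi/2) ^ m = 0"
      by (intro has_integral_0_cbox_imp_0[of 0 pi "%t. cos (l * cos t) * sin t ^ m"])
         (use pi_gt_zero in \<open>auto intro!: continuous_intros mult_nonneg_nonneg less_imp_le[OF cp] zero_le_power sin_ge_zero simp del: pi_gt_zero\<close>)
    then show False by simp
  qed
  ultimately show ?thesis by simp
qed

lemma Jm_le_pi: "\<bar>Jm m l\<bar> <= pi"
proof -
  have "norm (integral (cbox 0 pi) (%t. cos (l * cos t) * sin t ^ m)) <= 1 * measure lborel (cbox 0 pi)"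
  proof (rule integrable_bound)
    show "(%t. cos (l * cos t) * sin t ^ m) integrable_on cbox 0 pi"
      unfolding cbox_interval by (intro integrable_continuous_interval continuous_intros)
    show "norm (cos (l * cos t) * sin t ^ m) <= 1" for t
      by (auto simp: abs_mult power_abs intro!: mult_le_one power_le_one)
  qed auto
  then show ?thesis by (simp add: Jm_def)
qed

lemma continuous_on_Jm [continuous_intros]:
  "continuous_on S f ==> continuous_on S (%x. Jm m (f x))"
  by (rule continuous_on_compose2[of UNIV "Jm m"])
     (auto intro!: continuous_at_imp_continuous_on DERIV_isCont Jm_deriv)

lemma borel_measurable_Jm [measurable]: "Jm m \<in> borel_measurable borel"
  by (intro borel_measurable_continuous_onI continuous_intros)

text \<open>For \<open>y l = l powr N * Jm m l\<close> Bessel's equation reads y'' = (c / l^2 - 1)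
  y, a harmonic oscillator with an integrable perturbation. Gronwall's inequality keeps the energy
  \<open>E\<close> between positive constants, and \<open>u\<close>, the solution seen in the
  rotating frame, has a derivative of order l^(-2). So \<open>u\<close> converges at rate 1/l, and
  its limit \<open>A\<close> is nonzero because the energy stays positive.\<close>

theorem Jm_asymptotics:
  fixes m :: nat
  defines "N \<equiv> (real m + 1) / 2"
  obtains C a where "0 < C" "a \<noteq> 0"
    "\<And>l. 0 <= l ==> \<bar>Jm m l\<bar> <= C * (1 + l) powr - N"
    "\<And>l. 1/2 <= l ==> norm (of_real (Jm m l) - of_real (l powr - N) * (a * cis l + cnj a * cis (- l))) <= C * l powr (- N - 1)"
proof -
  define c where "c = N * (N - 1)"
  define y where "y l = l powr N * Jm m l" for l
  define z where "z l = N * l powr (N - 1) * Jm m l + l powr N * Jm' m l" for l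
  define E where "E l = (y l)\<^sup>2 + (z l)\<^sup>2" for l
  have N: "2 * N = real m + 1" by (simp add: N_def)
  have Np: "N > 0" by (simp add: N_def)
  have ode: "Jm'' m l = - Jm m l - 2 * N * Jm' m l / l" if "l > 0" for l
    using Jm_ode[of l m] that unfolding N by (simp add: field_simps)
  have dy: "(y has_real_derivative z l) (at l)" if "l > 0" for l
    unfolding y_def[abs_def] z_def
    by (rule derivative_eq_intros Jm_deriv | use that in simp)+
  have dz: "(z has_real_derivative (c / l\<^sup>2 - 1) * y l) (at l)" if "l > 0" for l
  proof -
    have p: "l powr (N - 1) = l powr N / l" "l powr (N - 1 - 1) = l powr N / l\<^sup>2"
      using that by (simp_all add: powr_diff power2_eq_square)
    have "(z has_real_derivative ((N * ((N - 1) * l powr (N - 1 - 1))) * Jm m l + Jm' m l * (N * l powr (N - 1)) +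
        ((N * l powr (N - 1)) * Jm' m l + Jm'' m l * l powr N))) (at l)"
      unfolding z_def[abs_def]
      by (intro DERIV_add DERIV_mult' DERIV_mult Jm_deriv Jm'_deriv DERIV_cmult has_real_derivative_powr that)
    also have "(N * ((N - 1) * l powr (N - 1 - 1))) * Jm m l + Jm' m l * (N * l powr (N - 1)) +
        ((N * l powr (N - 1)) * Jm' m l + Jm'' m l * l powr N) = (c / l\<^sup>2 - 1) * y l"
      unfolding p ode[OF that] y_def c_def
      by (simp add: algebra_simps)
    finally show ?thesis .
  qed
  have dE: "(E has_real_derivative 2 * c * (y l * z l) / l\<^sup>2) (at l)" if "l > 0" for l
    unfolding E_def[abs_def]
    apply (rule derivative_eq_intros dy[OF that] dz[OF that] refl)+
    using that apply (simp add: field_simps power2_eq_square)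
    done
  have E0: "0 <= E l" for l by (simp add: E_def)
  have yz: "\<bar>2 * (y l * z l)\<bar> <= E l" for l
    using sum_squares_bound[of "\<bar>y l\<bar>" "\<bar>z l\<bar>"] unfolding E_def by (simp add: abs_mult)
  have dEb: "\<bar>2 * c * (y l * z l) / l\<^sup>2\<bar> <= \<bar>c\<bar> * E l / l\<^sup>2" for l
  proof -
    have "\<bar>2 * c * (y l * z l)\<bar> = \<bar>c\<bar> * \<bar>2 * (y l * z l)\<bar>" by (simp add: abs_mult)
    also have "... <= \<bar>c\<bar> * E l" using yz by (intro mult_left_mono) auto
    finally show ?thesis by (simp add: abs_divide divide_right_mono)
  qed
  have dexp: "((%x. exp (k / x)) has_real_derivative exp (k / x) * (- k / x\<^sup>2)) (at x)" if "x > 0" for k x :: real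
    by (rule derivative_eq_intros refl | use that in \<open>simp add: power2_eq_square\<close>)+
  \<comment> \<open>The derivative of \<open>E\<close> is at most
    \<open>\<bar>c\<bar> * E l / l\<^sup>2\<close> in absolute value. Hence
    \<open>E l * exp (\<bar>c\<bar> / l)\<close> is nonincreasing and
    \<open>E l * exp (- \<bar>c\<bar> / l)\<close> is nondecreasing.\<close>
  have Eup: "E l * exp (\<bar>c\<bar> / l) <= E (1/2) * exp (\<bar>c\<bar> / (1/2))" if "1/2 <= l" for l
  proof (rule DERIV_nonpos_imp_nonincreasing[OF that])
    fix x :: real assume x: "1/2 <= x" "x <= l"
    have "((%x. E x * exp (\<bar>c\<bar> / x)) has_real_derivative
       (2 * c * (y x * z x) / x\<^sup>2 - \<bar>c\<bar> * E x / x\<^sup>2) * exp (\<bar>c\<bar> / x)) (at x)"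
      by (rule DERIV_cong[OF DERIV_mult[OF dE dexp]]) (use x in \<open>simp_all add: algebra_simps diff_divide_distrib\<close>)
    moreover have "(2 * c * (y x * z x) / x\<^sup>2 - \<bar>c\<bar> * E x / x\<^sup>2) * exp (\<bar>c\<bar> / x) <= 0"
      using abs_le_D1[OF dEb[of x]] by (intro mult_nonpos_nonneg) simp_all
    ultimately show "\<exists>d. ((%x. E x * exp (\<bar>c\<bar> / x)) has_real_derivative d) (at x) \<and> d <= 0" by blast
  qed
  have Elo: "E (1/2) * exp (- \<bar>c\<bar> / (1/2)) <= E l * exp (- \<bar>c\<bar> / l)" if "1/2 <= l" for l
  proof (rule DERIV_nonneg_imp_nondecreasing[OF that])
    fix x :: real assume x: "1/2 <= x" "x <= l"
    have "((%x. E x * exp (- \<bar>c\<bar> / x)) has_real_derivative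
       (2 * c * (y x * z x) / x\<^sup>2 + \<bar>c\<bar> * E x / x\<^sup>2) * exp (- \<bar>c\<bar> / x)) (at x)"
      by (rule DERIV_cong[OF DERIV_mult[OF dE dexp]]) (use x in \<open>simp_all add: algebra_simps diff_divide_distrib\<close>)
    moreover have "0 <= (2 * c * (y x * z x) / x\<^sup>2 + \<bar>c\<bar> * E x / x\<^sup>2) * exp (- \<bar>c\<bar> / x)"
      using abs_le_D2[OF dEb[of x]] by (intro mult_nonneg_nonneg) simp_all
    ultimately show "\<exists>d. ((%x. E x * exp (- \<bar>c\<bar> / x)) has_real_derivative d) (at x) \<and> 0 <= d" by blast
  qed
  define E1 where "E1 = E (1/2) * exp (2 * \<bar>c\<bar>)"
  define E2 where "E2 = E (1/2) * exp (- 2 * \<bar>c\<bar>)"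
  have "Jm m (1/2) > 0" by (rule Jm_pos) simp
  then have "y (1/2) > 0" by (simp add: y_def)
  then have Ep: "E (1/2) > 0" unfolding E_def by (simp add: add_pos_nonneg)
  have E1: "E l <= E1" if "1/2 <= l" for l
  proof -
    have "E l * 1 <= E l * exp (\<bar>c\<bar> / l)" using that E0 by (intro mult_left_mono) auto
    then show ?thesis using Eup[OF that] by (simp add: E1_def mult.commute)
  qed
  have E2: "E2 <= E l" if "1/2 <= l" for l
  proof -
    have "E l * exp (- \<bar>c\<bar> / l) <= E l * 1" using that E0 by (intro mult_left_mono) auto
    then show ?thesis using Elo[OF that] by (simp add: E2_def mult.commute)
  qed
  have E2p: "E2 > 0" using Ep by (simp add: E2_def)
  have E1p: "E1 > 0" using Ep by (simp add: E1_def)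
  have yb: "\<bar>y l\<bar> <= sqrt E1" if "1/2 <= l" for l
  proof -
    have "(y l)\<^sup>2 <= E1" using E1[OF that] unfolding E_def by (smt (verit) zero_le_power2)
    then show ?thesis using real_le_rsqrt by fastforce
  qed
  define u where "u l = cis (- l) * (of_real (z l) + \<i> * of_real (y l))" for l
  have du: "(u has_vector_derivative (cis (- l) * of_real (c * y l / l\<^sup>2))) (at l)" if "l > 0" for l
  proof -
    have "((%l. cis (- l)) has_vector_derivative (of_real (-1) * (\<i> * cis (- l)))) (at l)"
      using has_derivative_cis[of uminus uminus l UNIV]
      unfolding has_vector_derivative_def
      by (rule has_derivative_eq_rhs) (auto simp: fun_eq_iff scaleR_conv_of_real intro!: derivative_eq_intros)
    then show ?thesis unfolding u_def[abs_def]
      apply -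
      apply (rule has_vector_derivative_eq_rhs)
      apply (assumption | rule has_vector_derivative_mult has_vector_derivative_of_real derivative_eq_intros dy dz refl that)+
      apply (simp add: algebra_simps)
      done
  qed
  define K where "K = \<bar>c\<bar> * sqrt E1"
  have K0: "0 <= K" using E1p by (simp add: K_def)
  have ud: "norm (u l' - u l) <= K / l - K / l'" if "1/2 <= l" "l <= l'" for l l'
  proof (cases "l = l'")
    case False
    have "norm (u l' - u l) <= (- K / l') - (- K / l)"
    proof (rule differentiable_bound_general)
      show "l < l'" using that False by simp
      show "continuous_on {l..l'} u"
        using that by (intro continuous_at_imp_continuous_on ballI has_vector_derivative_continuous[OF du]) auto
      show "continuous_on {l..l'} (%l. - K / l)" using that by (intro continuous_intros) auto
      fix x assume x: "l < x" "x < l'"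
      show "(u has_vector_derivative (cis (- x) * of_real (c * y x / x\<^sup>2))) (at x)"
        using du x that by auto
      show "((%l. - K / l) has_vector_derivative (K / x\<^sup>2)) (at x)"
        unfolding has_real_derivative_iff_has_vector_derivative[symmetric]
        by (rule derivative_eq_intros refl | use x that in \<open>simp add: power2_eq_square\<close>)+
      have "\<bar>c\<bar> * \<bar>y x\<bar> <= K" unfolding K_def using yb[of x] x that by (intro mult_left_mono) auto
      then show "norm (cis (- x) * complex_of_real (c * y x / x\<^sup>2)) <= K / x\<^sup>2"
        by (simp add: norm_mult norm_divide abs_mult norm_power power2_abs divide_right_mono)
    qed
    then show ?thesis by simp
  qed simp
  have "Cauchy (%n. u (real n + 1))"
  proof (rule CauchyI')
    fix e :: real assume e: "e > 0"
    obtain M :: nat where M: "K / e < real M" using reals_Archimedean2 by blast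
    show "\<exists>M. \<forall>m\<ge>M. \<forall>n>m. dist (u (real m + 1)) (u (real n + 1)) < e"
    proof (intro exI allI impI)
      fix m n :: nat assume mn: "M <= m" "m < n"
      have "dist (u (real m + 1)) (u (real n + 1)) = norm (u (real n + 1) - u (real m + 1))"
        by (metis dist_norm dist_commute)
      also have "... <= K / (real m + 1) - K / (real n + 1)"
        using mn by (intro ud) auto
      also have "... <= K / (real m + 1)" using K0 by simp
      also have "... < e"
      proof -
        have "K < real M * e" using M e by (simp add: field_simps)
        also have "... <= (real m + 1) * e" using mn e by (intro mult_right_mono) auto
        finally show ?thesis by (simp add: field_simps)
      qed
      finally show "dist (u (real m + 1)) (u (real n + 1)) < e" .
    qed
  qed
  then obtain A where A: "(%n. u (real n + 1)) \<longlonglongrightarrow> A"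
    using Cauchy_convergent_iff convergent_def by blast
  have uA: "norm (A - u l) <= K / l" if "1/2 <= l" for l
  proof (rule tendsto_upperbound)
    show "(%n. norm (u (real n + 1) - u l)) \<longlonglongrightarrow> norm (A - u l)"
      by (intro tendsto_intros A)
    obtain M :: nat where M: "l < real M" using reals_Archimedean2 by blast
    show "\<forall>\<^sub>F n in sequentially. norm (u (real n + 1) - u l) <= K / l"
      using eventually_ge_at_top[of M]
    proof eventually_elim
      case (elim n)
      have "norm (u (real n + 1) - u l) <= K / l - K / (real n + 1)" using that elim M by (intro ud) auto
      also have "... <= K / l" using K0 by simp
      finally show ?case .
    qed
  qed simp
  have nu: "norm (u l) = sqrt (E l)" for l
    unfolding u_def norm_mult norm_cis mult_1 by (simp add: E_def cmod_def add.commute)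
  have "sqrt E2 <= norm A"
    by (rule tendsto_lowerbound[OF tendsto_norm[OF A]]) (auto simp: nu intro!: always_eventually E2)
  then have A0: "A \<noteq> 0" using E2p by auto
  \<comment> \<open>Since \<open>y l\<close> is the imaginary part of \<open>u l * cis l\<close>,
    its leading term is \<open>Im (A * cis l)\<close>; this \<open>a\<close> writes it as a sum of
    two conjugate waves.\<close>
  define a where "a = - \<i> * A / 2"
  have a0: "a \<noteq> 0" using A0 by (simp add: a_def)
  have ImA: "a * cis l + cnj a * cis (- l) = of_real (Im (A * cis l))" for l
    by (simp add: a_def complex_eq_iff field_simps)
  have yIm: "y l = Im (u l * cis l)" for l
  proof -
    have "u l * cis l = of_real (z l) + \<i> * of_real (y l)"
      unfolding u_def by (simp add: mult.commute mult.left_commute cis_mult)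
    then show ?thesis by simp
  qed
  have asym: "norm (of_real (Jm m l) - of_real (l powr - N) * (a * cis l + cnj a * cis (- l))) <= K * l powr (- N - 1)"
    if l: "1/2 <= l" for l
  proof -
    have "Jm m l = l powr - N * y l" using l by (simp add: y_def powr_minus field_simps)
    then have "complex_of_real (Jm m l) - of_real (l powr - N) * (a * cis l + cnj a * cis (- l))
       = of_real (l powr - N * Im ((u l - A) * cis l))"
      unfolding ImA yIm by (simp add: algebra_simps)
    also have "norm ... = l powr - N * \<bar>Im ((u l - A) * cis l)\<bar>"
      unfolding norm_of_real abs_mult by simp
    also have "... <= l powr - N * norm ((u l - A) * cis l)"
      by (intro mult_left_mono abs_Im_le_cmod) simp
    also have "... <= l powr - N * (K / l)"
      using uA[OF l] by (intro mult_left_mono) (auto simp: norm_mult norm_minus_commute)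
    also have "... = K * l powr (- N - 1)" using l by (simp add: powr_diff)
    finally show ?thesis .
  qed
  \<comment> \<open>The summands serve the asymptotics, the region \<open>1/2 <= l\<close>, where
    \<open>(1 + l) / 3 <= l\<close>, and the region \<open>l < 1/2\<close>, where
    \<open>1 + l <= 2\<close> and \<open>\<bar>Jm m l\<bar> <= pi\<close> suffices.\<close>
  define C where "C = K + sqrt E1 * 3 powr N + pi * 2 powr N + 1"
  have Cp: "0 < C" unfolding C_def using K0 E1p by (auto intro!: add_nonneg_pos add_nonneg_nonneg)
  show thesis
  proof (rule that[OF Cp a0])
    fix l :: real assume "1/2 <= l"
    note asym[OF this]
    also have "K * l powr (- N - 1) <= C * l powr (- N - 1)"
      unfolding C_def using E1p by (intro mult_right_mono) auto
    finally show "norm (of_real (Jm m l) - of_real (l powr - N) * (a * cis l + cnj a * cis (- l))) <= C * l powr (- N - 1)" .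
  next
    fix l :: real assume l: "0 <= l"
    show "\<bar>Jm m l\<bar> <= C * (1 + l) powr - N"
    proof (cases "l < 1/2")
      case True
      have "\<bar>Jm m l\<bar> <= pi" by (rule Jm_le_pi)
      also have "... = pi * 2 powr N * 2 powr - N" by (simp add: powr_minus)
      also have "... <= C * (1 + l) powr - N"
        using True l Np K0 E1p unfolding C_def by (intro mult_mono powr_mono2') auto
      finally show ?thesis .
    next
      case False
      then have l: "1/2 <= l" by simp
      have "\<bar>Jm m l\<bar> = l powr - N * \<bar>y l\<bar>" using l by (simp add: y_def powr_minus abs_mult field_simps)
      also have "... <= ((1 + l) / 3) powr - N * sqrt E1"
        using l Np yb[OF l] by (intro mult_mono powr_mono2') auto
      also have "... = sqrt E1 * 3 powr N * (1 + l) powr - N"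
        using l by (simp add: powr_divide powr_minus field_simps)
      also have "... <= C * (1 + l) powr - N"
        unfolding C_def using K0 by (intro mult_right_mono) auto
      finally show ?thesis .
    qed
  qed
qed

section \<open>Polar coordinates\<close>

lemma nn_integral_lborel_translate:
  fixes f :: "'a::euclidean_space => ennreal"
  assumes [measurable]: "f \<in> borel_measurable borel"
  shows "(NNINT x. f (a + x)) = (NNINT x. f x)"
  by (subst (2) lborel_affine[of 1 a]) (simp_all add: nn_integral_density nn_integral_distr)

lemma nn_integral_lborel_reflect:
  fixes f :: "'a::euclidean_space => ennreal"
  assumes [measurable]: "f \<in> borel_measurable borel"
  shows "(NNINT x. f (a - x)) = (NNINT x. f x)"
  by (subst (2) lborel_affine[of "-1" a]) (simp_all add: nn_integral_density nn_integral_distr)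

text \<open>Both sides are translation invariant in \<open>u\<close>; integrating \<open>u (f x) * v (f x + y)\<close> in the two
  possible orders shows that they agree up to a factor, which is 1 because \<open>f\<close> preserves the unit ball.\<close>
lemma nn_integral_lborel_orthogonal:
  fixes f :: "'a::euclidean_space => 'a" and u :: "'a => ennreal"
  assumes f: "orthogonal_transformation f" and [measurable]: "u \<in> borel_measurable borel"
  shows "(NNINT x. u (f x)) = (NNINT x. u x)"
proof -
  have lin: "linear f" using f orthogonal_transformation_linear by blast
  have [measurable]: "f \<in> borel_measurable borel"
    using lin by (intro borel_measurable_continuous_onI linear_continuous_on linear_conv_bounded_linear[THEN iffD1])
  define v :: "'a => ennreal" where "v = indicator (cball 0 1)"
  have [measurable]: "v \<in> borel_measurable borel"
    unfolding v_def by (intro borel_measurable_indicator borel_closed closed_cball)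
  have vf: "v (f x) = v x" for x
    using orthogonal_transformation_norm[OF f, of x] by (simp add: v_def indicator_def)
  define c where "c = unit_ball_vol (real DIM('a))"
  have "0 < c" by (simp add: c_def)
  have c: "emeasure lborel (cball (0::'a) 1) = ennreal c" by (simp add: emeasure_cball c_def)
  have V: "(NNINT x. v x) = emeasure lborel (cball (0::'a) 1)" by (simp add: v_def)
  have "(NNINT x. u (f x)) * (NNINT y. v y) = (NNINT x. (NNINT y. u (f x) * v (f x + y)))"
    by (simp add: nn_integral_cmult nn_integral_multc nn_integral_lborel_translate)
  also have "... = (NNINT y. (NNINT x. u (f x) * v (f x + y)))"
    by (rule lborel_pair.Fubini') measurable
  also have "... = (NNINT y. (NNINT x. u (f x - y) * v (f x)))"
  proof (rule nn_integral_cong)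
    fix y
    obtain z where z: "f z = y" using orthogonal_transformation_surj[OF f] by (metis surjD)
    have "(NNINT x. u (f x) * v (f x + y)) = (NNINT x. u (f (- z + x)) * v (f (- z + x) + y))"
      by (rule nn_integral_lborel_translate[symmetric]) measurable
    also have "... = (NNINT x. u (f x - y) * v (f x))"
    proof -
      have "f (- z + x) = f x - y" for x by (simp only: linear_add[OF lin] linear_neg[OF lin] z) simp
      then show ?thesis by simp
    qed
    finally show "(NNINT x. u (f x) * v (f x + y)) = (NNINT x. u (f x - y) * v (f x))" .
  qed
  also have "... = (NNINT x. (NNINT y. u (f x - y) * v (f x)))"
    by (rule lborel_pair.Fubini') measurable
  also have "... = (NNINT x. u x) * (NNINT y. v y)"
    by (simp add: nn_integral_cmult nn_integral_multc nn_integral_lborel_reflect vf)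
  finally have *: "(NNINT x. u (f x)) * ennreal c = (NNINT x. u x) * ennreal c"
    unfolding V c .
  have "x = x * ennreal c * ennreal (1 / c)" for x
    using \<open>0 < c\<close> by (simp add: mult.assoc ennreal_mult[symmetric])
  then show ?thesis using * by metis
qed

lemma lborel_distr_orthogonal:
  fixes f :: "'a::euclidean_space => 'a"
  assumes f: "orthogonal_transformation f"
  shows "f \<in> borel_measurable borel" "distr lborel borel f = lborel"
proof -
  have lin: "linear f" using f orthogonal_transformation_linear by blast
  show m[measurable]: "f \<in> borel_measurable borel"
    using lin by (intro borel_measurable_continuous_onI linear_continuous_on linear_conv_bounded_linear[THEN iffD1])
  show "distr lborel borel f = lborel"
  proof (rule measure_eqI)
    fix A assume "A \<in> sets (distr lborel borel f)"
    then have [measurable]: "A \<in> sets borel" by simp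
    have "emeasure (distr lborel borel f) A = (NNINT x. indicator A (f x))"
      by (subst nn_integral_distr[symmetric, of f lborel borel]) auto
    also have "... = emeasure lborel A" by (subst nn_integral_lborel_orthogonal[OF f]) auto
    finally show "emeasure (distr lborel borel f) A = emeasure lborel A" .
  qed simp
qed

section \<open>Recurrence in the dimension and slices of balls\<close>

lemma Jm_add_2: "Jm'' m l + Jm m l = Jm (m + 2) l"
proof -
  have "((%t. - (cos t)\<^sup>2 * cos (l * cos t) * sin t ^ m + cos (l * cos t) * sin t ^ m) has_integral (Jm'' m l + Jm m l)) {0..pi}"
    unfolding Jm_def Jm''_def
    by (intro has_integral_add integrable_integral integrable_continuous_interval continuous_intros)
  moreover have "- (cos t)\<^sup>2 * cos (l * cos t) * sin t ^ m + cos (l * cos t) * sin t ^ m = cos (l * cos t) * sin t ^ (m + 2)" for t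
  proof -
    have "(sin t)\<^sup>2 = 1 - (cos t)\<^sup>2" by (simp add: sin_squared_eq)
    then have "sin t ^ (m + 2) = sin t ^ m * (1 - (cos t)\<^sup>2)" unfolding power_add by (simp only:)
    then show ?thesis by (simp only:) (simp add: algebra_simps)
  qed
  ultimately show ?thesis unfolding Jm_def by (simp add: integral_unique)
qed

text \<open>Obtained by differentiating Bessel's equation in the form
  \<open>l * Jm (m + 2) l = - (real m + 1) * Jm' m l\<close>. It says that s^(m+2) Jm (m+2) (s r)
  has the derivative (m+1) s^(m+1) Jm m (s r) in s, which is the passage from balls to
  spheres.\<close>

lemma Jm_recurrence: "(real m + 2) * Jm (m + 2) l + l * Jm' (m + 2) l = (real m + 1) * Jm m l"
proof -
  have eq: "l * Jm (m + 2) l = - (real m + 1) * Jm' m l" for l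
    using Jm_ode[of l m] by (simp add: Jm_add_2)
  have "((%l. l * Jm (m + 2) l) has_real_derivative (1 * Jm (m + 2) l + Jm' (m + 2) l * l)) (at l)"
    by (intro DERIV_mult DERIV_ident Jm_deriv)
  moreover have "((%l. l * Jm (m + 2) l) has_real_derivative (- (real m + 1) * Jm'' m l)) (at l)"
    unfolding eq by (intro DERIV_cmult Jm'_deriv)
  ultimately have "1 * Jm (m + 2) l + Jm' (m + 2) l * l = - (real m + 1) * Jm'' m l" by (rule DERIV_unique)
  moreover have "Jm'' m l = Jm (m + 2) l - Jm m l" using Jm_add_2[of m l] by simp
  ultimately have "1 * Jm (m + 2) l + Jm' (m + 2) l * l = - (real m + 1) * (Jm (m + 2) l - Jm m l)" by (simp only:)
  then show ?thesis by algebra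
qed

text \<open>Both sides equal \<rho>^(m+2) (Jm (m+2) 0 + Jm (m+2) (\<rho> r)): the left one by the
  substitution \<open>z = - \<rho> * cos t\<close>, the right one by \<open>Jm_recurrence\<close>.
  Adding 1 to the cosine makes the integrands nonnegative, so that the identity can later become one
  between measures.\<close>

lemma slice_integral:
  fixes r \<rho> :: real and m :: nat
  assumes \<rho>: "0 < \<rho>"
  shows "(NNINT z. ennreal ((1 + cos (r * z)) * sqrt (\<rho>\<^sup>2 - z\<^sup>2) ^ (m + 1)) * indicator {-\<rho>..\<rho>} z)
     = (NNINT s. ennreal ((real m + 1) * s ^ (m + 1) * (Jm m 0 + Jm m (s * r))) * indicator {0..\<rho>} s)"
proof -
  let ?f = "%z. (1 + cos (r * z)) * sqrt (\<rho>\<^sup>2 - z\<^sup>2) ^ (m + 1)"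
  let ?\<Psi> = "%s. s ^ (m + 2) * (Jm (m + 2) 0 + Jm (m + 2) (s * r))"
  have cb: "0 <= 1 + cos x" for x :: real using cos_ge_minus_one[of x] by linarith
  have sub: "((%t. (\<rho> * sin t) *\<^sub>R ?f (- \<rho> * cos t)) has_integral (integral {- \<rho> * cos 0..- \<rho> * cos pi} ?f)) {0..pi}"
  proof (rule has_integral_substitution)
    show "(%t. - \<rho> * cos t) ` {0..pi} \<subseteq> {-\<rho>..\<rho>}"
    proof
      fix y assume "y \<in> (%t. - \<rho> * cos t) ` {0..pi}"
      then obtain t where "y = - \<rho> * cos t" by blast
      moreover have "\<rho> * cos t <= \<rho> * 1" "\<rho> * (-1) <= \<rho> * cos t" using \<rho> by (intro mult_left_mono; simp)+
      ultimately show "y \<in> {-\<rho>..\<rho>}" by auto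
    qed
  qed (use \<rho> in \<open>auto intro!: continuous_intros derivative_eq_intros\<close>)
  have sub': "((%t. (\<rho> * sin t) *\<^sub>R ?f (- \<rho> * cos t)) has_integral ?\<Psi> \<rho>) {0..pi}"
  proof -
    have "((%t. \<rho> ^ (m + 2) * (cos (0 * cos t) * sin t ^ (m + 2) + cos ((\<rho> * r) * cos t) * sin t ^ (m + 2)))
        has_integral ?\<Psi> \<rho>) {0..pi}"
      unfolding Jm_def
      by (intro has_integral_mult_right has_integral_add integrable_integral integrable_continuous_interval continuous_intros)
    moreover have "\<rho> ^ (m + 2) * (cos (0 * cos t) * sin t ^ (m + 2) + cos ((\<rho> * r) * cos t) * sin t ^ (m + 2))
       = (\<rho> * sin t) *\<^sub>R ?f (- \<rho> * cos t)" if "t \<in> {0..pi}" for t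
    proof -
      have s0: "0 <= sin t" using that by (intro sin_ge_zero) auto
      have "\<rho>\<^sup>2 - (- \<rho> * cos t)\<^sup>2 = (\<rho> * sin t)\<^sup>2" by (simp add: power_mult_distrib sin_squared_eq algebra_simps)
      then have sq: "sqrt (\<rho>\<^sup>2 - (- \<rho> * cos t)\<^sup>2) = \<rho> * sin t" using s0 \<rho> by simp
      have cr: "cos (r * (- \<rho> * cos t)) = cos (\<rho> * r * cos t)" by (simp add: mult_ac)
      show ?thesis unfolding sq cr by (simp add: power_mult_distrib algebra_simps)
    qed
    ultimately show ?thesis by (rule has_integral_eq[rotated])
  qed
  have iv: "integral {- \<rho>..\<rho>} ?f = ?\<Psi> \<rho>"
    using has_integral_unique[OF sub sub'] by simp
  have "?f integrable_on {-\<rho>..\<rho>}" by (intro integrable_continuous_interval continuous_intros)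
  then have hf: "(?f has_integral ?\<Psi> \<rho>) {-\<rho>..\<rho>}" unfolding iv[symmetric] by (rule integrable_integral)
  have "((%s. (real m + 1) * s ^ (m + 1) * (Jm m 0 + Jm m (s * r))) has_integral (?\<Psi> \<rho> - ?\<Psi> 0)) {0..\<rho>}"
  proof (rule fundamental_theorem_of_calculus)
    fix s :: real
    have "(?\<Psi> has_real_derivative ((real (m + 2) * s ^ (m + 1)) * (Jm (m + 2) 0 + Jm (m + 2) (s * r)) + (Jm' (m + 2) (s * r) * r) * s ^ (m + 2))) (at s)"
      by (rule derivative_eq_intros DERIV_chain2[OF Jm_deriv] refl | simp)+
    moreover have "(real (m + 2) * s ^ (m + 1)) * (Jm (m + 2) 0 + Jm (m + 2) (s * r)) + (Jm' (m + 2) (s * r) * r) * s ^ (m + 2)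
       = s ^ (m + 1) * (((real m + 2) * Jm (m + 2) 0 + 0 * Jm' (m + 2) 0) + ((real m + 2) * Jm (m + 2) (s * r) + (s * r) * Jm' (m + 2) (s * r)))"
      by (simp add: algebra_simps)
    ultimately have "(?\<Psi> has_real_derivative ((real m + 1) * s ^ (m + 1) * (Jm m 0 + Jm m (s * r)))) (at s)"
      unfolding Jm_recurrence by (simp add: algebra_simps)
    then show "(?\<Psi> has_vector_derivative (real m + 1) * s ^ (m + 1) * (Jm m 0 + Jm m (s * r))) (at s within {0..\<rho>})"
      unfolding has_real_derivative_iff_has_vector_derivative[symmetric] by (rule has_field_derivative_at_within)
  qed (use \<rho> in simp)
  then have hg: "((%s. (real m + 1) * s ^ (m + 1) * (Jm m 0 + Jm m (s * r))) has_integral ?\<Psi> \<rho>) {0..\<rho>}" by simp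
  have J0: "0 <= Jm m 0 + Jm m l" for l
  proof -
    have "Jm m 0 + Jm m l = integral {0..pi} (%t. cos (0 * cos t) * sin t ^ m + cos (l * cos t) * sin t ^ m)"
      unfolding Jm_def by (rule Henstock_Kurzweil_Integration.integral_add[symmetric]) (intro integrable_continuous_interval continuous_intros)+
    also have "... \<ge> 0"
    proof (rule integral_nonneg)
      fix t assume "t \<in> {0..pi}"
      then have "0 <= (1 + cos (l * cos t)) * sin t ^ m" by (intro mult_nonneg_nonneg cb zero_le_power sin_ge_zero) auto
      then show "0 <= cos (0 * cos t) * sin t ^ m + cos (l * cos t) * sin t ^ m" by (simp add: algebra_simps)
    qed (intro integrable_continuous_interval continuous_intros)
    finally show ?thesis .
  qed
  have "(NNINT z. ennreal (?f z) * indicator {-\<rho>..\<rho>} z) = ennreal (?\<Psi> \<rho>)"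
    by (rule nn_integral_has_integral_lebesgue'[OF _ hf])
       (use \<rho> in \<open>auto intro!: mult_nonneg_nonneg cb zero_le_power simp: abs_le_square_iff[symmetric]\<close>)
  moreover have "(NNINT s. ennreal ((real m + 1) * s ^ (m + 1) * (Jm m 0 + Jm m (s * r))) * indicator {0..\<rho>} s) = ennreal (?\<Psi> \<rho>)"
    by (rule nn_integral_has_integral_lebesgue'[OF _ hg]) (auto intro!: mult_nonneg_nonneg J0)
  ultimately show ?thesis by simp
qed

lemma norm_sq_Basis: "(norm x)\<^sup>2 = (\<Sum>b\<in>Basis. (x \<bullet> b)\<^sup>2)" for x :: "'a::euclidean_space"
  by (simp add: norm_eq_sqrt_inner euclidean_inner[of x x] power2_eq_square sum_nonneg)

text \<open>Cavalieri's principle along \<open>b\<close>: the slice of the ball at height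
  \<open>z\<close> is a ball of dimension \<open>m + 1\<close> and radius
  \<open>sqrt (\<rho>\<^sup>2 - z\<^sup>2)\<close>.\<close>

lemma nn_integral_slice:
  fixes b :: "'a::euclidean_space"
  assumes b: "b \<in> Basis" and dim: "DIM('a) = m + 2" and \<rho>: "0 < \<rho>"
  shows "(NNINT \<xi>. ennreal (1 + cos (r * (\<xi> \<bullet> b))) * indicator {..\<rho>} (norm \<xi>))
    = ennreal (unit_ball_vol (real m + 1)) * (NNINT z. ennreal ((1 + cos (r * z)) * sqrt (\<rho>\<^sup>2 - z\<^sup>2) ^ (m + 1)) * indicator {-\<rho>..\<rho>} z)"
proof -
  let ?B = "Basis - {b}"
  let ?v = "unit_ball_vol (real m + 1)"
  have v0: "0 <= ?v" by simp
  interpret product_sigma_finite "%_::'a. lborel :: real measure" by standard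
  have cb: "0 <= 1 + cos x" for x :: real using cos_ge_minus_one[of x] by linarith
  have cB: "card ?B = m + 1" using b dim by (simp add: card_Diff_singleton)
  have ins: "insert b ?B = Basis" using b by auto
  define g where "g \<xi> = ennreal (1 + cos (r * (\<xi> \<bullet> b))) * indicator {..\<rho>} (norm \<xi>)" for \<xi> :: 'a
  have [measurable]: "g \<in> borel_measurable borel" unfolding g_def by measurable
  have m: "(%f. \<Sum>b\<in>Basis. f b *\<^sub>R b :: 'a) \<in> measurable (\<Pi>\<^sub>M b\<in>Basis. lborel) borel" by measurable
  have nrm: "norm (\<Sum>i\<in>Basis. (x(b := z)) i *\<^sub>R i :: 'a) = sqrt (z\<^sup>2 + (\<Sum>i\<in>?B. (x i)\<^sup>2))" for x z
  proof -
    have "(norm (\<Sum>i\<in>Basis. (x(b := z)) i *\<^sub>R i :: 'a))\<^sup>2 = (\<Sum>i\<in>Basis. ((x(b := z)) i)\<^sup>2)"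
      unfolding norm_sq_Basis by (intro sum.cong) simp_all
    also have "... = z\<^sup>2 + (\<Sum>i\<in>?B. (x i)\<^sup>2)"
      using b by (subst sum.remove[of _ b]) (auto intro!: sum.cong)
    finally show ?thesis by (metis norm_ge_zero real_sqrt_abs2 real_sqrt_unique)
  qed
  have in_b: "(\<Sum>i\<in>Basis. (x(b := z)) i *\<^sub>R i :: 'a) \<bullet> b = z" for x z using b by simp
  have "(NNINT \<xi>. g \<xi>) = (\<integral>\<^sup>+f. g (\<Sum>b\<in>Basis. f b *\<^sub>R b) \<partial>(\<Pi>\<^sub>M b\<in>Basis. lborel))"
    apply (subst lborel_eq)
    apply (subst nn_integral_distr[OF m])
     apply simp_all
    done
  also have "... = (NNINT z. (\<integral>\<^sup>+x. g (\<Sum>i\<in>Basis. (x(b := z)) i *\<^sub>R i) \<partial>(\<Pi>\<^sub>M i\<in>?B. lborel)))"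
    using product_nn_integral_insert_rev[of ?B b "%f. g (\<Sum>b\<in>Basis. f b *\<^sub>R b)"] unfolding ins by simp
  also have "... = (NNINT z. ennreal ?v * (ennreal ((1 + cos (r * z)) * sqrt (\<rho>\<^sup>2 - z\<^sup>2) ^ (m + 1)) * indicator {-\<rho>..\<rho>} z))"
  proof (rule nn_integral_cong_AE)
    \<comment> \<open>At these two heights the slice is a single point; at all others it is empty or
      a ball of positive radius.\<close>
    have "AE z in lborel. z \<noteq> \<rho> \<and> z \<noteq> - \<rho>"
      using AE_lborel_singleton[of \<rho>] AE_lborel_singleton[of "-\<rho>"] by eventually_elim auto
    then show "AE z in lborel. (\<integral>\<^sup>+x. g (\<Sum>i\<in>Basis. (x(b := z)) i *\<^sub>R i) \<partial>(\<Pi>\<^sub>M i\<in>?B. lborel))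
       = ennreal ?v * (ennreal ((1 + cos (r * z)) * sqrt (\<rho>\<^sup>2 - z\<^sup>2) ^ (m + 1)) * indicator {-\<rho>..\<rho>} z)"
    proof eventually_elim
      case (elim z)
      show ?case
      proof (cases "\<bar>z\<bar> < \<rho>")
        case True
        define R where "R = sqrt (\<rho>\<^sup>2 - z\<^sup>2)"
        have z2: "z\<^sup>2 < \<rho>\<^sup>2" using True by (metis abs_ge_zero less_eq_real_def power2_abs power_strict_mono zero_less_numeral)
        have R: "0 < R" using z2 by (simp add: R_def)
        have eq: "g (\<Sum>i\<in>Basis. (x(b := z)) i *\<^sub>R i) = ennreal (1 + cos (r * z)) * indicator ({f. sqrt (\<Sum>i\<in>?B. (f i)\<^sup>2) <= R} \<inter> space (\<Pi>\<^sub>M i\<in>?B. lborel)) x"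
          if "x \<in> space (\<Pi>\<^sub>M i\<in>?B. lborel)" for x
        proof -
          have "sqrt (z\<^sup>2 + (\<Sum>i\<in>?B. (x i)\<^sup>2)) <= \<rho> \<longleftrightarrow> z\<^sup>2 + (\<Sum>i\<in>?B. (x i)\<^sup>2) <= \<rho>\<^sup>2"
            using \<rho> real_sqrt_le_iff'[of "z\<^sup>2 + (\<Sum>i\<in>?B. (x i)\<^sup>2)" \<rho>] by (simp add: sum_nonneg add_nonneg_nonneg)
          also have "... \<longleftrightarrow> sqrt (\<Sum>i\<in>?B. (x i)\<^sup>2) <= R" unfolding R_def by auto
          finally have iff: "sqrt (z\<^sup>2 + (\<Sum>i\<in>?B. (x i)\<^sup>2)) <= \<rho> \<longleftrightarrow> sqrt (\<Sum>i\<in>?B. (x i)\<^sup>2) <= R" .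
          show ?thesis unfolding g_def in_b nrm using that iff by (simp add: indicator_def)
        qed
        have "(\<integral>\<^sup>+x. g (\<Sum>i\<in>Basis. (x(b := z)) i *\<^sub>R i) \<partial>(\<Pi>\<^sub>M i\<in>?B. lborel))
          = (\<integral>\<^sup>+x. ennreal (1 + cos (r * z)) * indicator ({f. sqrt (\<Sum>i\<in>?B. (f i)\<^sup>2) <= R} \<inter> space (\<Pi>\<^sub>M i\<in>?B. lborel)) x \<partial>(\<Pi>\<^sub>M i\<in>?B. lborel))"
          by (intro nn_integral_cong eq)
        also have "... = ennreal (1 + cos (r * z)) * emeasure (\<Pi>\<^sub>M i\<in>?B. lborel) ({f. sqrt (\<Sum>i\<in>?B. (f i)\<^sup>2) <= R} \<inter> space (\<Pi>\<^sub>M i\<in>?B. lborel))"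
          by (intro nn_integral_cmult_indicator) measurable
        also have "... = ennreal (1 + cos (r * z)) * ennreal (unit_ball_vol (real (m + 1)) * R ^ (m + 1))"
          by (subst emeasure_cball_aux) (auto simp: R cB)
        finally have I: "(\<integral>\<^sup>+x. g (\<Sum>i\<in>Basis. (x(b := z)) i *\<^sub>R i) \<partial>(\<Pi>\<^sub>M i\<in>?B. lborel)) = ..." .
        have "indicator {-\<rho>..\<rho>} z = (1::ennreal)" using True by (auto simp: indicator_def)
        then show ?thesis unfolding I using True R cb[of "r * z"] by (simp add: R_def[symmetric] ennreal_mult[symmetric] mult_ac add.commute)
      next
        case False
        then have z: "\<rho> < \<bar>z\<bar>" using elim by linarith
        have "g (\<Sum>i\<in>Basis. (x(b := z)) i *\<^sub>R i) = 0" for x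
        proof -
          have "\<bar>z\<bar> <= sqrt (z\<^sup>2 + (\<Sum>i\<in>?B. (x i)\<^sup>2))" by (intro real_le_rsqrt) (simp add: sum_nonneg)
          then show ?thesis unfolding g_def nrm using z by simp
        qed
        moreover have "indicator {-\<rho>..\<rho>} z = (0::ennreal)" using z by (auto simp: indicator_def)
        ultimately show ?thesis by simp
      qed
    qed
  qed
  also have "... = ennreal ?v * (NNINT z. ennreal ((1 + cos (r * z)) * sqrt (\<rho>\<^sup>2 - z\<^sup>2) ^ (m + 1)) * indicator {-\<rho>..\<rho>} z)"
    by (intro nn_integral_cmult) measurable
  finally show ?thesis by (simp add: g_def)
qed

text \<open>The surface measure of the unit sphere in dimension m+1, the equator of the unit sphere
  in dimension m+2. Hence \<open>polar_const m * Jm m 0\<close> is the surface measure of the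
  latter.\<close>

definition polar_const :: "nat => real" where
  "polar_const m = unit_ball_vol (real m + 1) * (real m + 1)"

lemma polar_const_pos: "0 < polar_const m" by (simp add: polar_const_def)

lemma Jm_nonneg_add: "0 <= Jm m 0 + Jm m l"
proof -
  have "\<bar>Jm m l\<bar> <= Jm m 0"
  proof -
    have "norm (integral {0..pi} (%t. cos (l * cos t) * sin t ^ m)) <= integral {0..pi} (%t. cos (0 * cos t) * sin t ^ m)"
    proof (rule integral_norm_bound_integral)
      fix t assume "t \<in> {0..pi}"
      then have s: "0 <= sin t" by (intro sin_ge_zero) auto
      then have "\<bar>cos (l * cos t)\<bar> * sin t ^ m <= 1 * sin t ^ m" by (intro mult_right_mono) auto
      then show "norm (cos (l * cos t) * sin t ^ m) <= cos (0 * cos t) * sin t ^ m" using s by (simp add: abs_mult)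
    qed (intro integrable_continuous_interval continuous_intros)+
    then show ?thesis by (simp add: Jm_def)
  qed
  then show ?thesis by linarith
qed

text \<open>A rotation takes \<open>x\<close> to a multiple of a basis vector, to which the slice
  formulas apply. For \<open>\<rho> <= 0\<close> both sides are integrals over null sets.\<close>

lemma polar_ball:
  fixes x :: "real^'n"
  assumes dim: "CARD('n) = m + 2"
  shows "(NNINT \<xi>. ennreal (1 + cos (x \<bullet> \<xi>)) * indicator {..\<rho>} (norm \<xi>))
    = (NNINT s. ennreal (polar_const m * s ^ (m + 1) * (Jm m 0 + Jm m (s * norm x))) * indicator {0..} s * indicator {..\<rho>} s)"
proof (cases "0 < \<rho>")
  case True
  have d: "DIM(real^'n) = m + 2" by (simp add: dim)
  obtain b :: "real^'n" where b: "b \<in> Basis" using nonempty_Basis by blast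
  have "norm x = norm (norm x *\<^sub>R b)" using b by simp
  then obtain f where f: "orthogonal_transformation f" "f x = norm x *\<^sub>R b"
    using orthogonal_transformation_exists by metis
  have [measurable]: "f \<in> borel_measurable borel" by (rule lborel_distr_orthogonal[OF f(1)])
  have xx: "x \<bullet> \<xi> = norm x * (f \<xi> \<bullet> b)" for \<xi>
    using f unfolding orthogonal_transformation_def by (metis inner_commute inner_scaleR_right)
  have nf: "norm \<xi> = norm (f \<xi>)" for \<xi> using f orthogonal_transformation_norm by metis
  have "(NNINT \<xi>. ennreal (1 + cos (x \<bullet> \<xi>)) * indicator {..\<rho>} (norm \<xi>))
     = (NNINT \<xi>. (%\<xi>. ennreal (1 + cos (norm x * (\<xi> \<bullet> b))) * indicator {..\<rho>} (norm \<xi>)) (f \<xi>))"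
    unfolding xx nf[symmetric] ..
  also have "... = (NNINT \<xi>. ennreal (1 + cos (norm x * (\<xi> \<bullet> b))) * indicator {..\<rho>} (norm \<xi>))"
    by (rule nn_integral_lborel_orthogonal[OF f(1)]) measurable
  also have "... = ennreal (unit_ball_vol (real m + 1)) * (NNINT s. ennreal ((real m + 1) * s ^ (m + 1) * (Jm m 0 + Jm m (s * norm x))) * indicator {0..\<rho>} s)"
    unfolding nn_integral_slice[OF b d True] slice_integral[OF True] ..
  also have "... = (NNINT s. ennreal (unit_ball_vol (real m + 1)) * (ennreal ((real m + 1) * s ^ (m + 1) * (Jm m 0 + Jm m (s * norm x))) * indicator {0..\<rho>} s))"
    by (intro nn_integral_cmult[symmetric]) measurable
  also have "... = (NNINT s. ennreal (polar_const m * s ^ (m + 1) * (Jm m 0 + Jm m (s * norm x))) * indicator {0..} s * indicator {..\<rho>} s)"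
    by (intro nn_integral_cong)
       (auto simp: indicator_def polar_const_def ennreal_mult[symmetric] mult_ac Jm_nonneg_add)
  finally show ?thesis .
next
  case False
  have "AE \<xi> in lborel. \<xi> \<noteq> (0::real^'n)" by (rule AE_lborel_singleton)
  then have "(NNINT \<xi>. ennreal (1 + cos (x \<bullet> \<xi>)) * indicator {..\<rho>} (norm \<xi>)) = (integral\<^sup>N lborel (%_::real^'n. 0))"
  proof (intro nn_integral_cong_AE, eventually_elim)
    case (elim \<xi>)
    then have "0 < norm \<xi>" by simp
    then have "\<not> norm \<xi> <= \<rho>" using False by linarith
    then show ?case by simp
  qed
  moreover have "AE s in lborel. s \<noteq> (0::real)" by (rule AE_lborel_singleton)
  then have "(NNINT s. ennreal (polar_const m * s ^ (m + 1) * (Jm m 0 + Jm m (s * norm x))) * indicator {0..} s * indicator {..\<rho>} s) = (integral\<^sup>N lborel (%_::real. 0))"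
    using False by (intro nn_integral_cong_AE) (auto simp: indicator_def elim!: eventually_mono)
  ultimately show ?thesis by simp
qed

text \<open>Half-lines are stable under intersection and generate the Borel sets, so the formula for
  balls determines the image measure. A character is no density of a measure, but
  \<open>1 + cos\<close> is one, and \<open>polar_fourier\<close> subtracts the 1 again.\<close>

lemma polar_measure:
  fixes x :: "real^'n"
  assumes dim: "CARD('n) = m + 2"
  shows "distr (density lborel (%\<xi>. ennreal (1 + cos (x \<bullet> \<xi>)))) borel norm
    = density lborel (%s. ennreal (polar_const m * s ^ (m + 1) * (Jm m 0 + Jm m (s * norm x))) * indicator {0..} s)" (is "?M = ?N")
proof (rule measure_eqI_generator_eq[where E = "range (%a::real. {..a})" and \<Omega> = UNIV and A = "%n. {..real n}"])
  have M: "emeasure ?M {..a} = (NNINT \<xi>. ennreal (1 + cos (x \<bullet> \<xi>)) * indicator {..a} (norm \<xi>))" for a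
  proof -
    have "norm -` {..a} = cball (0::real^'n) a" by auto
    then have [measurable]: "norm -` {..a} \<in> sets (borel :: (real^'n) measure)" by simp
    show ?thesis
      by (subst emeasure_distr, simp, simp, subst emeasure_density) (auto simp: indicator_def intro!: nn_integral_cong)
  qed
  have N: "emeasure ?N {..a} = (NNINT s. ennreal (polar_const m * s ^ (m + 1) * (Jm m 0 + Jm m (s * norm x))) * indicator {0..} s * indicator {..a} s)" for a
    by (subst emeasure_density) auto
  show "emeasure ?M X = emeasure ?N X" if "X \<in> range (%a::real. {..a})" for X
    using that M N polar_ball[OF dim] by auto
  show "emeasure ?M {..real n} \<noteq> \<infinity>" for n
  proof -
    have "emeasure ?M {..real n} <= (NNINT \<xi>. 2 * indicator (cball (0::real^'n) (real n)) \<xi>)"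
      unfolding M
    proof (rule nn_integral_mono)
      fix \<xi> :: "real^'n"
      have "ennreal (1 + cos (x \<bullet> \<xi>)) <= ennreal 2" by (intro ennreal_leI) (simp add: cos_le_one)
      then show "ennreal (1 + cos (x \<bullet> \<xi>)) * indicator {..real n} (norm \<xi>) <= 2 * indicator (cball 0 (real n)) \<xi>"
        by (auto simp: indicator_def)
    qed
    also have "... = 2 * emeasure lborel (cball (0::real^'n) (real n))"
      by (intro nn_integral_cmult_indicator) auto
    also have "... < \<infinity>" by (simp add: ennreal_mult_less_top emeasure_cball)
    finally show ?thesis by simp
  qed
  show "Int_stable (range (%a::real. {..a}))" unfolding Int_stable_def by auto
  show "(\<Union>i. {..real i}) = UNIV" using real_arch_simple by auto
qed (auto simp: borel_eq_atMost)

text \<open>The case \<open>x = 0\<close> of \<open>polar_measure\<close>, in which the density is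
  constantly \<open>2\<close>.\<close>

theorem polar_nn_integral:
  fixes f :: "real => ennreal"
  assumes dim: "CARD('n) = m + 2" and [measurable]: "f \<in> borel_measurable borel"
  shows "(NNINT (\<xi>::real^'n). f (norm \<xi>))
    = ennreal (polar_const m * Jm m 0) * (NNINT s. f s * ennreal (s ^ (m + 1)) * indicator {0..} s)"
proof -
  have p0: "0 <= Jm m 0" using Jm_nonneg_add[of m 0] by simp
  have t: "ennreal (1 + cos ((0::real^'n) \<bullet> \<xi>)) = 2" for \<xi> by simp
  have "2 * (NNINT (\<xi>::real^'n). f (norm \<xi>)) = (\<integral>\<^sup>+s. f s \<partial>distr (density lborel (%\<xi>. ennreal (1 + cos ((0::real^'n) \<bullet> \<xi>)))) borel norm)"
    by (subst nn_integral_distr, simp, simp, subst nn_integral_density) (simp_all add: nn_integral_cmult)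
  also have "... = (NNINT s. ennreal (polar_const m * s ^ (m + 1) * (Jm m 0 + Jm m (s * norm (0::real^'n)))) * indicator {0..} s * f s)"
    unfolding polar_measure[OF dim] by (subst nn_integral_density) (simp_all)
  also have "... = (NNINT s. 2 * (ennreal (polar_const m * Jm m 0) * (f s * ennreal (s ^ (m + 1)) * indicator {0..} s)))"
  proof (rule nn_integral_cong)
    fix s :: real
    have "ennreal (polar_const m * s ^ (m + 1) * (Jm m 0 + Jm m (s * norm (0::real^'n)))) = 2 * (ennreal (polar_const m * Jm m 0) * ennreal (s ^ (m + 1)))" if "0 <= s"
    proof -
      have "polar_const m * s ^ (m + 1) * (Jm m 0 + Jm m (s * norm (0::real^'n))) = 2 * ((polar_const m * Jm m 0) * s ^ (m + 1))"
        by (simp add: algebra_simps)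
      then show ?thesis using that p0 polar_const_pos[of m] by (simp add: ennreal_mult mult_ac)
    qed
    then show "ennreal (polar_const m * s ^ (m + 1) * (Jm m 0 + Jm m (s * norm (0::real^'n)))) * indicator {0..} s * f s
       = 2 * (ennreal (polar_const m * Jm m 0) * (f s * ennreal (s ^ (m + 1)) * indicator {0..} s))"
      by (cases "0 <= s") (auto simp: mult_ac)
  qed
  also have "... = 2 * (ennreal (polar_const m * Jm m 0) * (NNINT s. f s * ennreal (s ^ (m + 1)) * indicator {0..} s))"
    by (simp add: nn_integral_cmult)
  finally show ?thesis by (simp add: ennreal_mult_cancel_left)
qed

text \<open>The cosine part is \<open>polar_measure\<close> at \<open>x\<close> minus the
  contribution of the constant 1, known from the case \<open>x = 0\<close>. The sine part is odd in
  \<open>\<xi>\<close> and vanishes.\<close>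

theorem polar_fourier:
  fixes f :: "real => complex" and x :: "real^'n"
  assumes dim: "CARD('n) = m + 2" and fm[measurable]: "f \<in> borel_measurable borel"
    and int: "integrable lborel (%\<xi>::real^'n. f (norm \<xi>))"
  shows "integrable lborel (%s. f s * of_real (s ^ (m + 1)) * indicator {0..} s)"
    and "(LBINT \<xi>. cis (x \<bullet> \<xi>) * f (norm \<xi>))
    = of_real (polar_const m) * (LBINT s. f s * of_real (s ^ (m + 1) * Jm m (s * norm x)) * indicator {0..} s)"
proof -
  have J0p: "0 < Jm m 0" by (rule Jm_pos) simp
  show fi: "integrable lborel (%s. f s * of_real (s ^ (m + 1)) * indicator {0..} s)"
    unfolding integrable_iff_bounded
  proof
    have "(NNINT s. ennreal (norm (f s * of_real (s ^ (m + 1)) * indicator {0..} s))) = (NNINT s. ennreal (norm (f s)) * ennreal (s ^ (m + 1)) * indicator {0..} s)"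
      by (intro nn_integral_cong) (auto simp: indicator_def norm_mult norm_power ennreal_mult)
    moreover have "ennreal (polar_const m * Jm m 0) * ... < \<infinity>"
      using int by (subst polar_nn_integral[OF dim, symmetric]) (auto simp: integrable_iff_bounded)
    moreover have "ennreal (polar_const m * Jm m 0) \<noteq> 0" using J0p polar_const_pos[of m] by (simp add: ennreal_eq_0_iff not_le)
    ultimately show "(NNINT s. ennreal (norm (f s * of_real (s ^ (m + 1)) * indicator {0..} s))) < \<infinity>"
      by (simp only: infinity_ennreal_def ennreal_mult_less_top) auto
  qed measurable
  have fJ: "integrable lborel (%s. f s * of_real (s ^ (m + 1) * Jm m (s * r)) * indicator {0..} s)" for r
  proof (rule Bochner_Integration.integrable_bound)
    show "integrable lborel (%s. of_real pi * (f s * of_real (s ^ (m + 1)) * indicator {0..} s))" using fi by simp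
    show "AE s in lborel. norm (f s * of_real (s ^ (m + 1) * Jm m (s * r)) * indicator {0..} s) <= norm (of_real pi * (f s * of_real (s ^ (m + 1)) * indicator {0..} s))"
    proof (rule AE_I2)
      fix s
      have "norm (f s) * \<bar>s\<bar> ^ (m + 1) * \<bar>Jm m (s * r)\<bar> <= norm (f s) * \<bar>s\<bar> ^ (m + 1) * pi"
        by (intro mult_left_mono Jm_le_pi) auto
      then show "norm (f s * of_real (s ^ (m + 1) * Jm m (s * r)) * indicator {0..} s) <= norm (of_real pi * (f s * of_real (s ^ (m + 1)) * indicator {0..} s))"
        by (cases "0 <= s") (simp_all add: norm_mult norm_power mult_ac)
    qed
  qed measurable
  have A: "(LBINT \<xi>. of_real (1 + cos (x \<bullet> \<xi>)) * f (norm \<xi>))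
     = of_real (polar_const m) * ((LBINT s. f s * of_real (s ^ (m + 1) * Jm m (s * 0)) * indicator {0..} s) + (LBINT s. f s * of_real (s ^ (m + 1) * Jm m (s * norm x)) * indicator {0..} s))" for x :: "real^'n"
  proof -
    have c: "0 <= 1 + cos y" for y :: real using cos_ge_minus_one[of y] by linarith
    have "(LBINT \<xi>. of_real (1 + cos (x \<bullet> \<xi>)) * f (norm \<xi>)) = (\<integral>s. f s \<partial>distr (density lborel (%\<xi>. ennreal (1 + cos (x \<bullet> \<xi>)))) borel norm)"
      by (subst integral_distr, simp, simp, subst integral_density) (auto simp: c scaleR_conv_of_real)
    also have "... = (\<integral>s. f s \<partial>density lborel (%s. ennreal (polar_const m * s ^ (m + 1) * (Jm m 0 + Jm m (s * norm x)) * indicator {0..} s)))"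
      unfolding polar_measure[OF dim]
      by (intro arg_cong2[of _ _ _ _ lebesgue_integral] arg_cong2[of _ _ _ _ density] refl ext) (auto simp: indicator_def)
    also have "... = (LBINT s. (polar_const m * s ^ (m + 1) * (Jm m 0 + Jm m (s * norm x)) * indicator {0..} s) *\<^sub>R f s)"
      using polar_const_pos[of m] by (subst integral_density) (auto intro!: AE_I2 mult_nonneg_nonneg Jm_nonneg_add simp: indicator_def)
    also have "... = (LBINT s. of_real (polar_const m) * (f s * of_real (s ^ (m + 1) * Jm m (s * 0)) * indicator {0..} s + f s * of_real (s ^ (m + 1) * Jm m (s * norm x)) * indicator {0..} s))"
      by (intro Bochner_Integration.integral_cong) (auto simp: indicator_def scaleR_conv_of_real algebra_simps)
    also have "... = of_real (polar_const m) * ((LBINT s. f s * of_real (s ^ (m + 1) * Jm m (s * 0)) * indicator {0..} s) + (LBINT s. f s * of_real (s ^ (m + 1) * Jm m (s * norm x)) * indicator {0..} s))"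
      by (simp only: integral_mult_right_zero Bochner_Integration.integral_add[OF fJ fJ])
    finally show ?thesis .
  qed
  have ic: "integrable lborel (%\<xi>::real^'n. of_real (g \<xi>) * f (norm \<xi>))" if [measurable]: "g \<in> borel_measurable borel" and "\<And>\<xi>. \<bar>g \<xi>\<bar> <= 1" for g
    by (rule Bochner_Integration.integrable_bound[OF int]) (use that in \<open>auto simp: norm_mult intro!: AE_I2 mult_left_le_one_le\<close>)
  have ii: "integrable lborel (%\<xi>::real^'n. of_real (cos (x \<bullet> \<xi>)) * f (norm \<xi>))" "integrable lborel (%\<xi>::real^'n. of_real (sin (x \<bullet> \<xi>)) * f (norm \<xi>))"
    by (auto intro!: ic)
  have A': "(LBINT \<xi>. of_real (1 + cos (x \<bullet> \<xi>)) * f (norm \<xi>)) = (integral\<^sup>L lborel (%\<xi>::real^'n. f (norm \<xi>))) + (LBINT \<xi>. of_real (cos (x \<bullet> \<xi>)) * f (norm \<xi>))"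
    using Bochner_Integration.integral_add[OF int ii(1)] by (simp add: distrib_right)
  have "2 * (integral\<^sup>L lborel (%\<xi>::real^'n. f (norm \<xi>))) = of_real (polar_const m) * (2 * (LBINT s. f s * of_real (s ^ (m + 1) * Jm m (s * 0)) * indicator {0..} s))"
  proof -
    have "2 * (integral\<^sup>L lborel (%\<xi>::real^'n. f (norm \<xi>))) = (LBINT \<xi>. of_real (1 + cos ((0::real^'n) \<bullet> \<xi>)) * f (norm \<xi>))" by simp
    also note A
    finally show ?thesis by (simp only: norm_zero mult_2)
  qed
  then have A0: "(integral\<^sup>L lborel (%\<xi>::real^'n. f (norm \<xi>))) = of_real (polar_const m) * (LBINT s. f s * of_real (s ^ (m + 1) * Jm m (s * 0)) * indicator {0..} s)"
    by simp
  have C: "(LBINT \<xi>. of_real (cos (x \<bullet> \<xi>)) * f (norm \<xi>)) = of_real (polar_const m) * (LBINT s. f s * of_real (s ^ (m + 1) * Jm m (s * norm x)) * indicator {0..} s)"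
    using A[of x] unfolding A' A0 distrib_left by simp
  have S: "(LBINT \<xi>. of_real (sin (x \<bullet> \<xi>)) * f (norm \<xi>)) = 0"
  proof -
    have o: "orthogonal_transformation (uminus :: real^'n => real^'n)" by (simp add: orthogonal_transformation_neg)
    have "(LBINT \<xi>. of_real (sin (x \<bullet> \<xi>)) * f (norm \<xi>)) = (\<integral>\<xi>. of_real (sin (x \<bullet> \<xi>)) * f (norm \<xi>) \<partial>distr lborel borel uminus)"
      unfolding lborel_distr_orthogonal(2)[OF o] ..
    also have "... = (LBINT \<xi>. of_real (sin (x \<bullet> (- \<xi>))) * f (norm (- \<xi>)))" by (rule integral_distr) auto
    also have "... = - (LBINT \<xi>. of_real (sin (x \<bullet> \<xi>)) * f (norm \<xi>))" by simp
    finally show ?thesis by simp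
  qed
  have "(LBINT \<xi>. cis (x \<bullet> \<xi>) * f (norm \<xi>)) = (LBINT \<xi>. of_real (cos (x \<bullet> \<xi>)) * f (norm \<xi>) + \<i> * (of_real (sin (x \<bullet> \<xi>)) * f (norm \<xi>)))"
    by (intro Bochner_Integration.integral_cong) (auto simp: cis_conv_exp exp_Euler cos_of_real sin_of_real algebra_simps)
  also have "... = (LBINT \<xi>. of_real (cos (x \<bullet> \<xi>)) * f (norm \<xi>)) + \<i> * (LBINT \<xi>. of_real (sin (x \<bullet> \<xi>)) * f (norm \<xi>))"
    by (subst Bochner_Integration.integral_add) (auto intro!: ii)
  finally show "(LBINT \<xi>. cis (x \<bullet> \<xi>) * f (norm \<xi>))
    = of_real (polar_const m) * (LBINT s. f s * of_real (s ^ (m + 1) * Jm m (s * norm x)) * indicator {0..} s)"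
    unfolding S C by simp
qed

section \<open>Van der Corput\<close>

lemma has_vector_derivative_cis:
  assumes "(f has_real_derivative d) (at x within S)"
  shows "((%x. cis (f x)) has_vector_derivative (of_real d * (\<i> * cis (f x)))) (at x within S)"
  using has_derivative_cis[OF assms[unfolded has_field_derivative_def]]
  unfolding has_vector_derivative_def
  by (rule has_derivative_eq_rhs) (auto simp: fun_eq_iff scaleR_conv_of_real)

text \<open>Integration by parts against \<open>1 / th1\<close>. As \<open>th2\<close> has one sign,
  the total variation of \<open>1 / th1\<close> is the difference of its end values, at most 2/l;
  the two boundary terms add another 2/l.\<close>

lemma van_der_Corput_first:
  fixes th th1 th2 :: "real => real"
  assumes ab: "a <= b" and l: "0 < l"
    and d1: "\<And>x. x \<in> {a..b} ==> (th has_real_derivative th1 x) (at x within {a..b})"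
    and d2: "\<And>x. x \<in> {a..b} ==> (th1 has_real_derivative th2 x) (at x within {a..b})"
    and c2: "continuous_on {a..b} th2"
    and pos: "\<And>x. x \<in> {a..b} ==> 0 <= th2 x"
    and lo: "\<And>x. x \<in> {a..b} ==> l <= \<bar>th1 x\<bar>"
  shows "norm (integral {a..b} (%x. cis (th x))) <= 4 / l"
proof -
  have c0: "continuous_on {a..b} th" and c1: "continuous_on {a..b} th1"
    using DERIV_continuous_on d1 d2 by blast+
  have nz: "th1 x \<noteq> 0" if "x \<in> {a..b}" for x using lo[OF that] l by auto
  define F where "F x = cis (th x) * complex_of_real (1 / th1 x) / \<i>" for x
  define G where "G x = cis (th x) * (complex_of_real (th2 x / (th1 x)\<^sup>2)) / \<i>" for x
  have dF: "(F has_vector_derivative (cis (th x) - G x)) (at x within {a..b})" if "x \<in> {a..b}" for x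
    unfolding F_def G_def
    apply (rule has_vector_derivative_eq_rhs)
    apply (rule has_vector_derivative_cis[OF d1[OF that]] has_vector_derivative_mult has_vector_derivative_divide has_vector_derivative_of_real derivative_eq_intros refl d2[OF that] | simp add: nz[OF that])+
    using nz[OF that] apply (simp add: field_simps power2_eq_square)
    done
  have i1: "((%x. cis (th x) - G x) has_integral (F b - F a)) {a..b}"
    by (rule fundamental_theorem_of_calculus[OF ab]) (use dF in auto)
  have cG: "continuous_on {a..b} G" unfolding G_def
    by (intro continuous_intros c0 c1 c2) (auto simp: nz)
  have i2: "integral {a..b} (%x. cis (th x)) = (F b - F a) + integral {a..b} G"
  proof -
    have "(%x. cis (th x)) integrable_on {a..b}" "G integrable_on {a..b}"
      by (intro integrable_continuous_interval continuous_intros c0 cG)+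
    from integral_diff[OF this] integral_unique[OF i1] show ?thesis by simp
  qed
  have nG: "norm (integral {a..b} G) <= integral {a..b} (%x. th2 x / (th1 x)\<^sup>2)"
  proof (rule integral_norm_bound_integral)
    show "G integrable_on {a..b}" by (intro integrable_continuous_interval cG)
    show "(%x. th2 x / (th1 x)\<^sup>2) integrable_on {a..b}"
      by (intro integrable_continuous_interval continuous_intros c1 c2) (auto simp: nz)
    show "norm (G x) <= th2 x / (th1 x)\<^sup>2" if "x \<in> {a..b}" for x
      unfolding G_def norm_divide norm_mult norm_of_real using pos[OF that] by (simp add: norm_cis)
  qed
  have "((%x. th2 x / (th1 x)\<^sup>2) has_integral (- (1 / th1 b) - - (1 / th1 a))) {a..b}"
    apply (rule fundamental_theorem_of_calculus[OF ab])
    apply (simp only: has_real_derivative_iff_has_vector_derivative[symmetric])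
    apply (rule derivative_eq_intros refl d2 | simp add: nz)+
    apply (auto simp: field_simps power2_eq_square nz)
    done
  hence "integral {a..b} (%x. th2 x / (th1 x)\<^sup>2) = 1 / th1 a - 1 / th1 b"
    by (simp add: integral_unique)
  also have "... <= \<bar>1 / th1 a\<bar> + \<bar>1 / th1 b\<bar>" by linarith
  also have "... <= 1 / l + 1 / l"
    using lo[of a] lo[of b] ab l by (intro add_mono) (auto simp: abs_divide intro!: divide_left_mono)
  finally have "norm (integral {a..b} G) <= 2 / l" using nG by simp
  moreover have "norm (F x) <= 1 / l" if "x \<in> {a..b}" for x
    unfolding F_def norm_divide norm_mult norm_of_real using lo[OF that] l
    by (simp add: norm_cis abs_divide) (auto intro!: divide_left_mono)
  hence "norm (F a) <= 1 / l" "norm (F b) <= 1 / l" using ab by auto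
  moreover have "norm (integral {a..b} (%x. cis (th x))) <= norm (F b) + norm (F a) + norm (integral {a..b} G)"
    unfolding i2 by (smt (verit) norm_triangle_ineq norm_triangle_ineq4)
  ultimately show ?thesis by (simp add: field_simps)
qed

text \<open>Since \<open>th1\<close> grows at rate at least \<open>\<mu>\<close>, it lies between
  \<open>- sqrt \<mu>\<close> and \<open>sqrt \<mu>\<close> only on an interval of length at most 2
  / sqrt \<mu>, which is estimated by its length. The pieces on either side fall under the first
  derivative test with \<open>l = sqrt \<mu>\<close>. The constant is 4 + 2 + 4.\<close>

lemma van_der_Corput_second:
  fixes th th1 th2 :: "real => real"
  assumes ab: "a <= b" and l: "0 < \<mu>"
    and d1: "\<And>x. x \<in> {a..b} ==> (th has_real_derivative th1 x) (at x within {a..b})"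
    and d2: "\<And>x. x \<in> {a..b} ==> (th1 has_real_derivative th2 x) (at x within {a..b})"
    and c2: "continuous_on {a..b} th2"
    and lo: "\<And>x. x \<in> {a..b} ==> \<mu> <= th2 x"
  shows "norm (integral {a..b} (%x. cis (th x))) <= 10 / sqrt \<mu>"
proof -
  define l where "l = sqrt \<mu>"
  have lpos: "l > 0" and ll: "l * l = \<mu>" using l by (auto simp: l_def)
  have c0: "continuous_on {a..b} th" and c1: "continuous_on {a..b} th1"
    using DERIV_continuous_on d1 d2 by blast+
  have grow: "\<mu> * (y - x) <= th1 y - th1 x" if "a <= x" "x <= y" "y <= b" for x y
  proof -
    have "\<exists>z\<in>{x..y}. th1 y - th1 x = th2 z * (y - x)"
    proof (rule mvt_very_simple)
      show "(th1 has_derivative (*) (th2 z)) (at z within {x..y})" if "x <= z" "z <= y" for z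
        using d2[of z] that \<open>a <= x\<close> \<open>y <= b\<close> unfolding has_field_derivative_def
        by (auto intro: has_derivative_subset)
    qed (fact that)
    then obtain z where "z \<in> {x..y}" "th1 y - th1 x = th2 z * (y - x)" by blast
    moreover have "\<mu> * (y - x) <= th2 z * (y - x)"
      using lo[of z] calculation that by (intro mult_right_mono) auto
    ultimately show ?thesis by simp
  qed
  \<comment> \<open>The point \<open>c\<close> is where \<open>th1\<close> reaches
    \<open>-l\<close>, or an end point if it never does. The guards \<open>a < c\<close> and
    \<open>c < b\<close> make the claims empty on a degenerate piece.\<close>
  have "\<exists>c\<in>{a..b}. (\<forall>x\<in>{a..c}. a < c --> th1 x <= -l) \<and> (\<forall>x\<in>{c..b}. c < b --> - l <= th1 x)"
  proof -
    consider "th1 a \<ge> -l" | "th1 b <= -l" | "th1 a < -l" "-l < th1 b" by linarith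
    then show ?thesis
    proof cases
      case 1
      have "- l <= th1 x" if "x \<in> {a..b}" for x
        using grow[of a x] that 1 l by (smt (verit) atLeastAtMost_iff mult_nonneg_nonneg)
      then show ?thesis using ab by (intro bexI[of _ a]) auto
    next
      case 2
      have "th1 x <= - l" if "x \<in> {a..b}" for x
        using grow[of x b] that 2 l by (smt (verit) atLeastAtMost_iff mult_nonneg_nonneg)
      then show ?thesis using ab by (intro bexI[of _ b]) auto
    next
      case 3
      obtain c where c: "a <= c" "c <= b" "th1 c = -l"
        using IVT'[of th1 a "-l" b] 3 ab c1 by auto
      have "th1 x <= - l" if "x \<in> {a..c}" for x
        using grow[of x c] that c l by (smt (verit) atLeastAtMost_iff mult_nonneg_nonneg)
      moreover have "- l <= th1 x" if "x \<in> {c..b}" for x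
        using grow[of c x] that c l by (smt (verit) atLeastAtMost_iff mult_nonneg_nonneg)
      ultimately show ?thesis using c by (intro bexI[of _ c]) auto
    qed
  qed
  then obtain c where c: "c \<in> {a..b}" "\<And>x. x \<in> {a..c} ==> a < c ==> th1 x <= -l"
     "\<And>x. x \<in> {c..b} ==> c < b ==> - l <= th1 x" by blast
  have "\<exists>d\<in>{c..b}. (\<forall>x\<in>{d..b}. d < b --> l <= th1 x) \<and> (c < d --> th1 d <= l)"
  proof -
    consider "th1 c \<ge> l" | "th1 b <= l" | "th1 c < l" "l < th1 b" by linarith
    then show ?thesis
    proof cases
      case 1
      have "l <= th1 x" if "x \<in> {c..b}" for x
        using grow[of c x] that 1 l c(1) by (smt (verit) atLeastAtMost_iff mult_nonneg_nonneg)
      then show ?thesis using c(1) by (intro bexI[of _ c]) auto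
    next
      case 2
      then show ?thesis using c(1) by (intro bexI[of _ b]) auto
    next
      case 3
      obtain d where d: "c <= d" "d <= b" "th1 d = l"
        using IVT'[of th1 c l b] 3 c(1) continuous_on_subset[OF c1, of "{c..b}"] by auto
      have "l <= th1 x" if "x \<in> {d..b}" for x
        using grow[of d x] that c(1) d l by (smt (verit) atLeastAtMost_iff mult_nonneg_nonneg)
      then show ?thesis using d by (intro bexI[of _ d]) auto
    qed
  qed
  then obtain d where d: "d \<in> {c..b}" "\<And>x. x \<in> {d..b} ==> d < b ==> l <= th1 x"
     "c < d ==> th1 d <= l" by blast
  let ?f = "%x. cis (th x)"
  have int: "?f integrable_on {a..b}"
    by (intro integrable_continuous_interval continuous_intros c0)
  have b1: "norm (integral {u..v} ?f) <= 4 / l" if "a <= u" "v <= b" "u < v ==> \<forall>x\<in>{u..v}. l <= \<bar>th1 x\<bar>" for u v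
  proof (cases "u < v")
    case True
    have sub: "{u..v} \<subseteq> {a..b}" using that by auto
    show ?thesis
    proof (rule van_der_Corput_first[OF _ lpos])
      show "(th has_real_derivative th1 x) (at x within {u..v})" if "x \<in> {u..v}" for x
        using d1[of x] that sub by (meson DERIV_subset subset_iff)
      show "(th1 has_real_derivative th2 x) (at x within {u..v})" if "x \<in> {u..v}" for x
        using d2[of x] that sub by (meson DERIV_subset subset_iff)
      show "continuous_on {u..v} th2" using c2 sub continuous_on_subset by blast
      show "0 <= th2 x" if "x \<in> {u..v}" for x using lo[of x] that sub l by fastforce
    qed (use True that in auto)
  next
    case False
    then have "u = v \<or> v < u" by auto
    then show ?thesis using lpos by auto
  qed
  have b2: "norm (integral {c..d} ?f) <= 2 / l"
  proof -
    have "\<mu> * (d - c) <= 2 * l"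
    proof (cases "c < d")
      case True
      then have "th1 d <= l" "- l <= th1 c" using d c by auto
      then show ?thesis using grow[of c d] c(1) d(1) by auto
    qed (use d lpos in auto)
    then have "l * (l * (d - c)) <= l * 2" unfolding ll[symmetric] by (simp add: mult_ac)
    then have "l * (d - c) <= 2" using lpos by (simp only: mult_le_cancel_left_pos)
    then have *: "d - c <= 2 / l" using lpos by (simp add: field_simps)
    have "norm (integral (cbox c d) ?f) <= 1 * measure lborel (cbox c d)"
      by (rule integrable_bound) (use int c d in \<open>auto intro!: integrable_continuous_interval continuous_intros continuous_on_subset[OF c0]\<close>)
    also have "... <= 2 / l" using * d(1) by simp
    finally show ?thesis by simp
  qed
  have "integral {a..b} ?f = integral {a..c} ?f + (integral {c..d} ?f + integral {d..b} ?f)"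
    using c(1) d(1) Henstock_Kurzweil_Integration.integral_combine[of a c b ?f]
      Henstock_Kurzweil_Integration.integral_combine[of c d b ?f] int
      integrable_on_subinterval[OF int, of c b] by auto
  also have "norm ... <= 4 / l + (2 / l + 4 / l)"
  proof (intro order_trans[OF norm_triangle_ineq] add_mono b1 b2)
    show "\<forall>x\<in>{a..c}. l <= \<bar>th1 x\<bar>" if "a < c" using c(2) that by fastforce
    show "\<forall>x\<in>{d..b}. l <= \<bar>th1 x\<bar>" if "d < b" using d(2) that by fastforce
  qed (use c d in auto)
  also have "... = 10 / sqrt \<mu>" by (simp add: l_def)
  finally show ?thesis .
qed

section \<open>Marcinkiewicz and Stein--Weiss inequalities\<close>

lemma nn_integral_powr_0:
  fixes a e :: real
  assumes "0 <= a" "-1 < e"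
  shows "(NNINT x. ennreal (x powr e) * indicator {0..a} x) = ennreal (a powr (e + 1) / (e + 1))"
  by (rule nn_integral_has_integral_lebesgue'[OF _ has_integral_powr_from_0]) (use assms in auto)

lemma layer_cake_powr:
  fixes a q :: real
  assumes "0 <= a" "0 < q"
  shows "ennreal (a powr q) = (NNINT x. ennreal (q * x powr (q - 1)) * indicator {0<..<a} x)"
proof -
  have "ennreal (a powr q) = ennreal q * ennreal (a powr (q - 1 + 1) / (q - 1 + 1))"
    using assms by (simp add: ennreal_mult[symmetric])
  also have "... = (NNINT x. ennreal q * (ennreal (x powr (q - 1)) * indicator {0..a} x))"
    using assms by (subst nn_integral_powr_0[symmetric]) (auto simp: nn_integral_cmult)
  also have "... = (NNINT x. ennreal (q * x powr (q - 1)) * indicator {0<..<a} x)"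
  proof (rule nn_integral_cong_AE)
    have "AE x in lborel. x \<noteq> 0 \<and> x \<noteq> a" using AE_lborel_singleton[of 0] AE_lborel_singleton[of a] by eventually_elim auto
    then show "AE x in lborel. ennreal q * (ennreal (x powr (q - 1)) * indicator {0..a} x)
        = ennreal (q * x powr (q - 1)) * indicator {0<..<a} x"
      by eventually_elim (use assms in \<open>auto simp: indicator_def ennreal_mult\<close>)
  qed
  finally show ?thesis .
qed

text \<open>A common domain for the operators below: contained in every L^p, so that their integrals
  converge absolutely, and closed under the truncations used in interpolation.\<close>

definition bdd_fun :: "(real => complex) => bool" where
  "bdd_fun f \<longleftrightarrow> f \<in> borel_measurable borel \<and> (\<exists>K. \<forall>x. norm (f x) <= K) \<and> (\<exists>N. \<forall>x. N < \<bar>x\<bar> --> f x = 0)"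

lemma bdd_funD: "bdd_fun f ==> f \<in> borel_measurable borel" by (simp add: bdd_fun_def)

lemma bdd_fun_integrable_powr:
  assumes f: "bdd_fun f" and p: "0 < p"
  shows "integrable lborel (%x. norm (f x) powr p)"
proof -
  obtain K N where K: "\<And>x. norm (f x) <= K" and N: "\<And>x. N < \<bar>x\<bar> ==> f x = 0"
    using f by (auto simp: bdd_fun_def)
  have [measurable]: "f \<in> borel_measurable borel" using f by (rule bdd_funD)
  have K0: "0 <= K" using order_trans[OF norm_ge_zero K[of 0]] .
  have "integrable lborel (%x. (K powr p) * indicator {- \<bar>N\<bar>..\<bar>N\<bar>} x :: real)" by simp
  then show ?thesis
  proof (rule Bochner_Integration.integrable_bound)
    show "AE x in lborel. norm (norm (f x) powr p) <= norm ((K powr p) * indicator {- \<bar>N\<bar>..\<bar>N\<bar>} x :: real)"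
    proof (rule AE_I2)
      fix x show "norm (norm (f x) powr p) <= norm ((K powr p) * indicator {- \<bar>N\<bar>..\<bar>N\<bar>} x :: real)"
        using K[of x] N[of x] p K0 by (cases "x \<in> {- \<bar>N\<bar>..\<bar>N\<bar>}") (auto intro!: powr_mono2)
    qed
  qed measurable
qed

lemma bdd_fun_integrable: "bdd_fun f ==> integrable lborel f"
  using bdd_fun_integrable_powr[of f 1] bdd_funD[of f] by (simp add: integrable_norm_iff)

lemma bdd_fun_integrable_sq: "bdd_fun f ==> integrable lborel (%x. (norm (f x))\<^sup>2)"
  using bdd_fun_integrable_powr[of f 2] by simp

lemma bdd_fun_mult_indicator:
  assumes "bdd_fun f" "S \<in> sets borel" shows "bdd_fun (%x. f x * indicator S x)"
proof -
  obtain K N where K: "\<And>x. norm (f x) <= K" and N: "\<And>x. N < \<bar>x\<bar> ==> f x = 0"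
    using assms by (auto simp: bdd_fun_def)
  have "norm (f x * indicator S x) <= K" for x
    using K[of x] order_trans[OF norm_ge_zero K[of x]] by (auto simp: indicator_def)
  then show ?thesis using assms N unfolding bdd_fun_def by auto
qed

text \<open>Interpolation between L^2 -> L^2 and L^1 -> L^\<infinity>. At each level
  \<open>l\<close> the function is split at a height \<open>\<mu> l\<close> such that
  \<open>U\<close> of the high part stays below l/2. Chebyshev's inequality in L^2 for the low part
  gives the measure of the level set, and the layer cake formula sums over \<open>l\<close>. The
  height depends on the norm of \<open>f\<close>, which makes the resulting bound homogeneous in
  \<open>f\<close>.\<close>

lemma marcinkiewicz:
  fixes U :: "(real => complex) => real => complex" and q A B :: real
  defines "p \<equiv> q / (q - 1)"
  assumes q: "2 < q" and A: "0 <= A" and B: "0 < B"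
    and meas: "\<And>f. bdd_fun f ==> U f \<in> borel_measurable borel"
    and add: "\<And>f g t. bdd_fun f ==> bdd_fun g ==> U (%x. f x + g x) t = U f t + U g t"
    and L2: "\<And>f. bdd_fun f ==> (NNINT t. ennreal ((norm (U f t))\<^sup>2)) <= ennreal (A * (LBINT x. (norm (f x))\<^sup>2))"
    and Linf: "\<And>f t. bdd_fun f ==> norm (U f t) <= B * (LBINT x. norm (f x))"
    and f: "bdd_fun f"
  shows "(NNINT t. ennreal (norm (U f t) powr q))
    <= ennreal (4 * q * 2 powr (q - 2) / (q - 2) * A * B powr (q - 2) * (LBINT x. norm (f x) powr p) powr (q - 1))"
proof -
  have p1: "1 < p" using q by (simp add: p_def field_simps)
  define X where "X = (LBINT x. norm (f x) powr p)"
  have fi: "integrable lborel (%x. norm (f x) powr p)" using bdd_fun_integrable_powr[OF f] p1 by simp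
  have X0: "0 <= X" unfolding X_def by (intro integral_nonneg_AE) auto
  have [measurable]: "f \<in> borel_measurable borel" "U f \<in> borel_measurable borel" using f bdd_funD meas by auto
  show ?thesis
  proof (cases "X = 0")
    case True
    then have "AE x in lborel. norm (f x) powr p = 0"
      unfolding X_def using integral_nonneg_eq_0_iff_AE[OF fi] by auto
    then have "AE x in lborel. norm (f x) = 0" by eventually_elim (use p1 in auto)
    then have "(LBINT x. norm (f x)) = 0" by (simp add: integral_eq_zero_AE)
    then have "U f t = 0" for t using Linf[OF f, of t] by simp
    then show ?thesis by simp
  next
    case False
    then have Xp: "X > 0" using X0 by simp
    \<comment> \<open>Chosen so that \<open>\<mu> l powr (1 - p) = l / (2 * B * X)\<close>. Above
      this height |f| <= |f|^p (\<mu> l)^(1-p), so the high part has L^1 norm at most l / (2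
      B).\<close>
    define \<mu> where "\<mu> l = (2 * B * X / l) powr (q - 1)" for l
    have weak: "(NNINT t. indicator {0<..<norm (U f t)} l)
        <= ennreal (4 * A / l\<^sup>2) * (NNINT x. ennreal ((norm (f x))\<^sup>2) * indicator {..\<mu> l} (norm (f x)))" if l: "0 < l" for l
    proof -
      define S where "S = {x. norm (f x) <= \<mu> l}"
      have S[measurable]: "S \<in> sets borel" unfolding S_def by measurable
      define f1 where "f1 x = f x * indicator S x" for x
      define f2 where "f2 x = f x * indicator (- S) x" for x
      have f12: "bdd_fun f1" "bdd_fun f2" unfolding f1_def f2_def using S by (auto intro!: bdd_fun_mult_indicator f)
      have [measurable]: "U f1 \<in> borel_measurable borel" using meas f12 by auto
      have mp: "\<mu> l > 0" using Xp B l by (simp add: \<mu>_def)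
      have mu: "\<mu> l powr (1 - p) = l / (2 * B * X)"
      proof -
        have e: "(q - 1) * (1 - p) = -1" using q by (simp add: p_def field_simps)
        show ?thesis unfolding \<mu>_def powr_powr e using Xp B l by (simp add: powr_minus)
      qed
      have "(LBINT x. norm (f2 x)) <= (LBINT x. norm (f x) powr p * \<mu> l powr (1 - p))"
      proof (intro integral_mono integrable_mult_left fi integrable_norm bdd_fun_integrable f12)
        fix x show "norm (f2 x) <= norm (f x) powr p * \<mu> l powr (1 - p)"
        proof (cases "x \<in> S")
          case True then show ?thesis by (simp add: f2_def)
        next
          case False
          then have g: "\<mu> l < norm (f x)" by (simp add: S_def)
          have "norm (f2 x) = norm (f x) powr p * norm (f x) powr (1 - p)"
            using False g mp by (simp add: f2_def powr_add[symmetric])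
          also have "... <= norm (f x) powr p * \<mu> l powr (1 - p)"
            using g mp p1 by (intro mult_left_mono powr_mono2') auto
          finally show ?thesis .
        qed
      qed
      also have "... = l / (2 * B)" unfolding mu using Xp by (simp add: X_def[symmetric])
      finally have "B * (LBINT x. norm (f2 x)) <= l / 2" using B by (simp add: field_simps)
      then have U2: "norm (U f2 t) <= l / 2" for t using Linf[OF f12(2), of t] by simp
      have "f = (%x. f1 x + f2 x)" by (auto simp: f1_def f2_def indicator_def)
      then have Us: "U f t = U f1 t + U f2 t" for t using add[OF f12, of t] by simp
      have "(NNINT t. indicator {0<..<norm (U f t)} l) <= (NNINT t. ennreal (4 / l\<^sup>2) * ennreal ((norm (U f1 t))\<^sup>2))"
      proof (rule nn_integral_mono)
        fix t
        show "indicator {0<..<norm (U f t)} l <= ennreal (4 / l\<^sup>2) * ennreal ((norm (U f1 t))\<^sup>2)"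
        proof (cases "l < norm (U f t)")
          case True
          then have "l / 2 <= norm (U f1 t)" using Us[of t] U2[of t] norm_triangle_ineq[of "U f1 t" "U f2 t"] by simp
          then have "(l / 2)\<^sup>2 <= (norm (U f1 t))\<^sup>2" using l by (intro power_mono) auto
          then have "1 <= 4 / l\<^sup>2 * (norm (U f1 t))\<^sup>2" using l by (simp add: field_simps)
          then show ?thesis using True l by (simp add: ennreal_mult[symmetric] ennreal_leI flip: ennreal_1)
        qed auto
      qed
      also have "... = ennreal (4 / l\<^sup>2) * (NNINT t. ennreal ((norm (U f1 t))\<^sup>2))" by (simp add: nn_integral_cmult)
      also have "... <= ennreal (4 / l\<^sup>2) * ennreal (A * (LBINT x. (norm (f1 x))\<^sup>2))" by (intro mult_left_mono L2 f12) auto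
      also have "... = ennreal (4 * A / l\<^sup>2) * ennreal (LBINT x. (norm (f1 x))\<^sup>2)"
        using A by (simp add: ennreal_mult[symmetric])
      also have "ennreal (LBINT x. (norm (f1 x))\<^sup>2) = (NNINT x. ennreal ((norm (f1 x))\<^sup>2))"
        by (rule nn_integral_eq_integral[symmetric]) (auto intro!: bdd_fun_integrable_sq f12)
      also have "... = (NNINT x. ennreal ((norm (f x))\<^sup>2) * indicator {..\<mu> l} (norm (f x)))"
        by (intro nn_integral_cong) (auto simp: f1_def S_def indicator_def)
      finally show ?thesis .
    qed
    let ?w = "%l. ennreal (q * l powr (q - 1))"
    have "(NNINT t. ennreal (norm (U f t) powr q)) = (NNINT t. (NNINT l. ?w l * indicator {0<..<norm (U f t)} l))"
      using q by (intro nn_integral_cong layer_cake_powr) auto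
    also have "... = (NNINT l. (NNINT t. ?w l * indicator {0<..<norm (U f t)} l))"
      by (rule lborel_pair.Fubini') (simp add: greaterThanLessThan_def indicator_inter_arith lessThan_def greaterThan_def indicator_def[abs_def] del: Collect_conj_eq)
    also have "... <= (NNINT l. (NNINT x. ennreal (4 * q * A * l powr (q - 3)) * indicator {0<..} l * (ennreal ((norm (f x))\<^sup>2) * indicator {..\<mu> l} (norm (f x)))))"
    proof (rule nn_integral_mono)
      fix l :: real
      have m1: "(%t. indicator {0<..<norm (U f t)} l :: ennreal) \<in> borel_measurable borel"
        unfolding indicator_def greaterThanLessThan_iff by measurable
      show "(NNINT t. ?w l * indicator {0<..<norm (U f t)} l) <= (NNINT x. ennreal (4 * q * A * l powr (q - 3)) * indicator {0<..} l * (ennreal ((norm (f x))\<^sup>2) * indicator {..\<mu> l} (norm (f x))))"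
      proof (cases "0 < l")
        case True
        have "(NNINT t. ?w l * indicator {0<..<norm (U f t)} l) = ?w l * (NNINT t. indicator {0<..<norm (U f t)} l)"
          using m1 by (intro nn_integral_cmult) auto
        also have "... <= ?w l * (ennreal (4 * A / l\<^sup>2) * (NNINT x. ennreal ((norm (f x))\<^sup>2) * indicator {..\<mu> l} (norm (f x))))"
          by (intro mult_left_mono weak True) auto
        also have "... = ennreal (4 * q * A * l powr (q - 3)) * (NNINT x. ennreal ((norm (f x))\<^sup>2) * indicator {..\<mu> l} (norm (f x)))"
        proof -
          have "l powr (q - 1) / l\<^sup>2 = l powr (q - 1) / l powr 2" using True by simp
          also have "... = l powr (q - 3)" by (subst powr_diff[symmetric]) simp
          finally have E: "l powr (q - 1) / l\<^sup>2 = l powr (q - 3)" .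
          have "q * l powr (q - 1) * (4 * A / l\<^sup>2) = 4 * q * A * (l powr (q - 1) / l\<^sup>2)" by simp
          then have "q * l powr (q - 1) * (4 * A / l\<^sup>2) = 4 * q * A * l powr (q - 3)" by (simp only: E)
          then show ?thesis using A q by (simp add: ennreal_mult[symmetric] mult.assoc[symmetric])
        qed
        also have "... = (NNINT x. ennreal (4 * q * A * l powr (q - 3)) * indicator {0<..} l * (ennreal ((norm (f x))\<^sup>2) * indicator {..\<mu> l} (norm (f x))))"
          using True by (subst nn_integral_cmult) auto
        finally show ?thesis .
      next
        case False
        then have "(%t. ?w l * indicator {0<..<norm (U f t)} l) = (%t. 0)" by (auto simp: fun_eq_iff)
        then show ?thesis by simp
      qed
    qed
    also have "... = (NNINT x. (NNINT l. ennreal (4 * q * A * l powr (q - 3)) * indicator {0<..} l * (ennreal ((norm (f x))\<^sup>2) * indicator {..\<mu> l} (norm (f x)))))"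
      by (rule lborel_pair.Fubini') (simp add: \<mu>_def indicator_def[abs_def])
    also have "... <= (NNINT x. ennreal (4 * q * A / (q - 2) * (2 * B * X) powr (q - 2)) * ennreal (norm (f x) powr p))"
    proof (rule nn_integral_mono)
      fix x
      show "(NNINT l. ennreal (4 * q * A * l powr (q - 3)) * indicator {0<..} l * (ennreal ((norm (f x))\<^sup>2) * indicator {..\<mu> l} (norm (f x))))
         <= ennreal (4 * q * A / (q - 2) * (2 * B * X) powr (q - 2)) * ennreal (norm (f x) powr p)"
      proof (cases "f x = 0")
        case False
        define a where "a = norm (f x)"
        have a: "a > 0" using False by (simp add: a_def)
        \<comment> \<open>Solving \<open>a <= \<mu> l\<close> for \<open>l\<close> gives
          \<open>l <= L\<close>. The remaining integral of \<open>l powr (q - 3)\<close> converges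
          at 0 because \<open>2 < q\<close>.\<close>
        define L where "L = 2 * B * X * a powr (- 1 / (q - 1))"
        have L0: "0 <= L" using B Xp by (simp add: L_def)
        have imp: "l <= L" if "0 < l" "a <= \<mu> l" for l
        proof -
          have "a powr (1 / (q - 1)) <= \<mu> l powr (1 / (q - 1))" using that a q by (intro powr_mono2) auto
          also have "... = 2 * B * X / l" unfolding \<mu>_def powr_powr using q that B Xp by simp
          finally have "a powr (1 / (q - 1)) * l <= 2 * B * X" using that by (simp add: field_simps)
          then show ?thesis using a unfolding L_def by (simp add: powr_minus field_simps)
        qed
        have "(NNINT l. ennreal (4 * q * A * l powr (q - 3)) * indicator {0<..} l * (ennreal ((norm (f x))\<^sup>2) * indicator {..\<mu> l} (norm (f x))))
          <= (NNINT l. ennreal (4 * q * A * a\<^sup>2) * (ennreal (l powr (q - 3)) * indicator {0..L} l))"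
          using imp A q by (intro nn_integral_mono) (auto simp: indicator_def a_def[symmetric] ennreal_mult[symmetric] mult_ac)
        also have "... = ennreal (4 * q * A * a\<^sup>2) * ennreal (L powr (q - 3 + 1) / (q - 3 + 1))"
          using q L0 by (simp add: nn_integral_cmult nn_integral_powr_0)
        also have "... = ennreal (4 * q * A * a\<^sup>2 * (L powr (q - 2) / (q - 2)))"
          using q A by (simp add: ennreal_mult[symmetric])
        also have "4 * q * A * a\<^sup>2 * (L powr (q - 2) / (q - 2)) = 4 * q * A / (q - 2) * (2 * B * X) powr (q - 2) * a powr p"
        proof -
          have "a\<^sup>2 * (a powr (- 1 / (q - 1))) powr (q - 2) = a powr 2 * a powr (- 1 / (q - 1) * (q - 2))"
            using a by (simp add: powr_powr)
          also have "... = a powr p" unfolding powr_add[symmetric] p_def using q by (intro arg_cong[of _ _ "(powr) a"]) (simp add: field_simps)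
          finally have e: "a\<^sup>2 * (a powr (- 1 / (q - 1))) powr (q - 2) = a powr p" .
          have "L powr (q - 2) = (2 * B * X) powr (q - 2) * (a powr (- 1 / (q - 1))) powr (q - 2)"
            unfolding L_def using B Xp by (simp add: powr_mult)
          then show ?thesis unfolding e[symmetric] by (simp add: mult_ac)
        qed
        also have "ennreal (4 * q * A / (q - 2) * (2 * B * X) powr (q - 2) * a powr p) = ennreal (4 * q * A / (q - 2) * (2 * B * X) powr (q - 2)) * ennreal (norm (f x) powr p)"
          unfolding a_def by (subst ennreal_mult[symmetric]) (use q A in auto)
        finally show ?thesis .
      qed simp
    qed
    also have "... = ennreal (4 * q * A / (q - 2) * (2 * B * X) powr (q - 2)) * ennreal X"
      unfolding X_def by (subst nn_integral_cmult) (auto simp: nn_integral_eq_integral[OF fi])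
    also have "... = ennreal (4 * q * A / (q - 2) * (2 * B * X) powr (q - 2) * X)"
      using q A X0 by (simp add: ennreal_mult[symmetric])
    also have "4 * q * A / (q - 2) * (2 * B * X) powr (q - 2) * X = 4 * q * 2 powr (q - 2) / (q - 2) * A * B powr (q - 2) * X powr (q - 1)"
    proof -
      have "X powr (q - 1) = X powr (q - 2) * X" using Xp powr_add[of X "q - 2" 1] by simp
      then show ?thesis using B Xp by (simp add: powr_mult mult_ac)
    qed
    finally show ?thesis by (simp add: X_def)
  qed
qed

section \<open>The Stein--Weiss inequality on the half-line\<close>

lemma geometric_le_sum:
  fixes a b c x :: real
  assumes "0 <= a" "0 <= b" "0 <= c" "0 < x" "x < 1/2"
  shows "a powr x * b powr x * c powr (1 - 2 * x) <= a + b + c"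
proof (cases "a + b + c = 0")
  case True then show ?thesis using assms by (simp add: add_nonneg_eq_0_iff)
next
  case False
  then have S: "a + b + c > 0" using assms by linarith
  have "a powr x * b powr x * c powr (1 - 2 * x) <= (a + b + c) powr x * (a + b + c) powr x * (a + b + c) powr (1 - 2 * x)"
    using assms by (intro mult_mono powr_mono2) auto
  also have "... = a + b + c" using S by (simp add: powr_add[symmetric])
  finally show ?thesis .
qed

lemma ennreal_le_sum3: "(a::ennreal) <= a + b + c" "(b::ennreal) <= a + b + c" "(c::ennreal) <= a + b + c"
  by (auto intro: add_increasing add_increasing2)

lemma nn_integral_powr_inf:
  fixes a e :: real
  assumes "0 < a" "e < -1"
  shows "(NNINT x. ennreal (x powr e) * indicator {a..} x) = ennreal (- (a powr (e + 1)) / (e + 1))"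
  by (rule nn_integral_has_integral_lebesgue'[OF _ has_integral_powr_to_inf]) (use assms in auto)

text \<open>The kernel is homogeneous of degree -1, so the substitution s = r u removes
  \<open>r\<close>. The remaining integral converges at 0 since (1+\<beta>)/2 < 1, at 1 since
  1-\<beta> < 1 and at infinity since (3-\<beta>)/2 > 1. The three majorants \<open>?m1\<close>,
  \<open>?m2\<close>, \<open>?m3\<close> belong to these places.\<close>

lemma stein_weiss_const:
  fixes \<beta> :: real assumes \<beta>: "0 < \<beta>" "\<beta> < 1"
  obtains C where "0 <= C" "\<And>r. 0 < r ==>
     (NNINT s. ennreal (r powr ((1 - \<beta>) / 2) * s powr (- (1 + \<beta>) / 2) * \<bar>r - s\<bar> powr (- (1 - \<beta>))) * indicator {0<..} s) <= ennreal C"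
proof -
  let ?k = "%u::real. u powr (- (1 + \<beta>) / 2) * \<bar>1 - u\<bar> powr (- (1 - \<beta>))"
  let ?m1 = "%u::real. ennreal (u powr (- (1 + \<beta>) / 2)) * indicator {0..1} u"
  let ?m2 = "%u::real. ennreal (\<bar>1 - u\<bar> powr (- (1 - \<beta>))) * indicator {0..2} u"
  let ?m3 = "%u::real. ennreal (u powr (- (3 - \<beta>) / 2)) * indicator {1..} u"
  have pt: "ennreal (?k u) * indicator {0<..} u <= 2 * ?m1 u + 2 * ?m2 u + 2 * ?m3 u" for u
  proof (cases "u <= 0")
    case True then show ?thesis by simp
  next
    case False
    then have u: "0 < u" by simp
    have two: "2 powr (1 - \<beta>) <= (2::real)" "2 powr ((1 + \<beta>) / 2) <= (2::real)"
      using powr_mono[of "1 - \<beta>" 1 "2::real"] powr_mono[of "(1 + \<beta>) / 2" 1 "2::real"] \<beta> by auto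
    have half: "(1/2) powr (- (1 - \<beta>)) <= (2::real)" "(1/2) powr (- (1 + \<beta>) / 2) <= (2::real)"
    proof -
      have "(1/2::real) powr (- e) = 2 powr e" for e by (simp add: powr_divide powr_minus)
      note h = this
      show "(1/2) powr (- (1 - \<beta>)) <= (2::real)" unfolding h by (rule two)
      show "(1/2) powr (- (1 + \<beta>) / 2) <= (2::real)" unfolding minus_divide_left[symmetric] h by (rule two)
    qed
    consider "u <= 1/2" | "1/2 < u" "u < 2" | "2 <= u" by linarith
    then show ?thesis
    proof cases
      case 1
      have "?k u <= u powr (- (1 + \<beta>) / 2) * (1/2) powr (- (1 - \<beta>))"
        using 1 \<beta> u by (intro mult_left_mono powr_mono2') auto
      also have "... <= u powr (- (1 + \<beta>) / 2) * 2" using half by (intro mult_left_mono) auto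
      finally have "ennreal (?k u) <= ennreal (2 * u powr (- (1 + \<beta>) / 2))" by (intro ennreal_leI) simp
      also have "... = 2 * ?m1 u" using 1 u by (simp add: ennreal_mult)
      also have "... <= 2 * ?m1 u + 2 * ?m2 u + 2 * ?m3 u" by (rule ennreal_le_sum3)
      finally show ?thesis using u by simp
    next
      case 2
      have "?k u <= (1/2) powr (- (1 + \<beta>) / 2) * \<bar>1 - u\<bar> powr (- (1 - \<beta>))"
        using 2 \<beta> u by (intro mult_right_mono powr_mono2') auto
      also have "... <= 2 * \<bar>1 - u\<bar> powr (- (1 - \<beta>))" using half by (intro mult_right_mono) auto
      finally have "ennreal (?k u) <= ennreal (2 * \<bar>1 - u\<bar> powr (- (1 - \<beta>)))" by (intro ennreal_leI) simp
      also have "... = 2 * ?m2 u" using 2 u by (simp add: ennreal_mult)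
      also have "... <= 2 * ?m1 u + 2 * ?m2 u + 2 * ?m3 u" by (rule ennreal_le_sum3)
      finally show ?thesis using u by simp
    next
      case 3
      have "?k u <= u powr (- (1 + \<beta>) / 2) * (u / 2) powr (- (1 - \<beta>))"
        using 3 \<beta> u by (intro mult_left_mono powr_mono2') auto
      also have "... = 2 powr (1 - \<beta>) * (u powr (- (1 + \<beta>) / 2) * u powr (- (1 - \<beta>)))"
      proof -
        have h: "(u / 2) powr (- e) = 2 powr e * u powr (- e)" for e using u by (simp add: powr_divide powr_minus field_simps)
        show ?thesis unfolding h by (simp only: mult_ac)
      qed
      also have "u powr (- (1 + \<beta>) / 2) * u powr (- (1 - \<beta>)) = u powr (- (3 - \<beta>) / 2)"
        unfolding powr_add[symmetric] by (intro arg_cong[of _ _ "(powr) u"]) (simp add: field_simps)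
      also have "2 powr (1 - \<beta>) * u powr (- (3 - \<beta>) / 2) <= 2 * u powr (- (3 - \<beta>) / 2)"
        using two by (intro mult_right_mono) auto
      finally have "ennreal (?k u) <= ennreal (2 * u powr (- (3 - \<beta>) / 2))" by (intro ennreal_leI) simp
      also have "... = 2 * ?m3 u" using 3 u by (simp add: ennreal_mult)
      also have "... <= 2 * ?m1 u + 2 * ?m2 u + 2 * ?m3 u" by (rule ennreal_le_sum3)
      finally show ?thesis using u by simp
    qed
  qed
  have i1: "(NNINT u. ?m1 u) < \<top>"
    using nn_integral_powr_0[of 1 "- (1 + \<beta>) / 2"] \<beta> by simp
  have i3: "(NNINT u. ?m3 u) < \<top>"
    using nn_integral_powr_inf[of 1 "- (3 - \<beta>) / 2"] \<beta> by simp
  have i2: "(NNINT u. ?m2 u) < \<top>"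
  proof -
    let ?p = "%u::real. ennreal (u powr (- (1 - \<beta>))) * indicator {0..1} u"
    have "(NNINT u. ?m2 u) <= (NNINT u. ?p (1 + (- 1) * u) + ?p (- 1 + 1 * u))"
      by (intro nn_integral_mono) (auto simp: indicator_def)
    also have "... = (NNINT u. ?p (1 + (- 1) * u)) + (NNINT u. ?p (- 1 + 1 * u))"
      by (intro nn_integral_add) measurable
    also have "(NNINT u. ?p (1 + (- 1) * u)) = (NNINT u. ?p u)"
      by (subst (2) nn_integral_real_affine[where c = "-1" and t = 1]) auto
    also have "(NNINT u. ?p (- 1 + 1 * u)) = (NNINT u. ?p u)"
      by (subst (2) nn_integral_real_affine[where c = "1" and t = "-1"]) auto
    finally show ?thesis using nn_integral_powr_0[of 1 "- (1 - \<beta>)"] \<beta> by (auto simp: order_le_less_trans)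
  qed
  define I where "I = (NNINT u. ennreal (?k u) * indicator {0<..} u)"
  have "I <= (NNINT u. 2 * ?m1 u + 2 * ?m2 u + 2 * ?m3 u)"
    unfolding I_def by (intro nn_integral_mono pt)
  also have "... = 2 * (NNINT u. ?m1 u) + 2 * (NNINT u. ?m2 u) + 2 * (NNINT u. ?m3 u)"
    by (simp add: nn_integral_add nn_integral_cmult)
  also have "... < \<top>" using i1 i2 i3 by (simp add: ennreal_mult_less_top)
  finally have If: "I = ennreal (enn2real I)" by simp
  show thesis
  proof (rule that[of "enn2real I"])
    fix r :: real assume r: "0 < r"
    have "(NNINT s. ennreal (r powr ((1 - \<beta>) / 2) * s powr (- (1 + \<beta>) / 2) * \<bar>r - s\<bar> powr (- (1 - \<beta>))) * indicator {0<..} s)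
      = ennreal \<bar>r\<bar> * (NNINT u. ennreal (r powr ((1 - \<beta>) / 2) * (0 + r * u) powr (- (1 + \<beta>) / 2) * \<bar>r - (0 + r * u)\<bar> powr (- (1 - \<beta>))) * indicator {0<..} (0 + r * u))"
      using r by (subst nn_integral_real_affine[where c = r and t = 0]) auto
    also have "... = (NNINT u. ennreal \<bar>r\<bar> * (ennreal (r powr ((1 - \<beta>) / 2) * (0 + r * u) powr (- (1 + \<beta>) / 2) * \<bar>r - (0 + r * u)\<bar> powr (- (1 - \<beta>))) * indicator {0<..} (0 + r * u)))"
      by (intro nn_integral_cmult[symmetric]) measurable
    also have "... = I" unfolding I_def
    proof (intro nn_integral_cong)
      fix u :: real
      show "ennreal \<bar>r\<bar> * (ennreal (r powr ((1 - \<beta>) / 2) * (0 + r * u) powr (- (1 + \<beta>) / 2) * \<bar>r - (0 + r * u)\<bar> powr (- (1 - \<beta>))) * indicator {0<..} (0 + r * u))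
        = ennreal (?k u) * indicator {0<..} u"
      proof (cases "0 < u")
        case True
        have "r - (0 + r * u) = r * (1 - u)" by (simp add: algebra_simps)
        then have ab: "\<bar>r - (0 + r * u)\<bar> = r * \<bar>1 - u\<bar>" using r by (simp add: abs_mult)
        have "r * (r powr ((1 - \<beta>) / 2) * (0 + r * u) powr (- (1 + \<beta>) / 2) * \<bar>r - (0 + r * u)\<bar> powr (- (1 - \<beta>)))
           = (r powr 1 * r powr ((1 - \<beta>) / 2) * r powr (- (1 + \<beta>) / 2) * r powr (- (1 - \<beta>))) * ?k u"
          unfolding ab using r True by (simp add: powr_mult)
        also have "r powr 1 * r powr ((1 - \<beta>) / 2) * r powr (- (1 + \<beta>) / 2) * r powr (- (1 - \<beta>)) = r powr 0"
          unfolding powr_add[symmetric] by (intro arg_cong[of _ _ "(powr) r"]) (simp add: field_simps)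
        finally show ?thesis using r True by (simp add: ennreal_mult[symmetric])
      qed (use r in \<open>simp add: zero_less_mult_iff\<close>)
    qed
    finally show "(NNINT s. ennreal (r powr ((1 - \<beta>) / 2) * s powr (- (1 + \<beta>) / 2) * \<bar>r - s\<bar> powr (- (1 - \<beta>))) * indicator {0<..} s) <= ennreal (enn2real I)"
      using If by simp
  qed simp
qed

text \<open>In the logarithmic variable the kernel becomes the convolution kernel
  \<open>\<bar>2 * sinh (u / 2)\<bar> powr - \<gamma>\<close>, which lies in \<open>L^(q/2)\<close>; this is the corresponding case of Young's inequality.\<close>
lemma stein_weiss:
  fixes q \<beta> \<gamma> p :: real
  assumes q: "2 < q" "q < 6" and \<beta>: "\<beta> = 3/2 - q/4" and \<gamma>: "\<gamma> = 1/2 - 1/q" and p: "p = q / (q - 1)"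
  obtains C where "0 <= C" "\<And>f X. f \<in> borel_measurable borel ==> (\<And>r. 0 <= f r) ==> 0 < X ==>
     (NNINT r. ennreal (f r powr p) * indicator {0<..} r) = ennreal X ==>
     (NNINT r. (NNINT s. ennreal (f r * f s * (r * s) powr (- \<beta> / q) * \<bar>r - s\<bar> powr (- \<gamma>)) * indicator {0<..} r * indicator {0<..} s))
       <= ennreal (C * X powr (2 / p))"
proof -
  have b: "0 < \<beta>" "\<beta> < 1" using q by (auto simp: \<beta>)
  obtain C0 where C0: "0 <= C0" "\<And>r. 0 < r ==>
     (NNINT s. ennreal (r powr ((1 - \<beta>) / 2) * s powr (- (1 + \<beta>) / 2) * \<bar>r - s\<bar> powr (- (1 - \<beta>))) * indicator {0<..} s) <= ennreal C0"
    using stein_weiss_const[OF b] by blast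
  define L where "L r s = r powr ((1 - \<beta>) / 2) * s powr (- (1 + \<beta>) / 2) * \<bar>r - s\<bar> powr (- (1 - \<beta>))" for r s :: real
  have L0: "0 <= L r s" for r s by (simp add: L_def)
  show thesis
  proof (rule that[of "2 * C0 + 1"])
    fix f :: "real => real" and X :: real
    assume [measurable]: "f \<in> borel_measurable borel" and f0: "\<And>r. 0 <= f r" and X: "0 < X"
      and fX: "(NNINT r. ennreal (f r powr p) * indicator {0<..} r) = ennreal X"
    have [measurable]: "(%x. L (fst x) (snd x)) \<in> borel_measurable (borel \<Otimes>\<^sub>M borel)" unfolding L_def by measurable
    have [measurable]: "(%x. L (snd x) (fst x)) \<in> borel_measurable (borel \<Otimes>\<^sub>M borel)" unfolding L_def by measurable
    let ?F = "%r. ennreal (f r powr p) * indicator {0<..} r"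
    \<comment> \<open>The integrand is a geometric mean of these three functions with weights 1/q,
      1/q and 1 - 2/q, and is bounded by their sum. The first two are integrated by
      \<open>stein_weiss_const\<close>, in one order of integration each. The third is a product
      whose factor \<open>1 / X\<close> gives it integral \<open>X\<close>, like the others up to a
      constant.\<close>
    let ?A = "%r s. ?F r * (ennreal (L r s) * indicator {0<..} s)"
    let ?B = "%r s. ?F s * (ennreal (L s r) * indicator {0<..} r)"
    let ?D = "%r s. ?F r * (?F s * ennreal (1 / X))"
    have pt: "ennreal (f r * f s * (r * s) powr (- \<beta> / q) * \<bar>r - s\<bar> powr (- \<gamma>)) * indicator {0<..} r * indicator {0<..} s
       <= ennreal (X powr (1 - 2 / q)) * (?A r s + ?B r s + ?D r s)" for r s
    proof (cases "0 < r \<and> 0 < s")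
      case True
      define a where "a = f r powr p * L r s"
      define b where "b = f s powr p * L s r"
      define c where "c = f r powr p * f s powr p / X"
      have abc: "0 <= a" "0 <= b" "0 <= c" using X L0 by (auto simp: a_def b_def c_def)
      have eq: "f r * f s * (r * s) powr (- \<beta> / q) * \<bar>r - s\<bar> powr (- \<gamma>) = X powr (1 - 2 / q) * (a powr (1/q) * b powr (1/q) * c powr (1 - 2 * (1/q)))"
      proof (cases "f r = 0 \<or> f s = 0 \<or> r = s")
        \<comment> \<open>\<open>0 powr x = 0\<close> for every \<open>x\<close>, so the singular
          kernel takes the value 0 on the diagonal and both sides vanish.\<close>
        case True
        then show ?thesis using q by (auto simp: a_def b_def c_def L_def \<gamma>)
      next
        case False
        then have pos: "0 < f r" "0 < f s" "0 < \<bar>r - s\<bar>" "0 < r" "0 < s" using f0[of r] f0[of s] True by auto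
        have rs: "\<bar>s - r\<bar> = \<bar>r - s\<bar>" by simp
        have "p / q + p * (1 - 2 / q) = p * ((q - 1) / q)" using q by (simp add: field_simps)
        also have "... = 1" using q unfolding p by simp
        finally have e1: "p / q + p * (1 - 2 / q) = 1" .
        have e2: "(1 - \<beta>) / (2 * q) + - (1 + \<beta>) / (2 * q) = - \<beta> / q" using q by (simp add: field_simps)
        have e3: "- (1 - \<beta>) / q + - (1 - \<beta>) / q = - \<gamma>" using q unfolding \<beta> \<gamma> by (simp add: field_simps)
        have "ln (f r * f s * (r * s) powr (- \<beta> / q) * \<bar>r - s\<bar> powr (- \<gamma>)) = ln (X powr (1 - 2 / q) * (a powr (1/q) * b powr (1/q) * c powr (1 - 2 * (1/q))))"
        proof -
          have "ln (X powr (1 - 2 / q) * (a powr (1/q) * b powr (1/q) * c powr (1 - 2 * (1/q))))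
            = (p / q + p * (1 - 2 / q)) * ln (f r) + (p / q + p * (1 - 2 / q)) * ln (f s)
              + ((1 - \<beta>) / (2 * q) + - (1 + \<beta>) / (2 * q)) * (ln r + ln s) + (- (1 - \<beta>) / q + - (1 - \<beta>) / q) * ln \<bar>r - s\<bar>"
            using pos X unfolding a_def b_def c_def L_def rs
            by (simp add: ln_mult ln_div ln_powr) (simp add: algebra_simps diff_divide_distrib add_divide_distrib)
          also have "... = ln (f r * f s * (r * s) powr (- \<beta> / q) * \<bar>r - s\<bar> powr (- \<gamma>))"
            unfolding e1 e2 e3 using pos by (simp add: ln_mult ln_powr algebra_simps)
          finally show ?thesis ..
        qed
        moreover have "0 < f r * f s * (r * s) powr (- \<beta> / q) * \<bar>r - s\<bar> powr (- \<gamma>)" using pos by simp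
        moreover have "0 < X powr (1 - 2 / q) * (a powr (1/q) * b powr (1/q) * c powr (1 - 2 * (1/q)))"
          using pos X unfolding a_def b_def c_def L_def by simp
        ultimately show ?thesis using ln_inj_iff by blast
      qed
      have "a powr (1/q) * b powr (1/q) * c powr (1 - 2 * (1/q)) <= a + b + c"
        using q by (intro geometric_le_sum abc) (auto simp: field_simps)
      then have "f r * f s * (r * s) powr (- \<beta> / q) * \<bar>r - s\<bar> powr (- \<gamma>) <= X powr (1 - 2 / q) * (a + b + c)"
        unfolding eq by (intro mult_left_mono) auto
      then have "ennreal (f r * f s * (r * s) powr (- \<beta> / q) * \<bar>r - s\<bar> powr (- \<gamma>)) <= ennreal (X powr (1 - 2 / q) * (a + b + c))"
        by (rule ennreal_leI)
      also have "... = ennreal (X powr (1 - 2 / q)) * (ennreal a + ennreal b + ennreal c)"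
        using abc by (simp add: ennreal_mult)
      also have "ennreal a + ennreal b + ennreal c = ?A r s + ?B r s + ?D r s"
        using True X L0 by (simp add: a_def b_def c_def ennreal_mult'[symmetric] mult.assoc)
      finally show ?thesis using True by simp
    qed auto
    have IA: "(NNINT r. (NNINT s. ?A r s)) <= ennreal (C0 * X)"
    proof -
      have "(NNINT r. (NNINT s. ?A r s)) <= (NNINT r. ?F r * ennreal C0)"
      proof (rule nn_integral_mono)
        fix r :: real
        have "(NNINT s. ?A r s) = ?F r * (NNINT s. ennreal (L r s) * indicator {0<..} s)"
          by (intro nn_integral_cmult) (simp add: L_def)
        also have "... <= ?F r * ennreal C0"
          using C0(2)[of r] by (cases "0 < r") (auto simp: L_def intro!: mult_left_mono)
        finally show "(NNINT s. ?A r s) <= ?F r * ennreal C0" .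
      qed
      also have "... = ennreal X * ennreal C0" by (simp add: nn_integral_multc fX)
      finally show ?thesis using X C0 by (simp add: ennreal_mult mult.commute)
    qed
    have IB: "(NNINT r. (NNINT s. ?B r s)) <= ennreal (C0 * X)"
      by (subst lborel_pair.Fubini') (use IA in simp_all)
    have ID: "(NNINT r. (NNINT s. ?D r s)) = ennreal X"
      using X by (simp add: nn_integral_cmult nn_integral_multc fX ennreal_mult[symmetric])
    have "(NNINT r. (NNINT s. ennreal (f r * f s * (r * s) powr (- \<beta> / q) * \<bar>r - s\<bar> powr (- \<gamma>)) * indicator {0<..} r * indicator {0<..} s))
       <= (NNINT r. (NNINT s. ennreal (X powr (1 - 2 / q)) * (?A r s + ?B r s + ?D r s)))"
      by (intro nn_integral_mono pt)
    also have "... = ennreal (X powr (1 - 2 / q)) * ((NNINT r. (NNINT s. ?A r s)) + (NNINT r. (NNINT s. ?B r s)) + (NNINT r. (NNINT s. ?D r s)))"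
    proof -
      have [measurable]: "(%s. L r s) \<in> borel_measurable borel" "(%s. L s r) \<in> borel_measurable borel" for r
        unfolding L_def by measurable
      show ?thesis by (simp add: nn_integral_cmult nn_integral_add)
    qed
    also have "... <= ennreal (X powr (1 - 2 / q)) * (ennreal (C0 * X) + ennreal (C0 * X) + ennreal X)"
      unfolding ID by (intro mult_left_mono add_mono IA IB order_refl) simp
    also have "... = ennreal (X powr (1 - 2 / q) * ((2 * C0 + 1) * X))"
      using X C0 by (simp add: ennreal_mult[symmetric] ennreal_plus[symmetric] algebra_simps del: ennreal_plus)
    also have "X powr (1 - 2 / q) * ((2 * C0 + 1) * X) = (2 * C0 + 1) * X powr (2 / p)"
    proof -
      have "2 / p = (1 - 2 / q) + 1" using q unfolding p by (simp add: field_simps)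
      show ?thesis unfolding \<open>2 / p = (1 - 2 / q) + 1\<close> powr_add using X by (simp add: mult_ac)
    qed
    finally show "(NNINT r. (NNINT s. ennreal (f r * f s * (r * s) powr (- \<beta> / q) * \<bar>r - s\<bar> powr (- \<gamma>)) * indicator {0<..} r * indicator {0<..} s))
       <= ennreal ((2 * C0 + 1) * X powr (2 / p))" .
  qed (use C0 in simp)
qed

lemma nn_integral_Holder:
  fixes f g :: "real => real" and p q a b :: real
  assumes pq: "1 < p" "1 < q" "1 / p + 1 / q = 1"
    and [measurable]: "f \<in> borel_measurable borel" "g \<in> borel_measurable borel"
    and f0: "\<And>x. 0 <= f x" and g0: "\<And>x. 0 <= g x" and a: "0 < a" and b: "0 < b"
    and f: "(NNINT x. ennreal (f x powr p)) <= ennreal (a powr p)"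
    and g: "(NNINT x. ennreal (g x powr q)) <= ennreal (b powr q)"
  shows "(NNINT x. ennreal (f x * g x)) <= ennreal (a * b)"
proof -
  have pt: "f x * g x <= a * b / (p * a powr p) * f x powr p + a * b / (q * b powr q) * g x powr q" for x
  proof -
    have "(f x / a) * (g x / b) <= (f x / a) powr p / p + (g x / b) powr q / q"
      using pq f0 g0 a b by (intro Youngs_inequality) auto
    then have "(a * b) * ((f x / a) * (g x / b)) <= (a * b) * ((f x / a) powr p / p + (g x / b) powr q / q)"
      using a b by (intro mult_left_mono) auto
    moreover have "(a * b) * ((f x / a) * (g x / b)) = f x * g x" using a b by simp
    moreover have "(a * b) * ((f x / a) powr p / p + (g x / b) powr q / q) = a * b / (p * a powr p) * f x powr p + a * b / (q * b powr q) * g x powr q"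
      using a b f0 g0 by (simp add: powr_divide distrib_left mult_ac)
    ultimately show ?thesis by simp
  qed
  have "(NNINT x. ennreal (f x * g x)) <= (NNINT x. ennreal (a * b / (p * a powr p)) * ennreal (f x powr p) + ennreal (a * b / (q * b powr q)) * ennreal (g x powr q))"
    using pt pq a b by (intro nn_integral_mono) (simp add: ennreal_mult[symmetric] ennreal_plus[symmetric] ennreal_leI del: ennreal_plus)
  also have "... = ennreal (a * b / (p * a powr p)) * (NNINT x. ennreal (f x powr p)) + ennreal (a * b / (q * b powr q)) * (NNINT x. ennreal (g x powr q))"
    by (simp add: nn_integral_add nn_integral_cmult)
  also have "... <= ennreal (a * b / (p * a powr p)) * ennreal (a powr p) + ennreal (a * b / (q * b powr q)) * ennreal (b powr q)"
    by (intro add_mono mult_left_mono f g) auto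
  also have "... = ennreal (a * b / p + a * b / q)"
    using pq a b by (simp add: ennreal_mult[symmetric] ennreal_plus[symmetric] del: ennreal_plus)
  also have "a * b / p + a * b / q = a * b * (1 / p + 1 / q)" by (simp add: distrib_left)
  finally show ?thesis unfolding pq by simp
qed

section \<open>One-dimensional Strichartz estimates\<close>

text \<open>What \<open>L2_bound\<close> requires of a phase on the frequency interval. Curvature
  enters the later estimates separately, as a hypothesis on the decay of the kernel.\<close>

locale phase =
  fixes \<Phi> :: "real => real" and c :: real
  assumes \<Phi>_meas[measurable]: "\<Phi> \<in> borel_measurable borel"
    and c: "0 < c"
    and lo: "\<And>s s'. s \<in> {1/2..2} ==> s' \<in> {1/2..2} ==> c * \<bar>s - s'\<bar> <= \<bar>\<Phi> s - \<Phi> s'\<bar>"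
begin

lemma L2_time:
  assumes [measurable]: "H \<in> borel_measurable borel" and H: "integrable lborel H" "integrable lborel (%s. (norm (H s))\<^sup>2)"
    and supp: "\<And>s. s \<notin> {1/2..2} ==> H s = (0::complex)"
  shows "(NNINT t. ennreal ((norm (LBINT s. cis (t * \<Phi> s) * H s))\<^sup>2)) <= ennreal (2 * pi / c * (LBINT s. (norm (H s))\<^sup>2))"
  using L2_bound[OF H \<Phi>_meas c] supp lo by (force simp: mult.commute)

text \<open>Dual to \<open>L2_time\<close>.\<close>
lemma L2_freq:
  assumes f: "bdd_fun f"
  defines "g \<equiv> %s. \<integral>t. cis (- (t * \<Phi> s)) * f t \<partial>lborel"
  shows "(LBINT s. (norm (g s * indicator {1/2..2} s))\<^sup>2) <= 2 * pi / c * (LBINT t. (norm (f t))\<^sup>2)"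
proof -
  have [measurable]: "f \<in> borel_measurable borel" by (rule bdd_funD[OF f])
  have [measurable]: "g \<in> borel_measurable borel" unfolding g_def by measurable
  have fi: "integrable lborel f" by (rule bdd_fun_integrable[OF f])
  have gb: "norm (g s) <= (LBINT t. norm (f t))" for s
    unfolding g_def using integral_norm_bound[of lborel "%t. cis (- (t * \<Phi> s)) * f t"] by (simp add: norm_mult)
  define H where "H s = g s * indicator {1/2..2} s" for s
  have Hb: "bdd_fun H" unfolding H_def bdd_fun_def
  proof (intro conjI exI allI impI)
    show "norm (g x * indicator {1/2..2} x) <= (LBINT t. norm (f t))" for x
      using gb[of x] by (auto simp: indicator_def)
    show "g x * indicator {1/2..2} x = 0" if "2 < \<bar>x\<bar>" for x using that by (auto simp: indicator_def)
  qed measurable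
  have [measurable]: "H \<in> borel_measurable borel" by (rule bdd_funD[OF Hb])
  have Hi: "integrable lborel H" "integrable lborel (%s. (norm (H s))\<^sup>2)"
    using Hb by (auto intro: bdd_fun_integrable bdd_fun_integrable_sq)
  define h where "h t = (LBINT s. cis (t * \<Phi> s) * H s)" for t
  have [measurable]: "h \<in> borel_measurable borel" unfolding h_def by measurable
  define Z where "Z = (LBINT s. (norm (H s))\<^sup>2)"
  define F where "F = (LBINT t. (norm (f t))\<^sup>2)"
  have Z0: "0 <= Z" "0 <= F" unfolding Z_def F_def by (auto intro: integral_nonneg_AE)
  \<comment> \<open>\<open>Z\<close> is the pairing of \<open>f\<close> with \<open>h\<close>, so
    Cauchy-Schwarz and \<open>L2_time\<close> give Z^2 <= F (2 pi / c) Z, and one factor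
    \<open>Z\<close> cancels.\<close>
  have HH: "complex_of_real ((norm (H s))\<^sup>2) = (LBINT t. cis (- (t * \<Phi> s)) * f t * cnj (H s))" for s
  proof -
    have "complex_of_real ((norm (H s))\<^sup>2) = H s * cnj (H s)" by (rule complex_norm_square)
    also have "... = g s * cnj (H s)" by (simp add: H_def indicator_def)
    finally show ?thesis by (simp add: g_def)
  qed
  have int: "integrable (lborel \<Otimes>\<^sub>M lborel) (%(s, t). cis (- (t * \<Phi> s)) * f t * cnj (H s))"
  proof (rule Bochner_Integration.integrable_bound)
    show "integrable (lborel \<Otimes>\<^sub>M lborel) (%z. H (fst z) * f (snd z))" by (rule integrable_pair_mult[OF Hi(1) fi])
  qed (auto simp: norm_mult)
  have "complex_of_real Z = (LBINT s. (LBINT t. cis (- (t * \<Phi> s)) * f t * cnj (H s)))"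
    unfolding Z_def HH[symmetric] by (rule integral_complex_of_real[symmetric])
  also have "... = (LBINT t. (LBINT s. cis (- (t * \<Phi> s)) * f t * cnj (H s)))"
    using lborel_pair.Fubini_integral[OF int] by simp
  also have "... = (LBINT t. f t * cnj (h t))"
  proof (rule Bochner_Integration.integral_cong[OF refl])
    fix t
    have "(LBINT s. cis (- (t * \<Phi> s)) * f t * cnj (H s)) = (LBINT s. f t * cnj (cis (t * \<Phi> s) * H s))"
      by (intro Bochner_Integration.integral_cong) (auto simp: cis_cnj)
    then show "(LBINT s. cis (- (t * \<Phi> s)) * f t * cnj (H s)) = f t * cnj (h t)"
      by (simp only: integral_mult_right_zero Bochner_Integration.integral_cnj h_def)
  qed
  finally have Zeq: "complex_of_real Z = (LBINT t. f t * cnj (h t))" .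
  have hb: "norm (h t) <= (LBINT s. norm (H s))" for t
    unfolding h_def using integral_norm_bound[of lborel "%s. cis (t * \<Phi> s) * H s"] by (simp add: norm_mult)
  have fhi: "integrable lborel (%t. f t * cnj (h t))"
  proof (rule Bochner_Integration.integrable_bound)
    show "integrable lborel (%t. f t * of_real (LBINT s. norm (H s)))" using fi by simp
    show "AE t in lborel. norm (f t * cnj (h t)) <= norm (f t * of_real (LBINT s. norm (H s)))"
      using hb by (intro AE_I2) (auto simp: norm_mult intro!: mult_left_mono intro: order_trans[OF _ abs_ge_self])
  qed measurable
  have "ennreal Z = ennreal (norm (complex_of_real Z))" using Z0 by simp
  also have "... <= (NNINT t. ennreal (norm (f t)) * ennreal (norm (h t)))"
    unfolding Zeq using integral_norm_bound_ennreal[OF fhi] by (simp add: norm_mult ennreal_mult)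
  finally have "(ennreal Z)\<^sup>2 <= (NNINT t. ennreal (norm (f t)) * ennreal (norm (h t)))\<^sup>2"
    by (rule power_mono) simp
  also have "... <= (NNINT t. (ennreal (norm (f t)))\<^sup>2) * (NNINT t. (ennreal (norm (h t)))\<^sup>2)"
    by (intro Cauchy_Schwarz_nn_integral) measurable
  also have "... = (NNINT t. ennreal ((norm (f t))\<^sup>2)) * (NNINT t. ennreal ((norm (h t))\<^sup>2))"
    by (simp add: ennreal_power)
  also have "... <= ennreal F * ennreal (2 * pi / c * Z)"
  proof (rule mult_mono)
    show "(NNINT t. ennreal ((norm (f t))\<^sup>2)) <= ennreal F"
      unfolding F_def by (subst nn_integral_eq_integral) (auto intro: bdd_fun_integrable_sq f)
    show "(NNINT t. ennreal ((norm (h t))\<^sup>2)) <= ennreal (2 * pi / c * Z)"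
      unfolding Z_def h_def
      by (rule L2_time[OF \<open>H \<in> borel_measurable borel\<close> Hi]) (simp add: H_def)
  qed auto
  finally have E: "(ennreal Z)\<^sup>2 <= ennreal F * ennreal (2 * pi / c * Z)" .
  have "ennreal (Z\<^sup>2) <= ennreal (F * (2 * pi / c * Z))"
    by (subst ennreal_mult) (use Z0 c E in \<open>simp_all add: ennreal_power\<close>)
  moreover have "0 <= F * (2 * pi / c * Z)" using Z0 c by simp
  ultimately have "Z\<^sup>2 <= F * (2 * pi / c * Z)" by (simp only: ennreal_le_iff)
  then have "Z * Z <= (2 * pi / c * F) * Z" by (simp add: power2_eq_square mult_ac)
  then have "Z <= 2 * pi / c * F"
  proof (cases "Z = 0")
    case False
    then show ?thesis using \<open>Z * Z <= (2 * pi / c * F) * Z\<close> Z0 by (intro mult_right_le_imp_le[of Z Z]) auto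
  qed (use Z0 c in simp)
  then show ?thesis by (simp add: Z_def F_def H_def)
qed

text \<open>The TT* operator in time between two fixed radii: \<open>f\<close> is analysed into
  frequencies in [1/2, 2], modulated by \<open>cis (R * s)\<close> with \<open>R\<close> plus or
  minus the difference of the radii, and synthesised again.\<close>

definition U :: "real => (real => complex) => real => complex" where
  "U R f t = (LBINT s. cis (t * \<Phi> s) * (cis (R * s) * ((LBINT t'. cis (- (t' * \<Phi> s)) * f t') * indicator {1/2..2} s)))"

lemma bdd_fun_freq:
  assumes f: "bdd_fun f"
  shows "bdd_fun (%s. cis (R * s) * ((LBINT t'. cis (- (t' * \<Phi> s)) * f t') * indicator {1/2..2} s))"
  unfolding bdd_fun_def
proof (intro conjI exI allI impI)
  have [measurable]: "f \<in> borel_measurable borel" by (rule bdd_funD[OF f])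
  show "(%s. cis (R * s) * ((LBINT t'. cis (- (t' * \<Phi> s)) * f t') * indicator {1/2..2} s)) \<in> borel_measurable borel" by measurable
  fix s
  have "norm (LBINT t'. cis (- (t' * \<Phi> s)) * f t') <= (LBINT t. norm (f t))"
    using integral_norm_bound[of lborel "%t. cis (- (t * \<Phi> s)) * f t"] by (simp add: norm_mult)
  then show "norm (cis (R * s) * ((LBINT t'. cis (- (t' * \<Phi> s)) * f t') * indicator {1/2..2} s)) <= (LBINT t. norm (f t))"
    by (auto simp: norm_mult indicator_def)
next
  fix s :: real assume "2 < \<bar>s\<bar>"
  then show "cis (R * s) * ((LBINT t'. cis (- (t' * \<Phi> s)) * f t') * indicator {1/2..2} s) = 0" by (auto simp: indicator_def)
qed

lemma cis_mult_integrable: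
  assumes "integrable lborel f" and [measurable]: "g \<in> borel_measurable borel"
  shows "integrable lborel (%x. cis (g x) * f x)"
  by (rule Bochner_Integration.integrable_bound[OF assms(1)]) (use assms in \<open>auto simp: norm_mult\<close>)

lemma U_add:
  assumes f: "bdd_fun f" and g: "bdd_fun g"
  shows "U R (%x. f x + g x) t = U R f t + U R g t"
proof -
  have 1: "(LBINT t'. cis (- (t' * \<Phi> s)) * (f t' + g t')) = (LBINT t'. cis (- (t' * \<Phi> s)) * f t') + (LBINT t'. cis (- (t' * \<Phi> s)) * g t')" for s
    unfolding distrib_left by (intro Bochner_Integration.integral_add cis_mult_integrable bdd_fun_integrable f g) measurable
  show ?thesis unfolding U_def
    unfolding 1
    unfolding distrib_right distrib_left
    by (intro Bochner_Integration.integral_add cis_mult_integrable bdd_fun_integrable bdd_fun_freq f g) measurable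
qed

lemma U_L2:
  assumes f: "bdd_fun f"
  shows "(NNINT t. ennreal ((norm (U R f t))\<^sup>2)) <= ennreal ((2 * pi / c)\<^sup>2 * (LBINT t. (norm (f t))\<^sup>2))"
proof -
  let ?H = "%s. cis (R * s) * ((LBINT t'. cis (- (t' * \<Phi> s)) * f t') * indicator {1/2..2} s)"
  have H: "bdd_fun ?H" by (rule bdd_fun_freq[OF f])
  have "(NNINT t. ennreal ((norm (U R f t))\<^sup>2)) <= ennreal (2 * pi / c * (LBINT s. (norm (?H s))\<^sup>2))"
    unfolding U_def by (rule L2_time) (use H in \<open>auto intro: bdd_fun_integrable bdd_fun_integrable_sq bdd_funD\<close>)
  also have "(LBINT s. (norm (?H s))\<^sup>2) = (LBINT s. (norm ((LBINT t'. cis (- (t' * \<Phi> s)) * f t') * indicator {1/2..2} s))\<^sup>2)"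
    by (simp add: norm_mult)
  also have "ennreal (2 * pi / c * ...) <= ennreal (2 * pi / c * (2 * pi / c * (LBINT t. (norm (f t))\<^sup>2)))"
    using c by (intro ennreal_leI mult_left_mono L2_freq f) auto
  finally show ?thesis by (simp add: power2_eq_square mult.assoc)
qed

text \<open>\<open>U R\<close> is convolution in time with the kernel that \<open>B\<close>
  bounds.\<close>

lemma U_Linf:
  assumes f: "bdd_fun f" and B: "\<And>t. norm (LBINT s. cis (t * \<Phi> s + R * s) * indicator {1/2..2} s) <= B"
  shows "norm (U R f t) <= B * (LBINT t. norm (f t))"
proof -
  have [measurable]: "f \<in> borel_measurable borel" by (rule bdd_funD[OF f])
  have fi: "integrable lborel f" by (rule bdd_fun_integrable[OF f])
  let ?i = "%s::real. indicator {1/2..2} s :: complex"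
  let ?K = "%t. (LBINT s. cis (t * \<Phi> s + R * s) * ?i s)"
  have ii: "integrable lborel ?i"
    by (intro bdd_fun_integrable) (auto simp: bdd_fun_def indicator_def intro!: exI[of _ 1] exI[of _ 2])
  have int: "integrable (lborel \<Otimes>\<^sub>M lborel) (%(s, t'). cis ((t - t') * \<Phi> s + R * s) * ?i s * f t')"
  proof (rule Bochner_Integration.integrable_bound)
    show "integrable (lborel \<Otimes>\<^sub>M lborel) (%z. ?i (fst z) * f (snd z))" by (rule integrable_pair_mult[OF ii fi])
  qed (auto simp: norm_mult)
  have "U R f t = (LBINT s. (LBINT t'. cis ((t - t') * \<Phi> s + R * s) * ?i s * f t'))"
    unfolding U_def
  proof (rule Bochner_Integration.integral_cong[OF refl])
    fix s
    have "cis ((t - t') * \<Phi> s + R * s) * ?i s * f t' = (cis (t * \<Phi> s) * cis (R * s) * ?i s) * (cis (- (t' * \<Phi> s)) * f t')" for t'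
      by (simp add: cis_mult algebra_simps)
    then have "(LBINT t'. cis ((t - t') * \<Phi> s + R * s) * ?i s * f t') = (cis (t * \<Phi> s) * cis (R * s) * ?i s) * (LBINT t'. cis (- (t' * \<Phi> s)) * f t')"
      by (simp only: integral_mult_right_zero)
    then show "cis (t * \<Phi> s) * (cis (R * s) * ((LBINT t'. cis (- (t' * \<Phi> s)) * f t') * ?i s)) = (LBINT t'. cis ((t - t') * \<Phi> s + R * s) * ?i s * f t')"
      by (simp add: mult_ac)
  qed
  also have "... = (LBINT t'. (LBINT s. cis ((t - t') * \<Phi> s + R * s) * ?i s * f t'))"
    using lborel_pair.Fubini_integral[OF int] by simp
  also have "... = (LBINT t'. ?K (t - t') * f t')" by (simp only: integral_mult_left_zero)
  finally have eq: "U R f t = (LBINT t'. ?K (t - t') * f t')" .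
  have B0: "0 <= B" using order_trans[OF norm_ge_zero B[of 0]] .
  have pt: "norm (?K (t - t') * f t') <= norm (of_real B * f t')" for t'
    using B[of "t - t'"] B0 by (simp add: norm_mult mult_right_mono)
  have "norm (U R f t) <= (LBINT t'. norm (?K (t - t') * f t'))" unfolding eq by (rule integral_norm_bound)
  also have "... <= (LBINT t'. norm (of_real B * f t'))"
  proof (rule integral_mono)
    show "integrable lborel (%t'. norm (of_real B * f t'))" using fi by simp
    have "integrable lborel (%t'. ?K (t - t') * f t')"
      by (rule Bochner_Integration.integrable_bound[of lborel "%t'. of_real B * f t'"]) (use fi pt in auto)
    then show "integrable lborel (%t'. norm (?K (t - t') * f t'))" by simp
  qed (rule pt)
  finally show ?thesis using B0 by (simp add: norm_mult)
qed

lemma U_Lq: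
  fixes q p :: real
  assumes q: "2 < q" and p: "p = q / (q - 1)"
    and f: "bdd_fun f" and B0: "0 < B" and B: "\<And>t. norm (LBINT s. cis (t * \<Phi> s + R * s) * indicator {1/2..2} s) <= B"
  shows "(NNINT t. ennreal (norm (U R f t) powr q))
    <= ennreal (4 * q * 2 powr (q - 2) / (q - 2) * (2 * pi / c)\<^sup>2 * B powr (q - 2) * (LBINT x. norm (f x) powr p) powr (q - 1))"
  unfolding p
proof (rule marcinkiewicz[OF q _ B0 _ _ _ _ f])
  show "U R f \<in> borel_measurable borel" if "bdd_fun f" for f
  proof -
    have [measurable]: "f \<in> borel_measurable borel" by (rule bdd_funD[OF that])
    show ?thesis unfolding U_def by measurable
  qed
qed (auto intro: U_add U_L2 U_Linf B)

end

lemma nn_integral_Holder0: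
  fixes f g :: "real => real" and p q a b :: real
  assumes pq: "1 < p" "1 < q" "1 / p + 1 / q = 1"
    and [measurable]: "f \<in> borel_measurable borel" "g \<in> borel_measurable borel"
    and f0: "\<And>x. 0 <= f x" and g0: "\<And>x. 0 <= g x" and a: "0 <= a" and b: "0 <= b"
    and f: "(NNINT x. ennreal (f x powr p)) <= ennreal (a powr p)"
    and g: "(NNINT x. ennreal (g x powr q)) <= ennreal (b powr q)"
  shows "(NNINT x. ennreal (f x * g x)) <= ennreal (a * b)"
proof (cases "a = 0 \<or> b = 0")
  case True
  then have "AE x in lborel. f x * g x = 0"
  proof
    assume "a = 0"
    then have "(NNINT x. ennreal (f x powr p)) = 0" using f by simp
    then have "AE x in lborel. ennreal (f x powr p) = 0" by (subst (asm) nn_integral_0_iff_AE) auto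
    then show ?thesis by eventually_elim (auto simp: ennreal_eq_0_iff powr_def split: if_splits)
  next
    assume "b = 0"
    then have "(NNINT x. ennreal (g x powr q)) = 0" using g by simp
    then have "AE x in lborel. ennreal (g x powr q) = 0" by (subst (asm) nn_integral_0_iff_AE) auto
    then show ?thesis by eventually_elim (auto simp: ennreal_eq_0_iff powr_def split: if_splits)
  qed
  then have "(NNINT x. ennreal (f x * g x)) = 0" by (subst nn_integral_0_iff_AE) auto
  then show ?thesis by simp
next
  case False
  then show ?thesis using assms by (intro nn_integral_Holder[of p q]) auto
qed

lemma norm_integral_cis_le: "norm (LBINT x. cis (g x) * f x) <= (LBINT x. norm (f x))"
  using integral_norm_bound[of lborel "%x. cis (g x) * f x"] by (simp add: norm_mult)

context phase begin

text \<open>Hoelder's inequality in time combined with \<open>U_Lq\<close>. Interpolation against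
  L^2 weakens the kernel decay \<open>\<bar>R\<bar> powr (- 1/2)\<close> to the power 1/2 - 1/q,
  which is the \<open>\<gamma>\<close> of \<open>stein_weiss\<close>.\<close>

lemma U_pairing:
  fixes q p :: real
  assumes q: "2 < q" and p: "p = q / (q - 1)"
    and f: "bdd_fun f" and g: "bdd_fun g" and D0: "0 < D" and R: "R \<noteq> 0"
    and D: "\<And>t. norm (LBINT s. cis (t * \<Phi> s + R * s) * indicator {1/2..2} s) <= D * \<bar>R\<bar> powr (- 1/2)"
  shows "norm (LBINT t. g t * U R f t)
    <= (4 * q * 2 powr (q - 2) / (q - 2) * (2 * pi / c)\<^sup>2) powr (1 / q) * D powr (1 - 2 / q) * \<bar>R\<bar> powr (- (1/2 - 1/q))
      * (LBINT x. norm (g x) powr p) powr (1 / p) * (LBINT x. norm (f x) powr p) powr (1 / p)"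
proof -
  have [measurable]: "f \<in> borel_measurable borel" "g \<in> borel_measurable borel" using f g bdd_funD by auto
  have [measurable]: "U R f \<in> borel_measurable borel" unfolding U_def by measurable
  have p1: "1 < p" using q by (simp add: p field_simps)
  have pq: "1 / p + 1 / q = 1" using q by (simp add: p field_simps)
  define B where "B = D * \<bar>R\<bar> powr (- 1/2)"
  have B0: "0 < B" using D0 R by (simp add: B_def)
  define A where "A = 4 * q * 2 powr (q - 2) / (q - 2) * (2 * pi / c)\<^sup>2"
  have A0: "0 <= A" using q c by (simp add: A_def)
  define nf where "nf = (LBINT x. norm (f x) powr p)"
  define ng where "ng = (LBINT x. norm (g x) powr p)"
  have n0: "0 <= nf" "0 <= ng" unfolding nf_def ng_def by (auto intro: integral_nonneg_AE)
  have gi: "(NNINT x. ennreal (norm (g x) powr p)) = ennreal ng"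
    unfolding ng_def using p1 by (intro nn_integral_eq_integral bdd_fun_integrable_powr g) auto
  define b where "b = A powr (1 / q) * B powr (1 - 2 / q) * nf powr (1 / p)"
  have b0: "0 <= b" by (simp add: b_def)
  have bq: "b powr q = A * B powr (q - 2) * nf powr (q - 1)"
  proof -
    have e: "(1 - 2 / q) * q = q - 2" "1 / p * q = q - 1" "q / p = q - 1" using q by (auto simp: p field_simps)
    show ?thesis unfolding b_def using A0 B0 n0 q by (simp add: powr_mult powr_powr e)
  qed
  have "ennreal (norm (LBINT t. g t * U R f t)) <= (NNINT t. ennreal (norm (g t) * norm (U R f t)))"
  \<comment> \<open>A product that is not integrable has integral \<open>0\<close> by convention,
    and the bound is then trivial.\<close>
  proof (cases "integrable lborel (%t. g t * U R f t)")
    case True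
    then show ?thesis using integral_norm_bound_ennreal[OF True] by (simp add: norm_mult)
  qed (simp add: not_integrable_integral_eq)
  also have "... <= ennreal (ng powr (1 / p) * b)"
  proof (rule nn_integral_Holder0[OF p1 _ pq])
    show "(NNINT x. ennreal (norm (g x) powr p)) <= ennreal ((ng powr (1 / p)) powr p)"
      using n0 p1 by (simp add: gi powr_powr)
    show "(NNINT x. ennreal (norm (U R f x) powr q)) <= ennreal (b powr q)"
      unfolding bq A_def nf_def by (rule U_Lq[OF q p f B0]) (use D in \<open>simp add: B_def\<close>)
  qed (use q b0 in auto)
  finally have "norm (LBINT t. g t * U R f t) <= ng powr (1 / p) * b"
    using b0 by (simp add: ennreal_le_iff)
  moreover have "B powr (1 - 2 / q) = D powr (1 - 2 / q) * \<bar>R\<bar> powr (- (1/2 - 1/q))"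
  proof -
    have e: "- 1/2 * (1 - 2 / q) = - (1/2 - 1/q)" using q by (simp add: field_simps)
    show ?thesis unfolding B_def using D0 by (simp only: powr_mult abs_ge_zero less_imp_le powr_ge_zero powr_powr e)
  qed
  ultimately show ?thesis unfolding b_def A_def nf_def ng_def by (simp only: mult_ac)
qed

text \<open>The TT* argument. Let \<open>X\<close> be the truncated integral; it equals the pairing
  of \<open>h\<close> with a function \<open>g\<close>, so X^2 is at most the product of their
  squared L^2 norms. Opening the square of \<open>g\<close> produces one pairing for each two radii,
  bounded by \<open>U_pairing\<close> and summed by \<open>SW\<close>. The result is X^2 <= const
  X^(2/p). Truncation to a box makes \<open>X\<close> finite, so that X^(2/p) may be divided
  out.\<close>

lemma strichartz_truncated:
  fixes q \<beta> \<gamma> p C0 D \<sigma> :: real and N :: nat and h :: "real => complex"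
  assumes q: "2 < q" "q < 6" and \<beta>: "\<beta> = 3/2 - q/4" and \<gamma>: "\<gamma> = 1/2 - 1/q" and p: "p = q / (q - 1)"
    and C0: "0 <= C0"
    and SW: "\<And>f X. f \<in> borel_measurable borel ==> (\<And>r. 0 <= f r) ==> 0 < X ==>
     (NNINT r. ennreal (f r powr p) * indicator {0<..} r) = ennreal X ==>
     (NNINT r. (NNINT s. ennreal (f r * f s * (r * s) powr (- \<beta> / q) * \<bar>r - s\<bar> powr (- \<gamma>)) * indicator {0<..} r * indicator {0<..} s))
       <= ennreal (C0 * X powr (2 / p))"
    and D0: "0 < D"
    and D: "\<And>t R. R \<noteq> 0 ==> norm (LBINT s. cis (t * \<Phi> s + R * s) * indicator {1/2..2} s) <= D * \<bar>R\<bar> powr (- 1/2)"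
    and \<sigma>: "\<bar>\<sigma>\<bar> = 1"
    and h: "integrable lborel h" and h2: "integrable lborel (%s. (norm (h s))\<^sup>2)"
    and supp: "\<And>s. s \<notin> {1/2..2} ==> h s = 0"
  defines "W \<equiv> %r t. \<integral>s. cis (t * \<Phi> s + \<sigma> * r * s) * h s \<partial>lborel"
    and "E \<equiv> (4 * q * 2 powr (q - 2) / (q - 2) * (2 * pi / c)\<^sup>2) powr (1 / q) * D powr (1 - 2 / q)"
  shows "(NNINT r. (NNINT t. ennreal (norm (W r t) powr q * r powr (- \<beta>)) * indicator {1..real N} r * indicator {- real N..real N} t))
     <= ennreal ((C0 * E * (LBINT s. (norm (h s))\<^sup>2)) powr (q / 2))"
proof -
  have hm[measurable]: "h \<in> borel_measurable borel" using h by auto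
  have Wm[measurable]: "(%z. W (fst z) (snd z)) \<in> borel_measurable (borel \<Otimes>\<^sub>M borel)" unfolding W_def by measurable
  have Wm1[measurable]: "(%t. W r t) \<in> borel_measurable borel" for r unfolding W_def by measurable
  define Hn where "Hn = (LBINT s. norm (h s))"
  have Hn0: "0 <= Hn" unfolding Hn_def by (auto intro: integral_nonneg_AE)
  have Wb: "norm (W r t) <= Hn" for r t unfolding W_def Hn_def by (rule norm_integral_cis_le)
  have b: "0 < \<beta>" using q by (simp add: \<beta>)
  have p1: "1 < p" using q by (simp add: p field_simps)
  define iR where "iR r = (indicator {1..real N} r :: real)" for r :: real
  define iT where "iT t = (indicator {- real N..real N} t :: real)" for t :: real
  have [measurable]: "iR \<in> borel_measurable borel" "iT \<in> borel_measurable borel" unfolding iR_def iT_def by measurable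
  have ib: "0 <= iR r" "iR r <= 1" "0 <= iT t" "iT t <= 1" for r t by (auto simp: iR_def iT_def indicator_def)
  have ii: "integrable lborel iR" "integrable lborel iT" unfolding iR_def iT_def by (auto intro!: integrable_real_indicator simp: emeasure_lborel_Icc_eq)
  have rb: "iR r * r powr (- a) <= 1" if "0 <= a" for r a
  proof (cases "r \<in> {1..real N}")
    case True then show ?thesis using that powr_mono[of "- a" 0 r] by (simp add: iR_def)
  qed (simp add: iR_def)
  \<comment> \<open>The function dual to \<open>W\<close> in the weighted L^q space: its product
    with \<open>W\<close> is the weighted \<open>q\<close>-th power, and its \<open>p\<close>-th
    power is of the same kind because \<open>(q - 1) * p = q\<close>.\<close>
  define F where "F r t = of_real (norm (W r t) powr (q - 2) * (iR r * r powr (- \<beta>)) * iT t) * cnj (W r t)" for r t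
  have Fm[measurable]: "(%z. F (fst z) (snd z)) \<in> borel_measurable (borel \<Otimes>\<^sub>M borel)" unfolding F_def by measurable
  have Fm1[measurable]: "(%t. F r t) \<in> borel_measurable borel" for r unfolding F_def by measurable
  define K where "K = Hn powr (q - 2) * Hn"
  have K0: "0 <= K" using Hn0 by (simp add: K_def)
  have nF: "norm (F r t) = norm (W r t) powr (q - 1) * (iR r * r powr (- \<beta>)) * iT t" for r t
  proof (cases "W r t = 0")
    case False
    have "norm (W r t) powr (q - 1) = norm (W r t) powr (q - 2) * norm (W r t)" using False powr_add[of "norm (W r t)" "q - 2" 1] by simp
    then show ?thesis unfolding F_def norm_mult norm_of_real using ib by (simp add: abs_mult)
  qed (simp add: F_def)
  have Fb: "norm (F r t) <= K * (iR r * iT t)" for r t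
  proof -
    have "norm (W r t) powr (q - 1) <= Hn powr (q - 1)" using Wb q by (intro powr_mono2) auto
    also have "Hn powr (q - 1) = K" using Hn0 powr_add[of Hn "q - 2" 1] unfolding K_def by (cases "Hn = 0") auto
    finally have 1: "norm (W r t) powr (q - 1) <= K" .
    have 2: "iR r * r powr (- \<beta>) <= iR r" using rb[of \<beta> r] b by (cases "r \<in> {1..real N}") (auto simp: iR_def)
    have "norm (F r t) <= K * iR r * iT t" unfolding nF using 1 2 ib K0 by (intro mult_mono) auto
    then show ?thesis by (simp add: mult.assoc)
  qed
  have FB: "bdd_fun (%t. F r t)" for r unfolding bdd_fun_def
  proof (intro conjI exI allI impI)
    show "norm (F r t) <= K" for t
      by (rule order_trans[OF Fb]) (use K0 ib in \<open>auto intro!: mult_left_le mult_le_one\<close>)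
    show "F r t = 0" if "real N < \<bar>t\<bar>" for t using that by (auto simp: F_def iT_def indicator_def)
  qed measurable
  have FcB: "bdd_fun (%t. cnj (F r t))" for r
    using FB[of r] unfolding bdd_fun_def by auto
  define X where "X = (LBINT r. (LBINT t. norm (W r t) powr q * (iR r * r powr (- \<beta>)) * iT t))"
  have WF: "W r t * F r t = of_real (norm (W r t) powr q * (iR r * r powr (- \<beta>)) * iT t)" for r t
  proof (cases "W r t = 0")
    case False
    have "W r t * F r t = of_real (norm (W r t) powr (q - 2) * (iR r * r powr (- \<beta>)) * iT t) * (W r t * cnj (W r t))" by (simp add: F_def)
    also have "W r t * cnj (W r t) = of_real ((norm (W r t))\<^sup>2)" by (rule complex_norm_square[symmetric])
    finally have 1: "W r t * F r t = of_real (norm (W r t) powr (q - 2) * (iR r * r powr (- \<beta>)) * iT t) * of_real ((norm (W r t))\<^sup>2)" .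
    have 2: "norm (W r t) powr q = norm (W r t) powr (q - 2) * (norm (W r t))\<^sup>2"
      using False powr_add[of "norm (W r t)" "q - 2" 2] by simp
    show ?thesis unfolding 1 2 by (simp only: of_real_mult mult_ac)
  qed (use q in \<open>simp add: F_def\<close>)
  have box: "integrable (lborel \<Otimes>\<^sub>M lborel) (%z. complex_of_real (iR (fst z)) * of_real (iT (snd z)))"
    using ii by (intro integrable_pair_mult) auto
  have Fi: "integrable (lborel \<Otimes>\<^sub>M lborel) (%z. F (fst z) (snd z))"
  proof (rule Bochner_Integration.integrable_bound)
    show "integrable (lborel \<Otimes>\<^sub>M lborel) (%z. of_real K * (complex_of_real (iR (fst z)) * of_real (iT (snd z))))" using box by simp
  qed (use Fb K0 ib in \<open>auto simp: norm_mult\<close>)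
  have WFi: "integrable (lborel \<Otimes>\<^sub>M lborel) (%z. W (fst z) (snd z) * F (fst z) (snd z))"
  proof (rule Bochner_Integration.integrable_bound)
    show "integrable (lborel \<Otimes>\<^sub>M lborel) (%z. of_real Hn * F (fst z) (snd z))" using Fi by simp
  qed (use Wb Hn0 in \<open>auto simp: norm_mult intro!: mult_right_mono\<close>)
  have WFi': "integrable (lborel \<Otimes>\<^sub>M lborel) (%(r, t). norm (W r t) powr q * (iR r * r powr (- \<beta>)) * iT t)"
    using integrable_Re[OF WFi] unfolding WF by (simp add: case_prod_unfold)
  have nnX: "(NNINT r. (NNINT t. ennreal (norm (W r t) powr q * (iR r * r powr (- \<beta>)) * iT t))) = ennreal X"
  proof -
    have "(NNINT r. (NNINT t. ennreal (norm (W r t) powr q * (iR r * r powr (- \<beta>)) * iT t)))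
       = (\<integral>\<^sup>+z. ennreal (case z of (r, t) => norm (W r t) powr q * (iR r * r powr (- \<beta>)) * iT t) \<partial>(lborel \<Otimes>\<^sub>M lborel))"
      by (subst lborel.nn_integral_fst[symmetric]) (simp_all add: case_prod_unfold)
    also have "... = ennreal (\<integral>z. (case z of (r, t) => norm (W r t) powr q * (iR r * r powr (- \<beta>)) * iT t) \<partial>(lborel \<Otimes>\<^sub>M lborel))"
      by (rule nn_integral_eq_integral[OF WFi']) (auto simp: ib)
    also have "(\<integral>z. (case z of (r, t) => norm (W r t) powr q * (iR r * r powr (- \<beta>)) * iT t) \<partial>(lborel \<Otimes>\<^sub>M lborel)) = X"
      using lborel_pair.integral_fst'[OF WFi'] by (simp add: X_def)
    finally show ?thesis .
  qed
  have X0: "0 <= X" unfolding X_def by (intro integral_nonneg_AE AE_I2) (auto simp: ib)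
  define hh where "hh = (LBINT s. (norm (h s))\<^sup>2)"
  have hh0: "0 <= hh" unfolding hh_def by (auto intro: integral_nonneg_AE)
  have E0: "0 <= E" unfolding E_def by simp
  have key: "X\<^sup>2 <= hh * (E * (C0 * X powr (2 / p)))" if Xp: "0 < X"
  proof -
    define G where "G s r = (LBINT t. cis (t * \<Phi> s) * F r t)" for s r
    have Gm[measurable]: "(%z. G (fst z) (snd z)) \<in> borel_measurable (borel \<Otimes>\<^sub>M borel)" unfolding G_def F_def W_def by measurable
    have Gm1[measurable]: "(%r. G s r) \<in> borel_measurable borel" "(%s. G s r) \<in> borel_measurable borel" for s r unfolding G_def F_def W_def by measurable
    define KT where "KT = K * (LBINT t. iT t)"
    have Gb: "norm (G s r) <= KT * iR r" for s r
    proof -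
      have "norm (G s r) <= (LBINT t. norm (F r t))" unfolding G_def by (rule norm_integral_cis_le)
      also have "... <= (LBINT t. (K * iR r) * iT t)"
        using Fb ii by (intro integral_mono integrable_norm bdd_fun_integrable FB) (auto simp: mult.assoc)
      finally show ?thesis by (simp add: KT_def mult_ac)
    qed
    have Gi: "integrable lborel (%r. G s r)" for s
      by (rule Bochner_Integration.integrable_bound[of lborel "%r. KT * iR r"]) (use ii Gb in \<open>auto intro!: AE_I2 intro: order_trans[OF _ abs_ge_self]\<close>)
    define g where "g s = (LBINT r. cis (\<sigma> * r * s) * G s r)" for s
    have gm[measurable]: "g \<in> borel_measurable borel" unfolding g_def by measurable
    define KR where "KR = KT * (LBINT r. iR r)"
    have gb: "norm (g s) <= KR" for s
    proof -
      have "norm (g s) <= (LBINT r. norm (G s r))" unfolding g_def by (rule norm_integral_cis_le)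
      also have "... <= (LBINT r. KT * iR r)" using Gb ii Gi by (intro integral_mono) auto
      finally show ?thesis by (simp add: KR_def)
    qed
    \<comment> \<open>Fubini's theorem moves the operator onto the other factor: \<open>g\<close> is
      the adjoint of the map from \<open>h\<close> to \<open>W\<close>, applied to
      \<open>F\<close>.\<close>
    have X1: "complex_of_real X = (LBINT s. h s * g s)"
    proof -
      have cX: "complex_of_real X = (\<integral>z. W (fst z) (snd z) * F (fst z) (snd z) \<partial>(lborel \<Otimes>\<^sub>M lborel))"
      proof -
        have "X = (\<integral>z. (case z of (r, t) => norm (W r t) powr q * (iR r * r powr (- \<beta>)) * iT t) \<partial>(lborel \<Otimes>\<^sub>M lborel))"
          using lborel_pair.integral_fst'[OF WFi'] by (simp add: X_def)
        then show ?thesis unfolding WF integral_complex_of_real by (simp add: case_prod_unfold)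
      qed
      have tri: "integrable (lborel \<Otimes>\<^sub>M (lborel :: (real \<times> real) measure)) (%(s, z). cis (snd z * \<Phi> s + \<sigma> * fst z * s) * h s * F (fst z) (snd z))"
      proof (rule Bochner_Integration.integrable_bound)
        show "integrable (lborel \<Otimes>\<^sub>M (lborel :: (real \<times> real) measure)) (%y. h (fst y) * (%z. F (fst z) (snd z)) (snd y))"
          by (rule integrable_pair_mult[OF h]) (use Fi in \<open>simp add: lborel_prod\<close>)
        show "(%(s, z). cis (snd z * \<Phi> s + \<sigma> * fst z * s) * h s * F (fst z) (snd z)) \<in> borel_measurable (lborel \<Otimes>\<^sub>M (lborel :: (real \<times> real) measure))"
          unfolding lborel_prod[symmetric] F_def W_def by measurable
      qed (auto simp: norm_mult)
      have "complex_of_real X = (\<integral>z. (LBINT s. cis (snd z * \<Phi> s + \<sigma> * fst z * s) * h s * F (fst z) (snd z)) \<partial>(lborel :: (real \<times> real) measure))"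
        unfolding cX W_def by (simp only: integral_mult_left_zero lborel_prod)
      also have "... = (LBINT s. (\<integral>z. cis (snd z * \<Phi> s + \<sigma> * fst z * s) * h s * F (fst z) (snd z) \<partial>(lborel :: (real \<times> real) measure)))"
        using lborel_pair.Fubini_integral[OF tri] by simp
      also have "... = (LBINT s. h s * g s)"
      proof (rule Bochner_Integration.integral_cong[OF refl])
        fix s
        have i: "integrable (lborel \<Otimes>\<^sub>M lborel) (%z. cis (snd z * \<Phi> s + \<sigma> * fst z * s) * F (fst z) (snd z))"
          by (rule Bochner_Integration.integrable_bound[OF Fi]) (auto simp: norm_mult)
        have "(\<integral>z. cis (snd z * \<Phi> s + \<sigma> * fst z * s) * h s * F (fst z) (snd z) \<partial>(lborel :: (real \<times> real) measure))
          = (\<integral>z. h s * (cis (snd z * \<Phi> s + \<sigma> * fst z * s) * F (fst z) (snd z)) \<partial>(lborel \<Otimes>\<^sub>M lborel))"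
          by (simp add: mult_ac lborel_prod)
        also have "... = h s * (\<integral>z. cis (snd z * \<Phi> s + \<sigma> * fst z * s) * F (fst z) (snd z) \<partial>(lborel \<Otimes>\<^sub>M lborel))" by (rule integral_mult_right_zero)
        also have "(\<integral>z. cis (snd z * \<Phi> s + \<sigma> * fst z * s) * F (fst z) (snd z) \<partial>(lborel \<Otimes>\<^sub>M lborel)) = (LBINT r. (LBINT t. cis (t * \<Phi> s + \<sigma> * r * s) * F r t))"
          using lborel_pair.integral_fst'[OF i] by simp
        also have "... = g s" unfolding g_def G_def
        proof (rule Bochner_Integration.integral_cong[OF refl])
          fix r
          have "cis (t * \<Phi> s + \<sigma> * r * s) * F r t = cis (\<sigma> * r * s) * (cis (t * \<Phi> s) * F r t)" for t
            by (simp add: cis_mult[symmetric] mult_ac)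
          then show "(LBINT t. cis (t * \<Phi> s + \<sigma> * r * s) * F r t) = cis (\<sigma> * r * s) * (LBINT t. cis (t * \<Phi> s) * F r t)"
            by (simp only: integral_mult_right_zero)
        qed
        finally show "(\<integral>z. cis (snd z * \<Phi> s + \<sigma> * fst z * s) * h s * F (fst z) (snd z) \<partial>(lborel :: (real \<times> real) measure)) = h s * g s" .
      qed
      finally show ?thesis .
    qed
    define I where "I s = (indicator {1/2..2} s :: real)" for s :: real
    have [measurable]: "I \<in> borel_measurable borel" unfolding I_def by measurable
    have Ii: "integrable lborel I" unfolding I_def by (auto intro!: integrable_real_indicator simp: emeasure_lborel_Icc_eq)
    have I01: "I s = 0 \<or> I s = 1" for s by (auto simp: I_def indicator_def)
    define Y where "Y = (LBINT s. (norm (of_real (I s) * g s))\<^sup>2)"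
    have Yi: "integrable lborel (%s. (norm (of_real (I s) * g s))\<^sup>2)"
    proof (rule Bochner_Integration.integrable_bound[of lborel "%s. KR\<^sup>2 * I s"])
      show "AE s in lborel. norm ((norm (of_real (I s) * g s))\<^sup>2) <= norm (KR\<^sup>2 * I s)"
      proof (rule AE_I2)
        fix s show "norm ((norm (of_real (I s) * g s))\<^sup>2) <= norm (KR\<^sup>2 * I s)"
          using I01[of s] power_mono[OF gb norm_ge_zero, of s 2] by (auto simp: norm_mult)
      qed
    qed (use Ii in auto)
    have Y0: "0 <= Y" unfolding Y_def by (auto intro: integral_nonneg_AE)
    have XY: "X\<^sup>2 <= hh * Y"
    proof -
      have hg: "h s * g s = h s * (of_real (I s) * g s)" for s using supp[of s] by (auto simp: I_def indicator_def)
      have hgi: "integrable lborel (%s. h s * g s)"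
        by (rule Bochner_Integration.integrable_bound[of lborel "%s. of_real KR * h s"])
           (use h gb in \<open>auto simp: norm_mult mult.commute[of "norm (h _)"] intro!: AE_I2 mult_right_mono intro: order_trans[OF _ abs_ge_self]\<close>)
      have "ennreal X = ennreal (norm (complex_of_real X))" using X0 by simp
      also have "... <= (NNINT s. ennreal (norm (h s)) * ennreal (norm (of_real (I s) * g s)))"
        unfolding X1 using integral_norm_bound_ennreal[OF hgi] by (simp only: hg norm_mult[of "h _"] ennreal_mult norm_ge_zero)
      finally have "(ennreal X)\<^sup>2 <= (NNINT s. ennreal (norm (h s)) * ennreal (norm (of_real (I s) * g s)))\<^sup>2" by (rule power_mono) simp
      also have "... <= (NNINT s. (ennreal (norm (h s)))\<^sup>2) * (NNINT s. (ennreal (norm (of_real (I s) * g s)))\<^sup>2)"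
        by (intro Cauchy_Schwarz_nn_integral) measurable
      also have "... = (NNINT s. ennreal ((norm (h s))\<^sup>2)) * (NNINT s. ennreal ((norm (of_real (I s) * g s))\<^sup>2))"
        by (simp only: ennreal_power norm_ge_zero)
      also have "... = ennreal hh * ennreal Y"
        unfolding hh_def Y_def using h2 Yi by (simp add: nn_integral_eq_integral)
      also have "... = ennreal (hh * Y)" using hh0 Y0 by (simp add: ennreal_mult)
      finally have "ennreal (X\<^sup>2) <= ennreal (hh * Y)" using X0 by (simp add: ennreal_power)
      moreover have "0 <= hh * Y" using hh0 Y0 by simp
      ultimately show ?thesis by (simp only: ennreal_le_iff)
    qed
    \<comment> \<open>The frequency integral of the parts of \<open>g\<close> and its conjugate at
      radii \<open>r\<close> and \<open>r'\<close>. The two modulations combine to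
      \<open>cis (\<sigma> * (r - r') * s)\<close>, which is the modulation in
      \<open>U\<close>.\<close>
    define J where "J r r' = (LBINT t. F r t * U (\<sigma> * (r - r')) (%t. cnj (F r' t)) t)" for r r'
    have inner: "(LBINT s. of_real (I s) * (cis (\<sigma> * r * s) * G s r) * cnj (cis (\<sigma> * r' * s) * G s r')) = J r r'" for r r'
    proof -
      let ?R = "\<sigma> * (r - r')"
      let ?g' = "%s. cis (?R * s) * ((LBINT t'. cis (- (t' * \<Phi> s)) * cnj (F r' t')) * indicator {1/2..2} s)"
      have g': "bdd_fun ?g'" by (rule bdd_fun_freq[OF FcB])
      have [measurable]: "?g' \<in> borel_measurable borel" by (rule bdd_funD[OF g'])
      have i: "integrable (lborel \<Otimes>\<^sub>M lborel) (%(s, t). cis (t * \<Phi> s) * ?g' s * F r t)"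
      proof (rule Bochner_Integration.integrable_bound)
        show "integrable (lborel \<Otimes>\<^sub>M lborel) (%z. ?g' (fst z) * F r (snd z))"
          by (rule integrable_pair_mult[OF bdd_fun_integrable[OF g'] bdd_fun_integrable[OF FB]])
      qed (auto simp: norm_mult case_prod_unfold)
      have cG: "cnj (G s r') = (LBINT t'. cis (- (t' * \<Phi> s)) * cnj (F r' t'))" for s
        unfolding G_def by (simp add: Bochner_Integration.integral_cnj[symmetric] cis_cnj del: Bochner_Integration.integral_cnj)
      have "(LBINT s. of_real (I s) * (cis (\<sigma> * r * s) * G s r) * cnj (cis (\<sigma> * r' * s) * G s r'))
         = (LBINT s. (LBINT t. cis (t * \<Phi> s) * ?g' s * F r t))"
      proof (rule Bochner_Integration.integral_cong[OF refl])
        fix s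
        have "(LBINT t. cis (t * \<Phi> s) * ?g' s * F r t) = (LBINT t. ?g' s * (cis (t * \<Phi> s) * F r t))" by (simp only: mult_ac)
        also have "... = ?g' s * G s r" unfolding G_def by (rule integral_mult_right_zero)
        also have "... = of_real (I s) * (cis (\<sigma> * r * s) * G s r) * cnj (cis (\<sigma> * r' * s) * G s r')"
        proof -
          have "cis (?R * s) = cis (\<sigma> * r * s) * cnj (cis (\<sigma> * r' * s))" by (simp add: cis_cnj cis_mult algebra_simps)
          moreover have "(indicator {1/2..2} s :: complex) = of_real (I s)" by (simp add: I_def indicator_def)
          ultimately show ?thesis unfolding cG[symmetric] by (simp add: mult_ac)
        qed
        finally show "of_real (I s) * (cis (\<sigma> * r * s) * G s r) * cnj (cis (\<sigma> * r' * s) * G s r') = (LBINT t. cis (t * \<Phi> s) * ?g' s * F r t)" ..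
      qed
      also have "... = (LBINT t. (LBINT s. cis (t * \<Phi> s) * ?g' s * F r t))"
        using lborel_pair.Fubini_integral[OF i] by simp
      also have "... = J r r'" unfolding J_def U_def integral_mult_left_zero by (simp only: mult.commute)
      finally show ?thesis .
    qed
    define n where "n r = (LBINT t. norm (F r t) powr p) powr (1 / p)" for r
    have Jb: "norm (J r r') <= E * (n r * n r' * \<bar>r - r'\<bar> powr (- \<gamma>))" if "r \<noteq> r'" for r r'
    proof -
      have R: "\<sigma> * (r - r') \<noteq> 0" using that \<sigma> by auto
      have aR: "\<bar>\<sigma> * (r - r')\<bar> = \<bar>r - r'\<bar>" using \<sigma> by (simp add: abs_mult)
      have "norm (J r r') <= E * \<bar>\<sigma> * (r - r')\<bar> powr (- (1/2 - 1/q)) * n r * n r'"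
        using U_pairing[OF q(1) p FcB[of r'] FB[of r] D0 R D[OF R]] unfolding J_def E_def n_def by simp
      then show ?thesis unfolding aR \<gamma> by (simp add: mult_ac)
    qed
    \<comment> \<open>The \<open>p\<close>-th power of \<open>fr\<close> integrates to
      \<open>X\<close>. Of the weight r^(-\<beta>) in \<open>F\<close>, the part r^(-\<beta>/p) goes
      into \<open>fr\<close>, and the part r^(-\<beta>/q) is left over as the weight of the
      Stein--Weiss kernel.\<close>
    define fr where "fr r = (iR r * r powr (- \<beta>) * (LBINT t. norm (W r t) powr q * iT t)) powr (1 / p)" for r
    have frm[measurable]: "fr \<in> borel_measurable borel" unfolding fr_def by measurable
    have nq0: "0 <= (LBINT t. norm (W r t) powr q * iT t)" for r by (intro integral_nonneg_AE AE_I2) (auto simp: ib)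
    have nfr: "n r * iR r = iR r * (r powr (- \<beta> / q) * fr r)" for r
    proof (cases "r \<in> {1..real N}")
      case True
      then have r: "0 < r" and iR1: "iR r = 1" by (auto simp: iR_def)
      have e: "(q - 1) * p = q" using q by (simp add: p)
      have "norm (F r t) powr p = r powr (- \<beta> * p) * (norm (W r t) powr q * iT t)" for t
      proof (cases "t \<in> {- real N..real N}")
        case True then show ?thesis unfolding nF using iR1 r p1 by (simp add: iT_def powr_mult powr_powr e)
      qed (use p1 in \<open>simp add: nF iT_def\<close>)
      then have "n r = (r powr (- \<beta> * p) * (LBINT t. norm (W r t) powr q * iT t)) powr (1 / p)"
        unfolding n_def by simp
      also have "... = r powr (- \<beta>) * (LBINT t. norm (W r t) powr q * iT t) powr (1 / p)"
        using p1 nq0 by (simp add: powr_mult powr_powr)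
      also have "r powr (- \<beta>) = r powr (- \<beta> / q) * (r powr (- \<beta>)) powr (1 / p)"
      proof -
        have e: "- \<beta> = - \<beta> / q + - \<beta> * (1 / p)" using q by (simp add: p field_simps)
        have "r powr (- \<beta>) = r powr (- \<beta> / q + - \<beta> * (1 / p))" using arg_cong[OF e, of "(powr) r"] .
        then show ?thesis unfolding powr_add powr_powr .
      qed
      finally show ?thesis using iR1 nq0 by (simp add: fr_def powr_mult)
    qed (simp add: iR_def)
    have frX: "(NNINT r. ennreal (fr r powr p) * indicator {0<..} r) = ennreal X"
    proof -
      have "(NNINT r. ennreal (fr r powr p) * indicator {0<..} r) = (NNINT r. (NNINT t. ennreal (norm (W r t) powr q * (iR r * r powr (- \<beta>)) * iT t)))"
      proof (rule nn_integral_cong)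
        fix r
        have it: "integrable lborel (%t. norm (W r t) powr q * iT t)"
        proof (rule Bochner_Integration.integrable_bound[of lborel "%t. Hn powr q * iT t"])
          show "AE t in lborel. norm (norm (W r t) powr q * iT t) <= norm (Hn powr q * iT t)"
            using Wb q ib by (intro AE_I2) (auto simp: abs_mult intro!: mult_right_mono powr_mono2)
        qed (use ii in auto)
        have "fr r powr p = iR r * r powr (- \<beta>) * (LBINT t. norm (W r t) powr q * iT t)"
          using nq0[of r] ib p1 by (simp add: fr_def powr_powr)
        then have "ennreal (fr r powr p) * indicator {0<..} r = ennreal (LBINT t. (iR r * r powr (- \<beta>)) * (norm (W r t) powr q * iT t))"
          by (cases "0 < r") (auto simp: iR_def)
        also have "... = (NNINT t. ennreal ((iR r * r powr (- \<beta>)) * (norm (W r t) powr q * iT t)))"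
          using it ib by (intro nn_integral_eq_integral[symmetric] integrable_mult_right) auto
        finally show "ennreal (fr r powr p) * indicator {0<..} r = (NNINT t. ennreal (norm (W r t) powr q * (iR r * r powr (- \<beta>)) * iT t))"
          by (simp add: mult_ac)
      qed
      then show ?thesis using nnX by simp
    qed
    have tri2: "integrable (lborel \<Otimes>\<^sub>M (lborel :: (real \<times> real) measure)) (%(s, z). of_real (I s) * (cis (\<sigma> * fst z * s) * G s (fst z)) * cnj (cis (\<sigma> * snd z * s) * G s (snd z)))"
    proof (rule Bochner_Integration.integrable_bound)
      have "integrable (lborel :: (real \<times> real) measure) (%z. complex_of_real (iR (fst z)) * of_real (iR (snd z)))"
        using ii integrable_pair_mult[of "%r. complex_of_real (iR r)" "%r. complex_of_real (iR r)"] by (simp add: lborel_prod)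
      then show "integrable (lborel \<Otimes>\<^sub>M (lborel :: (real \<times> real) measure)) (%y. (of_real (KT * KT) * of_real (I (fst y))) * (%z. complex_of_real (iR (fst z)) * of_real (iR (snd z))) (snd y))"
        using Ii by (intro integrable_pair_mult integrable_mult_right) auto
      show "(%(s, z). of_real (I s) * (cis (\<sigma> * fst z * s) * G s (fst z)) * cnj (cis (\<sigma> * snd z * s) * G s (snd z))) \<in> borel_measurable (lborel \<Otimes>\<^sub>M (lborel :: (real \<times> real) measure))"
        unfolding lborel_prod[symmetric] G_def F_def W_def by measurable
      show "AE y in lborel \<Otimes>\<^sub>M (lborel :: (real \<times> real) measure). norm (case y of (s, z) => of_real (I s) * (cis (\<sigma> * fst z * s) * G s (fst z)) * cnj (cis (\<sigma> * snd z * s) * G s (snd z)))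
         <= norm ((of_real (KT * KT) * of_real (I (fst y))) * (%z. complex_of_real (iR (fst z)) * of_real (iR (snd z))) (snd y))"
      proof (rule AE_I2)
        fix y :: "real \<times> real \<times> real"
        obtain s r r' where y: "y = (s, r, r')" by (metis prod.exhaust)
        have "norm (G s r) * norm (G s r') <= (KT * iR r) * (KT * iR r')"
          using Gb[of s r] Gb[of s r'] order_trans[OF norm_ge_zero Gb[of s r]] by (intro mult_mono) auto
        then have "\<bar>I s\<bar> * (norm (G s r) * norm (G s r')) <= \<bar>I s\<bar> * ((KT * iR r) * (KT * iR r'))" by (intro mult_left_mono) auto
        also have "... <= norm ((of_real (KT * KT) * of_real (I s)) * (complex_of_real (iR r) * of_real (iR r')))"
          using ib by (simp add: norm_mult abs_mult mult_ac)
        finally show "norm (case y of (s, z) => of_real (I s) * (cis (\<sigma> * fst z * s) * G s (fst z)) * cnj (cis (\<sigma> * snd z * s) * G s (snd z)))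
         <= norm ((of_real (KT * KT) * of_real (I (fst y))) * (%z. complex_of_real (iR (fst z)) * of_real (iR (snd z))) (snd y))"
          unfolding y by (simp add: norm_mult mult_ac)
      qed
    qed
    have Yeq: "complex_of_real Y = (\<integral>z. J (fst z) (snd z) \<partial>(lborel :: (real \<times> real) measure))"
    proof -
      have "complex_of_real Y = (LBINT s. of_real (I s) * (g s * cnj (g s)))"
        unfolding Y_def integral_complex_of_real[symmetric]
      proof (rule Bochner_Integration.integral_cong[OF refl])
        fix s show "complex_of_real ((norm (of_real (I s) * g s))\<^sup>2) = of_real (I s) * (g s * cnj (g s))"
          using I01[of s] complex_norm_square[of "g s"] by auto
      qed
      also have "... = (LBINT s. (\<integral>z. of_real (I s) * (cis (\<sigma> * fst z * s) * G s (fst z)) * cnj (cis (\<sigma> * snd z * s) * G s (snd z)) \<partial>(lborel :: (real \<times> real) measure)))"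
      proof (rule Bochner_Integration.integral_cong[OF refl])
        fix s
        let ?a = "%r. cis (\<sigma> * r * s) * G s r"
        have ai: "integrable lborel ?a" by (intro cis_mult_integrable Gi) measurable
        have "(\<integral>z. ?a (fst z) * cnj (?a (snd z)) \<partial>(lborel \<Otimes>\<^sub>M lborel)) = (LBINT r. (LBINT r'. ?a (fst (r, r')) * cnj (?a (snd (r, r')))))"
          by (rule lborel_pair.integral_fst'[symmetric]) (rule integrable_pair_mult[OF ai integrable_cnj[OF ai]])
        also have "... = g s * cnj (g s)" by (simp only: fst_conv snd_conv integral_mult_right_zero integral_mult_left_zero Bochner_Integration.integral_cnj g_def)
        finally have "g s * cnj (g s) = (\<integral>z. ?a (fst z) * cnj (?a (snd z)) \<partial>(lborel :: (real \<times> real) measure))" by (simp only: lborel_prod)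
        then show "of_real (I s) * (g s * cnj (g s)) = (\<integral>z. of_real (I s) * (cis (\<sigma> * fst z * s) * G s (fst z)) * cnj (cis (\<sigma> * snd z * s) * G s (snd z)) \<partial>(lborel :: (real \<times> real) measure))"
          by (simp only: mult.assoc[of "of_real (I s)"] integral_mult_right_zero)
      qed
      also have "... = (\<integral>z. (LBINT s. of_real (I s) * (cis (\<sigma> * fst z * s) * G s (fst z)) * cnj (cis (\<sigma> * snd z * s) * G s (snd z))) \<partial>(lborel :: (real \<times> real) measure))"
        using lborel_pair.Fubini_integral[OF tri2] by simp
      finally show ?thesis unfolding inner .
    qed
    have Ji: "integrable (lborel :: (real \<times> real) measure) (%z. J (fst z) (snd z))"
      using lborel_pair.integrable_snd[OF tri2] by (simp only: prod.case inner)
    have Jsupp: "J r r' = J r r' * of_real (iR r * iR r')" for r r'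
    proof (cases "iR r = 1 \<and> iR r' = 1")
      case False
      then have "iR r = 0 \<or> iR r' = 0" by (auto simp: iR_def indicator_def)
      then have "G s r = 0 \<or> G s r' = 0" for s using Gb[of s r] Gb[of s r'] by auto
      then have "of_real (I s) * (cis (\<sigma> * r * s) * G s r) * cnj (cis (\<sigma> * r' * s) * G s r') = 0" for s by auto
      then have "J r r' = integral\<^sup>L lborel (%_::real. 0)" unfolding inner[symmetric] by (simp only:)
      then show ?thesis by simp
    qed simp
    have "ennreal Y = ennreal (norm (complex_of_real Y))" using Y0 by simp
    also have "... <= (\<integral>\<^sup>+z. ennreal (norm (J (fst z) (snd z))) \<partial>(lborel \<Otimes>\<^sub>M lborel))"
      unfolding Yeq lborel_prod by (rule integral_norm_bound_ennreal[OF Ji])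
    also have "... = (NNINT r. (NNINT r'. ennreal (norm (J r r'))))"
    proof (subst lborel.nn_integral_fst[symmetric])
      show "(%z. ennreal (norm (J (fst z) (snd z)))) \<in> borel_measurable (lborel \<Otimes>\<^sub>M lborel)"
        using borel_measurable_integrable[OF Ji] unfolding lborel_prod by measurable
    qed simp
    also have "... <= (NNINT r. ennreal E * (NNINT r'. (ennreal (fr r * fr r' * (r * r') powr (- \<beta> / q) * \<bar>r - r'\<bar> powr (- \<gamma>)) * indicator {0<..} r * indicator {0<..} r')))"
    proof (rule nn_integral_mono)
      fix r :: real
      have "(NNINT r'. ennreal (norm (J r r'))) <= (NNINT r'. ennreal E * (ennreal (fr r * fr r' * (r * r') powr (- \<beta> / q) * \<bar>r - r'\<bar> powr (- \<gamma>)) * indicator {0<..} r * indicator {0<..} r'))"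
      proof (rule nn_integral_mono_AE)
        \<comment> \<open>The decay in \<open>r - r'\<close> says nothing on the diagonal, which is
          a null set.\<close>
        have "AE r' in lborel. r' \<noteq> r" by (rule AE_lborel_singleton)
        then show "AE r' in lborel. ennreal (norm (J r r')) <= ennreal E * (ennreal (fr r * fr r' * (r * r') powr (- \<beta> / q) * \<bar>r - r'\<bar> powr (- \<gamma>)) * indicator {0<..} r * indicator {0<..} r')"
        proof eventually_elim
          case (elim r')
          show ?case
          proof (cases "iR r = 1 \<and> iR r' = 1")
            case True
            then have pos: "0 < r" "0 < r'" by (auto simp: iR_def indicator_def split: if_splits)
            have "n r = r powr (- \<beta> / q) * fr r" "n r' = r' powr (- \<beta> / q) * fr r'" using nfr[of r] nfr[of r'] True by auto
            then have "norm (J r r') <= E * (fr r * fr r' * (r * r') powr (- \<beta> / q) * \<bar>r - r'\<bar> powr (- \<gamma>))"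
              using Jb[of r r'] elim pos by (simp add: powr_mult mult_ac)
            then have "ennreal (norm (J r r')) <= ennreal (E * (fr r * fr r' * (r * r') powr (- \<beta> / q) * \<bar>r - r'\<bar> powr (- \<gamma>)))" by (rule ennreal_leI)
            also have "... = ennreal E * ennreal (fr r * fr r' * (r * r') powr (- \<beta> / q) * \<bar>r - r'\<bar> powr (- \<gamma>))" by (rule ennreal_mult[OF E0]) (simp add: fr_def)
            finally show ?thesis using pos by simp
          next
            case False
            then have "iR r = 0 \<or> iR r' = 0" by (auto simp: iR_def indicator_def)
            then have "J r r' = 0" using Jsupp[of r r'] by auto
            then show ?thesis by simp
          qed
        qed
      qed
      also have "... = ennreal E * (NNINT r'. (ennreal (fr r * fr r' * (r * r') powr (- \<beta> / q) * \<bar>r - r'\<bar> powr (- \<gamma>)) * indicator {0<..} r * indicator {0<..} r'))"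
        by (intro nn_integral_cmult) measurable
      finally show "(NNINT r'. ennreal (norm (J r r'))) <= ..." .
    qed
    also have "... = ennreal E * (NNINT r. (NNINT r'. (ennreal (fr r * fr r' * (r * r') powr (- \<beta> / q) * \<bar>r - r'\<bar> powr (- \<gamma>)) * indicator {0<..} r * indicator {0<..} r')))"
      by (intro nn_integral_cmult) measurable
    also have "... <= ennreal E * ennreal (C0 * X powr (2 / p))"
      by (intro mult_left_mono SW[OF frm _ Xp frX]) (auto simp: fr_def)
    also have "... = ennreal (E * (C0 * X powr (2 / p)))" using E0 C0 by (simp add: ennreal_mult)
    finally have "Y <= E * (C0 * X powr (2 / p))" using E0 C0 by (simp add: ennreal_le_iff)
    then show ?thesis using XY hh0 by (meson mult_left_mono order_trans)
  qed
  have "X <= (C0 * E * hh) powr (q / 2)"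
  proof (cases "X = 0")
    case False
    then have Xp: "0 < X" using X0 by simp
    \<comment> \<open>Since 2/p + 2/q = 2, dividing by \<open>X powr (2 / p)\<close> leaves
      \<open>X powr (2 / q)\<close>.\<close>
    have e: "X\<^sup>2 = X powr (2 / p) * X powr (2 / q)"
    proof -
      have "2 / p + 2 / q = 2" using q by (simp add: p field_simps)
      then show ?thesis using Xp by (simp flip: powr_add)
    qed
    have "X powr (2 / p) * X powr (2 / q) <= X powr (2 / p) * (C0 * E * hh)" using key[OF Xp] unfolding e by (simp add: mult_ac)
    then have "X powr (2 / q) <= C0 * E * hh" using Xp by (simp add: mult_le_cancel_left_pos)
    then have "(X powr (2 / q)) powr (q / 2) <= (C0 * E * hh) powr (q / 2)" using q by (intro powr_mono2) auto
    then show ?thesis using Xp q by (simp add: powr_powr)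
  qed simp
  then have "ennreal X <= ennreal ((C0 * E * hh) powr (q / 2))" by (rule ennreal_leI)
  moreover have "ennreal (norm (W r t) powr q * (iR r * r powr (- \<beta>)) * iT t) = ennreal (norm (W r t) powr q * r powr (- \<beta>)) * indicator {1..real N} r * indicator {- real N..real N} t" for r t
    by (auto simp: iR_def iT_def indicator_def)
  ultimately show ?thesis using nnX by (simp add: hh_def)
qed

end

text \<open>If |t| M <= |R|/2, the linear term dominates and the first derivative of the phase is at
  least |R|/2. The geometric mean of the bound 8/|R| and the trivial bound 3/2 then has the required
  order |R|^(-1/2), and \<open>A\<close> compensates for the missing factor M/kp. Otherwise |t| is
  at least a multiple of |R|/M and the second derivative test with \<open>kp * \<bar>t\<bar>\<close>
  applies. The hypothesis \<open>kp\<close> makes the phase convex.\<close>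

lemma kernel_bound_aux:
  fixes \<Phi> \<Phi>1 \<Phi>2 :: "real => real" and A M kp t R :: real
  assumes d1: "\<And>s. s \<in> {1/2..2} ==> (\<Phi> has_real_derivative \<Phi>1 s) (at s within {1/2..2})"
    and d2: "\<And>s. s \<in> {1/2..2} ==> (\<Phi>1 has_real_derivative \<Phi>2 s) (at s within {1/2..2})"
    and c2: "continuous_on {1/2..2} \<Phi>2"
    and M: "\<And>s. s \<in> {1/2..2} ==> \<bar>\<Phi>1 s\<bar> <= M" and M0: "0 < M"
    and kp: "\<And>s. s \<in> {1/2..2} ==> kp * \<bar>t\<bar> <= t * \<Phi>2 s" and kp0: "0 < kp"
    and A: "1 <= A" "kp <= A * M" and R: "R \<noteq> 0"
  shows "norm (integral {1/2..2} (%s. cis (t * \<Phi> s + R * s))) <= 15 * sqrt A * sqrt (M / kp) * \<bar>R\<bar> powr (- 1/2)"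
proof -
  have sR: "\<bar>R\<bar> powr (- 1/2) = 1 / sqrt \<bar>R\<bar>"
  proof -
    have "\<bar>R\<bar> powr (- 1/2) = \<bar>R\<bar> powr - (1/2)" by simp
    also have "... = inverse (sqrt \<bar>R\<bar>)" by (simp only: powr_minus powr_half_sqrt abs_ge_zero)
    finally show ?thesis by (simp only: inverse_eq_divide)
  qed
  have c0: "continuous_on {1/2..2} \<Phi>" using DERIV_continuous_on d1 by blast
  let ?x = "norm (integral {1/2..2} (%s. cis (t * \<Phi> s + R * s)))"
  have D1: "((%s. t * \<Phi> s + R * s) has_real_derivative (t * \<Phi>1 s + R)) (at s within {1/2..2})" if "s \<in> {1/2..2}" for s
    using d1[OF that] by (auto intro!: derivative_eq_intros)
  have D2: "((%s. t * \<Phi>1 s + R) has_real_derivative (t * \<Phi>2 s)) (at s within {1/2..2})" if "s \<in> {1/2..2}" for s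
    using d2[OF that] by (auto intro!: derivative_eq_intros)
  have C2: "continuous_on {1/2..2} (%s. t * \<Phi>2 s)" by (intro continuous_intros c2)
  show ?thesis
  proof (cases "\<bar>t\<bar> * M <= \<bar>R\<bar> / 2")
    case True
    have "?x <= 4 / (\<bar>R\<bar> / 2)"
    proof (rule van_der_Corput_first[OF _ _ D1 D2 C2])
      show "0 <= t * \<Phi>2 s" if "s \<in> {1/2..2}" for s
        using kp[OF that] kp0 by (intro order_trans[OF _ kp[OF that]]) simp
      show "\<bar>R\<bar> / 2 <= \<bar>t * \<Phi>1 s + R\<bar>" if "s \<in> {1/2..2}" for s
      proof -
        have "\<bar>t * \<Phi>1 s\<bar> <= \<bar>t\<bar> * M" unfolding abs_mult using M[OF that] by (intro mult_left_mono) auto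
        then show ?thesis using True by linarith
      qed
    qed (use R in auto)
    moreover have "?x <= 3 / 2"
    proof -
      have "norm (integral (cbox (1/2) 2) (%s. cis (t * \<Phi> s + R * s))) <= 1 * measure lborel (cbox (1/2) (2::real))"
        by (rule integrable_bound)
           (auto intro!: integrable_continuous_interval continuous_intros c0)
      then show ?thesis by simp
    qed
    ultimately have "?x * ?x <= (4 / (\<bar>R\<bar> / 2)) * (3 / 2)" using R by (intro mult_mono) auto
    also have "... = 12 / \<bar>R\<bar>" by simp
    also have "... <= 225 * A * (M / kp) / \<bar>R\<bar>"
    proof -
      have "kp / kp <= (A * M) / kp" using A(2) kp0 by (intro divide_right_mono) auto
      then have "1 <= A * (M / kp)" using kp0 by simp
      then show ?thesis using R by (intro divide_right_mono) auto
    qed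
    also have "... = (15 * sqrt A * sqrt (M / kp) * (1 / sqrt \<bar>R\<bar>))\<^sup>2"
      using A M0 kp0 by (simp add: power_mult_distrib power_divide)
    finally have "?x\<^sup>2 <= (15 * sqrt A * sqrt (M / kp) * (1 / sqrt \<bar>R\<bar>))\<^sup>2" unfolding power2_eq_square[of ?x] .
    then show ?thesis unfolding sR by (rule power2_le_imp_le) (use A M0 kp0 in auto)
  next
    case False
    have t0: "\<bar>t\<bar> > 0" using False by (cases "t = 0") auto
    have "?x <= 10 / sqrt (kp * \<bar>t\<bar>)"
      by (rule van_der_Corput_second[OF _ _ D1 D2 C2]) (use t0 kp kp0 in auto)
    also have "... <= 15 * sqrt (M / kp) * (1 / sqrt \<bar>R\<bar>)"
    proof (rule power2_le_imp_le)
      have "(10 / sqrt (kp * \<bar>t\<bar>))\<^sup>2 = 100 / (kp * \<bar>t\<bar>)" using kp0 by (simp add: power_divide)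
      also have "... <= 225 * (M / kp) / \<bar>R\<bar>"
      proof -
        have "\<bar>R\<bar> <= 2 * (\<bar>t\<bar> * M)" using False by simp
        moreover have "0 <= \<bar>t\<bar> * M" using M0 by simp
        ultimately have "100 * \<bar>R\<bar> <= 225 * (\<bar>t\<bar> * M)" by linarith
        then have "(100 * \<bar>R\<bar>) / (kp * \<bar>t\<bar> * \<bar>R\<bar>) <= (225 * (\<bar>t\<bar> * M)) / (kp * \<bar>t\<bar> * \<bar>R\<bar>)"
          using kp0 by (intro divide_right_mono) auto
        then show ?thesis using t0 R by simp
      qed
      also have "... = (15 * sqrt (M / kp) * (1 / sqrt \<bar>R\<bar>))\<^sup>2" using M0 kp0 by (simp add: power_mult_distrib power_divide)
      finally show "(10 / sqrt (kp * \<bar>t\<bar>))\<^sup>2 <= (15 * sqrt (M / kp) * (1 / sqrt \<bar>R\<bar>))\<^sup>2" .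
    qed (use M0 kp0 in auto)
    also have "... <= 15 * sqrt A * sqrt (M / kp) * (1 / sqrt \<bar>R\<bar>)"
    proof -
      have "1 * sqrt (M / kp) <= sqrt A * sqrt (M / kp)" using A M0 kp0 by (intro mult_right_mono) auto
      then have "15 * sqrt (M / kp) * (1 / sqrt \<bar>R\<bar>) <= (15 * (sqrt A * sqrt (M / kp))) * (1 / sqrt \<bar>R\<bar>)"
        using R by (intro mult_right_mono) auto
      then show ?thesis by (simp add: mult.assoc)
    qed
    finally show ?thesis unfolding sR .
  qed
qed

text \<open>A continuous function without zeros keeps its sign on the interval, so
  \<open>t * \<Phi>2 s\<close> has one sign. If it is negative, complex conjugation replaces
  \<open>t\<close> and \<open>R\<close> by their negatives and restores convexity.\<close>

lemma kernel_bound: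
  fixes \<Phi> \<Phi>1 \<Phi>2 :: "real => real" and A M kp t R :: real
  assumes d1: "\<And>s. s \<in> {1/2..2} ==> (\<Phi> has_real_derivative \<Phi>1 s) (at s within {1/2..2})"
    and d2: "\<And>s. s \<in> {1/2..2} ==> (\<Phi>1 has_real_derivative \<Phi>2 s) (at s within {1/2..2})"
    and c2: "continuous_on {1/2..2} \<Phi>2"
    and M: "\<And>s. s \<in> {1/2..2} ==> \<bar>\<Phi>1 s\<bar> <= M" and M0: "0 < M"
    and kp: "\<And>s. s \<in> {1/2..2} ==> kp <= \<bar>\<Phi>2 s\<bar>" and kp0: "0 < kp"
    and A: "1 <= A" "kp <= A * M" and R: "R \<noteq> 0"
  shows "norm (LBINT s. cis (t * \<Phi> s + R * s) * indicator {1/2..2} s) <= 15 * sqrt A * sqrt (M / kp) * \<bar>R\<bar> powr (- 1/2)"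
proof -
  have c0: "continuous_on {1/2..2} \<Phi>" using DERIV_continuous_on d1 by blast
  have co: "continuous_on {1/2..2} (%s. cis (t * \<Phi> s + R * s))" by (intro continuous_intros c0)
  have "(LBINT s. cis (t * \<Phi> s + R * s) * indicator {1/2..2} s) = (\<integral>s\<in>{1/2..2}. cis (t * \<Phi> s + R * s) \<partial>lborel)"
    unfolding set_lebesgue_integral_def by (intro Bochner_Integration.integral_cong) (auto simp: indicator_def)
  also have "... = integral {1/2..2} (%s. cis (t * \<Phi> s + R * s))"
    by (rule set_borel_integral_eq_integral(2)) (rule borel_integrable_atLeastAtMost'[OF co])
  finally have eq: "(LBINT s. cis (t * \<Phi> s + R * s) * indicator {1/2..2} s) = integral {1/2..2} (%s. cis (t * \<Phi> s + R * s))" .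
  have nz: "\<Phi>2 s \<noteq> 0" if "s \<in> {1/2..2}" for s using kp[OF that] kp0 by auto
  have sgn: "(\<forall>s\<in>{1/2..2}. 0 < \<Phi>2 s) \<or> (\<forall>s\<in>{1/2..2}. \<Phi>2 s < 0)"
  proof (rule ccontr)
    assume "\<not> ?thesis"
    then obtain a b where ab: "a \<in> {1/2..2}" "\<Phi>2 a <= 0" "b \<in> {1/2..2}" "0 <= \<Phi>2 b" by (auto simp: not_less)
    have "connected (\<Phi>2 ` {1/2..2})" by (intro connected_continuous_image c2) auto
    then have "{\<Phi>2 a..\<Phi>2 b} \<subseteq> \<Phi>2 ` {1/2..2}" using ab by (intro connected_contains_Icc) auto
    moreover have "0 \<in> {\<Phi>2 a..\<Phi>2 b}" using ab by simp
    ultimately have "0 \<in> \<Phi>2 ` {1/2..2}" by (rule subsetD)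
    then obtain s where "s \<in> {1/2..2}" "\<Phi>2 s = 0" by (metis imageE)
    then show False using nz by simp
  qed
  consider "\<forall>s\<in>{1/2..2}. kp * \<bar>t\<bar> <= t * \<Phi>2 s" | "\<forall>s\<in>{1/2..2}. kp * \<bar>- t\<bar> <= (- t) * \<Phi>2 s"
  proof -
    have 1: "kp * \<bar>t\<bar> <= \<bar>t * \<Phi>2 s\<bar>" if "s \<in> {1/2..2}" for s
      unfolding abs_mult using mult_right_mono[OF kp[OF that] abs_ge_zero[of t]] by (simp only: mult.commute)
    have "(\<forall>s\<in>{1/2..2}. 0 <= t * \<Phi>2 s) \<or> (\<forall>s\<in>{1/2..2}. t * \<Phi>2 s <= 0)"
      using sgn by (cases "0 <= t") (auto simp: zero_le_mult_iff mult_le_0_iff less_imp_le)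
    then show thesis
    proof
      assume "\<forall>s\<in>{1/2..2}. 0 <= t * \<Phi>2 s"
      then show thesis using that(1) 1 by fastforce
    next
      assume "\<forall>s\<in>{1/2..2}. t * \<Phi>2 s <= 0"
      then show thesis using that(2) 1 by fastforce
    qed
  qed
  then show ?thesis
  proof cases
    case 1
    show ?thesis unfolding eq by (rule kernel_bound_aux[OF d1 d2 c2 M M0 _ kp0 A R]) (use 1 in blast)+
  next
    case 2
    have "integral {1/2..2} (%s. cis ((- t) * \<Phi> s + (- R) * s)) = cnj (integral {1/2..2} (%s. cis (t * \<Phi> s + R * s)))"
      unfolding Henstock_Kurzweil_Integration.integral_cnj by (simp add: cis_cnj)
    moreover have "norm (integral {1/2..2} (%s. cis ((- t) * \<Phi> s + (- R) * s))) <= 15 * sqrt A * sqrt (M / kp) * \<bar>- R\<bar> powr (- 1/2)"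
    proof (rule kernel_bound_aux[OF d1 d2 c2 M M0 _ kp0 A])
      show "kp * \<bar>- t\<bar> <= - t * \<Phi>2 s" if "s \<in> {1/2..2}" for s using 2 that by blast
      show "- R \<noteq> 0" using R by simp
    qed
    ultimately show ?thesis unfolding eq by (simp only: complex_mod_cnj abs_minus_cancel)
  qed
qed

text \<open>The bound of \<open>strichartz_truncated\<close> does not depend on \<open>N\<close>,
  and Fatou's lemma removes the box.\<close>

lemma (in phase) strichartz:
  fixes q \<beta> \<gamma> p C0 D \<sigma> :: real and h :: "real => complex"
  assumes q: "2 < q" "q < 6" and \<beta>: "\<beta> = 3/2 - q/4" and \<gamma>: "\<gamma> = 1/2 - 1/q" and p: "p = q / (q - 1)"
    and C0: "0 <= C0"
    and SW: "\<And>f X. f \<in> borel_measurable borel ==> (\<And>r. 0 <= f r) ==> 0 < X ==>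
     (NNINT r. ennreal (f r powr p) * indicator {0<..} r) = ennreal X ==>
     (NNINT r. (NNINT s. ennreal (f r * f s * (r * s) powr (- \<beta> / q) * \<bar>r - s\<bar> powr (- \<gamma>)) * indicator {0<..} r * indicator {0<..} s))
       <= ennreal (C0 * X powr (2 / p))"
    and D0: "0 < D"
    and D: "\<And>t R. R \<noteq> 0 ==> norm (LBINT s. cis (t * \<Phi> s + R * s) * indicator {1/2..2} s) <= D * \<bar>R\<bar> powr (- 1/2)"
    and \<sigma>: "\<bar>\<sigma>\<bar> = 1"
    and h: "integrable lborel h" and h2: "integrable lborel (%s. (norm (h s))\<^sup>2)"
    and supp: "\<And>s. s \<notin> {1/2..2} ==> h s = 0"
  defines "W \<equiv> %r t. \<integral>s. cis (t * \<Phi> s + \<sigma> * r * s) * h s \<partial>lborel"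
    and "E \<equiv> (4 * q * 2 powr (q - 2) / (q - 2) * (2 * pi / c)\<^sup>2) powr (1 / q) * D powr (1 - 2 / q)"
  shows "(NNINT r. (NNINT t. ennreal (norm (W r t) powr q * r powr (- \<beta>))) * indicator {1..} r)
     <= ennreal ((C0 * E * (LBINT s. (norm (h s))\<^sup>2)) powr (q / 2))"
proof -
  have hm[measurable]: "h \<in> borel_measurable borel" using h by auto
  have Wm[measurable]: "(%z. W (fst z) (snd z)) \<in> borel_measurable (borel \<Otimes>\<^sub>M borel)" unfolding W_def by measurable
  have Wm1[measurable]: "(%t. W r t) \<in> borel_measurable borel" for r unfolding W_def by measurable
  let ?f = "%N z. ennreal (norm (W (fst z) (snd z)) powr q * fst z powr (- \<beta>)) * indicator {1..real N} (fst z) * indicator {- real N..real N} (snd z)"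
  let ?g = "%z. ennreal (norm (W (fst z) (snd z)) powr q * fst z powr (- \<beta>)) * indicator {1..} (fst z)"
  have lim: "(%N. ?f N z) \<longlonglongrightarrow> ?g z" for z
  proof (rule tendsto_eventually)
    obtain N0 :: nat where N0: "\<bar>fst z\<bar> + \<bar>snd z\<bar> <= real N0" using real_arch_simple by blast
    show "\<forall>\<^sub>F N in sequentially. ?f N z = ?g z"
      using eventually_ge_at_top[of N0]
    proof eventually_elim
      case (elim N)
      then have "\<bar>fst z\<bar> + \<bar>snd z\<bar> <= real N" using N0 by linarith
      then have "\<bar>fst z\<bar> <= real N" "\<bar>snd z\<bar> <= real N" by auto
      then show ?case by (auto simp: indicator_def)
    qed
  qed
  have "(NNINT r. (NNINT t. ennreal (norm (W r t) powr q * r powr (- \<beta>))) * indicator {1..} r) = (NNINT r. (NNINT t. ?g (r, t)))"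
    by (simp add: nn_integral_multc)
  also have "... = (\<integral>\<^sup>+z. ?g z \<partial>(lborel \<Otimes>\<^sub>M lborel))"
    by (rule lborel.nn_integral_fst) measurable
  also have "... = (\<integral>\<^sup>+z. liminf (%N. ?f N z) \<partial>(lborel \<Otimes>\<^sub>M lborel))"
    by (intro nn_integral_cong) (simp add: lim_imp_Liminf[OF _ lim])
  also have "... <= liminf (%N. \<integral>\<^sup>+z. ?f N z \<partial>(lborel \<Otimes>\<^sub>M lborel))"
    by (rule nn_integral_liminf) measurable
  also have "... <= ennreal ((C0 * E * (LBINT s. (norm (h s))\<^sup>2)) powr (q / 2))"
  proof (intro Liminf_le always_eventually allI)
    fix N
    have "(\<integral>\<^sup>+z. ?f N z \<partial>(lborel \<Otimes>\<^sub>M lborel)) = (NNINT r. (NNINT t. ?f N (r, t)))"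
      by (rule lborel.nn_integral_fst[symmetric]) measurable
    also have "(NNINT r. (NNINT t. ?f N (r, t))) <= ennreal ((C0 * E * (LBINT s. (norm (h s))\<^sup>2)) powr (q / 2))"
      unfolding W_def E_def fst_conv snd_conv
      by (rule strichartz_truncated[OF q \<beta> \<gamma> p C0 SW D0 D \<sigma> h h2 supp])
    finally show "(\<integral>\<^sup>+z. ?f N z \<partial>(lborel \<Otimes>\<^sub>M lborel)) <= ennreal ((C0 * E * (LBINT s. (norm (h s))\<^sup>2)) powr (q / 2))" .
  qed simp
  finally show ?thesis .
qed

section \<open>Estimates in time for square-integrable amplitudes\<close>

lemma integrable_of_square:
  fixes h :: "real => complex"
  assumes hm: "h \<in> borel_measurable borel" and h2: "integrable lborel (%s. (norm (h s))\<^sup>2)" and supp: "\<And>s. s \<notin> {1/2..2} ==> h s = 0"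
  shows "integrable lborel h" and "(LBINT s. norm (h s)) <= sqrt (3/2) * sqrt (LBINT s. (norm (h s))\<^sup>2)"
proof -
  have i1: "integrable lborel (indicat_real {1/2..2::real})" by (auto intro!: integrable_real_indicator simp: emeasure_lborel_Icc_eq)
  have i: "integrable lborel (%s. indicat_real {1/2..2} s + (norm (h s))\<^sup>2)" using i1 h2 by (rule Bochner_Integration.integrable_add)
  show hi: "integrable lborel h"
  proof (rule Bochner_Integration.integrable_bound[OF i])
    show "AE s in lborel. norm (h s) <= norm (indicat_real {1/2..2} s + (norm (h s))\<^sup>2)"
    proof (rule AE_I2)
      fix s show "norm (h s) <= norm (indicat_real {1/2..2} s + (norm (h s))\<^sup>2)"
      proof (cases "s \<in> {1/2..2}")
        case True
        have "norm (h s) <= 1 + (norm (h s))\<^sup>2" using sum_squares_bound[of 1 "norm (h s)"] norm_ge_zero[of "h s"] by (simp del: norm_ge_zero)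
        then show ?thesis using True by simp
      qed (use supp in simp)
    qed
  qed (use hm in simp)
  have nn: "(NNINT s. ennreal (norm (h s))) = ennreal (LBINT s. norm (h s))"
    using hi by (intro nn_integral_eq_integral) auto
  have "(NNINT s. ennreal (norm (h s))) = (NNINT s. indicator {1/2..2} s * ennreal (norm (h s)))"
    by (intro nn_integral_cong) (use supp in \<open>auto simp: indicator_def\<close>)
  then have "(ennreal (LBINT s. norm (h s)))\<^sup>2 = (NNINT s. indicator {1/2..2} s * ennreal (norm (h s)))\<^sup>2" using nn by simp
  also have "... <= (NNINT s. (indicator {1/2..2::real} s)\<^sup>2) * (NNINT s. (ennreal (norm (h s)))\<^sup>2)"
    using hm by (intro Cauchy_Schwarz_nn_integral) auto
  also have "(NNINT (s::real). (indicator {1/2..2} s)\<^sup>2) = (NNINT (s::real). indicator {1/2..2} s)"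
    by (intro nn_integral_cong) (auto simp: indicator_def)
  also have "... = ennreal (3/2)" by simp
  also have "(NNINT s. (ennreal (norm (h s)))\<^sup>2) = ennreal (LBINT s. (norm (h s))\<^sup>2)"
    using h2 by (simp add: ennreal_power nn_integral_eq_integral)
  also have "ennreal (3/2) * ennreal (LBINT s. (norm (h s))\<^sup>2) = ennreal (3/2 * (LBINT s. (norm (h s))\<^sup>2))"
    by (rule ennreal_mult[symmetric]) (auto intro: integral_nonneg_AE)
  finally have "ennreal ((LBINT s. norm (h s))\<^sup>2) <= ennreal (3/2 * (LBINT s. (norm (h s))\<^sup>2))"
    by (subst ennreal_power[symmetric]) (auto intro: integral_nonneg_AE)
  moreover have "0 <= 3/2 * (LBINT s. (norm (h s))\<^sup>2)" by (auto intro: integral_nonneg_AE)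
  ultimately have "(LBINT s. norm (h s))\<^sup>2 <= 3/2 * (LBINT s. (norm (h s))\<^sup>2)" by (simp only: ennreal_le_iff)
  then show "(LBINT s. norm (h s)) <= sqrt (3/2) * sqrt (LBINT s. (norm (h s))\<^sup>2)"
    unfolding real_sqrt_mult[symmetric] by (rule real_le_rsqrt)
qed

text \<open>Only the size of \<open>H\<close> relative to \<open>h\<close> enters, so the Bessel
  factor at a fixed radius can be absorbed into \<open>H\<close>, with its supremum as
  \<open>B\<close>. The factor 3/2 is the length of the frequency interval, from
  Cauchy-Schwarz.\<close>

lemma (in phase) time_bound:
  fixes h H :: "real => complex"
  assumes q: "2 <= q" and B: "0 <= B"
    and hm[measurable]: "h \<in> borel_measurable borel" and h2: "integrable lborel (%s. (norm (h s))\<^sup>2)" and supp: "\<And>s. s \<notin> {1/2..2} ==> h s = 0"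
    and Hm[measurable]: "H \<in> borel_measurable borel" and HB: "\<And>s. norm (H s) <= B * norm (h s)"
  defines "L \<equiv> sqrt (LBINT s. (norm (h s))\<^sup>2)"
  shows "norm (LBINT s. cis (t * \<Phi> s) * H s) <= sqrt (3/2) * B * L"
    and "(NNINT t. ennreal (norm (LBINT s. cis (t * \<Phi> s) * H s) powr q)) <= ennreal (2 * pi / c * (3/2) powr ((q - 2) / 2) * (B * L) powr q)"
proof -
  have hi: "integrable lborel h" by (rule integrable_of_square(1)[OF hm h2 supp])
  have Hi: "integrable lborel H"
    by (rule Bochner_Integration.integrable_bound[of lborel "%s. of_real B * h s"]) (use hi HB B in \<open>auto simp: norm_mult\<close>)
  have HB2: "(norm (H s))\<^sup>2 <= B\<^sup>2 * (norm (h s))\<^sup>2" for s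
    using power_mono[OF HB norm_ge_zero, of s 2] by (simp add: power_mult_distrib)
  have H2: "integrable lborel (%s. (norm (H s))\<^sup>2)"
    by (rule Bochner_Integration.integrable_bound[of lborel "%s. B\<^sup>2 * (norm (h s))\<^sup>2"]) (use h2 HB2 in auto)
  have L0: "0 <= L" by (simp add: L_def integral_nonneg_AE)
  have L2: "(LBINT s. (norm (h s))\<^sup>2) = L\<^sup>2" by (simp add: L_def integral_nonneg_AE)
  have sup: "norm (LBINT s. cis (t * \<Phi> s) * H s) <= sqrt (3/2) * B * L" for t
  proof -
    have "norm (LBINT s. cis (t * \<Phi> s) * H s) <= (LBINT s. norm (H s))" by (rule norm_integral_cis_le)
    also have "... <= (LBINT s. B * norm (h s))" using Hi hi HB by (intro integral_mono) auto
    also have "... <= B * (sqrt (3/2) * L)"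
      using integrable_of_square(2)[OF hm h2 supp] B by (simp add: L_def mult_left_mono)
    finally show ?thesis by (simp add: mult_ac)
  qed
  show "norm (LBINT s. cis (t * \<Phi> s) * H s) <= sqrt (3/2) * B * L" by (rule sup)
  let ?v = "%t. \<integral>s. cis (t * \<Phi> s) * H s \<partial>lborel"
  have [measurable]: "?v \<in> borel_measurable borel" by measurable
  define S where "S = sqrt (3/2) * B * L"
  have S0: "0 <= S" using B L0 by (simp add: S_def)
  have "(NNINT t. ennreal (norm (?v t) powr q)) <= (NNINT t. ennreal (S powr (q - 2)) * ennreal ((norm (?v t))\<^sup>2))"
  proof (rule nn_integral_mono)
    fix t
    have "norm (?v t) powr q <= S powr (q - 2) * (norm (?v t))\<^sup>2"
    proof (cases "?v t = 0")
      case False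
      have "norm (?v t) powr q = norm (?v t) powr (q - 2) * (norm (?v t))\<^sup>2" using False powr_add[of "norm (?v t)" "q - 2" 2] by simp
      also have "... <= S powr (q - 2) * (norm (?v t))\<^sup>2" using sup[of t] q unfolding S_def by (intro mult_right_mono powr_mono2) auto
      finally show ?thesis .
    qed simp
    then show "ennreal (norm (?v t) powr q) <= ennreal (S powr (q - 2)) * ennreal ((norm (?v t))\<^sup>2)"
      by (subst ennreal_mult[symmetric]) (auto intro: ennreal_leI)
  qed
  also have "... = ennreal (S powr (q - 2)) * (NNINT t. ennreal ((norm (?v t))\<^sup>2))" by (rule nn_integral_cmult) measurable
  also have "... <= ennreal (S powr (q - 2)) * ennreal (2 * pi / c * (LBINT s. (norm (H s))\<^sup>2))"
  proof (intro mult_left_mono L2_time Hi H2 Hm)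
    show "H s = 0" if "s \<notin> {1/2..2}" for s using HB[of s] supp[OF that] by simp
  qed simp
  also have "... <= ennreal (S powr (q - 2)) * ennreal (2 * pi / c * (B\<^sup>2 * L\<^sup>2))"
  proof (intro mult_left_mono ennreal_leI)
    have "(LBINT s. (norm (H s))\<^sup>2) <= (LBINT s. B\<^sup>2 * (norm (h s))\<^sup>2)" using H2 h2 HB2 by (intro integral_mono) auto
    then show "(LBINT s. (norm (H s))\<^sup>2) <= B\<^sup>2 * L\<^sup>2" by (simp add: L2)
  qed (use c in auto)
  also have "... = ennreal (2 * pi / c * (S powr (q - 2) * (B * L)\<^sup>2))"
    using c by (simp add: ennreal_mult[symmetric] mult_ac power_mult_distrib)
  also have "S powr (q - 2) * (B * L)\<^sup>2 = (3/2) powr ((q - 2) / 2) * (B * L) powr q"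
  proof (cases "B * L = 0")
    case False
    then have BL: "0 < B * L" using B L0 by (simp add: less_le)
    have "S powr (q - 2) = (sqrt (3/2)) powr (q - 2) * (B * L) powr (q - 2)"
      unfolding S_def mult.assoc by (rule powr_mult)
    also have "(sqrt (3/2)) powr (q - 2) = (3/2::real) powr ((q - 2) / 2)"
      by (simp add: powr_half_sqrt[symmetric] powr_powr)
    finally have "S powr (q - 2) * (B * L)\<^sup>2 = (3/2) powr ((q - 2) / 2) * ((B * L) powr (q - 2) * (B * L) powr 2)"
      using BL by (simp add: mult.assoc)
    also have "(B * L) powr (q - 2) * (B * L) powr 2 = (B * L) powr q" by (simp flip: powr_add)
    finally show ?thesis .
  next
    case True
    show ?thesis unfolding True by simp
  qed
  finally show "(NNINT t. ennreal (norm (?v t) powr q)) <= ennreal (2 * pi / c * (3/2) powr ((q - 2) / 2) * (B * L) powr q)"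
    by (simp add: mult.assoc)
qed

section \<open>The oscillatory integral at unit frequency\<close>

definition osc :: "nat => (real => real) => (real => complex) => real => real => complex" where
  "osc m \<Phi> h t r = (LBINT s. cis (t * \<Phi> s) * (of_real (Jm m (r * s)) * h s))"

lemma osc_measurable [measurable (raw)]:
  assumes [measurable]: "\<Phi> \<in> borel_measurable borel" "h \<in> borel_measurable borel"
  shows "(%z. osc m \<Phi> h (fst z) (snd z)) \<in> borel_measurable (borel \<Otimes>\<^sub>M borel)"
  unfolding osc_def by measurable

lemma nn_integral_bracket_finite:
  assumes dim: "CARD('n) = m + 2" and a: "real m + 2 < a"
  shows "(NNINT (y::real^'n). ennreal ((1 + norm y / 2) powr - a)) < \<top>"
proof -
  have "(NNINT s. ennreal ((1 + s / 2) powr - a) * ennreal (s ^ (m + 1)) * indicator {0..} s)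
    <= (NNINT s. indicator {0..1} s + ennreal (2 powr a) * (ennreal (s powr (real m + 1 - a)) * indicator {1..} s))"
  proof (rule nn_integral_mono)
    fix s :: real
    consider "s < 0" | "0 <= s" "s < 1" | "1 <= s" by linarith
    then show "ennreal ((1 + s / 2) powr - a) * ennreal (s ^ (m + 1)) * indicator {0..} s
       <= indicator {0..1} s + ennreal (2 powr a) * (ennreal (s powr (real m + 1 - a)) * indicator {1..} s)"
    proof cases
      case 2
      have "(1 + s / 2) powr - a * s ^ (m + 1) <= 1 * 1"
        using 2 a powr_mono2'[of "- a" 1 "1 + s / 2"] by (intro mult_mono power_le_one) (auto intro: order_trans[OF powr_mono2'[of "a" 1 "1 + s / 2"]])
      then have "ennreal ((1 + s / 2) powr - a * s ^ (m + 1)) <= ennreal 1" by (intro ennreal_leI) simp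
      then show ?thesis using 2 by (simp add: ennreal_mult)
    next
      case 3
      have "(1 + s / 2) powr - a * s ^ (m + 1) <= (s / 2) powr - a * s ^ (m + 1)"
        using 3 a by (intro mult_right_mono powr_mono2') auto
      also have "(s / 2) powr - a = 2 powr a * s powr - a" using 3 by (simp add: powr_divide powr_minus field_simps)
      also have "2 powr a * s powr - a * s ^ (m + 1) = 2 powr a * (s powr (- a) * s powr (real (m + 1)))" using 3 by (simp only: powr_realpow mult.assoc)
      also have "s powr (- a) * s powr (real (m + 1)) = s powr (real m + 1 - a)" by (simp add: powr_add[symmetric] add.commute)
      finally have "ennreal ((1 + s / 2) powr - a * s ^ (m + 1)) <= ennreal (2 powr a * s powr (real m + 1 - a))" by (rule ennreal_leI)
      then have "ennreal ((1 + s / 2) powr - a) * ennreal (s ^ (m + 1)) * indicator {0..} s <= ennreal (2 powr a) * (ennreal (s powr (real m + 1 - a)) * indicator {1..} s)"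
        using 3 by (simp add: ennreal_mult)
      then show ?thesis by (rule order_trans) simp
    qed simp
  qed
  also have "... = (NNINT (s::real). indicator {0..1} s) + ennreal (2 powr a) * (NNINT s. ennreal (s powr (real m + 1 - a)) * indicator {1..} s)"
    by (simp add: nn_integral_add nn_integral_cmult)
  also have "... < \<top>" using a by (subst nn_integral_powr_inf) (auto simp: ennreal_mult_less_top)
  finally show ?thesis
    by (subst polar_nn_integral[OF dim, of "%s. ennreal ((1 + s / 2) powr - a)"]) (auto simp: ennreal_mult_less_top)
qed

text \<open>For \<open>s\<close> in [1/2, 2] the Bessel factor at radius |y| is at most a multiple
  of (1 + |y|/2)^(-N), and its \<open>q\<close>-th power is integrable in dimension m+2 when N q >
  m+2, which is the condition on \<open>q\<close>. The constant sees the phase only through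
  \<open>1 / c\<close>; this is what later yields the exact power of 2^k.\<close>

lemma core_bound_1:
  assumes dim: "CARD('n) = m + 2" and q: "2 <= q" "2 * (real m + 2) / (real m + 1) < q"
  obtains K where "0 <= K" "\<And>\<Phi> c h. phase \<Phi> c ==> h \<in> borel_measurable borel ==> integrable lborel (%s. (norm (h s))\<^sup>2) ==>
     (\<And>s. s \<notin> {1/2..2} ==> h s = 0) ==>
     (NNINT (y::real^'n). (NNINT t. ennreal (norm (osc m \<Phi> h t (norm y)) powr q)))
       <= ennreal (K / c * (sqrt (LBINT s. (norm (h s))\<^sup>2)) powr q)"
proof -
  define N where "N = (real m + 1) / 2"
  obtain C a where C0: "0 < C" "a \<noteq> 0" and C1: "\<And>l. 0 <= l ==> \<bar>Jm m l\<bar> <= C * (1 + l) powr - N"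
    and as: "\<And>l. 1/2 <= l ==> norm (of_real (Jm m l) - of_real (l powr - N) * (a * cis l + cnj a * cis (- l))) <= C * l powr (- N - 1)"
  proof (rule Jm_asymptotics[of m, folded N_def], goal_cases)
    case (1 C a)
    from 1(2-) show thesis by (rule that)
  qed
  note C = C0(1) C1
  have N0: "0 < N" by (simp add: N_def)
  have Nq: "real m + 2 < N * q" using q(2) by (simp add: N_def field_simps)
  define I where "I = enn2real (NNINT (y::real^'n). ennreal ((1 + norm y / 2) powr - (N * q)))"
  have I: "(NNINT (y::real^'n). ennreal ((1 + norm y / 2) powr - (N * q))) = ennreal I"
    unfolding I_def using nn_integral_bracket_finite[OF dim Nq] by simp
  have I0: "0 <= I" by (simp add: I_def)
  define K where "K = 2 * pi * (3/2) powr ((q - 2) / 2) * C powr q * I"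
  show thesis
  proof (rule that[of K])
    show "0 <= K" using I0 by (simp add: K_def)
  next
    fix \<Phi> c and h :: "real => complex"
    assume "phase \<Phi> c" and hm[measurable]: "h \<in> borel_measurable borel" and h2: "integrable lborel (%s. (norm (h s))\<^sup>2)"
      and supp: "\<And>s. s \<notin> {1/2..2} ==> h s = 0"
    then interpret phase \<Phi> c by simp
    define L where "L = sqrt (LBINT s. (norm (h s))\<^sup>2)"
    have L0: "0 <= L" by (simp add: L_def integral_nonneg_AE)
    have "(NNINT (y::real^'n). (NNINT t. ennreal (norm (osc m \<Phi> h t (norm y)) powr q)))
       <= (NNINT (y::real^'n). ennreal (2 * pi / c * (3/2) powr ((q - 2) / 2) * (C * L) powr q) * ennreal ((1 + norm y / 2) powr - (N * q)))"
    proof (rule nn_integral_mono)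
      fix y :: "real^'n"
      define B where "B = C * (1 + norm y / 2) powr - N"
      have "(NNINT t. ennreal (norm (osc m \<Phi> h t (norm y)) powr q)) <= ennreal (2 * pi / c * (3/2) powr ((q - 2) / 2) * (B * L) powr q)"
        unfolding osc_def L_def
      proof (rule time_bound(2)[OF q(1) _ hm h2 supp])
        show "norm (of_real (Jm m (norm y * s)) * h s) <= B * norm (h s)" for s
        proof (cases "s \<in> {1/2..2}")
          case True
          have "\<bar>Jm m (norm y * s)\<bar> <= C * (1 + norm y * s) powr - N" using True by (intro C) auto
          also have "... <= C * (1 + norm y / 2) powr - N"
          proof (intro mult_left_mono powr_mono2')
            show "1 + norm y / 2 <= 1 + norm y * s" using True mult_left_mono[of "1/2" s "norm y"] by auto
          qed (use C N0 in \<open>auto intro: add_pos_nonneg\<close>)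
          finally show ?thesis unfolding B_def norm_mult norm_of_real by (rule mult_right_mono) simp
        qed (use supp in simp)
      qed (use C in \<open>auto simp: B_def\<close>)
      also have "(B * L) powr q = (C * L) powr q * (1 + norm y / 2) powr - (N * q)"
      proof -
        have "B * L = (C * L) * (1 + norm y / 2) powr - N" by (simp add: B_def mult_ac)
        show ?thesis unfolding \<open>B * L = _\<close> powr_mult[of "C * L"] powr_powr by simp
      qed
      also have "ennreal (2 * pi / c * (3/2) powr ((q - 2) / 2) * ((C * L) powr q * (1 + norm y / 2) powr - (N * q)))
        = ennreal (2 * pi / c * (3/2) powr ((q - 2) / 2) * (C * L) powr q) * ennreal ((1 + norm y / 2) powr - (N * q))"
        using c by (subst ennreal_mult[symmetric]) (auto simp: mult.assoc)
      finally show "(NNINT t. ennreal (norm (osc m \<Phi> h t (norm y)) powr q)) <= ..." .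
    qed
    also have "... = ennreal (2 * pi / c * (3/2) powr ((q - 2) / 2) * (C * L) powr q) * ennreal I"
      by (subst nn_integral_cmult) (auto simp: I)
    also have "... = ennreal (K / c * L powr q)"
      using c I0 C L0 by (subst ennreal_mult[symmetric]) (auto simp: K_def powr_mult mult_ac)
    finally show "(NNINT (y::real^'n). (NNINT t. ennreal (norm (osc m \<Phi> h t (norm y)) powr q))) <= ennreal (K / c * L powr q)" .
  qed
qed

lemma nn_integral_linear_combination:
  assumes [measurable]: "g \<in> borel_measurable M" "f1 \<in> borel_measurable M" "f2 \<in> borel_measurable M" "f3 \<in> borel_measurable M"
  shows "(\<integral>\<^sup>+r. g r + c * (a * f1 r + a * f2 r + b * f3 r) \<partial>M)
    = (\<integral>\<^sup>+r. g r \<partial>M) + c * (a * (\<integral>\<^sup>+r. f1 r \<partial>M) + a * (\<integral>\<^sup>+r. f2 r \<partial>M) + b * (\<integral>\<^sup>+r. f3 r \<partial>M))"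
  by (simp add: nn_integral_add nn_integral_cmult)

lemma sum3_powr_le:
  fixes x y z q :: real
  assumes "0 <= x" "0 <= y" "0 <= z" "0 < q"
  shows "(x + y + z) powr q <= 3 powr q * (x powr q + y powr q + z powr q)"
proof -
  have "(x + y + z) powr q <= (3 * max x (max y z)) powr q" using assms by (intro powr_mono2) auto
  also have "... = 3 powr q * (max x (max y z)) powr q" by (rule powr_mult)
  also have "... <= 3 powr q * (x powr q + y powr q + z powr q)"
    by (intro mult_left_mono) (auto simp: max_def)
  finally show ?thesis .
qed

text \<open>The condition on \<open>q\<close> is \<open>q \<ge> (4 n + 2) / (2 n - 1)\<close>, i.e. the weight coming from the radial
  decay dominates the scale-invariant weight of the one-dimensional estimate.\<close>
lemma core_bound_2:
  assumes dim: "CARD('n) = m + 2" and q: "2 < q" "q < 6" and qn: "3/2 - q/4 <= (real m + 1) * (q / 2 - 1)"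
  obtains K where "0 <= K" "\<And>\<Phi> c D h. phase \<Phi> c ==> 0 < D ==>
     (\<And>t R. R \<noteq> 0 ==> norm (LBINT s. cis (t * \<Phi> s + R * s) * indicator {1/2..2} s) <= D * \<bar>R\<bar> powr (- 1/2)) ==>
     h \<in> borel_measurable borel ==> integrable lborel (%s. (norm (h s))\<^sup>2) ==>
     (\<And>s. s \<notin> {1/2..2} ==> h s = 0) ==>
     (NNINT (y::real^'n). (NNINT t. ennreal (norm (osc m \<Phi> h t (norm y)) powr q)))
       <= ennreal (K / c * (1 + D powr ((q - 2) / 2)) * (sqrt (LBINT s. (norm (h s))\<^sup>2)) powr q)"
proof -
  define N where "N = (real m + 1) / 2"
  obtain C a where Ca: "0 < C" "a \<noteq> 0" and C1: "\<And>l. 0 <= l ==> \<bar>Jm m l\<bar> <= C * (1 + l) powr - N"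
    and as: "\<And>l. 1/2 <= l ==> norm (of_real (Jm m l) - of_real (l powr - N) * (a * cis l + cnj a * cis (- l))) <= C * l powr (- N - 1)"
  proof (rule Jm_asymptotics[of m, folded N_def], goal_cases)
    case (1 C a)
    from 1(2-) show thesis by (rule that)
  qed
  note C = Ca(1) C1
  have N0: "0 < N" by (simp add: N_def)
  define \<beta> where "\<beta> = 3/2 - q/4"
  define \<gamma> where "\<gamma> = 1/2 - 1/q"
  define p where "p = q / (q - 1)"
  obtain C0 where C0: "0 <= C0" and SW: "\<And>f X. f \<in> borel_measurable borel ==> (\<And>r. 0 <= f r) ==> 0 < X ==>
     (NNINT r. ennreal (f r powr p) * indicator {0<..} r) = ennreal X ==>
     (NNINT r. (NNINT s. ennreal (f r * f s * (r * s) powr (- \<beta> / q) * \<bar>r - s\<bar> powr (- \<gamma>)) * indicator {0<..} r * indicator {0<..} s))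
       <= ennreal (C0 * X powr (2 / p))"
  proof (rule stein_weiss[OF q \<beta>_def \<gamma>_def p_def], goal_cases)
    case (1 C0)
    from 1(2-) show thesis by (rule that)
  qed
  define A where "A = 4 * q * 2 powr (q - 2) / (q - 2)"
  have A0: "0 <= A" using q by (simp add: A_def)
  define e where "e l = of_real (Jm m l) - of_real (l powr - N) * (a * cis l + cnj a * cis (- l))" for l
  have [measurable]: "e \<in> borel_measurable borel" unfolding e_def by measurable
  define k0 where "k0 = 2 * pi * (3/2) powr ((q - 2) / 2)"
  have k0: "0 <= k0" by (simp add: k0_def)
  \<comment> \<open>The exponent of \<open>r\<close> in the contribution of the remainder
    \<open>e\<close>. The remainder decays one power faster than the main term, which makes this
    integrable at infinity as soon as \<open>2 < q\<close>.\<close>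
  define x where "x = real m + 1 - (N + 1) * q"
  have x: "x < - 1"
  proof -
    have "(N + 1) * 2 < (N + 1) * q" using q N0 by (intro mult_strict_left_mono) auto
    moreover have "(N + 1) * 2 = real m + 3" by (simp add: N_def)
    ultimately show ?thesis unfolding x_def by linarith
  qed
  define P where "P = polar_const m * Jm m 0"
  have P0: "0 <= P" using polar_const_pos[of m] Jm_nonneg_add[of m 0] by (simp add: P_def)
  define K1 where "K1 = k0 * C powr q"
  define K2 where "K2 = 3 powr q * (2 * norm a powr q * (C0 powr (q / 2) * sqrt A * (2 * pi) * 2 powr (N * q)))"
  define K3 where "K3 = 3 powr q * (k0 * (C * 2 powr (N + 1)) powr q * (- 1 / (x + 1)))"
  have x1: "0 <= - 1 / (x + 1)" using x by (intro divide_nonpos_nonpos) auto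
  have K0: "0 <= K1" "0 <= K2" "0 <= K3" unfolding K1_def K2_def K3_def
    by (intro mult_nonneg_nonneg k0 C0 x1 powr_ge_zero norm_ge_zero real_sqrt_ge_zero A0; simp)+
  define K where "K = P * (K1 + K2 + K3)"
  show thesis
  proof (rule that[of K])
    show "0 <= K" using P0 K0 by (simp add: K_def)
  next
    fix \<Phi> c D and h :: "real => complex"
    assume "phase \<Phi> c" and D0: "0 < D"
      and D: "\<And>t R. R \<noteq> 0 ==> norm (LBINT s. cis (t * \<Phi> s + R * s) * indicator {1/2..2} s) <= D * \<bar>R\<bar> powr (- 1/2)"
      and hm[measurable]: "h \<in> borel_measurable borel" and h2: "integrable lborel (%s. (norm (h s))\<^sup>2)"
      and supp: "\<And>s. s \<notin> {1/2..2} ==> h s = 0"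
    then interpret phase \<Phi> c by simp
    define L where "L = sqrt (LBINT s. (norm (h s))\<^sup>2)"
    have L0: "0 <= L" by (simp add: L_def integral_nonneg_AE)
    have L2: "(LBINT s. (norm (h s))\<^sup>2) = L\<^sup>2" by (simp add: L_def integral_nonneg_AE)
    have hi: "integrable lborel h" by (rule integrable_of_square(1)[OF hm h2 supp])
    \<comment> \<open>The leading term of the Bessel factor contains (r s)^(-N). Moving s^(-N) into
      the amplitude leaves r^(-N) times plain waves \<open>W\<close>, to which the one-dimensional
      estimate applies.\<close>
    define h' where "h' s = of_real (s powr - N) * h s" for s
    have h'm[measurable]: "h' \<in> borel_measurable borel" unfolding h'_def by measurable
    have h'b: "norm (h' s) <= 2 powr N * norm (h s)" for s
    proof (cases "s \<in> {1/2..2}")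
      case True
      have "s powr - N <= (1/2) powr - N" using True N0 by (intro powr_mono2') auto
      also have "(1/2::real) powr - N = 2 powr N" by (simp add: powr_divide powr_minus)
      finally show ?thesis unfolding h'_def norm_mult norm_of_real by (intro mult_right_mono) auto
    qed (use supp in \<open>simp add: h'_def\<close>)
    have h'2b: "(norm (h' s))\<^sup>2 <= (2 powr N)\<^sup>2 * (norm (h s))\<^sup>2" for s
      using power_mono[OF h'b norm_ge_zero, of s 2] by (simp add: power_mult_distrib)
    have h'2: "integrable lborel (%s. (norm (h' s))\<^sup>2)"
      by (rule Bochner_Integration.integrable_bound[of lborel "%s. (2 powr N)\<^sup>2 * (norm (h s))\<^sup>2"]) (use h2 h'2b in auto)
    have h'supp: "h' s = 0" if "s \<notin> {1/2..2}" for s using supp[OF that] by (simp add: h'_def)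
    have h'i: "integrable lborel h'" by (rule integrable_of_square(1)[OF h'm h'2 h'supp])
    have h'L: "(LBINT s. (norm (h' s))\<^sup>2) <= (2 powr N * L)\<^sup>2"
    proof -
      have "(LBINT s. (norm (h' s))\<^sup>2) <= (LBINT s. (2 powr N)\<^sup>2 * (norm (h s))\<^sup>2)" using h'2 h2 h'2b by (intro integral_mono) auto
      then show ?thesis by (simp add: L2 power_mult_distrib)
    qed
    define W where "W \<sigma> r t = (LBINT s. cis (t * \<Phi> s + \<sigma> * r * s) * h' s)" for \<sigma> r t
    define V where "V r t = (LBINT s. cis (t * \<Phi> s) * (e (r * s) * h s))" for r t
    have [measurable]: "(%z. W \<sigma> (fst z) (snd z)) \<in> borel_measurable (borel \<Otimes>\<^sub>M borel)" "(%t. W \<sigma> r t) \<in> borel_measurable borel" for \<sigma> r unfolding W_def by measurable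
    have [measurable]: "(%z. V (fst z) (snd z)) \<in> borel_measurable (borel \<Otimes>\<^sub>M borel)" "(%t. V r t) \<in> borel_measurable borel" for r unfolding V_def by measurable
    have [measurable]: "(%z. osc m \<Phi> h (snd z) (fst z)) \<in> borel_measurable (borel \<Otimes>\<^sub>M borel)" "(%t. osc m \<Phi> h t r) \<in> borel_measurable borel" for r unfolding osc_def by measurable
    define E where "E = (4 * q * 2 powr (q - 2) / (q - 2) * (2 * pi / c)\<^sup>2) powr (1 / q) * D powr (1 - 2 / q)"
    have E0: "0 <= E" by (simp add: E_def)
    define S where "S = (C0 powr (q / 2) * sqrt A * (2 * pi) * 2 powr (N * q)) / c * D powr ((q - 2) / 2) * L powr q"
    have S0: "0 <= S" using C0 A0 c by (simp add: S_def)
    have TS: "(NNINT r. (NNINT t. ennreal (norm (W \<sigma> r t) powr q * r powr (- \<beta>))) * indicator {1..} r) <= ennreal S" if "\<bar>\<sigma>\<bar> = 1" for \<sigma>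
    proof -
      have "(NNINT r. (NNINT t. ennreal (norm (W \<sigma> r t) powr q * r powr (- \<beta>))) * indicator {1..} r)
         <= ennreal ((C0 * E * (LBINT s. (norm (h' s))\<^sup>2)) powr (q / 2))"
        unfolding W_def E_def by (rule strichartz[OF q \<beta>_def \<gamma>_def p_def C0 SW D0 D that h'i h'2 h'supp])
      also have "... <= ennreal ((C0 * E * (2 powr N * L)\<^sup>2) powr (q / 2))"
        using h'L C0 E0 q by (intro ennreal_leI powr_mono2 mult_left_mono) (auto intro!: mult_nonneg_nonneg integral_nonneg_AE)
      also have "(C0 * E * (2 powr N * L)\<^sup>2) powr (q / 2) = S"
      proof -
        have "E powr (q / 2) = (A * (2 * pi / c)\<^sup>2) powr (1 / 2) * D powr ((q - 2) / 2)"
        proof -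
          have x: "1 / q * (q / 2) = 1 / 2" "(1 - 2 / q) * (q / 2) = (q - 2) / 2" using q by (auto simp: field_simps)
          show ?thesis unfolding E_def A_def[symmetric] using A0 D0 by (simp only: powr_mult powr_ge_zero powr_powr x)
        qed
        also have "(A * (2 * pi / c)\<^sup>2) powr (1 / 2) = sqrt A * (2 * pi / c)"
          using A0 c by (simp add: powr_half_sqrt real_sqrt_mult)
        finally have EE: "E powr (q / 2) = sqrt A * (2 * pi / c) * D powr ((q - 2) / 2)" .
        have LL: "((2 powr N * L)\<^sup>2) powr (q / 2) = 2 powr (N * q) * L powr q"
        proof -
          have "((2 powr N * L)\<^sup>2) powr (q / 2) = (2 powr N * L) powr q"
          proof (cases "L = 0")
            case False
            then have "0 < 2 powr N * L" using L0 by simp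
            then have "(2 powr N * L)\<^sup>2 = (2 powr N * L) powr 2" by simp
            then show ?thesis by (simp only: powr_powr) simp
          qed simp
          also have "... = 2 powr (N * q) * L powr q" using L0 by (simp add: powr_mult powr_powr)
          finally show ?thesis .
        qed
        have "(C0 * E * (2 powr N * L)\<^sup>2) powr (q / 2) = C0 powr (q / 2) * E powr (q / 2) * ((2 powr N * L)\<^sup>2) powr (q / 2)"
          using C0 E0 by (simp add: powr_mult)
        then show ?thesis unfolding EE LL S_def by (simp add: mult_ac)
      qed
      finally show ?thesis .
    qed
    define T where "T \<sigma> r = (NNINT t. ennreal (norm (W \<sigma> r t) powr q * r powr (- \<beta>)))" for \<sigma> r
    have [measurable]: "T \<sigma> \<in> borel_measurable borel" for \<sigma> unfolding T_def by measurable
    define G where "G r = (NNINT t. ennreal (norm (osc m \<Phi> h t r) powr q))" for r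
    have Gm[measurable]: "G \<in> borel_measurable borel" unfolding G_def by measurable
    have Gsmall: "G r <= ennreal (K1 / c * L powr q)" if "0 <= r" for r
    proof -
      have "G r <= ennreal (2 * pi / c * (3/2) powr ((q - 2) / 2) * (C * L) powr q)"
        unfolding G_def osc_def L_def
      proof (rule time_bound(2)[OF _ _ hm h2 supp])
        show "norm (of_real (Jm m (r * s)) * h s) <= C * norm (h s)" for s
        proof (cases "s \<in> {1/2..2}")
          case True
          have "\<bar>Jm m (r * s)\<bar> <= C * (1 + r * s) powr - N" using True that by (intro C) auto
          also have "... <= C * 1 powr - N"
            using True that C N0 by (intro mult_left_mono powr_mono2') auto
          finally show ?thesis by (simp add: norm_mult mult_right_mono)
        qed (use supp in simp)
      qed (use C q in auto)
      also have "2 * pi / c * (3/2) powr ((q - 2) / 2) * (C * L) powr q = K1 / c * L powr q"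
        using C L0 by (simp add: K1_def k0_def powr_mult)
      finally show ?thesis .
    qed
    define k3 where "k3 = k0 / c * (C * 2 powr (N + 1)) powr q * L powr q"
    have k3: "0 <= k3" using k0 c by (simp add: k3_def)
    have VE: "(NNINT t. ennreal (norm (V r t) powr q)) <= ennreal (k3 * r powr (- (N + 1) * q))" if r: "1 <= r" for r
    proof -
      define B where "B = C * (r / 2) powr (- N - 1)"
      have "(NNINT t. ennreal (norm (V r t) powr q)) <= ennreal (2 * pi / c * (3/2) powr ((q - 2) / 2) * (B * L) powr q)"
        unfolding V_def L_def
      proof (rule time_bound(2)[OF _ _ hm h2 supp])
        show "norm (e (r * s) * h s) <= B * norm (h s)" for s
        proof (cases "s \<in> {1/2..2}")
          case True
          have rs: "r / 2 <= r * s" using True r mult_left_mono[of "1/2" s r] by auto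
          moreover have "1 * (1 / 2) <= r * s" using True r by (intro mult_mono) auto
          ultimately have "norm (e (r * s)) <= C * (r * s) powr (- N - 1)" using r unfolding e_def by (intro as) auto
          also have "... <= B" unfolding B_def using rs r C N0 by (intro mult_left_mono powr_mono2') auto
          finally show ?thesis by (simp add: norm_mult mult_right_mono)
        qed (use supp in simp)
      qed (use C q in \<open>auto simp: B_def\<close>)
      also have "2 * pi / c * (3/2) powr ((q - 2) / 2) * (B * L) powr q = k3 * r powr (- (N + 1) * q)"
      proof -
        have "B = (C * 2 powr (N + 1)) * r powr (- (N + 1))"
        proof -
          have "(r / 2) powr (- (N + 1)) = r powr (- (N + 1)) * 2 powr (N + 1)" using r by (simp only: powr_divide powr_minus) (simp add: field_simps)
          moreover have "- N - 1 = - (N + 1)" by simp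
          ultimately show ?thesis unfolding B_def by (simp only: mult_ac)
        qed
        then have "(B * L) powr q = (C * 2 powr (N + 1)) powr q * r powr (- (N + 1) * q) * L powr q"
          using C L0 by (simp only: powr_mult powr_powr powr_ge_zero less_imp_le mult_nonneg_nonneg zero_le_numeral)
        then show ?thesis by (simp add: k3_def k0_def mult_ac)
      qed
      finally show ?thesis .
    qed
    \<comment> \<open>Two conjugate waves travelling inwards and outwards, and a remainder. The
      asymptotics are available because \<open>1/2 <= r * s\<close>.\<close>
    have split: "osc m \<Phi> h t r = a * of_real (r powr - N) * W 1 r t + cnj a * of_real (r powr - N) * W (-1) r t + V r t" if r: "1 <= r" for r t
    proof -
      have i: "integrable lborel (%s. cis (t * \<Phi> s + \<sigma> * r * s) * h' s)" for \<sigma>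
        by (intro cis_mult_integrable h'i) measurable
      have ie: "integrable lborel (%s. cis (t * \<Phi> s) * (e (r * s) * h s))"
      proof (rule Bochner_Integration.integrable_bound[of lborel "%s. of_real (C * (1/2) powr (- N - 1)) * h s"])
        show "AE s in lborel. norm (cis (t * \<Phi> s) * (e (r * s) * h s)) <= norm (of_real (C * (1/2) powr (- N - 1)) * h s)"
        proof (rule AE_I2)
          fix s show "norm (cis (t * \<Phi> s) * (e (r * s) * h s)) <= norm (of_real (C * (1/2) powr (- N - 1)) * h s)"
          proof (cases "s \<in> {1/2..2}")
            case True
            have "1 * (1 / 2) <= r * s" using True r by (intro mult_mono) auto
            then have rs: "1 / 2 <= r * s" by simp
            then have "norm (e (r * s)) <= C * (r * s) powr (- N - 1)" unfolding e_def by (intro as) auto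
            also have "... <= C * (1/2) powr (- N - 1)" using rs C N0 by (intro mult_left_mono powr_mono2') auto
            finally show ?thesis using C by (simp add: norm_mult mult_right_mono)
          qed (use supp in simp)
        qed
      qed (use hi in auto)
      have "osc m \<Phi> h t r = (LBINT s. (a * of_real (r powr - N) * (cis (t * \<Phi> s + 1 * r * s) * h' s) + cnj a * of_real (r powr - N) * (cis (t * \<Phi> s + (-1) * r * s) * h' s)) + cis (t * \<Phi> s) * (e (r * s) * h s))"
        unfolding osc_def
      proof (rule Bochner_Integration.integral_cong[OF refl])
        fix s
        show "cis (t * \<Phi> s) * (of_real (Jm m (r * s)) * h s) = (a * of_real (r powr - N) * (cis (t * \<Phi> s + 1 * r * s) * h' s) + cnj a * of_real (r powr - N) * (cis (t * \<Phi> s + (-1) * r * s) * h' s)) + cis (t * \<Phi> s) * (e (r * s) * h s)"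
        proof (cases "s \<in> {1/2..2}")
          case True
          have 1: "(r * s) powr - N = r powr - N * s powr - N" using True r by (simp add: powr_mult)
          have 2: "of_real (Jm m (r * s)) = e (r * s) + of_real (r powr - N * s powr - N) * (a * cis (r * s) + cnj a * cis (- (r * s)))"
            by (simp add: e_def 1)
          have 3: "cis (t * \<Phi> s + 1 * r * s) = cis (t * \<Phi> s) * cis (r * s)" "cis (t * \<Phi> s + (-1) * r * s) = cis (t * \<Phi> s) * cis (- (r * s))"
            by (simp_all add: cis_mult)
          show ?thesis unfolding 2 3 h'_def of_real_mult by (simp only: distrib_left distrib_right mult_ac add_ac)
        qed (use supp in \<open>simp add: h'_def\<close>)
      qed
      also have "... = a * of_real (r powr - N) * W 1 r t + cnj a * of_real (r powr - N) * W (-1) r t + V r t"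
        unfolding W_def V_def
        by (subst Bochner_Integration.integral_add[OF Bochner_Integration.integrable_add[OF integrable_mult_right[OF i] integrable_mult_right[OF i]] ie],
            subst Bochner_Integration.integral_add[OF integrable_mult_right[OF i] integrable_mult_right[OF i]]) (simp only: integral_mult_right_zero)
      finally show ?thesis .
    qed
    have Glarge: "G r * ennreal (r ^ (m + 1)) <= ennreal (3 powr q) * (ennreal (norm a powr q) * T 1 r + ennreal (norm a powr q) * T (-1) r + ennreal (k3 * r powr x))" if r: "1 <= r" for r
    proof -
      have rm: "r ^ (m + 1) = r powr (real m + 1)"
      proof -
        have "r powr real (m + 1) = r ^ (m + 1)" using r by (intro powr_realpow) auto
        then show ?thesis by (simp only: of_nat_add of_nat_1)
      qed
      have pt: "norm (osc m \<Phi> h t r) powr q * r ^ (m + 1) <= 3 powr q * (norm a powr q * (norm (W 1 r t) powr q * r powr - \<beta>) + norm a powr q * (norm (W (-1) r t) powr q * r powr - \<beta>) + norm (V r t) powr q * r ^ (m + 1))" for t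
      proof -
        let ?u = "%\<sigma>. norm a * r powr - N * norm (W \<sigma> r t)"
        have "norm (osc m \<Phi> h t r) <= ?u 1 + ?u (-1) + norm (V r t)"
          unfolding split[OF r]
          by (intro order_trans[OF norm_triangle_ineq] add_mono order_refl) (simp_all add: norm_mult)
        then have "norm (osc m \<Phi> h t r) powr q <= (?u 1 + ?u (-1) + norm (V r t)) powr q" using q by (intro powr_mono2) auto
        also have "... <= 3 powr q * ((?u 1) powr q + (?u (-1)) powr q + norm (V r t) powr q)" using q by (intro sum3_powr_le) auto
        finally have "norm (osc m \<Phi> h t r) powr q * r ^ (m + 1) <= (3 powr q * ((?u 1) powr q + (?u (-1)) powr q + norm (V r t) powr q)) * r ^ (m + 1)"
          using r by (intro mult_right_mono) auto
        also have "... = 3 powr q * ((?u 1) powr q * r ^ (m + 1) + (?u (-1)) powr q * r ^ (m + 1) + norm (V r t) powr q * r ^ (m + 1))"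
          by (simp only: distrib_right mult.assoc)
        also have "... <= 3 powr q * (norm a powr q * (norm (W 1 r t) powr q * r powr - \<beta>) + norm a powr q * (norm (W (-1) r t) powr q * r powr - \<beta>) + norm (V r t) powr q * r ^ (m + 1))"
        proof -
          have u: "(?u \<sigma>) powr q * r ^ (m + 1) <= norm a powr q * (norm (W \<sigma> r t) powr q * r powr - \<beta>)" for \<sigma>
          proof -
            have "(?u \<sigma>) powr q * r ^ (m + 1) = norm a powr q * (norm (W \<sigma> r t) powr q * (r powr (- N * q) * r powr (real m + 1)))"
              unfolding rm by (simp add: powr_mult powr_powr mult_ac)
            also have "r powr (- N * q) * r powr (real m + 1) = r powr (- N * q + (real m + 1))" by (rule powr_add[symmetric])
            \<comment> \<open>Here \<open>qn\<close> is used: the Jacobian and the decay of the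
              Bessel factor together are no larger than the weight of the one-dimensional estimate.
              The comparison of powers requires \<open>1 <= r\<close>.\<close>
            also have "... <= r powr - \<beta>"
            proof (rule powr_mono)
              have "(real m + 1) * (q / 2 - 1) = N * q - (real m + 1)" by (simp add: N_def field_simps)
              then show "- N * q + (real m + 1) <= - \<beta>" using qn unfolding \<beta>_def by linarith
            qed (use r in simp)
            finally show ?thesis by (simp add: mult_left_mono)
          qed
          show ?thesis by (intro mult_left_mono add_mono u order_refl) simp
        qed
        finally show ?thesis .
      qed
      have "G r * ennreal (r ^ (m + 1)) = (NNINT t. ennreal (norm (osc m \<Phi> h t r) powr q * r ^ (m + 1)))"
        unfolding G_def using r by (subst nn_integral_multc[symmetric]) (auto simp: ennreal_mult)
      also have "... <= (NNINT t. ennreal (3 powr q) * (ennreal (norm a powr q) * ennreal (norm (W 1 r t) powr q * r powr - \<beta>) + ennreal (norm a powr q) * ennreal (norm (W (-1) r t) powr q * r powr - \<beta>) + ennreal (norm (V r t) powr q) * ennreal (r ^ (m + 1))))"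
      proof (rule nn_integral_mono)
        fix t
        have "ennreal (norm (osc m \<Phi> h t r) powr q * r ^ (m + 1)) <= ennreal (3 powr q * (norm a powr q * (norm (W 1 r t) powr q * r powr - \<beta>) + norm a powr q * (norm (W (-1) r t) powr q * r powr - \<beta>) + norm (V r t) powr q * r ^ (m + 1)))"
          by (rule ennreal_leI[OF pt])
        also have "... = ennreal (3 powr q) * (ennreal (norm a powr q) * ennreal (norm (W 1 r t) powr q * r powr - \<beta>) + ennreal (norm a powr q) * ennreal (norm (W (-1) r t) powr q * r powr - \<beta>) + ennreal (norm (V r t) powr q) * ennreal (r ^ (m + 1)))"
          using r by (simp add: ennreal_mult)
        finally show "ennreal (norm (osc m \<Phi> h t r) powr q * r ^ (m + 1)) <= ..." .
      qed
      also have "... = ennreal (3 powr q) * (ennreal (norm a powr q) * T 1 r + ennreal (norm a powr q) * T (-1) r + (NNINT t. ennreal (norm (V r t) powr q)) * ennreal (r ^ (m + 1)))"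
        unfolding T_def by (simp add: nn_integral_cmult nn_integral_add nn_integral_multc)
      also have "... <= ennreal (3 powr q) * (ennreal (norm a powr q) * T 1 r + ennreal (norm a powr q) * T (-1) r + ennreal (k3 * r powr x))"
      proof (intro mult_left_mono add_mono order_refl)
        have "(NNINT t. ennreal (norm (V r t) powr q)) * ennreal (r ^ (m + 1)) <= ennreal (k3 * r powr (- (N + 1) * q)) * ennreal (r ^ (m + 1))"
          by (intro mult_right_mono VE r) simp
        also have "... = ennreal (k3 * (r powr (- (N + 1) * q) * r powr (real m + 1)))" unfolding rm using k3 by (simp add: ennreal_mult mult.assoc)
        also have "r powr (- (N + 1) * q) * r powr (real m + 1) = r powr x" unfolding powr_add[symmetric] x_def by (intro arg_cong[of _ _ "(powr) r"]) (simp add: algebra_simps)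
        finally show "(NNINT t. ennreal (norm (V r t) powr q)) * ennreal (r ^ (m + 1)) <= ennreal (k3 * r powr x)" .
      qed auto
      finally show ?thesis .
    qed
    have IY: "(NNINT (y::real^'n). (NNINT t. ennreal (norm (osc m \<Phi> h t (norm y)) powr q))) = ennreal P * (NNINT r. G r * ennreal (r ^ (m + 1)) * indicator {0..} r)"
      unfolding G_def[symmetric] P_def by (rule polar_nn_integral[OF dim Gm])
    have "(NNINT r. G r * ennreal (r ^ (m + 1)) * indicator {0..} r)
      <= (NNINT r. ennreal (K1 / c * L powr q) * indicator {0..1::real} r + ennreal (3 powr q) * (ennreal (norm a powr q) * (T 1 r * indicator {1..} r) + ennreal (norm a powr q) * (T (-1) r * indicator {1..} r) + ennreal k3 * (ennreal (r powr x) * indicator {1..} r)))"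
    proof (rule nn_integral_mono)
      fix r :: real
      consider "r < 0" | "0 <= r" "r < 1" | "1 <= r" by linarith
      then show "G r * ennreal (r ^ (m + 1)) * indicator {0..} r
        <= ennreal (K1 / c * L powr q) * indicator {0..1::real} r + ennreal (3 powr q) * (ennreal (norm a powr q) * (T 1 r * indicator {1..} r) + ennreal (norm a powr q) * (T (-1) r * indicator {1..} r) + ennreal k3 * (ennreal (r powr x) * indicator {1..} r))"
      proof cases
        case 2
        have "r ^ (m + 1) <= 1" using 2 by (intro power_le_one) auto
        then have "G r * ennreal (r ^ (m + 1)) <= ennreal (K1 / c * L powr q) * ennreal 1"
          using 2 by (intro mult_mono Gsmall ennreal_leI) auto
        then show ?thesis using 2 by simp
      next
        case 3
        have "G r * ennreal (r ^ (m + 1)) * indicator {0..} r <= ennreal (3 powr q) * (ennreal (norm a powr q) * (T 1 r * indicator {1..} r) + ennreal (norm a powr q) * (T (-1) r * indicator {1..} r) + ennreal k3 * (ennreal (r powr x) * indicator {1..} r))"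
          using Glarge[OF 3] 3 k3 by (simp add: ennreal_mult)
        then show ?thesis by (rule order_trans) simp
      qed simp
    qed
    also have "... = (NNINT r. ennreal (K1 / c * L powr q) * indicator {0..1::real} r) + ennreal (3 powr q) * (ennreal (norm a powr q) * (NNINT r. T 1 r * indicator {1..} r) + ennreal (norm a powr q) * (NNINT r. T (-1) r * indicator {1..} r) + ennreal k3 * (NNINT r. ennreal (r powr x) * indicator {1..} r))"
      by (rule nn_integral_linear_combination) measurable
    also have "(NNINT r. ennreal (K1 / c * L powr q) * indicator {0..1::real} r) = ennreal (K1 / c * L powr q) * 1"
      by (subst nn_integral_cmult_indicator) auto
    also have "ennreal (K1 / c * L powr q) * 1 + ennreal (3 powr q) * (ennreal (norm a powr q) * (NNINT r. T 1 r * indicator {1..} r) + ennreal (norm a powr q) * (NNINT r. T (-1) r * indicator {1..} r) + ennreal k3 * (NNINT r. ennreal (r powr x) * indicator {1..} r))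
      <= ennreal (K1 / c * L powr q) * 1 + ennreal (3 powr q) * (ennreal (norm a powr q) * ennreal S + ennreal (norm a powr q) * ennreal S + ennreal k3 * ennreal (- 1 / (x + 1)))"
      unfolding T_def using x by (intro add_mono mult_left_mono TS) (auto simp: nn_integral_powr_inf)
    also have "... = ennreal (K1 / c * L powr q + 3 powr q * (norm a powr q * S + norm a powr q * S + k3 * (- 1 / (x + 1))))"
    proof -
      have *: "ennreal w * 1 + ennreal A * (ennreal B * ennreal C + ennreal B * ennreal C + ennreal E * ennreal F)
          = ennreal (w + A * (B * C + B * C + E * F))"
        if "0 <= w" "0 <= A" "0 <= B" "0 <= C" "0 <= E" "0 <= F" for w A B C E F :: real
        using that by (simp only: ennreal_mult ennreal_plus mult_1_right mult_nonneg_nonneg add_nonneg_nonneg)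
      show ?thesis by (rule *) (use K0 c S0 k3 x1 in \<open>auto simp del: minus_divide_left intro!: divide_nonpos_nonpos\<close>)
    qed
    also have "K1 / c * L powr q + 3 powr q * (norm a powr q * S + norm a powr q * S + k3 * (- 1 / (x + 1))) = (K1 + K2 * D powr ((q - 2) / 2) + K3) / c * L powr q"
    proof -
      have 1: "3 powr q * (norm a powr q * S + norm a powr q * S) = K2 * D powr ((q - 2) / 2) / c * L powr q" by (simp add: K2_def S_def)
      have 2: "3 powr q * (k3 * (- 1 / (x + 1))) = K3 / c * L powr q" by (simp add: K3_def k3_def mult.assoc mult.commute[of c])
      show ?thesis unfolding distrib_left[of "3 powr q" "norm a powr q * S + norm a powr q * S"] 1 2 by (simp add: add_divide_distrib distrib_right)
    qed
    finally have Ib: "(NNINT r. G r * ennreal (r ^ (m + 1)) * indicator {0..} r) <= ennreal ((K1 + K2 * D powr ((q - 2) / 2) + K3) / c * L powr q)" .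
    note IY
    also have "ennreal P * (NNINT r. G r * ennreal (r ^ (m + 1)) * indicator {0..} r) <= ennreal P * ennreal ((K1 + K2 * D powr ((q - 2) / 2) + K3) / c * L powr q)"
      by (rule mult_left_mono[OF Ib]) simp
    also have "ennreal P * ennreal ((K1 + K2 * D powr ((q - 2) / 2) + K3) / c * L powr q) <= ennreal (K / c * (1 + D powr ((q - 2) / 2)) * L powr q)"
    proof -
      let ?d = "D powr ((q - 2) / 2)"
      have "K1 + K2 * ?d + K3 <= (K1 + K2 + K3) * (1 + ?d)"
        using K0 by (simp add: distrib_left distrib_right)
      then have "P * (K1 + K2 * ?d + K3) <= P * ((K1 + K2 + K3) * (1 + ?d))" using P0 by (intro mult_left_mono) auto
      then have "P * (K1 + K2 * ?d + K3) / c * L powr q <= P * ((K1 + K2 + K3) * (1 + ?d)) / c * L powr q"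
        using c by (intro mult_right_mono divide_right_mono) auto
      moreover have "P * ((K1 + K2 + K3) * (1 + ?d)) / c = K / c * (1 + ?d)" by (simp add: K_def)
      moreover have "ennreal P * ennreal ((K1 + K2 * ?d + K3) / c * L powr q) = ennreal (P * (K1 + K2 * ?d + K3) / c * L powr q)"
        using P0 K0 c by (subst ennreal_mult[symmetric]) auto
      ultimately show ?thesis by (simp only: ennreal_leI)
    qed
    finally show "(NNINT (y::real^'n). (NNINT t. ennreal (norm (osc m \<Phi> h t (norm y)) powr q))) <= ennreal (K / c * (1 + D powr ((q - 2) / 2)) * L powr q)" .
  qed
qed

section \<open>Reduction of the flow to unit frequency\<close>

lemma smooth_real_on_differentiable:
  assumes "smooth_real_on S f" "x \<in> S"
  shows "((deriv ^^ j) f has_real_derivative (deriv ^^ Suc j) f x) (at x)"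
  using assms unfolding smooth_real_on_def by (simp add: DERIV_deriv_iff_real_differentiable)

lemma cutoff_continuous:
  assumes "cutoff Phi"
  shows "continuous_on UNIV Phi"
proof (rule continuous_at_imp_continuous_on, rule ballI)
  fix x :: real
  have "smooth_real_on UNIV Phi" using assms by (simp add: cutoff_def)
  then have "((deriv ^^ 0) Phi has_real_derivative (deriv ^^ Suc 0) Phi x) (at x)"
    by (rule smooth_real_on_differentiable) simp
  then have "(Phi has_real_derivative deriv Phi x) (at x)" by simp
  then show "isCont Phi x" by (rule DERIV_isCont)
qed

lemma psi_continuous:
  assumes "cutoff Phi"
  shows "continuous_on UNIV (psi Phi)"
proof -
  note c = cutoff_continuous[OF assms]
  have "continuous_on UNIV (%x::real. 2 * x)" by (intro continuous_intros)
  from continuous_on_compose2[OF c this] have "continuous_on UNIV (%x. Phi (2 * x))" by simp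
  with c show ?thesis unfolding psi_def[abs_def] by (rule continuous_on_diff)
qed

lemma psi_measurable: "cutoff Phi ==> psi Phi \<in> borel_measurable borel"
  by (rule borel_measurable_continuous_onI[OF psi_continuous])

lemma psi_bounds:
  assumes "cutoff Phi"
  shows "0 <= psi Phi x" "psi Phi x <= 1" "\<bar>x\<bar> < 1/2 \<or> 2 < \<bar>x\<bar> ==> psi Phi x = 0"
proof -
  have P: "0 <= Phi y" "Phi y <= 1" "2 < \<bar>y\<bar> ==> Phi y = 0" "\<bar>y\<bar> <= 1 ==> Phi y = 1" for y
    using assms by (auto simp: cutoff_def)
  show "psi Phi x <= 1" using P(2)[of x] P(1)[of "2 * x"] by (simp add: psi_def)
  show "0 <= psi Phi x"
  proof (cases "\<bar>x\<bar> <= 1")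
    case True then show ?thesis using P(4)[OF True] P(2)[of "2 * x"] by (simp add: psi_def)
  next
    case False
    then have "Phi (2 * x) = 0" by (intro P(3)) simp
    then show ?thesis using P(1)[of x] by (simp add: psi_def)
  qed
  show "psi Phi x = 0" if "\<bar>x\<bar> < 1/2 \<or> 2 < \<bar>x\<bar>"
  proof (cases "2 < \<bar>x\<bar>")
    case True
    then have "Phi x = 0" "Phi (2 * x) = 0" by (auto intro!: P(3))
    then show ?thesis by (simp add: psi_def)
  next
    case False
    then have "\<bar>x\<bar> < 1/2" using that by simp
    then have "Phi x = 1" "Phi (2 * x) = 1" by (auto intro!: P(4))
    then show ?thesis by (simp add: psi_def)
  qed
qed

text \<open>The cutoff is prescribed to vanish beyond \<open>2\<close>, and at the point
  \<open>2\<close> it vanishes by continuity. The value at 1 later makes the test amplitude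
  nontrivial.\<close>

lemma psi_1: assumes "cutoff Phi" shows "psi Phi 1 = 1"
proof -
  have c: "isCont Phi 2" using cutoff_continuous[OF assms] by (simp add: continuous_on_eq_continuous_at)
  have "((%x. Phi x) \<longlongrightarrow> Phi 2) (at_right 2)" using c unfolding isCont_def by (rule filterlim_at_split[THEN iffD1, THEN conjunct2])
  moreover have "\<forall>\<^sub>F x in at_right 2. Phi x = 0"
    using assms by (auto simp: cutoff_def eventually_at_right_field intro!: exI[of _ 3])
  then have "((%x. Phi x) \<longlongrightarrow> 0) (at_right 2)" by (rule tendsto_eventually)
  ultimately have "Phi 2 = 0" using tendsto_unique[of "at_right (2::real)"] by simp
  then show ?thesis using assms by (simp add: psi_def cutoff_def)
qed

lemma integrable_on_ball_of_square:
  fixes u v :: "'a::euclidean_space => complex"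
  assumes [measurable]: "u \<in> borel_measurable borel" and u2: "integrable lborel (%x. (norm (u x))\<^sup>2)"
    and v[measurable]: "v \<in> borel_measurable borel" and vb: "\<And>x. norm (v x) <= B * norm (u x)" and B: "0 <= B" and supp: "\<And>x. R < norm x ==> v x = 0"
  shows "integrable lborel v"
proof (rule Bochner_Integration.integrable_bound)
  have "integrable lborel (indicat_real (cball (0::'a) R))"
    using emeasure_bounded_finite[OF bounded_cball[of "0::'a" R]] by (intro integrable_real_indicator) auto
  then show "integrable lborel (%x. B * (indicat_real (cball (0::'a) R) x + (norm (u x))\<^sup>2))"
    using u2 by (intro integrable_mult_right Bochner_Integration.integrable_add)
  show "AE x in lborel. norm (v x) <= norm (B * (indicat_real (cball (0::'a) R) x + (norm (u x))\<^sup>2))"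
  proof (rule AE_I2)
    fix x show "norm (v x) <= norm (B * (indicat_real (cball (0::'a) R) x + (norm (u x))\<^sup>2))"
    proof (cases "norm x <= R")
      case True
      have "norm (u x) <= 1 + (norm (u x))\<^sup>2" using sum_squares_bound[of 1 "norm (u x)"] norm_ge_zero[of "u x"] by (simp del: norm_ge_zero)
      then have "B * norm (u x) <= B * (1 + (norm (u x))\<^sup>2)" using B by (rule mult_left_mono)
      then show ?thesis using vb[of x] True B by (simp add: abs_mult)
    qed (use supp in simp)
  qed
qed measurable

text \<open>One half of Plancherel's theorem, as the case of \<open>L2_bound\<close> for the map
  from \<open>x\<close> to \<open>- x\<close>, which preserves distances.\<close>

lemma fourier_truncated:
  fixes u :: "'a::euclidean_space => complex"
  assumes u: "L2 u"
  defines "F \<equiv> %R. fourier_L1 (%x. indicator (cball 0 R) x * u x)"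
  shows "F R \<in> borel_measurable borel" "L2 (F R)" "L2norm (F R) <= sqrt ((2 * pi) ^ DIM('a)) * L2norm u"
proof -
  have um[measurable]: "u \<in> borel_measurable borel" and u2: "integrable lborel (%x. (norm (u x))\<^sup>2)" using u by (auto simp: L2_def)
  let ?h = "%x. indicator (cball 0 R) x * u x"
  have [measurable]: "(indicator (cball 0 R) :: 'a => complex) \<in> borel_measurable borel" by (intro borel_measurable_indicator) auto
  have hb: "norm (?h x) <= 1 * norm (u x)" for x by (auto simp: indicator_def)
  have hi: "integrable lborel ?h"
    by (rule integrable_on_ball_of_square[OF um u2 _ hb, of R]) (auto simp: indicator_def)
  have hb2: "(norm (?h x))\<^sup>2 <= (norm (u x))\<^sup>2" for x by (auto simp: indicator_def)
  have h2: "integrable lborel (%x. (norm (?h x))\<^sup>2)"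
    by (rule Bochner_Integration.integrable_bound[OF u2]) (use hb2 in auto)
  have eq: "F R \<xi> = (LBINT x. cis ((- x) \<bullet> \<xi>) * ?h x)" for \<xi>
    unfolding F_def fourier_L1_def by (simp add: cis_conv_exp)
  show Fm: "F R \<in> borel_measurable borel" unfolding eq[abs_def] by measurable
  have "(NNINT \<xi>. ennreal ((norm (F R \<xi>))\<^sup>2)) <= ennreal ((2 * pi / 1) ^ DIM('a) * (LBINT x. (norm (?h x))\<^sup>2))"
    unfolding eq by (rule L2_bound[OF hi h2]) (auto simp: norm_minus_commute)
  also have "... <= ennreal ((2 * pi) ^ DIM('a) * (L2norm u)\<^sup>2)"
  proof (intro ennreal_leI)
    have "(LBINT x. (norm (?h x))\<^sup>2) <= (LBINT x. (norm (u x))\<^sup>2)" using h2 u2 hb2 by (intro integral_mono) auto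
    then show "(2 * pi / 1) ^ DIM('a) * (LBINT x. (norm (?h x))\<^sup>2) <= (2 * pi) ^ DIM('a) * (L2norm u)\<^sup>2"
      by (simp add: L2norm_def integral_nonneg_AE)
  qed
  finally have B: "(NNINT \<xi>. ennreal ((norm (F R \<xi>))\<^sup>2)) <= ennreal ((2 * pi) ^ DIM('a) * (L2norm u)\<^sup>2)" .
  have F2: "integrable lborel (%\<xi>. (norm (F R \<xi>))\<^sup>2)"
    unfolding integrable_iff_bounded using Fm B by (auto simp: order_le_less_trans)
  then show "L2 (F R)" using Fm by (simp add: L2_def)
  have "ennreal (LBINT \<xi>. (norm (F R \<xi>))\<^sup>2) <= ennreal ((2 * pi) ^ DIM('a) * (L2norm u)\<^sup>2)"
    using B F2 by (subst nn_integral_eq_integral[symmetric]) auto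
  then have "(LBINT \<xi>. (norm (F R \<xi>))\<^sup>2) <= (2 * pi) ^ DIM('a) * (L2norm u)\<^sup>2" by (subst (asm) ennreal_le_iff) auto
  then have "sqrt (LBINT \<xi>. (norm (F R \<xi>))\<^sup>2) <= sqrt ((2 * pi) ^ DIM('a) * (L2norm u)\<^sup>2)" by (rule real_sqrt_le_mono)
  also have "... = sqrt ((2 * pi) ^ DIM('a)) * L2norm u"
  proof -
    have "0 <= L2norm u" by (simp add: L2norm_def integral_nonneg_AE)
    then show ?thesis by (simp add: real_sqrt_mult)
  qed
  finally show "L2norm (F R) <= sqrt ((2 * pi) ^ DIM('a)) * L2norm u" by (simp add: L2norm_def)
qed

lemma fourier_radial:
  fixes h :: "real^'n => complex"
  assumes h: "radial h" and [measurable]: "h \<in> borel_measurable borel"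
  shows "radial (fourier_L1 h)"
  unfolding radial_def
proof (intro allI impI)
  fix x y :: "real^'n" assume "norm x = norm y"
  then obtain f where f: "orthogonal_transformation f" "f x = y" using orthogonal_transformation_exists by metis
  have fm[measurable]: "f \<in> borel_measurable borel" by (rule lborel_distr_orthogonal[OF f(1)])
  have "fourier_L1 h y = (\<integral>z. exp (- (\<i> * complex_of_real (z \<bullet> y))) * h z \<partial>distr lborel borel f)"
    unfolding fourier_L1_def lborel_distr_orthogonal(2)[OF f(1)] ..
  also have "... = (LBINT z. exp (- (\<i> * complex_of_real (f z \<bullet> y))) * h (f z))"
    by (rule integral_distr) measurable
  also have "... = fourier_L1 h x"
    unfolding fourier_L1_def
  proof (rule Bochner_Integration.integral_cong[OF refl])
    fix z
    have "f z \<bullet> y = z \<bullet> x" using f unfolding orthogonal_transformation_def by metis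
    moreover have "h (f z) = h z" using h orthogonal_transformation_norm[OF f(1)] unfolding radial_def by metis
    ultimately show "exp (- (\<i> * complex_of_real (f z \<bullet> y))) * h (f z) = exp (- (\<i> * complex_of_real (z \<bullet> x))) * h z" by simp
  qed
  finally show "fourier_L1 h x = fourier_L1 h y" ..
qed

text \<open>The value \<open>0\<close> off the interval makes the function Borel measurable on the
  whole line, although \<open>phi\<close> is controlled on the positive half-line only.\<close>

definition freq_phase :: "(real => real) => int => real => real" where
  "freq_phase phi k s = (if s \<in> {1/2..2} then phi (2 powr real_of_int k * s) else 0)"

lemma freq_phase_measurable:
  assumes "smooth_real_on {0<..} phi"
  shows "freq_phase phi k \<in> borel_measurable borel"
proof -
  have "continuous_on {0<..} phi"
  proof (intro continuous_at_imp_continuous_on ballI)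
    fix x :: real assume "x \<in> {0<..}"
    from smooth_real_on_differentiable[OF assms this, of 0] show "isCont phi x" by (simp add: DERIV_isCont)
  qed
  then have "continuous_on {1/2..2} (%s. phi (2 powr real_of_int k * s))"
  proof (rule continuous_on_compose2)
    show "(%s. 2 powr real_of_int k * s) ` {1/2..2} \<subseteq> {0<..}" by (rule image_subsetI) (simp add: zero_less_mult_iff)
  qed (intro continuous_intros)
  then have "(%s. indicator {1/2..2} s *\<^sub>R phi (2 powr real_of_int k * s)) \<in> borel_measurable borel"
    by (intro borel_measurable_continuous_on_indicator) auto
  moreover have "freq_phase phi k = (%s. indicator {1/2..2} s *\<^sub>R phi (2 powr real_of_int k * s))"
    by (auto simp: freq_phase_def indicator_def)
  ultimately show ?thesis by simp
qed

text \<open>The power of \<open>s\<close> is the polar Jacobian. As \<open>psi\<close> is even, the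
  indicator also removes the negative copy of the frequency band.\<close>

definition freq_amp :: "(real => real) => nat => int => (real => complex) => real => complex" where
  "freq_amp Phi m k G s = of_real (indicator {1/2..2} s * (psi Phi s * s ^ (m + 1))) * G (2 powr real_of_int k * s)"

lemma freq_amp_measurable:
  assumes "cutoff Phi" and [measurable]: "G \<in> borel_measurable borel"
  shows "freq_amp Phi m k G \<in> borel_measurable borel"
proof -
  note [measurable] = psi_measurable[OF assms(1)]
  have "(%s. freq_amp Phi m k G s) \<in> borel_measurable borel" unfolding freq_amp_def by measurable
  then show ?thesis .
qed

text \<open>Outside the band \<open>psi\<close> vanishes, so replacing \<open>phi\<close> by its
  truncation does not change the product. This covers frequency 0, where nothing is known about
  \<open>phi\<close>.\<close>

lemma psi_freq_eq:
  fixes k :: int and \<rho> :: real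
  assumes Phi: "cutoff Phi" and "0 <= \<rho>"
  shows "cis (t * phi \<rho>) * complex_of_real (psi Phi (2 powr (- real_of_int k) * \<rho>))
    = cis (t * freq_phase phi k (2 powr (- real_of_int k) * \<rho>)) * of_real (psi Phi (2 powr (- real_of_int k) * \<rho>))"
proof (cases "2 powr (- real_of_int k) * \<rho> \<in> {1/2..2}")
  case True
  have "2 powr real_of_int k * (2 powr (- real_of_int k) * \<rho>) = \<rho>" by (simp add: mult.assoc[symmetric] powr_add[symmetric])
  moreover have "freq_phase phi k (2 powr (- real_of_int k) * \<rho>) = phi (2 powr real_of_int k * (2 powr (- real_of_int k) * \<rho>))"
    using True by (simp only: freq_phase_def if_True)
  ultimately show ?thesis by (simp only:)
next
  case False
  then have "\<bar>2 powr (- real_of_int k) * \<rho>\<bar> < 1/2 \<or> 2 < \<bar>2 powr (- real_of_int k) * \<rho>\<bar>" using assms by auto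
  then show ?thesis using psi_bounds(3)[OF Phi] by simp
qed

lemma sol_integrand_integrable:
  fixes g :: "'a::euclidean_space => complex"
  assumes Phi: "cutoff Phi" and phi: "smooth_real_on {0<..} phi" and g: "L2 g"
  shows "(%\<xi>. exp (\<i> * complex_of_real (x \<bullet> \<xi> + t * phi (norm \<xi>))) * complex_of_real (psi Phi (2 powr (- real_of_int k) * norm \<xi>)) * g \<xi>)
     = (%\<xi>. cis (x \<bullet> \<xi>) * (cis (t * freq_phase phi k (2 powr (- real_of_int k) * norm \<xi>)) * of_real (psi Phi (2 powr (- real_of_int k) * norm \<xi>)) * g \<xi>))"
    and "integrable lborel (%\<xi>. cis (t * freq_phase phi k (2 powr (- real_of_int k) * norm \<xi>)) * of_real (psi Phi (2 powr (- real_of_int k) * norm \<xi>)) * g \<xi>)"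
    and "integrable lborel (%\<xi>. exp (\<i> * complex_of_real (x \<bullet> \<xi> + t * phi (norm \<xi>))) * complex_of_real (psi Phi (2 powr (- real_of_int k) * norm \<xi>)) * g \<xi>)"
proof -
  have gm[measurable]: "g \<in> borel_measurable borel" and g2: "integrable lborel (%x. (norm (g x))\<^sup>2)" using g by (auto simp: L2_def)
  note [measurable] = psi_measurable[OF Phi] freq_phase_measurable[OF phi]
  show eq: "(%\<xi>. exp (\<i> * complex_of_real (x \<bullet> \<xi> + t * phi (norm \<xi>))) * complex_of_real (psi Phi (2 powr (- real_of_int k) * norm \<xi>)) * g \<xi>)
     = (%\<xi>. cis (x \<bullet> \<xi>) * (cis (t * freq_phase phi k (2 powr (- real_of_int k) * norm \<xi>)) * of_real (psi Phi (2 powr (- real_of_int k) * norm \<xi>)) * g \<xi>))"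
  proof
    fix \<xi> :: 'a
    have "exp (\<i> * complex_of_real (x \<bullet> \<xi> + t * phi (norm \<xi>))) = cis (x \<bullet> \<xi>) * cis (t * phi (norm \<xi>))"
      unfolding cis_mult by (simp only: cis_conv_exp)
    moreover note arg_cong[OF psi_freq_eq[OF Phi norm_ge_zero[of \<xi>], of t phi k], of "%z. cis (x \<bullet> \<xi>) * (z * g \<xi>)"]
    ultimately show "exp (\<i> * complex_of_real (x \<bullet> \<xi> + t * phi (norm \<xi>))) * complex_of_real (psi Phi (2 powr (- real_of_int k) * norm \<xi>)) * g \<xi>
      = cis (x \<bullet> \<xi>) * (cis (t * freq_phase phi k (2 powr (- real_of_int k) * norm \<xi>)) * of_real (psi Phi (2 powr (- real_of_int k) * norm \<xi>)) * g \<xi>)"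
      by (simp only: mult.assoc)
  qed
  define w where "w s = cis (t * freq_phase phi k s) * of_real (psi Phi s)" for s
  have [measurable]: "w \<in> borel_measurable borel" unfolding w_def[abs_def] by measurable
  have "(%\<xi>::'a. w (2 powr (- real_of_int k) * norm \<xi>) * g \<xi>) \<in> borel_measurable borel" by measurable
  then have vm: "(%\<xi>. cis (t * freq_phase phi k (2 powr (- real_of_int k) * norm \<xi>)) * of_real (psi Phi (2 powr (- real_of_int k) * norm \<xi>)) * g \<xi>) \<in> borel_measurable borel"
    by (simp only: w_def)
  show i: "integrable lborel (%\<xi>. cis (t * freq_phase phi k (2 powr (- real_of_int k) * norm \<xi>)) * of_real (psi Phi (2 powr (- real_of_int k) * norm \<xi>)) * g \<xi>)"
  proof (rule integrable_on_ball_of_square[OF gm g2 vm, of 1 "2 * 2 powr real_of_int k"])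
    fix \<xi> :: 'a
    show "norm (cis (t * freq_phase phi k (2 powr (- real_of_int k) * norm \<xi>)) * of_real (psi Phi (2 powr (- real_of_int k) * norm \<xi>)) * g \<xi>) <= 1 * norm (g \<xi>)"
      using psi_bounds[OF Phi, of "2 powr (- real_of_int k) * norm \<xi>"] by (simp add: norm_mult mult_left_le_one_le)
    assume "2 * 2 powr real_of_int k < norm \<xi>"
    then have "2 powr (- real_of_int k) * (2 * 2 powr real_of_int k) < 2 powr (- real_of_int k) * norm \<xi>" by (intro mult_strict_left_mono) auto
    moreover have "2 powr (- real_of_int k) * (2 * 2 powr real_of_int k) = 2" by (simp add: powr_minus)
    ultimately have "psi Phi (2 powr (- real_of_int k) * norm \<xi>) = 0" by (intro psi_bounds(3)[OF Phi]) auto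
    then show "cis (t * freq_phase phi k (2 powr (- real_of_int k) * norm \<xi>)) * of_real (psi Phi (2 powr (- real_of_int k) * norm \<xi>)) * g \<xi> = 0" by simp
  qed simp
  show "integrable lborel (%\<xi>. exp (\<i> * complex_of_real (x \<bullet> \<xi> + t * phi (norm \<xi>))) * complex_of_real (psi Phi (2 powr (- real_of_int k) * norm \<xi>)) * g \<xi>)"
    unfolding eq
  proof (rule Bochner_Integration.integrable_bound[OF i])
    have "(%\<xi>. cis (x \<bullet> \<xi>)) \<in> borel_measurable borel" by measurable
    from borel_measurable_times[OF this vm]
    show "(%\<xi>. cis (x \<bullet> \<xi>) * (cis (t * freq_phase phi k (2 powr (- real_of_int k) * norm \<xi>)) * of_real (psi Phi (2 powr (- real_of_int k) * norm \<xi>)) * g \<xi>)) \<in> borel_measurable lborel"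
      by simp
  qed (simp add: norm_mult)
qed

text \<open>In polar coordinates, and after rescaling to unit frequency, the solution is an oscillatory
  integral over \<open>[1/2, 2]\<close>.\<close>
lemma sol_polar:
  fixes g :: "real^'n => complex"
  assumes dim: "CARD('n) = m + 2" and Phi: "cutoff Phi" and phi: "smooth_real_on {0<..} phi" and g: "L2 g"
    and gG: "\<And>\<xi>. g \<xi> = G (norm \<xi>)" and Gm[measurable]: "G \<in> borel_measurable borel"
  shows "sol Phi phi k g t x = of_real ((2 * pi) powr (- real (m + 2)) * polar_const m * (2 powr real_of_int k) ^ (m + 2))
     * osc m (freq_phase phi k) (freq_amp Phi m k G) t (2 powr real_of_int k * norm x)"
proof -
  note [measurable] = psi_measurable[OF Phi] freq_phase_measurable[OF phi]
  define kp where "kp = 2 powr real_of_int k"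
  have kp: "0 < kp" by (simp add: kp_def)
  have kp': "2 powr (- real_of_int k) = 1 / kp" by (simp add: kp_def powr_minus divide_inverse)
  define f where "f \<rho> = cis (t * freq_phase phi k (1 / kp * \<rho>)) * of_real (psi Phi (1 / kp * \<rho>)) * G \<rho>" for \<rho>
  have fm[measurable]: "f \<in> borel_measurable borel" unfolding f_def by measurable
  have fi: "integrable lborel (%\<xi>::real^'n. f (norm \<xi>))"
    using sol_integrand_integrable(2)[OF Phi phi g, of t k] unfolding gG kp' f_def .
  have "sol Phi phi k g t x = of_real ((2 * pi) powr (- real (m + 2))) * (LBINT \<xi>. cis (x \<bullet> \<xi>) * f (norm \<xi>))"
    unfolding sol_def sol_integrand_integrable(1)[OF Phi phi g] unfolding gG kp' f_def using dim by simp
  also have "(LBINT \<xi>. cis (x \<bullet> \<xi>) * f (norm \<xi>)) = of_real (polar_const m) * (LBINT s. f s * of_real (s ^ (m + 1) * Jm m (s * norm x)) * indicator {0..} s)"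
    by (rule polar_fourier(2)[OF dim fm fi])
  also have "(LBINT s. f s * of_real (s ^ (m + 1) * Jm m (s * norm x)) * indicator {0..} s)
    = kp *\<^sub>R (LBINT s. f (0 + kp * s) * of_real ((0 + kp * s) ^ (m + 1) * Jm m ((0 + kp * s) * norm x)) * indicator {0..} (0 + kp * s))"
    using lborel_integral_real_affine[of kp "%s. f s * of_real (s ^ (m + 1) * Jm m (s * norm x)) * indicator {0..} s" 0] kp by simp
  also have "(LBINT s. f (0 + kp * s) * of_real ((0 + kp * s) ^ (m + 1) * Jm m ((0 + kp * s) * norm x)) * indicator {0..} (0 + kp * s))
    = (LBINT s. of_real (kp ^ (m + 1)) * (cis (t * freq_phase phi k s) * (of_real (Jm m (kp * norm x * s)) * freq_amp Phi m k G s)))"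
  proof (rule Bochner_Integration.integral_cong[OF refl])
    fix s :: real
    show "f (0 + kp * s) * of_real ((0 + kp * s) ^ (m + 1) * Jm m ((0 + kp * s) * norm x)) * indicator {0..} (0 + kp * s)
      = of_real (kp ^ (m + 1)) * (cis (t * freq_phase phi k s) * (of_real (Jm m (kp * norm x * s)) * freq_amp Phi m k G s))"
    proof (cases "s \<in> {1/2..2}")
      case True
      have 1: "1 / kp * (0 + kp * s) = s" using kp by simp
      have 2: "(0 + kp * s) * norm x = kp * norm x * s" by simp
      have 3: "indicator {0..} (0 + kp * s) = (1::complex)" using True kp by simp
      have 4: "(0 + kp * s) ^ (m + 1) = kp ^ (m + 1) * s ^ (m + 1)" by (simp only: add_0 power_mult_distrib)
      have 5: "freq_amp Phi m k G s = of_real (psi Phi s) * of_real (s ^ (m + 1)) * G (0 + kp * s)"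
        using True by (simp add: freq_amp_def kp_def)
      show ?thesis unfolding f_def 1 2 3 4 5 of_real_mult by (simp only: mult_ac mult_1)
    next
      case False
      have "f (0 + kp * s) * indicator {0..} (0 + kp * s) = 0"
      proof (cases "0 <= s")
        case True
        then have "\<bar>s\<bar> < 1/2 \<or> 2 < \<bar>s\<bar>" using False by auto
        then have "psi Phi s = 0" by (rule psi_bounds(3)[OF Phi])
        then show ?thesis using kp by (simp add: f_def)
      qed (use kp in \<open>simp add: zero_le_mult_iff\<close>)
      moreover have "freq_amp Phi m k G s = 0" using False by (simp add: freq_amp_def)
      ultimately show ?thesis by auto
    qed
  qed
  also have "... = of_real (kp ^ (m + 1)) * osc m (freq_phase phi k) (freq_amp Phi m k G) t (kp * norm x)"
    unfolding osc_def by (rule integral_mult_right_zero)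
  finally show ?thesis unfolding kp_def[symmetric] by (simp add: scaleR_conv_of_real mult_ac)
qed

text \<open>The squared amplitude contains the Jacobian twice. One copy is at most
  \<open>2 ^ (m + 1)\<close>, the other turns the integral into the L^2 norm of \<open>g\<close> in
  polar coordinates. Rescaling to unit frequency gives the power -n/2 of 2^k.\<close>

lemma freq_amp_norm:
  fixes g :: "real^'n => complex"
  assumes dim: "CARD('n) = m + 2" and Phi: "cutoff Phi" and g: "L2 g"
    and gG: "\<And>\<xi>. g \<xi> = G (norm \<xi>)" and Gm[measurable]: "G \<in> borel_measurable borel"
  shows "integrable lborel (%s. (norm (freq_amp Phi m k G s))\<^sup>2)"
    and "sqrt (LBINT s. (norm (freq_amp Phi m k G s))\<^sup>2) <= sqrt (2 ^ (m + 1) / (polar_const m * Jm m 0)) * (2 powr real_of_int k) powr (- real (m + 2) / 2) * L2norm g"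
proof -
  note [measurable] = psi_measurable[OF Phi] freq_amp_measurable[OF Phi Gm]
  define kp where "kp = 2 powr real_of_int k"
  have kp: "0 < kp" by (simp add: kp_def)
  define P where "P = polar_const m * Jm m 0"
  have "0 < Jm m 0" by (rule Jm_pos) simp
  then have P: "0 < P" using polar_const_pos[of m] by (simp add: P_def)
  have g2: "integrable lborel (%x. (norm (g x))\<^sup>2)" using g by (simp add: L2_def)
  have Ln: "(L2norm g)\<^sup>2 = (LBINT x. (norm (g x))\<^sup>2)" by (simp add: L2norm_def integral_nonneg_AE)
  have L0: "0 <= L2norm g" by (simp add: L2norm_def integral_nonneg_AE)
  define T where "T = (NNINT s. ennreal ((norm (G s))\<^sup>2) * ennreal (s ^ (m + 1)) * indicator {0..} s)"
  have "ennreal ((L2norm g)\<^sup>2) = (NNINT (\<xi>::real^'n). ennreal ((norm (G (norm \<xi>)))\<^sup>2))"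
    unfolding Ln gG[symmetric] using g2 by (intro nn_integral_eq_integral[symmetric]) auto
  also have "... = ennreal P * T" unfolding T_def P_def by (rule polar_nn_integral[OF dim]) measurable
  finally have PT: "ennreal ((L2norm g)\<^sup>2) = ennreal P * T" .
  have T1: "T = ennreal ((L2norm g)\<^sup>2 / P)"
  proof -
    have "ennreal (1 / P) * (ennreal P * T) = T" using P by (simp add: mult.assoc[symmetric] ennreal_mult[symmetric])
    then show ?thesis unfolding PT[symmetric] using P by (simp add: ennreal_mult[symmetric])
  qed
  have sc: "T = ennreal (kp ^ (m + 2)) * (NNINT s. ennreal ((norm (G (kp * s)))\<^sup>2) * ennreal (s ^ (m + 1)) * indicator {0..} s)"
  proof -
    have "T = \<bar>kp\<bar> * (NNINT s. ennreal ((norm (G (0 + kp * s)))\<^sup>2) * ennreal ((0 + kp * s) ^ (m + 1)) * indicator {0..} (0 + kp * s))"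
      unfolding T_def using kp by (intro nn_integral_real_affine) auto
    also have "... = \<bar>kp\<bar> * (NNINT s. ennreal (kp ^ (m + 1)) * (ennreal ((norm (G (kp * s)))\<^sup>2) * ennreal (s ^ (m + 1)) * indicator {0..} s))"
    proof -
      have "ennreal ((norm (G (0 + kp * s)))\<^sup>2) * ennreal ((0 + kp * s) ^ (m + 1)) * indicator {0..} (0 + kp * s) = ennreal (kp ^ (m + 1)) * (ennreal ((norm (G (kp * s)))\<^sup>2) * ennreal (s ^ (m + 1)) * indicator {0..} s)" for s
      proof (cases "0 <= s")
        case True
        have "ennreal ((0 + kp * s) ^ (m + 1)) = ennreal (kp ^ (m + 1)) * ennreal (s ^ (m + 1))"
          using True kp by (simp only: add_0 power_mult_distrib) (rule ennreal_mult, auto)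
        then show ?thesis using True kp by (simp add: mult_ac)
      qed (use kp in \<open>simp add: zero_le_mult_iff\<close>)
      then show ?thesis by (simp only:)
    qed
    also have "... = ennreal kp * (ennreal (kp ^ (m + 1)) * (NNINT s. ennreal ((norm (G (kp * s)))\<^sup>2) * ennreal (s ^ (m + 1)) * indicator {0..} s))"
      using kp by (subst nn_integral_cmult) auto
    finally show ?thesis using kp by (simp add: mult.assoc[symmetric] ennreal_mult[symmetric])
  qed
  define T' where "T' = (NNINT s. ennreal ((norm (G (kp * s)))\<^sup>2) * ennreal (s ^ (m + 1)) * indicator {0..} s)"
  have T2: "T' = ennreal ((L2norm g)\<^sup>2 / P / kp ^ (m + 2))"
  proof -
    have "ennreal (1 / kp ^ (m + 2)) * (ennreal (kp ^ (m + 2)) * T') = T'" using kp by (simp add: mult.assoc[symmetric] ennreal_mult[symmetric])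
    then show ?thesis unfolding T'_def sc[symmetric] unfolding T1 using P kp by (simp add: ennreal_mult[symmetric] mult_ac)
  qed
  define h where "h = freq_amp Phi m k G"
  have [measurable]: "h \<in> borel_measurable borel" unfolding h_def by measurable
  have "(NNINT s. ennreal ((norm (h s))\<^sup>2)) <= (NNINT s. ennreal (2 ^ (m + 1)) * (ennreal ((norm (G (kp * s)))\<^sup>2) * ennreal (s ^ (m + 1)) * indicator {0..} s))"
  proof (rule nn_integral_mono)
    fix s :: real
    show "ennreal ((norm (h s))\<^sup>2) <= ennreal (2 ^ (m + 1)) * (ennreal ((norm (G (kp * s)))\<^sup>2) * ennreal (s ^ (m + 1)) * indicator {0..} s)"
    proof (cases "s \<in> {1/2..2}")
      case True
      have p: "s ^ (m + 1) <= 2 ^ (m + 1)" using True by (intro power_mono) auto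
      have "(norm (h s))\<^sup>2 = (psi Phi s)\<^sup>2 * (s ^ (m + 1) * s ^ (m + 1)) * (norm (G (kp * s)))\<^sup>2"
        using True by (simp add: h_def freq_amp_def kp_def norm_mult power_mult_distrib power2_eq_square[of "s ^ _"] norm_power power2_eq_square)
      also have "... <= 1 * (2 ^ (m + 1) * s ^ (m + 1)) * (norm (G (kp * s)))\<^sup>2"
        using True psi_bounds[OF Phi, of s] p by (intro mult_mono power_le_one) auto
      finally have "ennreal ((norm (h s))\<^sup>2) <= ennreal (2 ^ (m + 1) * ((norm (G (kp * s)))\<^sup>2 * s ^ (m + 1)))" by (intro ennreal_leI) (simp add: mult_ac)
      also have "... = ennreal (2 ^ (m + 1)) * (ennreal ((norm (G (kp * s)))\<^sup>2) * ennreal (s ^ (m + 1)))" using True by (simp add: ennreal_mult)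
      finally show ?thesis using True by simp
    qed (simp add: h_def freq_amp_def)
  qed
  also have "... = ennreal (2 ^ (m + 1)) * T'" unfolding T'_def by (rule nn_integral_cmult) measurable
  also have "... = ennreal (2 ^ (m + 1) / P * ((L2norm g)\<^sup>2 / kp ^ (m + 2)))" unfolding T2 using P kp by (simp add: ennreal_mult[symmetric])
  finally have B: "(NNINT s. ennreal ((norm (h s))\<^sup>2)) <= ennreal (2 ^ (m + 1) / P * ((L2norm g)\<^sup>2 / kp ^ (m + 2)))" .
  have hi: "integrable lborel (%s. (norm (h s))\<^sup>2)"
    unfolding integrable_iff_bounded using B by (auto simp: order_le_less_trans)
  then show "integrable lborel (%s. (norm (freq_amp Phi m k G s))\<^sup>2)" by (simp add: h_def)
  have "ennreal (LBINT s. (norm (h s))\<^sup>2) <= ennreal (2 ^ (m + 1) / P * ((L2norm g)\<^sup>2 / kp ^ (m + 2)))"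
    using B hi by (subst nn_integral_eq_integral[symmetric]) auto
  then have "(LBINT s. (norm (h s))\<^sup>2) <= 2 ^ (m + 1) / P * ((L2norm g)\<^sup>2 / kp ^ (m + 2))"
    using P kp by (subst (asm) ennreal_le_iff) auto
  then have "sqrt (LBINT s. (norm (h s))\<^sup>2) <= sqrt (2 ^ (m + 1) / P * ((L2norm g)\<^sup>2 / kp ^ (m + 2)))" by (rule real_sqrt_le_mono)
  also have "... = sqrt (2 ^ (m + 1) / P) * (L2norm g / sqrt (kp ^ (m + 2)))"
    using L0 by (simp only: real_sqrt_mult real_sqrt_divide real_sqrt_abs abs_of_nonneg)
  also have "L2norm g / sqrt (kp ^ (m + 2)) = kp powr (- real (m + 2) / 2) * L2norm g"
  proof -
    have "sqrt (kp ^ (m + 2)) = (kp ^ (m + 2)) powr (1/2)" using kp by (intro powr_half_sqrt[symmetric]) simp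
    also have "... = (kp powr real (m + 2)) powr (1/2)" by (simp only: powr_realpow[OF kp])
    also have "... = kp powr (real (m + 2) / 2)" by (simp add: powr_powr)
    finally have 1: "sqrt (kp ^ (m + 2)) = kp powr (real (m + 2) / 2)" .
    have "kp powr (- real (m + 2) / 2) = kp powr (- (real (m + 2) / 2))" by (simp only: minus_divide_left)
    then show ?thesis unfolding 1 by (simp add: powr_minus_divide)
  qed
  finally show "sqrt (LBINT s. (norm (freq_amp Phi m k G s))\<^sup>2) <= sqrt (2 ^ (m + 1) / (polar_const m * Jm m 0)) * (2 powr real_of_int k) powr (- real (m + 2) / 2) * L2norm g"
    unfolding h_def P_def kp_def by (simp only: mult.assoc)
qed

text \<open>An equality, since it serves both the estimates and the counterexamples. Only space is
  rescaled, whence the factor \<open>1 / K\<close>; the time scale of the frequency stays in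
  \<open>freq_phase\<close> and is accounted for by its expansion constant.\<close>

lemma sol_Lq_eq:
  fixes g :: "real^'n => complex" and q :: real and k :: int
  assumes dim: "CARD('n) = m + 2" and Phi: "cutoff Phi" and phi: "smooth_real_on {0<..} phi" and g: "L2 g"
    and gG: "\<And>\<xi>. g \<xi> = G (norm \<xi>)" and Gm[measurable]: "G \<in> borel_measurable borel"
  defines "K \<equiv> (2 powr real_of_int k) ^ (m + 2)"
  shows "(\<integral>\<^sup>+z. ennreal (norm (sol Phi phi k g (fst z) (snd z)) powr q) \<partial>(lborel :: (real \<times> (real^'n)) measure))
    = ennreal (((2 * pi) powr (- real (m + 2)) * polar_const m * K) powr q) * (ennreal (1 / K)
      * (NNINT (y::real^'n). (NNINT t. ennreal (norm (osc m (freq_phase phi k) (freq_amp Phi m k G) t (norm y)) powr q))))"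
proof -
  define kp where "kp = 2 powr real_of_int k"
  have kp: "0 < kp" by (simp add: kp_def)
  define c where "c = (2 * pi) powr (- real (m + 2)) * polar_const m * kp ^ (m + 2)"
  have pc: "0 < polar_const m" by (rule polar_const_pos)
  have c: "0 <= c" using pc kp by (simp add: c_def)
  define W where "W t r = osc m (freq_phase phi k) (freq_amp Phi m k G) t r" for t r
  note [measurable] = freq_phase_measurable[OF phi, of k] freq_amp_measurable[OF Phi Gm, of m k]
  have Wm[measurable]: "(%z. W (fst z) (snd z)) \<in> borel_measurable (borel \<Otimes>\<^sub>M borel)"
    unfolding W_def by (rule osc_measurable) measurable
  define F where "F r = (NNINT t. ennreal (norm (W t r) powr q))" for r
  have "(%z. ennreal (norm (W (snd z) (fst z)) powr q)) \<in> borel_measurable (borel \<Otimes>\<^sub>M lborel)"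
  proof -
    have "(%z. (%z. W (fst z) (snd z)) (snd z, fst z)) \<in> borel_measurable (borel \<Otimes>\<^sub>M lborel)"
      by (rule measurable_compose[OF _ Wm]) measurable
    then show ?thesis by simp
  qed
  then have Fm[measurable]: "F \<in> borel_measurable borel" unfolding F_def
    by (intro lborel.borel_measurable_nn_integral[where f = "%r t. ennreal (norm (W t r) powr q)"]) (simp add: case_prod_beta')
  have solW: "norm (sol Phi phi k g t x) = c * norm (W t (kp * norm x))" for t and x :: "real^'n"
    unfolding sol_polar[OF dim Phi phi g gG Gm] W_def kp_def[symmetric] c_def[symmetric] norm_mult norm_of_real
    by (simp only: abs_of_nonneg[OF c])
  have m2: "(%(t, x). ennreal (norm (W t (kp * norm x)) powr q)) \<in> borel_measurable (lborel \<Otimes>\<^sub>M (lborel :: (real^'n) measure))"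
  proof -
    have "(%z::real \<times> (real^'n). (%z. W (fst z) (snd z)) (fst z, kp * norm (snd z))) \<in> borel_measurable (lborel \<Otimes>\<^sub>M lborel)"
      by (rule measurable_compose[OF _ Wm]) measurable
    then show ?thesis by (simp add: case_prod_beta')
  qed
  have "(\<integral>\<^sup>+z. ennreal (norm (sol Phi phi k g (fst z) (snd z)) powr q) \<partial>(lborel :: (real \<times> (real^'n)) measure))
    = (\<integral>\<^sup>+z. ennreal (c powr q) * (case z of (t, x) => ennreal (norm (W t (kp * norm x)) powr q)) \<partial>(lborel \<Otimes>\<^sub>M (lborel :: (real^'n) measure)))"
    unfolding lborel_prod
    by (rule nn_integral_cong) (use c in \<open>simp add: solW powr_mult ennreal_mult split_beta\<close>)
  also have "... = ennreal (c powr q) * (\<integral>\<^sup>+z. (case z of (t, x) => ennreal (norm (W t (kp * norm x)) powr q)) \<partial>(lborel \<Otimes>\<^sub>M (lborel :: (real^'n) measure)))"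
    by (rule nn_integral_cmult[OF m2])
  also have "(\<integral>\<^sup>+z. (case z of (t, x) => ennreal (norm (W t (kp * norm x)) powr q)) \<partial>(lborel \<Otimes>\<^sub>M (lborel :: (real^'n) measure)))
    = (NNINT (x::real^'n). (NNINT t. ennreal (norm (W t (kp * norm x)) powr q)))"
    by (subst lborel_pair.nn_integral_snd[symmetric, OF m2]) simp
  also have "... = (NNINT (x::real^'n). F (kp * norm x))" by (simp add: F_def)
  also have "... = ennreal (1 / kp ^ (m + 2)) * (NNINT (y::real^'n). F (norm y))"
  proof -
    have "(NNINT (y::real^'n). F (norm y)) = (\<integral>\<^sup>+(y::real^'n). F (norm y) \<partial>density (distr lborel borel (%x. 0 + kp *\<^sub>R x)) (%_. ennreal (\<bar>kp\<bar> ^ DIM(real^'n))))"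
      by (subst lborel_affine[of kp "0::real^'n"]) (use kp in simp_all)
    also have "... = (\<integral>\<^sup>+(y::real^'n). ennreal (kp ^ (m + 2)) * F (norm y) \<partial>distr lborel borel (%x. 0 + kp *\<^sub>R x))"
      using kp dim by (subst nn_integral_density) auto
    also have "... = (NNINT (x::real^'n). ennreal (kp ^ (m + 2)) * F (kp * norm x))"
      using kp by (subst nn_integral_distr) auto
    also have "... = ennreal (kp ^ (m + 2)) * (NNINT (x::real^'n). F (kp * norm x))"
      by (rule nn_integral_cmult) measurable
    finally show ?thesis using kp by (simp add: mult.assoc[symmetric] ennreal_mult[symmetric])
  qed
  finally show ?thesis unfolding c_def F_def W_def kp_def K_def .
qed

text \<open>The exponent of 2^k collects \<open>n\<close> from the inverse transform,
  \<open>- n / q\<close> from the rescaling of space and \<open>- n / 2\<close> from the L^2 norm of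
  the amplitude.\<close>

lemma sol_Lq_of_osc:
  fixes g :: "real^'n => complex" and q A :: real
  assumes dim: "CARD('n) = m + 2" and Phi: "cutoff Phi" and phi: "smooth_real_on {0<..} phi" and g: "L2 g"
    and gG: "\<And>\<xi>. g \<xi> = G (norm \<xi>)" and Gm[measurable]: "G \<in> borel_measurable borel"
    and q: "0 < q" and A: "0 <= A"
    and osc: "(NNINT (y::real^'n). (NNINT t. ennreal (norm (osc m (freq_phase phi k) (freq_amp Phi m k G) t (norm y)) powr q)))
      <= ennreal (A * (sqrt (LBINT s. (norm (freq_amp Phi m k G s))\<^sup>2)) powr q)"
  defines "Z \<equiv> (2 * pi) powr (- real (m + 2)) * polar_const m * sqrt (2 ^ (m + 1) / (polar_const m * Jm m 0))"
  shows "(\<integral>\<^sup>+z. ennreal (norm (sol Phi phi k g (fst z) (snd z)) powr q) \<partial>(lborel :: (real \<times> (real^'n)) measure))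
    <= ennreal ((Z * 2 powr ((real (m + 2) / 2 - real (m + 2) / q) * real_of_int k) * A powr (1 / q) * L2norm g) powr q)"
proof -
  define n where "n = real (m + 2)"
  define kp where "kp = 2 powr real_of_int k"
  have kp: "0 < kp" by (simp add: kp_def)
  define c where "c = (2 * pi) powr (- real (m + 2)) * polar_const m * kp ^ (m + 2)"
  note sol_Lq_eq[OF dim Phi phi g gG Gm, of k q, folded kp_def, folded c_def]
  also have "ennreal (c powr q) * (ennreal (1 / kp ^ (m + 2)) * (NNINT (y::real^'n). (NNINT t. ennreal (norm (osc m (freq_phase phi k) (freq_amp Phi m k G) t (norm y)) powr q))))
    <= ennreal (c powr q) * (ennreal (1 / kp ^ (m + 2)) * ennreal (A * (sqrt (LBINT s. (norm (freq_amp Phi m k G s))\<^sup>2)) powr q))"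
    using osc by (intro mult_left_mono) auto
  also have "... <= ennreal (c powr q) * (ennreal (1 / kp ^ (m + 2)) * ennreal (A * (sqrt (2 ^ (m + 1) / (polar_const m * Jm m 0)) * kp powr (- n / 2) * L2norm g) powr q))"
    using freq_amp_norm(2)[OF dim Phi g gG Gm, of k] A q kp
    unfolding n_def kp_def by (intro mult_left_mono ennreal_leI powr_mono2) (auto intro!: integral_nonneg_AE)
  also have "... = ennreal ((Z * 2 powr ((n / 2 - n / q) * real_of_int k) * A powr (1 / q) * L2norm g) powr q)"
  proof -
    have k1: "1 / kp ^ (m + 2) = (kp powr (- n / q)) powr q"
    proof -
      have "(kp powr (- n / q)) powr q = kp powr (- n)" using q by (simp add: powr_powr)
      also have "... = 1 / kp powr n" by (simp only: powr_minus inverse_eq_divide)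
      also have "kp powr n = kp ^ (m + 2)" using kp by (simp only: n_def powr_realpow)
      finally show ?thesis ..
    qed
    have k2: "c = (2 * pi) powr (- real (m + 2)) * polar_const m * kp powr n"
      using kp by (simp only: c_def n_def powr_realpow)
    have A1: "A = (A powr (1 / q)) powr q" using A q by (simp add: powr_powr)
    have k3: "kp powr n * kp powr (- n / q) * kp powr (- n / 2) = 2 powr ((n / 2 - n / q) * real_of_int k)"
      unfolding powr_add[symmetric] unfolding kp_def powr_powr by (intro arg_cong[of _ _ "(powr) 2"]) (simp add: algebra_simps)
    define S where "S = sqrt (2 ^ (m + 1) / (polar_const m * Jm m 0))"
    define E where "E = (2 * pi) powr (- real (m + 2)) * polar_const m"
    have "ennreal (c powr q) * (ennreal (1 / kp ^ (m + 2)) * ennreal (A * (S * kp powr (- n / 2) * L2norm g) powr q))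
      = ennreal (c powr q * ((kp powr (- n / q)) powr q * ((A powr (1 / q)) powr q * (S * kp powr (- n / 2) * L2norm g) powr q)))"
      unfolding k1 A1[symmetric] using A by (simp add: ennreal_mult)
    also have "... = ennreal ((c * (kp powr (- n / q) * (A powr (1 / q) * (S * kp powr (- n / 2) * L2norm g)))) powr q)"
      by (simp only: powr_mult)
    also have "c * (kp powr (- n / q) * (A powr (1 / q) * (S * kp powr (- n / 2) * L2norm g)))
       = E * S * (kp powr n * kp powr (- n / q) * kp powr (- n / 2)) * A powr (1 / q) * L2norm g"
      unfolding k2 E_def by (simp only: mult_ac)
    finally show ?thesis unfolding k3 unfolding E_def S_def Z_def .
  qed
  finally show ?thesis unfolding n_def .
qed

lemma sol_sup_of_osc:
  fixes g :: "real^'n => complex"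
  assumes dim: "CARD('n) = m + 2" and Phi: "cutoff Phi" and phi: "smooth_real_on {0<..} phi" and g: "L2 g"
    and gG: "\<And>\<xi>. g \<xi> = G (norm \<xi>)" and Gm[measurable]: "G \<in> borel_measurable borel" and A: "0 <= A"
    and osc: "\<And>t r. 0 <= r ==> norm (osc m (freq_phase phi k) (freq_amp Phi m k G) t r) <= A * sqrt (LBINT s. (norm (freq_amp Phi m k G s))\<^sup>2)"
  defines "Z \<equiv> (2 * pi) powr (- real (m + 2)) * polar_const m * sqrt (2 ^ (m + 1) / (polar_const m * Jm m 0))"
  shows "norm (sol Phi phi k g t x) <= Z * A * 2 powr (real (m + 2) / 2 * real_of_int k) * L2norm g"
proof -
  define n where "n = real (m + 2)"
  define kp where "kp = 2 powr real_of_int k"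
  have kp: "0 < kp" by (simp add: kp_def)
  define E where "E = (2 * pi) powr (- real (m + 2)) * polar_const m"
  define S where "S = sqrt (2 ^ (m + 1) / (polar_const m * Jm m 0))"
  have E: "0 <= E" using polar_const_pos[of m] by (simp add: E_def)
  have "norm (sol Phi phi k g t x) = E * kp powr n * norm (osc m (freq_phase phi k) (freq_amp Phi m k G) t (kp * norm x))"
  proof -
    have "0 <= E * kp powr n" using E by simp
    moreover have "kp ^ (m + 2) = kp powr n" using kp by (simp only: n_def powr_realpow)
    ultimately show ?thesis
      unfolding sol_polar[OF dim Phi phi g gG Gm] kp_def[symmetric] E_def[symmetric]
      by (simp only: norm_mult norm_of_real abs_of_nonneg)
  qed
  also have "... <= E * kp powr n * (A * (S * kp powr (- n / 2) * L2norm g))"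
  proof (rule mult_left_mono)
    have "A * sqrt (LBINT s. (norm (freq_amp Phi m k G s))\<^sup>2) <= A * (S * kp powr (- n / 2) * L2norm g)"
      using freq_amp_norm(2)[OF dim Phi g gG Gm, of k] A unfolding n_def kp_def S_def by (intro mult_left_mono)
    then show "norm (osc m (freq_phase phi k) (freq_amp Phi m k G) t (kp * norm x)) <= A * (S * kp powr (- n / 2) * L2norm g)"
      using osc[of "kp * norm x" t] kp by simp
  qed (use E in simp)
  also have "... = E * S * A * (kp powr n * kp powr (- n / 2)) * L2norm g" by (simp only: mult_ac)
  also have "kp powr n * kp powr (- n / 2) = 2 powr (n / 2 * real_of_int k)"
    unfolding powr_add[symmetric] unfolding kp_def powr_powr by (intro arg_cong[of _ _ "(powr) 2"]) (simp add: algebra_simps)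
  finally show ?thesis unfolding Z_def E_def S_def n_def .
qed

text \<open>Frequencies are confined to a ball, so by Cauchy-Schwarz L^2 convergence of the
  transforms implies convergence of the solutions at every point.\<close>

lemma sol_tendsto:
  fixes u g :: "'a::euclidean_space => complex"
  assumes Phi: "cutoff Phi" and phi: "smooth_real_on {0<..} phi" and u: "L2 u" and g: "is_L2_fourier u g"
  shows "(%j::nat. sol Phi phi k (fourier_L1 (%x. indicator (cball 0 (real j)) x * u x)) t x) \<longlonglongrightarrow> sol Phi phi k g t x"
proof -
  define F where "F R = fourier_L1 (%x. indicator (cball 0 R) x * u x)" for R
  have F: "L2 (F R)" "F R \<in> borel_measurable borel" for R unfolding F_def by (rule fourier_truncated[OF u])+
  have g2: "L2 g" using g by (simp add: is_L2_fourier_def)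
  then have [measurable]: "g \<in> borel_measurable borel" by (simp add: L2_def)
  note [measurable] = F(2)
  define w where "w \<xi> = exp (\<i> * complex_of_real (x \<bullet> \<xi> + t * phi (norm \<xi>))) * complex_of_real (psi Phi (2 powr (- real_of_int k) * norm \<xi>))" for \<xi>
  define c where "c = (2 * pi) powr (- real DIM('a))"
  define B where "B = cball (0::'a) (2 * 2 powr real_of_int k)"
  have wi: "integrable lborel (%\<xi>. w \<xi> * h \<xi>)" if "L2 h" for h
    unfolding w_def by (rule sol_integrand_integrable(3)[OF Phi phi that])
  have wb: "norm (w \<xi>) <= indicator B \<xi>" for \<xi>
  proof (cases "\<xi> \<in> B")
    case True
    then show ?thesis using psi_bounds[OF Phi, of "2 powr (- real_of_int k) * norm \<xi>"]
      by (simp only: w_def norm_mult norm_exp_i_times) simp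
  next
    case False
    then have "2 * 2 powr real_of_int k < norm \<xi>" by (simp add: B_def)
    then have "2 powr (- real_of_int k) * (2 * 2 powr real_of_int k) < 2 powr (- real_of_int k) * norm \<xi>" by (intro mult_strict_left_mono) auto
    moreover have "2 powr (- real_of_int k) * (2 * 2 powr real_of_int k) = 2" by (simp add: powr_minus)
    ultimately have "psi Phi (2 powr (- real_of_int k) * norm \<xi>) = 0" by (intro psi_bounds(3)[OF Phi]) auto
    then show ?thesis by (simp add: w_def)
  qed
  define e where "e R = (NNINT \<xi>. ennreal ((norm (g \<xi> - F R \<xi>))\<^sup>2))" for R
  have e0: "(%j. e (real j)) \<longlonglongrightarrow> 0"
    using g filterlim_compose[OF _ filterlim_real_sequentially, of e "nhds 0"]
    unfolding is_L2_fourier_def F_def[symmetric] e_def[symmetric] by simp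
  have bd: "ennreal ((norm (sol Phi phi k (F R) t x - sol Phi phi k g t x))\<^sup>2) <= ennreal (c\<^sup>2) * (emeasure lborel B * e R)" for R
  proof -
    have s: "sol Phi phi k h t x = of_real c * (LBINT \<xi>. w \<xi> * h \<xi>)" for h
      by (simp add: sol_def c_def w_def)
    have "sol Phi phi k (F R) t x - sol Phi phi k g t x = of_real c * (LBINT \<xi>. w \<xi> * F R \<xi> - w \<xi> * g \<xi>)"
      unfolding s by (simp add: Bochner_Integration.integral_diff[OF wi[OF F(1)] wi[OF g2]] right_diff_distrib)
    then have n: "norm (sol Phi phi k (F R) t x - sol Phi phi k g t x) = c * norm (LBINT \<xi>. w \<xi> * F R \<xi> - w \<xi> * g \<xi>)"
      by (simp add: norm_mult c_def)
    have "ennreal (norm (LBINT \<xi>. w \<xi> * F R \<xi> - w \<xi> * g \<xi>)) <= (NNINT \<xi>. ennreal (norm (w \<xi> * F R \<xi> - w \<xi> * g \<xi>)))"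
      by (rule integral_norm_bound_ennreal) (intro Bochner_Integration.integrable_diff wi F g2)
    also have "... <= (NNINT \<xi>. indicator B \<xi> * ennreal (norm (g \<xi> - F R \<xi>)))"
    proof (rule nn_integral_mono)
      fix \<xi>
      have "norm (w \<xi> * F R \<xi> - w \<xi> * g \<xi>) = norm (w \<xi>) * norm (g \<xi> - F R \<xi>)"
        unfolding right_diff_distrib[symmetric] norm_mult by (simp add: norm_minus_commute)
      also have "... <= indicator B \<xi> * norm (g \<xi> - F R \<xi>)" by (rule mult_right_mono[OF wb]) simp
      finally have "ennreal (norm (w \<xi> * F R \<xi> - w \<xi> * g \<xi>)) <= ennreal (indicator B \<xi> * norm (g \<xi> - F R \<xi>))" by (rule ennreal_leI)
      then show "ennreal (norm (w \<xi> * F R \<xi> - w \<xi> * g \<xi>)) <= indicator B \<xi> * ennreal (norm (g \<xi> - F R \<xi>))"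
        by (simp add: ennreal_mult ennreal_indicator)
    qed
    finally have "(ennreal (norm (LBINT \<xi>. w \<xi> * F R \<xi> - w \<xi> * g \<xi>)))\<^sup>2 <= (NNINT \<xi>. indicator B \<xi> * ennreal (norm (g \<xi> - F R \<xi>)))\<^sup>2"
      by (intro power_mono) auto
    also have "... <= (NNINT \<xi>. (indicator B \<xi>)\<^sup>2) * (NNINT \<xi>. (ennreal (norm (g \<xi> - F R \<xi>)))\<^sup>2)"
      by (rule Cauchy_Schwarz_nn_integral) (auto simp: B_def intro!: borel_measurable_indicator)
    also have "... = emeasure lborel B * e R"
    proof -
      have "(indicator B \<xi> :: ennreal)\<^sup>2 = indicator B \<xi>" for \<xi> by (simp add: indicator_def)
      then show ?thesis by (simp add: e_def ennreal_power B_def)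
    qed
    finally have "ennreal ((norm (LBINT \<xi>. w \<xi> * F R \<xi> - w \<xi> * g \<xi>))\<^sup>2) <= emeasure lborel B * e R" by (simp add: ennreal_power)
    then have "ennreal (c\<^sup>2) * ennreal ((norm (LBINT \<xi>. w \<xi> * F R \<xi> - w \<xi> * g \<xi>))\<^sup>2) <= ennreal (c\<^sup>2) * (emeasure lborel B * e R)" by (rule mult_left_mono) simp
    then show ?thesis unfolding n power_mult_distrib by (simp add: ennreal_mult)
  qed
  have "(%j. ennreal (c\<^sup>2) * (emeasure lborel B * e (real j))) \<longlonglongrightarrow> ennreal (c\<^sup>2) * (emeasure lborel B * 0)"
    using emeasure_bounded_finite[of B] e0 by (intro tendsto_intros) (auto simp: B_def)
  then have up: "(%j. ennreal (c\<^sup>2) * (emeasure lborel B * e (real j))) \<longlonglongrightarrow> 0" by simp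
  have "(%j. ennreal ((norm (sol Phi phi k (F (real j)) t x - sol Phi phi k g t x))\<^sup>2)) \<longlonglongrightarrow> 0"
    by (rule tendsto_sandwich[OF _ _ tendsto_const up]) (auto intro!: always_eventually bd)
  then have "(%j. (norm (sol Phi phi k (F (real j)) t x - sol Phi phi k g t x))\<^sup>2) \<longlonglongrightarrow> 0"
    using tendsto_ennrealD[of "%j. (norm (sol Phi phi k (F (real j)) t x - sol Phi phi k g t x))\<^sup>2" 0 sequentially] by simp
  then have "(%j. sqrt ((norm (sol Phi phi k (F (real j)) t x - sol Phi phi k g t x))\<^sup>2)) \<longlonglongrightarrow> sqrt 0" by (rule tendsto_real_sqrt)
  then have "(%j. sol Phi phi k (F (real j)) t x - sol Phi phi k g t x) \<longlonglongrightarrow> 0" by (simp add: tendsto_norm_zero_iff)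
  then show ?thesis unfolding F_def by (simp add: LIM_zero_iff)
qed

section \<open>Bounds for the phase and the Strichartz estimates\<close>

text \<open>The hypotheses on the phase change at \<open>r = 1\<close>, but \<open>sel\<close>
  changes at \<open>k = 0\<close>, and \<open>r = 2 powr real_of_int k * s\<close> may lie on the
  other side. This is harmless: \<open>k = -1\<close> with \<open>1 <= r\<close> forces
  \<open>r = 1\<close>, whose powers are 1, and \<open>k = 0\<close> with \<open>r < 1\<close> makes
  the exponent \<open>real_of_int k * sel k e1 e2\<close> vanish. The loss \<open>B\<close> covers
  the factor \<open>s\<close>.\<close>

lemma dyadic_power:
  fixes e1 e2 s :: real and k :: int
  assumes s: "s \<in> {1/2..2}"
  defines "r \<equiv> 2 powr real_of_int k * s" and "B \<equiv> 2 powr (\<bar>e1\<bar> + \<bar>e2\<bar>)"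
  shows "1 <= r ==> 2 powr (real_of_int k * sel k e1 e2) / B <= r powr e1"
    and "1 <= r ==> r powr e1 <= B * 2 powr (real_of_int k * sel k e1 e2)"
    and "r < 1 ==> 2 powr (real_of_int k * sel k e1 e2) / B <= r powr e2"
    and "r < 1 ==> r powr e2 <= B * 2 powr (real_of_int k * sel k e1 e2)"
proof -
  have s1: "\<bar>log 2 s\<bar> <= 1"
  proof -
    have "log 2 s <= log 2 2" using s by (intro log_mono) auto
    moreover have "log 2 (1/2) <= log 2 s" using s by (intro log_mono) auto
    moreover have "log 2 (1/2 :: real) = -1" by (simp add: log_divide)
    ultimately show ?thesis by simp
  qed
  have rp: "r powr e = 2 powr (real_of_int k * e + log 2 s * e)" for e
  proof -
    have "r = 2 powr (real_of_int k + log 2 s)" using s by (simp add: r_def powr_add)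
    then show ?thesis by (simp add: powr_powr distrib_right)
  qed
  have l: "\<bar>log 2 s * e\<bar> <= \<bar>e\<bar>" for e using mult_right_mono[OF s1, of "\<bar>e\<bar>"] by (simp add: abs_mult)
  have k1: "- 1 <= k" if "1 <= r"
  proof (rule ccontr)
    assume "\<not> - 1 <= k"
    then have "2 powr real_of_int k <= 2 powr (-2)" by (intro powr_mono) auto
    then have "r <= 2 powr (-2) * 2" unfolding r_def using s by (intro mult_mono) auto
    then show False using that by (simp add: powr_minus)
  qed
  have k0: "k <= 0" if "r < 1"
  proof (rule ccontr)
    assume "\<not> k <= 0"
    then have "2 powr 1 <= 2 powr real_of_int k" by (intro powr_mono) auto
    then have "2 powr 1 * (1/2) <= r" unfolding r_def using s by (intro mult_mono) auto
    then show False using that by simp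
  qed
  have r1: "k = -1 ==> 1 <= r ==> r powr e1 = 1"
    using s by (simp add: r_def powr_minus)
  have B: "2 powr x / B <= 2 powr y" "2 powr y <= B * 2 powr x" if "\<bar>x - y\<bar> <= \<bar>e1\<bar> + \<bar>e2\<bar>" for x y
  proof -
    have "2 powr x / B = 2 powr (x - (\<bar>e1\<bar> + \<bar>e2\<bar>))" by (simp add: B_def powr_diff)
    also have "... <= 2 powr y" using that by (intro powr_mono) auto
    finally show "2 powr x / B <= 2 powr y" .
    have "2 powr y <= 2 powr (\<bar>e1\<bar> + \<bar>e2\<bar> + x)" using that by (intro powr_mono) auto
    then show "2 powr y <= B * 2 powr x" by (simp only: B_def powr_add)
  qed
  have d1: "\<bar>real_of_int k * sel k e1 e2 - (real_of_int k * e1 + log 2 s * e1)\<bar> <= \<bar>e1\<bar> + \<bar>e2\<bar>" if "0 <= k"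
    using l[of e1] that by (simp add: sel_def)
  have d2: "\<bar>real_of_int k * sel k e1 e2 - (real_of_int k * e2 + log 2 s * e2)\<bar> <= \<bar>e1\<bar> + \<bar>e2\<bar>" if "r < 1"
  proof (cases "k = 0")
    case True then show ?thesis using l[of e2] by simp
  next
    case False then show ?thesis using l[of e2] k0[OF that] by (simp add: sel_def)
  qed
  have d3: "\<bar>real_of_int k * sel k e1 e2 - 0\<bar> <= \<bar>e1\<bar> + \<bar>e2\<bar>" if "k = -1" using that by (simp add: sel_def)
  show "2 powr (real_of_int k * sel k e1 e2) / B <= r powr e1" if "1 <= r"
  proof (cases "0 <= k")
    case True show ?thesis unfolding rp by (rule B(1)[OF d1[OF True]])
  next
    case False
    then have k: "k = -1" using k1[OF that] by simp
    show ?thesis using B(1)[OF d3[OF k]] r1[OF k that] by simp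
  qed
  show "r powr e1 <= B * 2 powr (real_of_int k * sel k e1 e2)" if "1 <= r"
  proof (cases "0 <= k")
    case True show ?thesis unfolding rp by (rule B(2)[OF d1[OF True]])
  next
    case False
    then have k: "k = -1" using k1[OF that] by simp
    show ?thesis using B(2)[OF d3[OF k]] r1[OF k that] by simp
  qed
  show "2 powr (real_of_int k * sel k e1 e2) / B <= r powr e2" if "r < 1" unfolding rp by (rule B(1)[OF d2[OF that]])
  show "r powr e2 <= B * 2 powr (real_of_int k * sel k e1 e2)" if "r < 1" unfolding rp by (rule B(2)[OF d2[OF that]])
qed

lemma dyadic_lower:
  fixes f :: "real => real"
  assumes "0 < c1" "\<And>r. 1 <= r ==> c1 * r powr e1 <= \<bar>f r\<bar>"
    and "0 < c2" "\<And>r. 0 < r ==> r < 1 ==> c2 * r powr e2 <= \<bar>f r\<bar>"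
  shows "\<exists>c>0. \<forall>k s. s \<in> {1/2..2} --> c * 2 powr (real_of_int k * sel k e1 e2) <= \<bar>f (2 powr real_of_int k * s)\<bar>"
proof (intro exI[of _ "min c1 c2 / 2 powr (\<bar>e1\<bar> + \<bar>e2\<bar>)"] conjI allI impI)
  show "0 < min c1 c2 / 2 powr (\<bar>e1\<bar> + \<bar>e2\<bar>)" using assms by simp
  fix k :: int and s :: real assume s: "s \<in> {1/2..2}"
  define r where "r = 2 powr real_of_int k * s"
  have r: "0 < r" using s by (simp add: r_def)
  note d = dyadic_power[OF s, where k = k and ?e1.0 = e1 and ?e2.0 = e2, folded r_def]
  show "min c1 c2 / 2 powr (\<bar>e1\<bar> + \<bar>e2\<bar>) * 2 powr (real_of_int k * sel k e1 e2) <= \<bar>f (2 powr real_of_int k * s)\<bar>"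
  proof (cases "1 <= r")
    case True
    have "min c1 c2 * (2 powr (real_of_int k * sel k e1 e2) / 2 powr (\<bar>e1\<bar> + \<bar>e2\<bar>)) <= c1 * r powr e1"
      using d(1)[OF True] assms by (intro mult_mono) auto
    with assms(2)[OF True] show ?thesis by (simp add: r_def)
  next
    case False
    then have F: "r < 1" by simp
    have "min c1 c2 * (2 powr (real_of_int k * sel k e1 e2) / 2 powr (\<bar>e1\<bar> + \<bar>e2\<bar>)) <= c2 * r powr e2"
      using d(3)[OF F] assms by (intro mult_mono) auto
    with assms(4)[OF r F] show ?thesis by (simp add: r_def)
  qed
qed

lemma dyadic_upper:
  fixes f :: "real => real"
  assumes u1: "\<And>r. 1 <= r ==> \<bar>f r\<bar> <= C1 * r powr e1"
    and u2: "\<And>r. 0 < r ==> r < 1 ==> \<bar>f r\<bar> <= C2 * r powr e2"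
  shows "\<exists>C>0. \<forall>k s. s \<in> {1/2..2} --> \<bar>f (2 powr real_of_int k * s)\<bar> <= C * 2 powr (real_of_int k * sel k e1 e2)"
proof (intro exI[of _ "(\<bar>C1\<bar> + \<bar>C2\<bar> + 1) * 2 powr (\<bar>e1\<bar> + \<bar>e2\<bar>)"] conjI allI impI)
  show "0 < (\<bar>C1\<bar> + \<bar>C2\<bar> + 1) * 2 powr (\<bar>e1\<bar> + \<bar>e2\<bar>)" by simp
  fix k :: int and s :: real assume s: "s \<in> {1/2..2}"
  define r where "r = 2 powr real_of_int k * s"
  have r: "0 < r" using s by (simp add: r_def)
  note d = dyadic_power[OF s, where k = k and ?e1.0 = e1 and ?e2.0 = e2, folded r_def]
  show "\<bar>f (2 powr real_of_int k * s)\<bar> <= (\<bar>C1\<bar> + \<bar>C2\<bar> + 1) * 2 powr (\<bar>e1\<bar> + \<bar>e2\<bar>) * 2 powr (real_of_int k * sel k e1 e2)"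
  proof (cases "1 <= r")
    case True
    have "C1 * r powr e1 <= (\<bar>C1\<bar> + \<bar>C2\<bar> + 1) * (2 powr (\<bar>e1\<bar> + \<bar>e2\<bar>) * 2 powr (real_of_int k * sel k e1 e2))"
      using d(2)[OF True] by (intro mult_mono) auto
    with u1[OF True] show ?thesis by (simp add: r_def)
  next
    case False
    then have F: "r < 1" by simp
    have "C2 * r powr e2 <= (\<bar>C1\<bar> + \<bar>C2\<bar> + 1) * (2 powr (\<bar>e1\<bar> + \<bar>e2\<bar>) * 2 powr (real_of_int k * sel k e1 e2))"
      using d(4)[OF F] by (intro mult_mono) auto
    with u2[OF r F] show ?thesis by (simp add: r_def)
  qed
qed

lemma freq_phase_deriv:
  assumes phi: "smooth_real_on {0<..} phi" and s: "s \<in> {1/2..2}"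
  shows "(freq_phase phi k has_real_derivative 2 powr real_of_int k * deriv phi (2 powr real_of_int k * s)) (at s within {1/2..2})"
    and "((%s. 2 powr real_of_int k * deriv phi (2 powr real_of_int k * s)) has_real_derivative
      2 powr real_of_int k * (2 powr real_of_int k * deriv (deriv phi) (2 powr real_of_int k * s))) (at s within {1/2..2})"
    and "continuous_on {1/2..2} (%s. 2 powr real_of_int k * (2 powr real_of_int k * deriv (deriv phi) (2 powr real_of_int k * s)))"
proof -
  define kp where "kp = 2 powr real_of_int k"
  have kp: "0 < kp" by (simp add: kp_def)
  have d: "((%s. (deriv ^^ j) phi (kp * s)) has_real_derivative kp * (deriv ^^ Suc j) phi (kp * s)) (at s within {1/2..2})"
    if "s \<in> {1/2..2}" for s j
  proof -
    have "kp * s \<in> {0<..}" using that kp by simp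
    from smooth_real_on_differentiable[OF phi this, of j]
    have "((deriv ^^ j) phi has_real_derivative (deriv ^^ Suc j) phi (kp * s)) (at (kp * s))" .
    moreover have "((%s. kp * s) has_real_derivative kp) (at s within {1/2..2})" by (auto intro!: derivative_eq_intros)
    ultimately show ?thesis by (subst mult.commute) (rule DERIV_chain2)
  qed
  have "((%s. phi (kp * s)) has_real_derivative kp * deriv phi (kp * s)) (at s within {1/2..2})" using d[OF s, of 0] by simp
  then show "(freq_phase phi k has_real_derivative 2 powr real_of_int k * deriv phi (2 powr real_of_int k * s)) (at s within {1/2..2})"
    unfolding kp_def[symmetric]
    by (rule has_field_derivative_transform_within[where d = 1]) (use s in \<open>auto simp: freq_phase_def kp_def\<close>)
  have "((%s. kp * deriv phi (kp * s)) has_real_derivative kp * (kp * deriv (deriv phi) (kp * s))) (at s within {1/2..2})"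
    using DERIV_cmult[OF d[OF s, of 1], of kp] by simp
  then show "((%s. 2 powr real_of_int k * deriv phi (2 powr real_of_int k * s)) has_real_derivative
      2 powr real_of_int k * (2 powr real_of_int k * deriv (deriv phi) (2 powr real_of_int k * s))) (at s within {1/2..2})"
    unfolding kp_def .
  have "continuous_on {1/2..2} (%s. (deriv ^^ 2) phi (kp * s))" by (rule DERIV_continuous_on[OF d])
  then have "continuous_on {1/2..2} (%s. deriv (deriv phi) (kp * s))" by (simp add: numeral_2_eq_2)
  then show "continuous_on {1/2..2} (%s. 2 powr real_of_int k * (2 powr real_of_int k * deriv (deriv phi) (2 powr real_of_int k * s)))"
    unfolding kp_def by (intro continuous_on_mult continuous_on_const)
qed

text \<open>The chain rule multiplies each derivative by 2^k, which turns the exponents m - 1 and m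
  - 2 into m. The mean value theorem converts the lower bound on the first derivative into expansion
  of distances.\<close>

lemma freq_phase_bounds:
  assumes phi: "smooth_real_on {0<..} phi" and H1: "H1 phi m1" and H2: "H2 phi m2"
  shows "\<exists>c>0. \<forall>k. phase (freq_phase phi k) (c * 2 powr (real_of_int k * sel k m1 m2))"
    and "\<exists>C>0. \<forall>k s. s \<in> {1/2..2} --> \<bar>2 powr real_of_int k * deriv phi (2 powr real_of_int k * s)\<bar> <= C * 2 powr (real_of_int k * sel k m1 m2)
      \<and> \<bar>2 powr real_of_int k * (2 powr real_of_int k * deriv (deriv phi) (2 powr real_of_int k * s))\<bar> <= C * 2 powr (real_of_int k * sel k m1 m2)"
proof -
  have sel1: "2 powr real_of_int k * 2 powr (real_of_int k * sel k (a - 1) (b - 1)) = 2 powr (real_of_int k * sel k a b)" for k a b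
    unfolding powr_add[symmetric] by (simp add: sel_def algebra_simps)
  have sel2: "2 powr real_of_int k * (2 powr real_of_int k * 2 powr (real_of_int k * sel k (a - 2) (b - 2))) = 2 powr (real_of_int k * sel k a b)" for k a b
    unfolding powr_add[symmetric] by (simp add: sel_def algebra_simps)
  obtain c1 C1 where c1: "0 < c1" "\<And>r. 1 <= r ==> c1 * r powr (m1 - 1) <= \<bar>deriv phi r\<bar>" "\<And>r. 1 <= r ==> \<bar>deriv phi r\<bar> <= C1 * r powr (m1 - 1)"
    using H1 unfolding H1_def by blast
  obtain c2 C2 where c2: "0 < c2" "\<And>r. 0 < r ==> r < 1 ==> c2 * r powr (m2 - 1) <= \<bar>deriv phi r\<bar>" "\<And>r. 0 < r ==> r < 1 ==> \<bar>deriv phi r\<bar> <= C2 * r powr (m2 - 1)"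
    using H2 unfolding H2_def by blast
  have "\<exists>D. \<forall>r\<ge>1. \<bar>(deriv ^^ 2) phi r\<bar> <= D * r powr (m1 - real 2)" using H1 unfolding H1_def by (metis order_refl)
  then obtain D1 where D1: "\<And>r. 1 <= r ==> \<bar>deriv (deriv phi) r\<bar> <= D1 * r powr (m1 - 2)" by (auto simp: numeral_2_eq_2)
  have "\<exists>D. \<forall>r. 0 < r \<and> r < 1 --> \<bar>(deriv ^^ 2) phi r\<bar> <= D * r powr (m2 - real 2)" using H2 unfolding H2_def by (metis order_refl)
  then obtain D2 where D2: "\<And>r. 0 < r ==> r < 1 ==> \<bar>deriv (deriv phi) r\<bar> <= D2 * r powr (m2 - 2)" by (auto simp: numeral_2_eq_2)
  obtain c where c: "0 < c" "\<And>k s. s \<in> {1/2..2} ==> c * 2 powr (real_of_int k * sel k (m1 - 1) (m2 - 1)) <= \<bar>deriv phi (2 powr real_of_int k * s)\<bar>"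
    using dyadic_lower[OF c1(1,2) c2(1,2)] by blast
  obtain C where C: "0 < C" "\<And>k s. s \<in> {1/2..2} ==> \<bar>deriv phi (2 powr real_of_int k * s)\<bar> <= C * 2 powr (real_of_int k * sel k (m1 - 1) (m2 - 1))"
    using dyadic_upper[OF c1(3) c2(3)] by blast
  obtain D where D: "0 < D" "\<And>k s. s \<in> {1/2..2} ==> \<bar>deriv (deriv phi) (2 powr real_of_int k * s)\<bar> <= D * 2 powr (real_of_int k * sel k (m1 - 2) (m2 - 2))"
    using dyadic_upper[OF D1 D2] by blast
  show "\<exists>c>0. \<forall>k. phase (freq_phase phi k) (c * 2 powr (real_of_int k * sel k m1 m2))"
  proof (intro exI[of _ c] conjI allI c(1))
    fix k :: int
    define \<Phi>1 where "\<Phi>1 s = 2 powr real_of_int k * deriv phi (2 powr real_of_int k * s)" for s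
    note d = freq_phase_deriv(1)[OF phi, of _ k, folded \<Phi>1_def]
    have lo: "c * 2 powr (real_of_int k * sel k m1 m2) <= \<bar>\<Phi>1 s\<bar>" if "s \<in> {1/2..2}" for s
    proof -
      have "2 powr real_of_int k * (c * 2 powr (real_of_int k * sel k (m1 - 1) (m2 - 1))) <= 2 powr real_of_int k * \<bar>deriv phi (2 powr real_of_int k * s)\<bar>"
        by (rule mult_left_mono[OF c(2)[OF that]]) simp
      then show ?thesis unfolding \<Phi>1_def abs_mult by (simp add: sel1[of k m1 m2, symmetric] mult_ac)
    qed
    have mvt: "c * 2 powr (real_of_int k * sel k m1 m2) * \<bar>s - s'\<bar> <= \<bar>freq_phase phi k s - freq_phase phi k s'\<bar>"
      if "s \<in> {1/2..2}" "s' \<in> {1/2..2}" "s < s'" for s s'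
    proof -
      have "\<exists>z\<in>{s..s'}. freq_phase phi k s' - freq_phase phi k s = (%v. v * \<Phi>1 z) (s' - s)"
      proof (rule mvt_very_simple[where f = "freq_phase phi k" and f' = "%z v. v * \<Phi>1 z"])
        show "s <= s'" using that by simp
        fix z assume "s <= z" "z <= s'"
        then have "z \<in> {1/2..2}" "{s..s'} \<subseteq> {1/2..2}" using that by auto
        then have "(freq_phase phi k has_real_derivative \<Phi>1 z) (at z within {s..s'})" using d DERIV_subset by blast
        then show "(freq_phase phi k has_derivative (%v. v * \<Phi>1 z)) (at z within {s..s'})"
          by (simp add: has_field_derivative_def mult_commute_abs)
      qed
      then obtain z where z: "z \<in> {s..s'}" "freq_phase phi k s' - freq_phase phi k s = (s' - s) * \<Phi>1 z" by blast
      have "z \<in> {1/2..2}" using z(1) that by auto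
      then have "c * 2 powr (real_of_int k * sel k m1 m2) * \<bar>s - s'\<bar> <= \<bar>\<Phi>1 z\<bar> * \<bar>s - s'\<bar>" by (intro mult_right_mono lo) auto
      also have "... = \<bar>freq_phase phi k s' - freq_phase phi k s\<bar>" unfolding z(2) by (simp add: abs_mult abs_minus_commute)
      finally show ?thesis by (simp add: abs_minus_commute)
    qed
    show "phase (freq_phase phi k) (c * 2 powr (real_of_int k * sel k m1 m2))"
    proof
      show "freq_phase phi k \<in> borel_measurable borel" by (rule freq_phase_measurable[OF phi])
      show "0 < c * 2 powr (real_of_int k * sel k m1 m2)" using c(1) by simp
      show "c * 2 powr (real_of_int k * sel k m1 m2) * \<bar>s - s'\<bar> <= \<bar>freq_phase phi k s - freq_phase phi k s'\<bar>"
        if "s \<in> {1/2..2}" "s' \<in> {1/2..2}" for s s'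
        using mvt[of s s'] mvt[of s' s] that by (cases s s' rule: linorder_cases) (auto simp: abs_minus_commute)
    qed
  qed
  show "\<exists>C>0. \<forall>k s. s \<in> {1/2..2} --> \<bar>2 powr real_of_int k * deriv phi (2 powr real_of_int k * s)\<bar> <= C * 2 powr (real_of_int k * sel k m1 m2)
      \<and> \<bar>2 powr real_of_int k * (2 powr real_of_int k * deriv (deriv phi) (2 powr real_of_int k * s))\<bar> <= C * 2 powr (real_of_int k * sel k m1 m2)"
  proof (intro exI[of _ "C + D"] conjI allI impI)
    show "0 < C + D" using C(1) D(1) by simp
    fix k :: int and s :: real assume s: "s \<in> {1/2..2}"
    have "\<bar>2 powr real_of_int k * deriv phi (2 powr real_of_int k * s)\<bar> = 2 powr real_of_int k * \<bar>deriv phi (2 powr real_of_int k * s)\<bar>" by (simp add: abs_mult)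
    also have "... <= 2 powr real_of_int k * (C * 2 powr (real_of_int k * sel k (m1 - 1) (m2 - 1)))" by (rule mult_left_mono[OF C(2)[OF s]]) simp
    also have "... = C * 2 powr (real_of_int k * sel k m1 m2)" by (simp add: sel1[of k m1 m2, symmetric] mult_ac)
    also have "... <= (C + D) * 2 powr (real_of_int k * sel k m1 m2)" using D(1) by (intro mult_right_mono) auto
    finally show "\<bar>2 powr real_of_int k * deriv phi (2 powr real_of_int k * s)\<bar> <= (C + D) * 2 powr (real_of_int k * sel k m1 m2)" .
    have "\<bar>2 powr real_of_int k * (2 powr real_of_int k * deriv (deriv phi) (2 powr real_of_int k * s))\<bar> = 2 powr real_of_int k * (2 powr real_of_int k * \<bar>deriv (deriv phi) (2 powr real_of_int k * s)\<bar>)" by (simp add: abs_mult)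
    also have "... <= 2 powr real_of_int k * (2 powr real_of_int k * (D * 2 powr (real_of_int k * sel k (m1 - 2) (m2 - 2))))" by (intro mult_left_mono D(2)[OF s]) auto
    also have "... = D * 2 powr (real_of_int k * sel k m1 m2)" by (simp add: sel2[of k m1 m2, symmetric] mult_ac)
    also have "... <= (C + D) * 2 powr (real_of_int k * sel k m1 m2)" using C(1) by (intro mult_right_mono) auto
    finally show "\<bar>2 powr real_of_int k * (2 powr real_of_int k * deriv (deriv phi) (2 powr real_of_int k * s))\<bar> <= (C + D) * 2 powr (real_of_int k * sel k m1 m2)" .
  qed
qed

lemma freq_phase_curvature:
  assumes H3: "H3 phi a1" and H4: "H4 phi a2"
  shows "\<exists>c>0. \<forall>k s. s \<in> {1/2..2} --> c * 2 powr (real_of_int k * sel k a1 a2) <= \<bar>2 powr real_of_int k * (2 powr real_of_int k * deriv (deriv phi) (2 powr real_of_int k * s))\<bar>"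
proof -
  have sel2: "2 powr real_of_int k * (2 powr real_of_int k * 2 powr (real_of_int k * sel k (a - 2) (b - 2))) = 2 powr (real_of_int k * sel k a b)" for k a b
    unfolding powr_add[symmetric] by (simp add: sel_def algebra_simps)
  obtain c1 where c1: "0 < c1" "\<And>r. 1 <= r ==> c1 * r powr (a1 - 2) <= \<bar>deriv (deriv phi) r\<bar>" using H3 unfolding H3_def by blast
  obtain c2 where c2: "0 < c2" "\<And>r. 0 < r ==> r < 1 ==> c2 * r powr (a2 - 2) <= \<bar>deriv (deriv phi) r\<bar>" using H4 unfolding H4_def by blast
  obtain c where c: "0 < c" "\<And>k s. s \<in> {1/2..2} ==> c * 2 powr (real_of_int k * sel k (a1 - 2) (a2 - 2)) <= \<bar>deriv (deriv phi) (2 powr real_of_int k * s)\<bar>"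
    using dyadic_lower[OF c1 c2] by blast
  show ?thesis
  proof (intro exI[of _ c] conjI allI impI c(1))
    fix k :: int and s :: real assume s: "s \<in> {1/2..2}"
    have "c * 2 powr (real_of_int k * sel k a1 a2) = 2 powr real_of_int k * (2 powr real_of_int k * (c * 2 powr (real_of_int k * sel k (a1 - 2) (a2 - 2))))"
      by (simp add: sel2[of k a1 a2, symmetric] mult_ac)
    also have "... <= 2 powr real_of_int k * (2 powr real_of_int k * \<bar>deriv (deriv phi) (2 powr real_of_int k * s)\<bar>)" by (intro mult_left_mono c(2)[OF s]) auto
    finally show "c * 2 powr (real_of_int k * sel k a1 a2) <= \<bar>2 powr real_of_int k * (2 powr real_of_int k * deriv (deriv phi) (2 powr real_of_int k * s))\<bar>"
      by (simp add: abs_mult)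
  qed
qed

text \<open>A transform given by an integral is radial at every point. Its profile is read off along
  the line of a unit vector, which also yields measurability.\<close>

lemma truncated_fourier_radial:
  fixes u :: "real^'n => complex" and R :: real
  assumes u: "L2 u" and r: "radial u"
  defines "F \<equiv> fourier_L1 (%x. indicator (cball 0 R) x * u x)"
  obtains G where "G \<in> borel_measurable borel" "\<And>\<xi>. F \<xi> = G (norm \<xi>)"
proof -
  obtain b :: "real^'n" where b: "norm b = 1" using vector_choose_size[of 1] by auto
  have [measurable]: "u \<in> borel_measurable borel" using u by (simp add: L2_def)
  have Fm[measurable]: "F \<in> borel_measurable borel" unfolding F_def by (rule fourier_truncated(1)[OF u])
  have "radial F" unfolding F_def
  proof (rule fourier_radial)
    show "radial (%x. indicator (cball 0 R) x * u x)"
      unfolding radial_def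
    proof (intro allI impI)
      fix x y :: "real^'n" assume n: "norm x = norm y"
      then have "u x = u y" using r unfolding radial_def by blast
      with n show "indicator (cball 0 R) x * u x = indicator (cball 0 R) y * u y" by (simp add: indicator_def)
    qed
    have "(indicator (cball 0 R) :: real^'n => complex) \<in> borel_measurable borel" by (intro borel_measurable_indicator) auto
    then show "(%x. indicator (cball 0 R) x * u x) \<in> borel_measurable borel" by (intro borel_measurable_times) auto
  qed
  have "F \<xi> = F (norm \<xi> *\<^sub>R b)" for \<xi>
  proof -
    have "norm \<xi> = norm (norm \<xi> *\<^sub>R b)" using b by simp
    with \<open>radial F\<close> show ?thesis unfolding radial_def by blast
  qed
  moreover have "(%\<rho>. F (\<rho> *\<^sub>R b)) \<in> borel_measurable borel" by measurable
  ultimately show thesis by (intro that[of "%\<rho>. F (\<rho> *\<^sub>R b)"])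
qed

section \<open>From profiles of radial transforms to arbitrary representatives\<close>

lemma sol_measurable:
  fixes g :: "real^'n => complex"
  assumes dim: "CARD('n) = m + 2" and Phi: "cutoff Phi" and phi: "smooth_real_on {0<..} phi" and g: "L2 g"
    and gG: "\<And>\<xi>. g \<xi> = G (norm \<xi>)" and Gm: "G \<in> borel_measurable borel"
  shows "(%z. sol Phi phi k g (fst z) (snd z)) \<in> borel_measurable (borel :: (real \<times> (real^'n)) measure)"
proof -
  note m = osc_measurable[OF freq_phase_measurable[OF phi, of k] freq_amp_measurable[OF Phi Gm, of m k], of m]
  have "(%z::real \<times> (real^'n). (fst z, 2 powr real_of_int k * norm (snd z))) \<in> borel \<Otimes>\<^sub>M borel \<rightarrow>\<^sub>M borel \<Otimes>\<^sub>M borel" by measurable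
  from measurable_compose[OF this m]
  have "(%z::real \<times> (real^'n). osc m (freq_phase phi k) (freq_amp Phi m k G) (fst z) (2 powr real_of_int k * norm (snd z))) \<in> borel_measurable borel"
    unfolding borel_prod by simp
  then show ?thesis unfolding sol_polar[OF dim Phi phi g gG Gm] by (intro borel_measurable_times borel_measurable_const)
qed

text \<open>Fatou's lemma along the truncations of \<open>u\<close>. Only transforms that are radial
  at every point have to be estimated, while \<open>g\<close> may be any representative. The factor
  \<open>sqrt ((2 * pi) ^ (m + 2))\<close> is that of Plancherel's theorem.\<close>

lemma Lq_bound_of_radial:
  fixes u g :: "real^'n => complex" and q C :: real
  assumes dim: "CARD('n) = m + 2" and Phi: "cutoff Phi" and phi: "smooth_real_on {0<..} phi"
    and u: "L2 u" "radial u" and g: "is_L2_fourier u g" and q: "0 < q" and C: "0 <= C"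
    and bd: "\<And>h H. L2 h ==> (\<And>\<xi>::real^'n. h \<xi> = H (norm \<xi>)) ==> H \<in> borel_measurable borel ==>
      (\<integral>\<^sup>+z. ennreal (norm (sol Phi phi k h (fst z) (snd z)) powr q) \<partial>(lborel :: (real \<times> (real^'n)) measure)) <= ennreal ((C * L2norm h) powr q)"
  shows "Lq_bound (ereal q) (sol Phi phi k g) (C * sqrt ((2 * pi) ^ (m + 2)) * L2norm u)"
proof -
  define B where "B = C * sqrt ((2 * pi) ^ (m + 2)) * L2norm u"
  have L0: "0 <= L2norm w" for w :: "real^'n => complex" by (simp add: L2norm_def integral_nonneg_AE)
  have B0: "0 <= B" using C L0[of u] by (simp add: B_def)
  define F where "F R = fourier_L1 (%x. indicator (cball 0 R) x * u x)" for R
  define w where "w j z = sol Phi phi k (F (real j)) (fst z) (snd z)" for j :: nat and z :: "real \<times> (real^'n)"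
  have F: "L2 (F R)" "L2norm (F R) <= sqrt ((2 * pi) ^ (m + 2)) * L2norm u" for R
    using fourier_truncated(2,3)[OF u(1), of R] dim unfolding F_def by simp_all
  have w: "w j \<in> borel_measurable borel" "(NNINT z. ennreal (norm (w j z) powr q)) <= ennreal (B powr q)" for j
  proof -
    obtain G where Gm: "G \<in> borel_measurable borel" and G: "\<And>\<xi>. F (real j) \<xi> = G (norm \<xi>)"
      using truncated_fourier_radial[OF u, of "real j"] unfolding F_def by metis
    show "w j \<in> borel_measurable borel" using sol_measurable[OF dim Phi phi F(1) G Gm, of k] by (simp add: w_def[abs_def])
    have "(NNINT z. ennreal (norm (w j z) powr q)) <= ennreal ((C * L2norm (F (real j))) powr q)"
      unfolding w_def by (rule bd[OF F(1) G Gm])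
    also have "... <= ennreal (B powr q)"
      unfolding B_def mult.assoc using C q L0 F(2)[of "real j"] by (intro ennreal_leI powr_mono2 mult_left_mono mult_nonneg_nonneg) auto
    finally show "(NNINT z. ennreal (norm (w j z) powr q)) <= ennreal (B powr q)" .
  qed
  have lim: "(%j. ennreal (norm (w j z) powr q)) \<longlonglongrightarrow> ennreal (norm (sol Phi phi k g (fst z) (snd z)) powr q)" for z
    unfolding w_def F_def using q
    by (intro tendsto_ennrealI tendsto_powr2 tendsto_norm sol_tendsto[OF Phi phi u(1) g] tendsto_const) (auto intro!: always_eventually)
  have "(NNINT z. ennreal (norm (sol Phi phi k g (fst z) (snd z)) powr q)) = (NNINT z. liminf (%j. ennreal (norm (w j z) powr q)))"
    by (rule nn_integral_cong) (simp add: lim_imp_Liminf[OF _ lim])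
  also have "... <= liminf (%j. \<integral>\<^sup>+z. ennreal (norm (w j z) powr q) \<partial>lborel)"
    using w(1) by (intro nn_integral_liminf) simp
  also have "... <= ennreal (B powr q)"
    by (rule Liminf_le) (simp_all add: w(2))
  finally show ?thesis using B0 by (simp add: Lq_bound_def B_def)
qed

lemma Linf_bound_of_radial:
  fixes u g :: "real^'n => complex" and C :: real
  assumes dim: "CARD('n) = m + 2" and Phi: "cutoff Phi" and phi: "smooth_real_on {0<..} phi"
    and u: "L2 u" "radial u" and g: "is_L2_fourier u g" and C: "0 <= C"
    and bd: "\<And>h H t x. L2 h ==> (\<And>\<xi>::real^'n. h \<xi> = H (norm \<xi>)) ==> H \<in> borel_measurable borel ==>
      norm (sol Phi phi k h t x) <= C * L2norm h"
  shows "Lq_bound \<infinity> (sol Phi phi k g) (C * sqrt ((2 * pi) ^ (m + 2)) * L2norm u)"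
proof -
  define F where "F R = fourier_L1 (%x. indicator (cball 0 R) x * u x)" for R
  have F: "L2 (F R)" "L2norm (F R) <= sqrt ((2 * pi) ^ (m + 2)) * L2norm u" for R
    using fourier_truncated(2,3)[OF u(1), of R] dim unfolding F_def by simp_all
  have "norm (sol Phi phi k g t x) <= C * sqrt ((2 * pi) ^ (m + 2)) * L2norm u" for t x
  proof (rule LIMSEQ_le_const2[OF tendsto_norm[OF sol_tendsto[OF Phi phi u(1) g]]], intro exI allI impI)
    fix j :: nat
    obtain G where Gm: "G \<in> borel_measurable borel" and G: "\<And>\<xi>. F (real j) \<xi> = G (norm \<xi>)"
      using truncated_fourier_radial[OF u, of "real j"] unfolding F_def by metis
    have "norm (sol Phi phi k (F (real j)) t x) <= C * L2norm (F (real j))" by (rule bd[OF F(1) G Gm])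
    also have "... <= C * (sqrt ((2 * pi) ^ (m + 2)) * L2norm u)" by (rule mult_left_mono[OF F(2) C])
    finally show "norm (sol Phi phi k (fourier_L1 (%x. indicator (cball 0 (real j)) x * u x)) t x) <= C * sqrt ((2 * pi) ^ (m + 2)) * L2norm u"
      by (simp add: F_def mult.assoc)
  qed
  then show ?thesis by (simp add: Lq_bound_def)
qed

text \<open>At frequency \<open>k\<close> the expansion constant is a multiple of 2^(k m(k)), so the
  factor \<open>1 / c\<close> of \<open>core_bound_1\<close>, raised to the power 1/q, supplies
  2^(-k m(k)/q). For \<open>q = \<infinity>\<close> the bound of the Bessel factor by
  \<open>pi\<close> is enough.\<close>

lemma strichartz_radial:
  fixes q :: ereal
  assumes dim: "CARD('n) = m + 2" and Phi: "cutoff Phi" and phi: "smooth_real_on {0<..} phi"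
    and H1: "H1 phi m1" and H2: "H2 phi m2" and q: "ereal (2 * (real m + 2) / (real m + 1)) < q"
  shows "\<exists>C\<ge>0. \<forall>(k::int) (u :: real^'n => complex) g. radial u \<and> L2 u \<and> is_L2_fourier u g -->
    Lq_bound q (sol Phi phi k g) (C * 2 powr ((real (m + 2) / 2 - (real (m + 2) + sel k m1 m2) * recip q) * real_of_int k) * L2norm u)"
proof -
  obtain c where c: "0 < c" and ph: "\<And>k. phase (freq_phase phi k) (c * 2 powr (real_of_int k * sel k m1 m2))"
    using freq_phase_bounds(1)[OF phi H1 H2] by blast
  have supp: "s \<notin> {1/2..2} ==> freq_amp Phi m k G s = 0" for s k G by (simp add: freq_amp_def)
  define Z where "Z = (2 * pi) powr (- real (m + 2)) * polar_const m * sqrt (2 ^ (m + 1) / (polar_const m * Jm m 0))"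
  have Z: "0 <= Z" using polar_const_pos[of m] Jm_pos[of 0 m] by (simp add: Z_def)
  show ?thesis
  proof (cases "q = \<infinity>")
    case True
    show ?thesis
    proof (intro exI[of _ "Z * (sqrt (3/2) * pi) * sqrt ((2 * pi) ^ (m + 2))"] conjI allI impI)
      show "0 <= Z * (sqrt (3/2) * pi) * sqrt ((2 * pi) ^ (m + 2))" using Z by simp
      fix k :: int and u g :: "real^'n => complex" assume u: "radial u \<and> L2 u \<and> is_L2_fourier u g"
      define K where "K = Z * (sqrt (3/2) * pi) * 2 powr (real (m + 2) / 2 * real_of_int k)"
      have "Lq_bound \<infinity> (sol Phi phi k g) (K * sqrt ((2 * pi) ^ (m + 2)) * L2norm u)"
      proof (rule Linf_bound_of_radial[OF dim Phi phi])
        fix h :: "real^'n => complex" and H t x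
        assume h: "L2 h" "\<And>\<xi>. h \<xi> = H (norm \<xi>)" and Hm: "H \<in> borel_measurable borel"
        interpret phase "freq_phase phi k" "c * 2 powr (real_of_int k * sel k m1 m2)" by (rule ph)
        note fm[measurable] = freq_amp_measurable[OF Phi Hm, of m k]
        show "norm (sol Phi phi k h t x) <= K * L2norm h"
          unfolding K_def Z_def
        proof (rule sol_sup_of_osc[OF dim Phi phi h Hm])
          fix t r :: real
          show "norm (osc m (freq_phase phi k) (freq_amp Phi m k H) t r) <= sqrt (3/2) * pi * sqrt (LBINT s. (norm (freq_amp Phi m k H s))\<^sup>2)"
            unfolding osc_def
          proof (rule time_bound(1)[OF order_refl _ fm freq_amp_norm(1)[OF dim Phi h Hm] supp])
            show "(%s. complex_of_real (Jm m (r * s)) * freq_amp Phi m k H s) \<in> borel_measurable borel" by measurable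
            show "norm (complex_of_real (Jm m (r * s)) * freq_amp Phi m k H s) <= pi * norm (freq_amp Phi m k H s)" for s
              using Jm_le_pi[of m "r * s"] by (simp add: norm_mult mult_right_mono)
          qed simp_all
        qed simp
      qed (use u Z in \<open>simp_all add: K_def\<close>)
      then show "Lq_bound q (sol Phi phi k g) (Z * (sqrt (3/2) * pi) * sqrt ((2 * pi) ^ (m + 2)) * 2 powr ((real (m + 2) / 2 - (real (m + 2) + sel k m1 m2) * recip q) * real_of_int k) * L2norm u)"
        unfolding True by (simp add: K_def recip_def mult_ac)
    qed
  next
    case False
    then obtain p where qp: "q = ereal p" using q by (cases q) auto
    have p: "2 * (real m + 2) / (real m + 1) < p" using q by (simp add: qp)
    have "2 < 2 * (real m + 2) / (real m + 1)" by (simp add: field_simps)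
    then have p2: "2 < p" using p by simp
    obtain K where K: "0 <= K" "\<And>\<Phi> c h. phase \<Phi> c ==> h \<in> borel_measurable borel ==> integrable lborel (%s. (norm (h s))\<^sup>2) ==>
       (\<And>s. s \<notin> {1/2..2} ==> h s = 0) ==>
       (NNINT (y::real^'n). (NNINT t. ennreal (norm (osc m \<Phi> h t (norm y)) powr p)))
         <= ennreal (K / c * (sqrt (LBINT s. (norm (h s))\<^sup>2)) powr p)"
    proof (rule core_bound_1[OF dim, of p], goal_cases)
      case 1 then show ?case using p2 by simp
    next
      case 2 then show ?case using p by simp
    next
      case (3 K) from 3(2-) show thesis by (rule that)
    qed
    show ?thesis
    proof (intro exI[of _ "Z * (K / c) powr (1 / p) * sqrt ((2 * pi) ^ (m + 2))"] conjI allI impI)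
      show "0 <= Z * (K / c) powr (1 / p) * sqrt ((2 * pi) ^ (m + 2))" using Z by simp
      fix k :: int and u g :: "real^'n => complex" assume u: "radial u \<and> L2 u \<and> is_L2_fourier u g"
      define M where "M = 2 powr (real_of_int k * sel k m1 m2)"
      define E where "E = Z * 2 powr ((real (m + 2) / 2 - real (m + 2) / p) * real_of_int k) * (K / (c * M)) powr (1 / p)"
      have "Lq_bound (ereal p) (sol Phi phi k g) (E * sqrt ((2 * pi) ^ (m + 2)) * L2norm u)"
      proof (rule Lq_bound_of_radial[OF dim Phi phi])
        fix h :: "real^'n => complex" and H
        assume h: "L2 h" "\<And>\<xi>. h \<xi> = H (norm \<xi>)" and Hm: "H \<in> borel_measurable borel"
        show "(\<integral>\<^sup>+z. ennreal (norm (sol Phi phi k h (fst z) (snd z)) powr p) \<partial>(lborel :: (real \<times> (real^'n)) measure)) <= ennreal ((E * L2norm h) powr p)"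
          unfolding E_def Z_def
        proof (rule sol_Lq_of_osc[OF dim Phi phi h Hm])
          show "(NNINT (y::real^'n). (NNINT t. ennreal (norm (osc m (freq_phase phi k) (freq_amp Phi m k H) t (norm y)) powr p)))
             <= ennreal (K / (c * M) * (sqrt (LBINT s. (norm (freq_amp Phi m k H s))\<^sup>2)) powr p)"
            unfolding M_def by (rule K(2)[OF ph freq_amp_measurable[OF Phi Hm] freq_amp_norm(1)[OF dim Phi h Hm] supp])
        qed (use p2 K(1) c in \<open>simp_all add: M_def\<close>)
      qed (use u Z p2 in \<open>simp_all add: E_def\<close>)
      moreover have "E = Z * (K / c) powr (1 / p) * 2 powr ((real (m + 2) / 2 - (real (m + 2) + sel k m1 m2) * (1 / p)) * real_of_int k)"
      proof -
        have "(K / (c * M)) powr (1 / p) = (K / c) powr (1 / p) * M powr (- (1 / p))"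
          unfolding powr_minus divide_divide_eq_left[symmetric] powr_divide divide_inverse[symmetric] by simp
        also have "M powr (- (1 / p)) = 2 powr (- sel k m1 m2 / p * real_of_int k)" by (simp add: M_def powr_powr mult_ac)
        finally have "E = Z * (K / c) powr (1 / p) * (2 powr ((real (m + 2) / 2 - real (m + 2) / p) * real_of_int k) * 2 powr (- sel k m1 m2 / p * real_of_int k))"
          by (simp add: E_def mult_ac)
        also have "2 powr ((real (m + 2) / 2 - real (m + 2) / p) * real_of_int k) * 2 powr (- sel k m1 m2 / p * real_of_int k)
          = 2 powr ((real (m + 2) / 2 - (real (m + 2) + sel k m1 m2) * (1 / p)) * real_of_int k)"
          unfolding powr_add[symmetric] by (simp add: algebra_simps add_divide_distrib)
        finally show ?thesis .
      qed
      ultimately show "Lq_bound q (sol Phi phi k g) (Z * (K / c) powr (1 / p) * sqrt ((2 * pi) ^ (m + 2)) * 2 powr ((real (m + 2) / 2 - (real (m + 2) + sel k m1 m2) * recip q) * real_of_int k) * L2norm u)"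
        unfolding qp by (simp add: recip_def mult_ac)
    qed
  qed
qed

lemma Lq_bound_mono:
  assumes w: "Lq_bound (ereal q) w B" and B: "B <= B'" and q: "0 <= q"
  shows "Lq_bound (ereal q) w B'"
proof -
  have B0: "0 <= B" using w by (simp add: Lq_bound_def)
  have "ennreal (B powr q) <= ennreal (B' powr q)" using B B0 q by (intro ennreal_leI powr_mono2)
  with w B0 B show ?thesis unfolding Lq_bound_def by (auto intro: order_trans)
qed

text \<open>First and second derivatives of the phase have sizes 2^(k m(k)) and at least 2^(k
  \<alpha>(k)), so \<open>kernel_bound\<close> gives a constant \<open>D\<close> of order
  \<open>loss k powr (1/2)\<close>. The powers (q-2)/2 in \<open>core_bound_2\<close> and 1/q in the
  norm turn this into the exponent 1/4 - 1/(2q). At \<open>q = 6\<close> the estimate without loss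
  from \<open>strichartz_radial\<close> is stronger, because \<open>loss\<close> is bounded
  below.\<close>

lemma strichartz_radial_curved:
  fixes q :: real
  assumes dim: "CARD('n) = m + 2" and Phi: "cutoff Phi" and phi: "smooth_real_on {0<..} phi"
    and H1: "H1 phi m1" and H2: "H2 phi m2" and H3: "H3 phi a1" and H4: "H4 phi a2"
    and q: "(4 * (real m + 2) + 2) / (2 * (real m + 2) - 1) <= q" "q <= 6"
  shows "\<exists>C\<ge>0. \<forall>(k::int) (u :: real^'n => complex) g. radial u \<and> L2 u \<and> is_L2_fourier u g -->
    Lq_bound (ereal q) (sol Phi phi k g) (C * 2 powr ((real (m + 2) / 2 - (real (m + 2) + sel k m1 m2) / q) * real_of_int k
       + (1/4 - 1 / (2 * q)) * (sel k m1 m2 - sel k a1 a2) * real_of_int k) * L2norm u)"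
proof -
  have L0: "0 <= L2norm w" for w :: "real^'n => complex" by (simp add: L2norm_def integral_nonneg_AE)
  have q2: "2 < q"
  proof -
    have "2 < (4 * (real m + 2) + 2) / (2 * (real m + 2) - 1)" by (simp add: field_simps)
    with q(1) show ?thesis by simp
  qed
  have qn: "3/2 - q/4 <= (real m + 1) * (q / 2 - 1)"
  proof -
    have "4 * (real m + 2) + 2 <= q * (2 * (real m + 2) - 1)" using q(1) by (simp add: pos_divide_le_eq)
    then show ?thesis by (simp add: algebra_simps)
  qed
  obtain c where c: "0 < c" and ph: "\<And>k. phase (freq_phase phi k) (c * 2 powr (real_of_int k * sel k m1 m2))"
    using freq_phase_bounds(1)[OF phi H1 H2] by blast
  obtain C0 where C0: "0 < C0" and up: "\<And>k s. s \<in> {1/2..2} ==> \<bar>2 powr real_of_int k * deriv phi (2 powr real_of_int k * s)\<bar> <= C0 * 2 powr (real_of_int k * sel k m1 m2)"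
      "\<And>k s. s \<in> {1/2..2} ==> \<bar>2 powr real_of_int k * (2 powr real_of_int k * deriv (deriv phi) (2 powr real_of_int k * s))\<bar> <= C0 * 2 powr (real_of_int k * sel k m1 m2)"
    using freq_phase_bounds(2)[OF phi H1 H2] by blast
  obtain c2 where c2: "0 < c2" and lo: "\<And>k s. s \<in> {1/2..2} ==> c2 * 2 powr (real_of_int k * sel k a1 a2) <= \<bar>2 powr real_of_int k * (2 powr real_of_int k * deriv (deriv phi) (2 powr real_of_int k * s))\<bar>"
    using freq_phase_curvature[OF H3 H4] by blast
  have supp: "s \<notin> {1/2..2} ==> freq_amp Phi m k G s = 0" for s k G by (simp add: freq_amp_def)
  \<comment> \<open>At \<open>s = 1\<close> the lower bound for the second derivative from
    \<open>H3\<close> and \<open>H4\<close> meets the upper bound from \<open>H1\<close> and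
    \<open>H2\<close>. Hence \<open>loss\<close> is bounded below, which absorbs the summand 1 in
    \<open>core_bound_2\<close>.\<close>
  have cmp: "c2 * 2 powr (real_of_int k * sel k a1 a2) <= C0 * 2 powr (real_of_int k * sel k m1 m2)" for k
    using lo[of 1 k] up(2)[of 1 k] by auto
  define loss where "loss k = 2 powr ((sel k m1 m2 - sel k a1 a2) * real_of_int k)" for k
  have loss: "C0 * 2 powr (real_of_int k * sel k m1 m2) / (c2 * 2 powr (real_of_int k * sel k a1 a2)) = C0 / c2 * loss k" for k
  proof -
    have "loss k = 2 powr (real_of_int k * sel k m1 m2) / 2 powr (real_of_int k * sel k a1 a2)"
      by (simp add: loss_def powr_diff[symmetric] algebra_simps)
    then show ?thesis by simp
  qed
  have loss1: "1 <= C0 / c2 * loss k" for k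
    unfolding loss[symmetric] using cmp[of k] c2 by (subst pos_le_divide_eq) auto
  have lossp: "0 < loss k" for k by (simp add: loss_def)
  define e where "e = 1/4 - 1 / (2 * q)"
  have e: "0 < e" "e * q = (q - 2) / 4" using q2 by (simp_all add: e_def field_simps)
  have split: "2 powr ((real (m + 2) / 2 - (real (m + 2) + sel k m1 m2) / q) * real_of_int k
       + (1/4 - 1 / (2 * q)) * (sel k m1 m2 - sel k a1 a2) * real_of_int k)
      = 2 powr ((real (m + 2) / 2 - (real (m + 2) + sel k m1 m2) / q) * real_of_int k) * loss k powr e" for k
  proof -
    have "loss k powr e = 2 powr (e * (sel k m1 m2 - sel k a1 a2) * real_of_int k)" by (simp add: loss_def powr_powr mult_ac)
    then show ?thesis by (simp only: powr_add e_def)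
  qed
  show ?thesis
  proof (cases "q = 6")
    case True
    have "2 * (real m + 2) / (real m + 1) < q" unfolding True by (simp add: field_simps)
    then obtain C where C: "0 <= C" "\<And>(k::int) (u :: real^'n => complex) g. radial u \<and> L2 u \<and> is_L2_fourier u g ==>
      Lq_bound (ereal q) (sol Phi phi k g) (C * 2 powr ((real (m + 2) / 2 - (real (m + 2) + sel k m1 m2) * recip (ereal q)) * real_of_int k) * L2norm u)"
      using strichartz_radial[OF dim Phi phi H1 H2, of "ereal q"] by auto
    show ?thesis unfolding split
    proof (intro exI[of _ "C * (C0 / c2) powr e"] conjI allI impI)
      show "0 <= C * (C0 / c2) powr e" using C(1) by simp
      fix k :: int and u g :: "real^'n => complex" assume u: "radial u \<and> L2 u \<and> is_L2_fourier u g"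
      let ?P = "2 powr ((real (m + 2) / 2 - (real (m + 2) + sel k m1 m2) / q) * real_of_int k)"
      have "1 <= (C0 / c2 * loss k) powr e" using loss1 e by (simp add: ge_one_powr_ge_zero)
      then have "C * ?P * L2norm u * 1 <= C * ?P * L2norm u * (C0 / c2 * loss k) powr e"
        using C(1) L0[of u] by (intro mult_left_mono) auto
      also have "... = C * (C0 / c2) powr e * (?P * loss k powr e) * L2norm u" unfolding powr_mult by (simp only: mult_ac)
      finally have le: "C * ?P * L2norm u <= C * (C0 / c2) powr e * (?P * loss k powr e) * L2norm u" by simp
      have "Lq_bound (ereal q) (sol Phi phi k g) (C * ?P * L2norm u)" using C(2)[OF u, of k] by (simp add: recip_def)
      from Lq_bound_mono[OF this le] show "Lq_bound (ereal q) (sol Phi phi k g) (C * (C0 / c2) powr e * (?P * loss k powr e) * L2norm u)" using q2 by simp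
    qed
  next
    case False
    then have q6: "q < 6" using q(2) by simp
    obtain K where K: "0 <= K" "\<And>\<Phi> c D h. phase \<Phi> c ==> 0 < D ==>
     (\<And>t R. R \<noteq> 0 ==> norm (LBINT s. cis (t * \<Phi> s + R * s) * indicator {1/2..2} s) <= D * \<bar>R\<bar> powr (- 1/2)) ==>
     h \<in> borel_measurable borel ==> integrable lborel (%s. (norm (h s))\<^sup>2) ==>
     (\<And>s. s \<notin> {1/2..2} ==> h s = 0) ==>
     (NNINT (y::real^'n). (NNINT t. ennreal (norm (osc m \<Phi> h t (norm y)) powr q)))
       <= ennreal (K / c * (1 + D powr ((q - 2) / 2)) * (sqrt (LBINT s. (norm (h s))\<^sup>2)) powr q)"
    proof (rule core_bound_2[OF dim q2 q6 qn], goal_cases)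
      case (1 K) from 1(2-) show thesis by (rule that)
    qed
    define Z where "Z = (2 * pi) powr (- real (m + 2)) * polar_const m * sqrt (2 ^ (m + 1) / (polar_const m * Jm m 0))"
    have Z: "0 <= Z" using polar_const_pos[of m] Jm_pos[of 0 m] by (simp add: Z_def)
    define K' where "K' = 2 * K * 15 powr ((q - 2) / 2) * (C0 / c2) powr ((q - 2) / 4) / c"
    have K': "0 <= K'" using K(1) c by (simp add: K'_def)
    show ?thesis unfolding split
    proof (intro exI[of _ "Z * K' powr (1 / q) * sqrt ((2 * pi) ^ (m + 2))"] conjI allI impI)
      show "0 <= Z * K' powr (1 / q) * sqrt ((2 * pi) ^ (m + 2))" using Z by simp
      fix k :: int and u g :: "real^'n => complex" assume u: "radial u \<and> L2 u \<and> is_L2_fourier u g"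
      define M where "M = 2 powr (real_of_int k * sel k m1 m2)"
      have M: "0 < M" by (simp add: M_def)
      define D where "D = 15 * sqrt (C0 / c2 * loss k)"
      have "1 <= sqrt (C0 / c2 * loss k)" by (rule real_sqrt_ge_one[OF loss1])
      then have D1: "1 <= D" unfolding D_def by linarith
      define A where "A = K' / M * loss k powr ((q - 2) / 4)"
      have A0: "0 <= A" using K' M by (simp add: A_def)
      have A: "K / (c * M) * (1 + D powr ((q - 2) / 2)) <= A"
      proof -
        have Dp: "D powr ((q - 2) / 2) = 15 powr ((q - 2) / 2) * ((C0 / c2) powr ((q - 2) / 4) * loss k powr ((q - 2) / 4))"
        proof -
          have "sqrt (C0 / c2 * loss k) = (C0 / c2 * loss k) powr (1/2)" using loss1[of k] by (intro powr_half_sqrt[symmetric]) auto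
          then have "D powr ((q - 2) / 2) = 15 powr ((q - 2) / 2) * (C0 / c2 * loss k) powr (1/2 * ((q - 2) / 2))"
            by (simp only: D_def powr_mult powr_powr)
          moreover have "1/2 * ((q - 2) / 2) = (q - 2) / 4" by simp
          ultimately show ?thesis by (simp only: powr_mult)
        qed
        have "1 <= D powr ((q - 2) / 2)" using D1 q2 by (simp add: ge_one_powr_ge_zero)
        then have "K / (c * M) * (1 + D powr ((q - 2) / 2)) <= K / (c * M) * (2 * D powr ((q - 2) / 2))"
          using K(1) c M by (intro mult_left_mono) auto
        also have "... = A" unfolding Dp by (simp add: A_def K'_def mult_ac)
        finally show ?thesis .
      qed
      define E where "E = Z * 2 powr ((real (m + 2) / 2 - real (m + 2) / q) * real_of_int k) * A powr (1 / q)"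
      have "Lq_bound (ereal q) (sol Phi phi k g) (E * sqrt ((2 * pi) ^ (m + 2)) * L2norm u)"
      proof (rule Lq_bound_of_radial[OF dim Phi phi])
        fix h :: "real^'n => complex" and H
        assume h: "L2 h" "\<And>\<xi>. h \<xi> = H (norm \<xi>)" and Hm: "H \<in> borel_measurable borel"
        show "(\<integral>\<^sup>+z. ennreal (norm (sol Phi phi k h (fst z) (snd z)) powr q) \<partial>(lborel :: (real \<times> (real^'n)) measure)) <= ennreal ((E * L2norm h) powr q)"
          unfolding E_def Z_def
        proof (rule sol_Lq_of_osc[OF dim Phi phi h Hm])
          have "(NNINT (y::real^'n). (NNINT t. ennreal (norm (osc m (freq_phase phi k) (freq_amp Phi m k H) t (norm y)) powr q)))
             <= ennreal (K / (c * M) * (1 + D powr ((q - 2) / 2)) * (sqrt (LBINT s. (norm (freq_amp Phi m k H s))\<^sup>2)) powr q)"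
            unfolding M_def
          proof (rule K(2)[OF ph _ _ freq_amp_measurable[OF Phi Hm] freq_amp_norm(1)[OF dim Phi h Hm] supp])
            show "0 < D" using D1 by simp
            fix t R :: real assume R: "R \<noteq> 0"
            have "norm (LBINT s. cis (t * freq_phase phi k s + R * s) * indicator {1/2..2} s)
              <= 15 * sqrt 1 * sqrt (C0 * 2 powr (real_of_int k * sel k m1 m2) / (c2 * 2 powr (real_of_int k * sel k a1 a2))) * \<bar>R\<bar> powr (- 1/2)"
              by (rule kernel_bound[OF freq_phase_deriv[OF phi] up(1) _ lo]) (use C0 c2 cmp[of k] R in auto)
            then show "norm (LBINT s. cis (t * freq_phase phi k s + R * s) * indicator {1/2..2} s) <= D * \<bar>R\<bar> powr (- 1/2)"
              unfolding loss D_def by simp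
          qed
          also have "... <= ennreal (A * (sqrt (LBINT s. (norm (freq_amp Phi m k H s))\<^sup>2)) powr q)"
            using A by (intro ennreal_leI mult_right_mono) auto
          finally show "(NNINT (y::real^'n). (NNINT t. ennreal (norm (osc m (freq_phase phi k) (freq_amp Phi m k H) t (norm y)) powr q)))
             <= ennreal (A * (sqrt (LBINT s. (norm (freq_amp Phi m k H s))\<^sup>2)) powr q)" .
        qed (use q2 A0 in simp_all)
      qed (use u Z q2 in \<open>simp_all add: E_def\<close>)
      moreover have "E = Z * K' powr (1 / q) * (2 powr ((real (m + 2) / 2 - (real (m + 2) + sel k m1 m2) / q) * real_of_int k) * loss k powr e)"
      proof -
        have "A powr (1 / q) = K' powr (1 / q) * M powr (- (1 / q)) * loss k powr ((q - 2) / 4 * (1 / q))"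
          unfolding A_def powr_mult powr_divide powr_powr powr_minus divide_inverse[of "K' powr (1 / q)"] by simp
        also have "(q - 2) / 4 * (1 / q) = e" using q2 by (simp add: e_def field_simps)
        also have "M powr (- (1 / q)) = 2 powr (- sel k m1 m2 / q * real_of_int k)" by (simp add: M_def powr_powr mult_ac)
        finally have "E = Z * K' powr (1 / q) * ((2 powr ((real (m + 2) / 2 - real (m + 2) / q) * real_of_int k) * 2 powr (- sel k m1 m2 / q * real_of_int k)) * loss k powr e)"
          by (simp add: E_def mult_ac)
        also have "2 powr ((real (m + 2) / 2 - real (m + 2) / q) * real_of_int k) * 2 powr (- sel k m1 m2 / q * real_of_int k)
          = 2 powr ((real (m + 2) / 2 - (real (m + 2) + sel k m1 m2) / q) * real_of_int k)"
          unfolding powr_add[symmetric] by (simp add: algebra_simps add_divide_distrib)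
        finally show ?thesis .
      qed
      ultimately show "Lq_bound (ereal q) (sol Phi phi k g) (Z * K' powr (1 / q) * sqrt ((2 * pi) ^ (m + 2)) * (2 powr ((real (m + 2) / 2 - (real (m + 2) + sel k m1 m2) / q) * real_of_int k) * loss k powr e) * L2norm u)"
        by (simp add: mult_ac)
    qed
  qed
qed

section \<open>Sharpness\<close>

text \<open>The test datum is normalised so that its transform, seen at unit frequency, does not
  depend on \<open>kp\<close>. Since \<open>u\<close> is integrable, \<open>g\<close> is given by
  the transform integral, and its distance to the truncated transforms is the transform of a tail of
  \<open>u\<close>, small by \<open>L2_bound\<close> and dominated convergence.\<close>

lemma fourier_gaussian:
  fixes kp :: real
  assumes kp: "0 < kp"
  defines "u \<equiv> %x::'a::euclidean_space. complex_of_real ((kp / sqrt (2 * pi)) ^ DIM('a) * exp (- (kp * norm x)\<^sup>2 / 2))"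
    and "g \<equiv> %\<xi>::'a. complex_of_real (exp (- (norm \<xi> / kp)\<^sup>2 / 2))"
  shows "radial u" "L2 u" "L2norm u <= sqrt (kp ^ DIM('a))" "is_L2_fourier u g"
proof -
  define \<beta> where "\<beta> = (kp / sqrt (2 * pi)) ^ DIM('a)"
  have \<beta>: "0 < \<beta>" using kp by (simp add: \<beta>_def)
  have um[measurable]: "u \<in> borel_measurable borel" unfolding u_def by measurable
  have gm[measurable]: "g \<in> borel_measurable borel" unfolding g_def by measurable
  show "radial u" by (simp add: radial_def u_def)
  have sq: "(exp (- (e * x)\<^sup>2 / 2))\<^sup>2 = exp (- ((sqrt 2 * e) * x)\<^sup>2 / 2)" for e x :: real
    unfolding exp_double[symmetric] by (simp add: power_mult_distrib)
  have nu: "(norm (u x))\<^sup>2 = \<beta>\<^sup>2 * exp (- ((sqrt 2 * kp) * norm x)\<^sup>2 / 2)" for x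
    unfolding u_def \<beta>_def[symmetric] norm_of_real power2_abs power_mult_distrib[of \<beta>] sq ..
  have ng: "(norm (g x))\<^sup>2 = exp (- ((sqrt 2 * (1 / kp)) * norm x)\<^sup>2 / 2)" for x
    unfolding sq[symmetric] g_def norm_of_real power2_abs by simp
  have u2: "integrable lborel (%x. (norm (u x))\<^sup>2)" unfolding nu using gauss_n_real(1)[of "sqrt 2 * kp", where 'a = 'a] kp by simp
  have g2: "integrable lborel (%x. (norm (g x))\<^sup>2)" unfolding ng using gauss_n_real(1)[of "sqrt 2 * (1 / kp)", where 'a = 'a] kp by simp
  show "L2 u" using u2 by (simp add: L2_def)
  have Lg: "L2 g" using g2 by (simp add: L2_def)
  have "(LBINT x. (norm (u x))\<^sup>2) = \<beta>\<^sup>2 * (sqrt (2 * pi) / (sqrt 2 * kp)) ^ DIM('a)"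
    unfolding nu using gauss_n_real(2)[of "sqrt 2 * kp", where 'a = 'a] kp by simp
  also have "... = (kp / (2 * sqrt pi)) ^ DIM('a)"
  proof -
    have "kp / sqrt (2 * pi) * (kp / sqrt (2 * pi)) * (sqrt (2 * pi) / (sqrt 2 * kp)) = kp / (2 * sqrt pi)"
    proof -
      have *: "kp / y * (kp / y) * (y / (z * kp)) = kp / (y * z)" if "y \<noteq> 0" for y z using that kp by simp
      have "kp / sqrt (2 * pi) * (kp / sqrt (2 * pi)) * (sqrt (2 * pi) / (sqrt 2 * kp)) = kp / (sqrt (2 * pi) * sqrt 2)" by (rule *) simp
      also have "sqrt (2 * pi) * sqrt 2 = 2 * sqrt pi" by (simp add: real_sqrt_mult)
      finally show ?thesis .
    qed
    then show ?thesis unfolding \<beta>_def power2_eq_square power_mult_distrib[symmetric] by simp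
  qed
  also have "... <= kp ^ DIM('a)"
  proof (rule power_mono)
    have "1 <= sqrt pi" using pi_gt3 by (intro real_sqrt_ge_one) simp
    then have "1 <= 2 * sqrt pi" by linarith
    then have "kp / (2 * sqrt pi) <= kp / 1" using kp by (intro divide_left_mono) simp_all
    then show "kp / (2 * sqrt pi) <= kp" by simp
  qed (use kp in simp)
  finally show "L2norm u <= sqrt (kp ^ DIM('a))" unfolding L2norm_def by (rule real_sqrt_le_mono)
  have ui: "integrable lborel u"
  proof -
    have "integrable lborel (%x::'a. complex_of_real (\<beta> * exp (- (kp * norm x)\<^sup>2 / 2)))"
      by (intro integrable_of_real integrable_mult_right gauss_n_real(1) kp)
    then show ?thesis by (simp add: u_def \<beta>_def)
  qed
  have gF: "g \<xi> = (LBINT x. cis ((- x) \<bullet> \<xi>) * u x)" for \<xi>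
  proof -
    have "(LBINT x. cis ((- x) \<bullet> \<xi>) * u x) = (LBINT x. of_real \<beta> * (cis (x \<bullet> (- \<xi>)) * of_real (exp (- (kp * norm x)\<^sup>2 / 2))))"
      by (rule Bochner_Integration.integral_cong) (simp_all add: u_def \<beta>_def)
    also have "... = of_real \<beta> * (of_real ((sqrt (2 * pi) / kp) ^ DIM('a) * exp (- (norm (- \<xi>) / kp)\<^sup>2 / 2)))"
      unfolding integral_mult_right_zero gauss_n(2)[OF kp] ..
    also have "... = of_real ((kp / sqrt (2 * pi) * (sqrt (2 * pi) / kp)) ^ DIM('a) * exp (- (norm (- \<xi>) / kp)\<^sup>2 / 2))"
      by (simp only: \<beta>_def power_mult_distrib of_real_mult mult.assoc)
    also have "kp / sqrt (2 * pi) * (sqrt (2 * pi) / kp) = 1" using kp by simp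
    finally show ?thesis by (simp add: g_def)
  qed
  show "is_L2_fourier u g" unfolding is_L2_fourier_def
  proof (intro conjI Lg)
    define T where "T R = (LBINT x. (norm (indicator (- cball 0 R) x * u x))\<^sup>2)" for R
    have im: "(indicator A :: 'a => complex) \<in> borel_measurable borel" if "A \<in> sets borel" for A using that by (rule borel_measurable_indicator)
    note [measurable] = im[of "cball 0 _"] im[of "- cball 0 _"]
    have bd: "(NNINT \<xi>. ennreal ((norm (g \<xi> - fourier_L1 (%x. indicator (cball 0 R) x * u x) \<xi>))\<^sup>2)) <= ennreal ((2 * pi) ^ DIM('a) * T R)" for R
    proof -
      have hm[measurable]: "(%x. indicator A x * u x) \<in> borel_measurable borel" if "A \<in> sets borel" for A
        by (rule borel_measurable_times[OF im[OF that] um])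
      have i1: "integrable lborel (%x. indicator A x * u x)" if "A \<in> sets borel" for A
      proof (rule Bochner_Integration.integrable_bound[OF ui])
        show "(%x. indicator A x * u x) \<in> borel_measurable lborel" using hm[OF that] by simp
      qed (auto simp: indicator_def)
      have i2: "integrable lborel (%x. (norm (indicator A x * u x))\<^sup>2)" if "A \<in> sets borel" for A
      proof (rule Bochner_Integration.integrable_bound[OF u2])
        show "(%x. (norm (indicator A x * u x))\<^sup>2) \<in> borel_measurable lborel"
          using borel_measurable_power[OF measurable_compose[OF hm[OF that] borel_measurable_norm]] by simp
      qed (auto simp: indicator_def)
      have ci: "integrable lborel (%x. cis ((- x) \<bullet> \<xi>) * v x)" if v: "integrable lborel v" for v :: "'a => complex" and \<xi>
      proof (rule Bochner_Integration.integrable_bound[OF v])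
        have "v \<in> borel_measurable lborel" using v by simp
        moreover have "(%x. cis ((- x) \<bullet> \<xi>)) \<in> borel_measurable lborel" by measurable
        ultimately show "(%x. cis ((- x) \<bullet> \<xi>) * v x) \<in> borel_measurable lborel" by (rule borel_measurable_times[rotated])
      qed (simp add: norm_mult)
      have "g \<xi> - fourier_L1 (%x. indicator (cball 0 R) x * u x) \<xi> = (LBINT x. cis ((- x) \<bullet> \<xi>) * (indicator (- cball 0 R) x * u x))" for \<xi>
      proof -
        have cb: "cball (0::'a) R \<in> sets borel" by simp
        have "fourier_L1 (%x. indicator (cball 0 R) x * u x) \<xi> = (LBINT x. cis ((- x) \<bullet> \<xi>) * (indicator (cball 0 R) x * u x))"
          unfolding fourier_L1_def by (simp add: cis_conv_exp)
        then have "g \<xi> - fourier_L1 (%x. indicator (cball 0 R) x * u x) \<xi>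
          = (LBINT x. cis ((- x) \<bullet> \<xi>) * u x - cis ((- x) \<bullet> \<xi>) * (indicator (cball 0 R) x * u x))"
          unfolding gF by (simp only: Bochner_Integration.integral_diff[OF ci[OF ui] ci[OF i1[OF cb]]])
        also have "... = (LBINT x. cis ((- x) \<bullet> \<xi>) * (indicator (- cball 0 R) x * u x))"
          by (rule Bochner_Integration.integral_cong) (auto simp: indicator_def)
        finally show ?thesis .
      qed
      moreover have "(NNINT \<xi>. ennreal ((norm (LBINT x. cis ((- x) \<bullet> \<xi>) * (indicator (- cball 0 R) x * u x)))\<^sup>2))
        <= ennreal ((2 * pi / 1) ^ DIM('a) * (LBINT x. (norm (indicator (- cball 0 R) x * u x))\<^sup>2))"
        by (rule L2_bound) (auto intro!: i1 i2 simp: norm_minus_commute)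
      ultimately show ?thesis by (simp add: T_def)
    qed
    have "(T \<longlongrightarrow> (\<integral>x. 0 \<partial>(lborel :: 'a measure))) at_top"
      unfolding T_def
    proof (rule integral_dominated_convergence_at_top[where w = "%x. (norm (u x))\<^sup>2"])
      show "\<forall>\<^sub>F R in at_top. AE x in lborel. norm ((norm (indicator (- cball 0 R) x * u x))\<^sup>2) <= (norm (u x))\<^sup>2"
        by (auto simp: indicator_def intro!: always_eventually)
      show "AE x in lborel. ((%R. (norm (indicator (- cball 0 R) x * u x))\<^sup>2) \<longlongrightarrow> 0) at_top"
      proof (rule AE_I2)
        fix x :: 'a
        show "((%R. (norm (indicator (- cball 0 R) x * u x))\<^sup>2) \<longlongrightarrow> 0) at_top"
          by (rule tendsto_eventually, rule eventually_mono[OF eventually_ge_at_top[of "norm x"]]) (simp add: indicator_def)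
      qed
    qed (use u2 im in \<open>auto intro!: borel_measurable_times borel_measurable_power borel_measurable_norm\<close>)
    then have T0: "(T \<longlongrightarrow> 0) at_top" by simp
    have "((%R. ennreal ((2 * pi) ^ DIM('a) * T R)) \<longlongrightarrow> ennreal ((2 * pi) ^ DIM('a) * 0)) at_top"
      by (intro tendsto_ennrealI tendsto_mult tendsto_const T0)
    then have up: "((%R. ennreal ((2 * pi) ^ DIM('a) * T R)) \<longlongrightarrow> 0) at_top" by simp
    show "((%R. \<integral>\<^sup>+\<xi>. ennreal ((norm (g \<xi> - fourier_L1 (%x. indicator (cball 0 R) x * u x) \<xi>))\<^sup>2) \<partial>lborel) \<longlongrightarrow> 0) at_top"
      by (rule tendsto_sandwich[OF _ _ tendsto_const up]) (simp_all only: bd zero_le eventually_True)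
  qed
qed

text \<open>Translating by half a period flips the sign of the oscillating factor.\<close>
lemma riemann_lebesgue:
  fixes w :: "real => real"
  assumes c: "continuous_on {1/4..3} w" and supp: "\<And>s. s \<notin> {1/2..2} ==> w s = 0"
    and wi: "integrable lborel w" and e: "0 < e"
  shows "\<exists>R0. \<forall>R\<ge>R0. norm (LBINT s. cis (R * s) * of_real (w s)) <= e"
proof -
  have "uniformly_continuous_on {1/4..3} w" by (rule compact_uniformly_continuous[OF c]) simp
  then obtain d where d: "0 < d" "\<And>s s'. s \<in> {1/4..3} ==> s' \<in> {1/4..3} ==> \<bar>s' - s\<bar> < d ==> \<bar>w s' - w s\<bar> < e"
    using e unfolding uniformly_continuous_on_def dist_real_def by metis
  have wm[measurable]: "w \<in> borel_measurable borel" using wi by simp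
  show ?thesis
  proof (intro exI allI impI)
    \<comment> \<open>With \<open>4 * pi <= R\<close> the half period \<open>h\<close> is at most
      1/4, so the difference of \<open>w\<close> and its translate lives on [1/4, 2] and all
      arguments stay in [1/4, 3]. The other bound makes \<open>h\<close> smaller than the modulus of
      continuity \<open>d\<close>.\<close>
    fix R assume R: "max (4 * pi) (2 * pi / d) <= R"
    define h where "h = pi / R"
    have R0: "0 < R" using R pi_gt_zero by linarith
    have h: "0 < h" "h <= 1/4" "h < d"
    proof -
      show "0 < h" using R0 by (simp add: h_def)
      show "h <= 1/4" using R R0 by (simp add: h_def pos_divide_le_eq)
      have "2 * pi <= R * d" using R d(1) by (simp add: pos_divide_le_eq)
      then have "pi < R * d" using pi_gt_zero by linarith
      then show "h < d" using R0 by (simp add: h_def pos_divide_less_eq mult.commute)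
    qed
    define I where "I = (LBINT s. cis (R * s) * of_real (w s))"
    have ci: "integrable lborel (%s. cis (R * s) * of_real (w s))"
      by (rule Bochner_Integration.integrable_bound[OF wi]) (auto simp: norm_mult)
    have whi: "integrable lborel (%s. w (h + s))" using lborel_integrable_real_affine[OF wi, of 1 h] by simp
    have ci2: "integrable lborel (%s. cis (R * s) * of_real (w (h + s)))"
      by (rule Bochner_Integration.integrable_bound[OF whi]) (auto simp: norm_mult)
    have "I = (LBINT s. cis (R * (h + s)) * of_real (w (h + s)))"
      unfolding I_def using lborel_integral_real_affine[of 1 "%s. cis (R * s) * of_real (w s)" h] by simp
    also have "... = (LBINT s. - (cis (R * s) * of_real (w (h + s))))"
    proof (rule Bochner_Integration.integral_cong[OF refl])
      fix s
      have "R * (h + s) = pi + R * s" using R0 by (simp add: h_def distrib_left)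
      then have "cis (R * (h + s)) = - cis (R * s)" by (simp only: cis_mult[symmetric]) simp
      then show "cis (R * (h + s)) * of_real (w (h + s)) = - (cis (R * s) * of_real (w (h + s)))" by simp
    qed
    finally have I2: "I = - (LBINT s. cis (R * s) * of_real (w (h + s)))" by simp
    have "2 * I = I - (LBINT s. cis (R * s) * of_real (w (h + s)))" using I2 by (simp add: algebra_simps)
    also have "... = (LBINT s. cis (R * s) * of_real (w s) - cis (R * s) * of_real (w (h + s)))"
      unfolding I_def by (rule Bochner_Integration.integral_diff[OF ci ci2, symmetric])
    finally have "norm (2 * I) = norm (LBINT s. cis (R * s) * of_real (w s) - cis (R * s) * of_real (w (h + s)))" by simp
    also have "... <= (LBINT s. e * indicator {1/4..2::real} s)"
    proof (rule order_trans[OF integral_norm_bound], rule integral_mono)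
      show "integrable lborel (%s. norm (cis (R * s) * of_real (w s) - cis (R * s) * of_real (w (h + s))))"
        by (intro integrable_norm Bochner_Integration.integrable_diff ci ci2)
      show "integrable lborel (%s. e * indicator {1/4..2::real} s)"
        by (intro integrable_mult_right integrable_real_indicator) (auto simp: emeasure_lborel_Icc_eq)
      fix s :: real
      have "cis (R * s) * of_real (w s) - cis (R * s) * of_real (w (h + s)) = cis (R * s) * of_real (w s - w (h + s))" by (simp add: right_diff_distrib)
      then have n: "norm (cis (R * s) * of_real (w s) - cis (R * s) * of_real (w (h + s))) = \<bar>w s - w (h + s)\<bar>" by (simp only: norm_mult norm_cis norm_of_real mult_1)
      show "norm (cis (R * s) * of_real (w s) - cis (R * s) * of_real (w (h + s))) <= e * indicator {1/4..2::real} s"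
        unfolding n
      proof (cases "s \<in> {1/4..2}")
        case True
        then have "\<bar>w s - w (h + s)\<bar> < e" using d(2)[of "h + s" s] h by auto
        then show "\<bar>w s - w (h + s)\<bar> <= e * indicator {1/4..2::real} s" using True by simp
      next
        case False
        then have "w s = 0" "w (h + s) = 0" using h by (auto intro!: supp)
        then show "\<bar>w s - w (h + s)\<bar> <= e * indicator {1/4..2::real} s" using e by simp
      qed
    qed
    also have "... = e * (7/4)" by (simp add: measure_def)
    finally show "norm (LBINT s. cis (R * s) * of_real (w s)) <= e" using e unfolding I_def[symmetric] by simp
  qed
qed

lemma norm_cis_diff_le: "norm (cis x - 1) <= \<bar>x\<bar>"
  using iexp_approx1[of x 0] by (simp add: cis_conv_exp)

text \<open>For \<open>\<tau>\<close> close to \<open>r\<close> the wave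
  \<open>cis (- (r * s))\<close> cancels the phase \<open>\<tau> * s\<close> up to a small angle, so
  its contribution \<open>W1\<close> is close to the full mass \<open>I0\<close>. The opposite wave
  has frequency \<open>\<tau> + r\<close> and is small by \<open>riemann_lebesgue\<close>, and the
  remainder of the Bessel asymptotics is smaller by a factor 1/r. The term with \<open>\<mu>\<close>
  is the effect of the square root in the phase, a bounded perturbation for small
  \<open>\<mu>\<close>.\<close>

lemma osc_lower_bound:
  fixes m :: nat and Phi :: "real => real"
  assumes Phi: "cutoff Phi"
  defines "N \<equiv> (real m + 1) / 2" and "b \<equiv> %s. indicator {1/2..2} s * (psi Phi s * s ^ (m + 1)) * exp (- s\<^sup>2 / 2)"
  obtains c A where "0 < c" "1 <= A"
    "\<And>\<tau> r \<mu>. A <= r ==> \<bar>\<tau> - r\<bar> <= 1/16 ==> 0 <= \<mu> ==> \<mu> <= 1/16 ==>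
      c * r powr - N <= norm (LBINT s. cis (\<tau> * s + \<mu> * s powr (1/2)) * (of_real (Jm m (r * s)) * of_real (b s)))"
proof -
  obtain C a where C: "0 < C" and a: "a \<noteq> 0"
    and as: "\<And>l. 1/2 <= l ==> norm (of_real (Jm m l) - of_real (l powr - N) * (a * cis l + cnj a * cis (- l))) <= C * l powr (- N - 1)"
  proof (rule Jm_asymptotics[of m, folded N_def], goal_cases)
    case (1 C a)
    from 1(2,3,5) show thesis by (rule that)
  qed
  have N: "0 < N" by (simp add: N_def)
  define w where "w s = s powr - N * b s" for s
  note [measurable] = psi_measurable[OF Phi]
  have bm[measurable]: "b \<in> borel_measurable borel" unfolding b_def by measurable
  have wm[measurable]: "w \<in> borel_measurable borel" unfolding w_def[abs_def] by measurable
  have supp: "b s = 0" "w s = 0" if "s \<notin> {1/2..2}" for s using that by (simp_all add: b_def w_def)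
  have b0: "0 <= b s" for s
    using psi_bounds(1)[OF Phi, of s] by (cases "s \<in> {1/2..2}") (auto simp: b_def)
  have w0: "0 <= w s" for s using b0[of s] by (simp add: w_def)
  have pc: "continuous_on S (psi Phi)" for S by (rule continuous_on_subset[OF psi_continuous[OF Phi]]) simp
  have beq: "b s = psi Phi s * s ^ (m + 1) * exp (- s\<^sup>2 / 2)" if "s \<in> {1/4..3}" for s
  proof (cases "s \<in> {1/2..2}")
    case False
    then have "psi Phi s = 0" using that by (intro psi_bounds(3)[OF Phi]) auto
    then show ?thesis using False by (simp add: b_def)
  qed (simp add: b_def)
  have "continuous_on {1/4..3} (%s. psi Phi s * s ^ (m + 1) * exp (- s\<^sup>2 / 2))"
    by (intro continuous_on_mult pc continuous_intros) auto
  then have bc: "continuous_on {1/4..3} b" by (rule continuous_on_eq) (rule beq[symmetric])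
  have wc: "continuous_on {1/4..3} w"
    unfolding w_def[abs_def] by (intro continuous_on_mult bc continuous_on_powr continuous_intros) auto
  have int_of_cont: "integrable lborel f" if "continuous_on {1/4..3} f" "\<And>s. s \<notin> {1/2..2} ==> f s = 0" for f :: "real => real"
  proof -
    have "integrable lborel (%s. indicator {1/4..3::real} s *\<^sub>R f s)"
      using borel_integrable_compact[OF _ that(1)] by (simp add: if_distrib indicator_def cong: if_cong)
    also have "(%s. indicator {1/4..3::real} s *\<^sub>R f s) = f" using that(2) by (force simp: indicator_def fun_eq_iff)
    finally show ?thesis .
  qed
  have bi: "integrable lborel b" by (rule int_of_cont[OF bc supp(1)])
  have wi: "integrable lborel w" by (rule int_of_cont[OF wc supp(2)])
  have cw: "integrable lborel (%s. cis (\<theta> s) * of_real (w s))" if [measurable]: "\<theta> \<in> borel_measurable borel" for \<theta>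
    by (rule Bochner_Integration.integrable_bound[OF wi]) (auto simp: norm_mult)
  define I0 where "I0 = (LBINT s. w s)"
  define I1 where "I1 = (LBINT s. b s)"
  have I1: "0 <= I1" unfolding I1_def by (rule integral_nonneg_AE) (simp add: b0)
  \<comment> \<open>The amplitude is nonnegative and continuous, and positive at 1 because
    \<open>psi Phi 1 = 1\<close>.\<close>
  have I0: "0 < I0"
  proof -
    have "b 1 = exp (- 1 / 2)" using psi_1[OF Phi] by (simp add: b_def)
    then have "0 < w 1" by (simp add: w_def)
    have hk: "I0 = integral {1/4..3} w"
    proof -
      have "I0 = (\<integral>s\<in>{1/4..3}. w s \<partial>lborel)"
        unfolding I0_def set_lebesgue_integral_def using supp(2) by (intro Bochner_Integration.integral_cong) (force simp: indicator_def)+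
      also have "... = integral {1/4..3} w"
        by (rule set_borel_integral_eq_integral(2)) (use wi in \<open>simp add: set_integrable_def integrable_mult_indicator[of _ lborel w, simplified]\<close>)
      finally show ?thesis .
    qed
    have "I0 \<noteq> 0"
    proof
      assume "I0 = 0"
      moreover have "w integrable_on {1/4..3}" by (rule integrable_continuous_interval[OF wc])
      ultimately have "(w has_integral 0) (cbox (1/4) 3)" using hk by (simp add: has_integral_integrable_integral)
      then have "w 1 = 0" by (rule has_integral_0_cbox_imp_0[rotated 2]) (use wc w0 in auto)
      with \<open>0 < w 1\<close> show False by simp
    qed
    moreover have "0 <= I0" unfolding I0_def by (rule integral_nonneg_AE) (simp add: w0)
    ultimately show ?thesis by simp
  qed
  \<comment> \<open>As \<open>w\<close> is nonnegative, changing the phase by at most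
    \<open>\<beta>\<close> costs at most the fraction \<open>\<beta>\<close> of the mass. With the
    constants 1/16 the total change is at most 1/16 * 2 + 1/8 = 1/4 for \<open>W1\<close> and 1/8
    for \<open>W2\<close>.\<close>
  have pert: "norm ((LBINT s. cis (R * s + \<theta> s) * of_real (w s)) - (LBINT s. cis (R * s) * of_real (w s))) <= \<beta> * I0"
    if [measurable]: "\<theta> \<in> borel_measurable borel" and \<theta>: "\<And>s. s \<in> {1/2..2} ==> \<bar>\<theta> s\<bar> <= \<beta>" for R \<theta> \<beta>
  proof -
    have i: "integrable lborel (%s. cis (R * s + \<theta> s) * of_real (w s))" "integrable lborel (%s. cis (R * s) * of_real (w s))"
      by (rule cw, measurable)+
    have "(LBINT s. cis (R * s + \<theta> s) * of_real (w s)) - (LBINT s. cis (R * s) * of_real (w s))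
      = (LBINT s. cis (R * s + \<theta> s) * of_real (w s) - cis (R * s) * of_real (w s))"
      by (rule Bochner_Integration.integral_diff[OF i, symmetric])
    also have "norm ... <= (LBINT s. norm (cis (R * s + \<theta> s) * of_real (w s) - cis (R * s) * of_real (w s)))" by (rule integral_norm_bound)
    also have "... <= (LBINT s. \<beta> * w s)"
    proof (rule integral_mono)
      fix s
      have "cis (R * s + \<theta> s) * of_real (w s) - cis (R * s) * of_real (w s) = cis (R * s) * (cis (\<theta> s) - 1) * of_real (w s)"
        unfolding cis_mult[symmetric] by (simp add: algebra_simps)
      then have n: "norm (cis (R * s + \<theta> s) * of_real (w s) - cis (R * s) * of_real (w s)) = norm (cis (\<theta> s) - 1) * w s"
        using w0[of s] by (simp add: norm_mult)
      show "norm (cis (R * s + \<theta> s) * of_real (w s) - cis (R * s) * of_real (w s)) <= \<beta> * w s"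
        unfolding n
      proof (cases "s \<in> {1/2..2}")
        case True
        show "norm (cis (\<theta> s) - 1) * w s <= \<beta> * w s" by (rule mult_right_mono[OF order_trans[OF norm_cis_diff_le \<theta>[OF True]] w0])
      qed (simp add: supp)
    qed (use i wi in auto)
    also have "... = \<beta> * I0" by (simp add: I0_def)
    finally show ?thesis .
  qed
  obtain R0 where R0: "\<And>R. R0 <= R ==> norm (LBINT s. cis (R * s) * of_real (w s)) <= I0 / 8"
    using riemann_lebesgue[OF wc supp(2) wi, of "I0 / 8"] I0 by auto
  define E where "E = C * 2 powr (N + 1) * I1"
  have E: "0 <= E" using C I1 by (simp add: E_def)
  \<comment> \<open>The main terms leave (3/4 - 1/4) |a| I0 = 2 c, and the remainder takes away at
    most \<open>c\<close> as soon as \<open>E / c <= r\<close>.\<close>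
  define c where "c = norm a * I0 / 4"
  have na: "0 < norm a" using a by simp
  have c0: "0 < c" using na I0 by (simp add: c_def)
  define A where "A = max (max 1 R0) (E / c) + 1"
  show thesis
  proof (rule that[of c A])
    show "0 < c" by (rule c0)
    show "1 <= A" by (simp add: A_def)
    fix \<tau> r \<mu> :: real
    assume r: "A <= r" and \<tau>: "\<bar>\<tau> - r\<bar> <= 1/16" and \<mu>: "0 <= \<mu>" "\<mu> <= 1/16"
    have r1: "1 <= r" "R0 <= r" "E / c <= r" using r by (auto simp: A_def)
    have sq2: "s powr (1/2) <= 2" "0 <= s powr (1/2)" if "s \<in> {1/2..2}" for s :: real
    proof -
      have "s powr (1/2) = sqrt s" using that by (intro powr_half_sqrt) auto
      also have "... <= sqrt 4" using that by (intro real_sqrt_le_mono) auto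
      finally show "s powr (1/2) <= 2" by simp
    qed simp
    have m2: "\<bar>\<mu> * s powr (1/2)\<bar> <= 1/8" if "s \<in> {1/2..2}" for s
      using mult_mono[OF \<mu>(2) sq2(1)[OF that]] \<mu> by (simp add: abs_mult)
    define W1 where "W1 = (LBINT s. cis ((\<tau> - r) * s + \<mu> * s powr (1/2)) * of_real (w s))"
    define W2 where "W2 = (LBINT s. cis ((\<tau> + r) * s + \<mu> * s powr (1/2)) * of_real (w s))"
    have W1: "norm (W1 - of_real I0) <= 1/4 * I0"
    proof -
      have "norm ((LBINT s. cis (0 * s + ((\<tau> - r) * s + \<mu> * s powr (1/2))) * of_real (w s)) - (LBINT s. cis (0 * s) * of_real (w s))) <= 1/4 * I0"
      proof (rule pert)
        fix s :: real assume s: "s \<in> {1/2..2}"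
        have "\<bar>(\<tau> - r) * s\<bar> <= 1/16 * 2" unfolding abs_mult using \<tau> s by (intro mult_mono) auto
        with m2[OF s] show "\<bar>(\<tau> - r) * s + \<mu> * s powr (1/2)\<bar> <= 1/4" by linarith
      qed measurable
      then show ?thesis by (simp add: W1_def I0_def)
    qed
    have W2: "norm W2 <= 1/4 * I0"
    proof -
      have "norm (W2 - (LBINT s. cis ((\<tau> + r) * s) * of_real (w s))) <= 1/8 * I0"
        unfolding W2_def by (rule pert[OF _ m2]) measurable
      moreover have "norm (LBINT s. cis ((\<tau> + r) * s) * of_real (w s)) <= I0 / 8" using r1 \<tau> by (intro R0) linarith
      ultimately show ?thesis using norm_triangle_sub[of W2 "\<integral>s. cis ((\<tau> + r) * s) * of_real (w s) \<partial>lborel"] by simp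
    qed
    define V where "V = (LBINT s. cis (\<tau> * s + \<mu> * s powr (1/2)) * (of_real (Jm m (r * s)) * of_real (b s)))"
    define U where "U = of_real (r powr - N) * (cnj a * W1 + a * W2)"
    have "norm (V - U) <= E * r powr (- N - 1)"
    proof -
      define f1 where "f1 s = cis (\<tau> * s + \<mu> * s powr (1/2)) * (of_real (Jm m (r * s)) * of_real (b s))" for s
      define f2 where "f2 s = of_real (r powr - N) * (cnj a * (cis ((\<tau> - r) * s + \<mu> * s powr (1/2)) * of_real (w s)) + a * (cis ((\<tau> + r) * s + \<mu> * s powr (1/2)) * of_real (w s)))" for s
      have i1: "integrable lborel f1"
      proof (rule Bochner_Integration.integrable_bound[where f = "%s. pi * b s"])
        show "f1 \<in> borel_measurable lborel" unfolding f1_def[abs_def] by measurable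
        show "AE s in lborel. norm (f1 s) <= norm (pi * b s)"
          unfolding f1_def norm_mult norm_cis norm_of_real using Jm_le_pi[of m] by (auto intro!: mult_right_mono)
      qed (use bi in simp)
      have iw: "integrable lborel (%s. cis ((\<tau> + \<sigma>) * s + \<mu> * s powr (1/2)) * of_real (w s))" for \<sigma>
        by (rule cw) measurable
      have i2: "integrable lborel f2" unfolding f2_def[abs_def]
        using iw[of "- r"] iw[of r] by (intro integrable_mult_right Bochner_Integration.integrable_add) simp_all
      have "U = (LBINT s. f2 s)"
        unfolding f2_def U_def W1_def W2_def
        using iw[of "- r"] iw[of r] by (simp add: Bochner_Integration.integral_add)
      then have "V - U = (LBINT s. f1 s - f2 s)"
        unfolding V_def f1_def[symmetric] by (simp add: Bochner_Integration.integral_diff[OF i1 i2])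
      also have "norm ... <= (LBINT s. norm (f1 s - f2 s))" by (rule integral_norm_bound)
      also have "... <= (LBINT s. C * 2 powr (N + 1) * r powr (- N - 1) * b s)"
      proof (rule integral_mono)
        fix s
        show "norm (f1 s - f2 s) <= C * 2 powr (N + 1) * r powr (- N - 1) * b s"
        proof (cases "s \<in> {1/2..2}")
          case True
          define l where "l = r * s"
          have l: "1/2 <= l" unfolding l_def using mult_mono[of 1 r "1/2" s] r1 True by auto
          have lN: "l powr - N = r powr - N * s powr - N" unfolding l_def by (rule powr_mult)
          have c1: "cis ((\<tau> - r) * s + \<mu> * s powr (1/2)) = cis (\<tau> * s + \<mu> * s powr (1/2)) * cis (- l)"
            unfolding cis_mult l_def by (simp add: algebra_simps)
          have c2: "cis ((\<tau> + r) * s + \<mu> * s powr (1/2)) = cis (\<tau> * s + \<mu> * s powr (1/2)) * cis l"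
            unfolding cis_mult l_def by (simp add: algebra_simps)
          have "f1 s - f2 s = cis (\<tau> * s + \<mu> * s powr (1/2)) * ((of_real (Jm m l) - of_real (l powr - N) * (a * cis l + cnj a * cis (- l))) * of_real (b s))"
            unfolding f1_def f2_def c1 c2 lN w_def l_def[symmetric] of_real_mult by (simp add: algebra_simps)
          then have "norm (f1 s - f2 s) = norm (of_real (Jm m l) - of_real (l powr - N) * (a * cis l + cnj a * cis (- l))) * b s"
            using b0[of s] by (simp add: norm_mult)
          also have "... <= C * l powr (- N - 1) * b s" by (rule mult_right_mono[OF as[OF l] b0])
          also have "... <= C * (2 powr (N + 1) * r powr (- N - 1)) * b s"
          proof (intro mult_right_mono mult_left_mono)
            have "l powr (- N - 1) <= (r * (1/2)) powr (- N - 1)" unfolding l_def using r1 True N by (intro powr_mono2') auto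
            also have "... = r powr (- N - 1) * (1/2) powr (- N - 1)" by (rule powr_mult)
            also have "(1/2 :: real) powr (- N - 1) = 2 powr (N + 1)" by (simp add: powr_divide powr_minus_divide[symmetric] add.commute)
            finally show "l powr (- N - 1) <= 2 powr (N + 1) * r powr (- N - 1)" by (simp add: mult.commute)
          qed (use C b0 in auto)
          finally show ?thesis by (simp add: mult.assoc)
        next
          case False then show ?thesis by (simp add: f1_def f2_def supp)
        qed
      qed (use i1 i2 bi in auto)
      also have "... = E * r powr (- N - 1)" by (simp add: E_def I1_def)
      finally show ?thesis .
    qed
    also have "... <= c * r powr - N"
    proof -
      have "E <= c * r" using r1(3) c0 by (simp add: pos_divide_le_eq mult.commute)
      then have "E * r powr (- N - 1) <= c * r * r powr (- N - 1)" by (rule mult_right_mono) simp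
      also have "... = c * (r powr 1 * r powr (- N - 1))" using r1(1) by simp
      also have "r powr 1 * r powr (- N - 1) = r powr - N" unfolding powr_add[symmetric] by simp
      finally show ?thesis .
    qed
    finally have VU: "norm (V - U) <= c * r powr - N" .
    have "2 * c * r powr - N <= norm U"
    proof -
      have "norm (of_real I0 :: complex) - norm W1 <= norm (of_real I0 - W1)" by (rule norm_triangle_ineq2)
      then have "3/4 * I0 <= norm W1" using W1 I0 by (simp add: norm_minus_commute)
      then have "norm a * (3/4 * I0) <= norm (cnj a * W1)" unfolding norm_mult complex_mod_cnj by (rule mult_left_mono) simp
      moreover have "norm (a * W2) <= norm a * (1/4 * I0)" unfolding norm_mult by (rule mult_left_mono[OF W2]) simp
      moreover have "norm (cnj a * W1) - norm (a * W2) <= norm (cnj a * W1 + a * W2)" using norm_triangle_ineq2[of "cnj a * W1" "- (a * W2)"] by simp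
      moreover have "2 * c = norm a * (3/4 * I0) - norm a * (1/4 * I0)" by (simp add: c_def algebra_simps)
      ultimately have "2 * c <= norm (cnj a * W1 + a * W2)" by linarith
      then have "r powr - N * (2 * c) <= r powr - N * norm (cnj a * W1 + a * W2)" by (rule mult_left_mono) simp
      then show ?thesis by (simp add: U_def norm_mult mult_ac)
    qed
    moreover have "norm U - norm V <= norm (V - U)" using norm_triangle_ineq2[of U V] by (simp add: norm_minus_commute)
    ultimately show "c * r powr - N <= norm (LBINT s. cis (\<tau> * s + \<mu> * s powr (1/2)) * (of_real (Jm m (r * s)) * of_real (b s)))"
      using VU unfolding V_def by linarith
  qed
qed

text \<open>One family for both counterexamples: \<delta> = 0 is the wave equation, and \<delta> = 1
  adds curvature of lower order at high frequency. Then m(k) - \<alpha>(k) = 1/2 for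
  \<open>k \<ge> 0\<close>, and the perturbation is invisible up to times t with 2^k t of order
  2^(k/2).\<close>

definition root_phase :: "real => real => real" where
  "root_phase \<delta> r = r + \<delta> * r powr (1/2)"

definition root_phase_deriv :: "real => nat => real => real" where
  "root_phase_deriv \<delta> j r = (if j = 0 then r else if j = 1 then 1 else 0) + \<delta> * ((\<Prod>i<j. 1/2 - real i) * r powr (1/2 - real j))"

section \<open>Smoothness and hypotheses for the counterexample phases\<close>

lemma root_phase_deriv_has_derivative:
  assumes "0 < r"
  shows "(root_phase_deriv \<delta> j has_real_derivative root_phase_deriv \<delta> (Suc j) r) (at r)"
proof -
  have 1: "((%r. if j = 0 then r else if j = 1 then 1 else 0) has_real_derivative (if Suc j = 0 then r else if Suc j = 1 then 1 else 0)) (at r)"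
    by (cases "j = 0") auto
  have "((%r. r powr (1/2 - real j)) has_real_derivative (1/2 - real j) * r powr (1/2 - real j - 1)) (at r)"
    by (rule has_real_derivative_powr[OF assms])
  then have 2: "((%r. \<delta> * ((\<Prod>i<j. 1/2 - real i) * r powr (1/2 - real j))) has_real_derivative
     \<delta> * ((\<Prod>i<j. 1/2 - real i) * ((1/2 - real j) * r powr (1/2 - real j - 1)))) (at r)"
    by (intro DERIV_cmult)
  have "1/2 - real j - 1 = 1/2 - real (Suc j)" by simp
  with DERIV_add[OF 1 2] show ?thesis unfolding root_phase_deriv_def[abs_def] by (simp add: mult.assoc)
qed

lemma root_phase_derivs:
  assumes "0 < r"
  shows "(deriv ^^ j) (root_phase \<delta>) r = root_phase_deriv \<delta> j r"
  using assms
proof (induction j arbitrary: r)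
  case 0
  then show ?case by (simp add: root_phase_def root_phase_deriv_def)
next
  case (Suc j)
  have "((deriv ^^ j) (root_phase \<delta>) has_real_derivative root_phase_deriv \<delta> (Suc j) r) (at r)"
    by (rule has_field_derivative_transform_within_open[OF root_phase_deriv_has_derivative[OF Suc.prems], of "{0<..}"])
      (use Suc in auto)
  then show ?case by (simp add: DERIV_imp_deriv)
qed

lemma root_phase_smooth: "smooth_real_on {0<..} (root_phase \<delta>)"
  unfolding smooth_real_on_def
proof (intro allI ballI)
  fix j and r :: real assume r: "r \<in> {0<..}"
  have "((deriv ^^ j) (root_phase \<delta>) has_real_derivative root_phase_deriv \<delta> (Suc j) r) (at r)"
    by (rule has_field_derivative_transform_within_open[OF root_phase_deriv_has_derivative, of _ "{0<..}"])
      (use r root_phase_derivs in auto)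
  then show "(deriv ^^ j) (root_phase \<delta>) differentiable (at r)" by (auto simp: real_differentiable_def)
qed

lemma root_phase_deriv1: "0 < r ==> deriv (root_phase \<delta>) r = 1 + \<delta> / 2 * r powr (- 1/2)"
  using root_phase_derivs[of r 1 \<delta>] by (simp add: root_phase_deriv_def)

lemma root_phase_deriv2: "0 < r ==> deriv (deriv (root_phase \<delta>)) r = - \<delta> / 4 * r powr (- 3/2)"
  using root_phase_derivs[of r 2 \<delta>] by (simp add: root_phase_deriv_def numeral_2_eq_2)

lemma root_phase_higher:
  "0 < r ==> 2 <= j ==> \<bar>(deriv ^^ j) (root_phase \<delta>) r\<bar> = \<bar>\<delta> * (\<Prod>i<j. 1/2 - real i)\<bar> * r powr (1/2 - real j)"
  by (simp add: root_phase_derivs root_phase_deriv_def abs_mult)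

lemma root_phase_H1: assumes "0 <= \<delta>" shows "H1 (root_phase \<delta>) 1"
  unfolding H1_def
proof (intro conjI allI impI)
  show "\<exists>c C. 0 < c \<and> 0 < C \<and> (\<forall>r\<ge>1. c * r powr (1 - 1) <= \<bar>deriv (root_phase \<delta>) r\<bar> \<and> \<bar>deriv (root_phase \<delta>) r\<bar> <= C * r powr (1 - 1))"
  proof (rule exI[of _ 1], rule exI[of _ "1 + \<delta> / 2"], intro conjI allI impI)
    fix r :: real assume r: "1 <= r"
    have "r powr (- 1/2) <= r powr 0" using r by (intro powr_mono) auto
    then have "\<delta> / 2 * r powr (- 1/2) <= \<delta> / 2 * 1" using r assms by (intro mult_left_mono) auto
    moreover have "0 <= \<delta> / 2 * r powr (- 1/2)" using assms by simp
    ultimately show "1 * r powr (1 - 1) <= \<bar>deriv (root_phase \<delta>) r\<bar>" "\<bar>deriv (root_phase \<delta>) r\<bar> <= (1 + \<delta> / 2) * r powr (1 - 1)"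
      using r by (simp_all add: root_phase_deriv1 abs_of_nonneg)
  qed (use assms in auto)
  fix j :: nat assume j: "2 <= j"
  show "\<exists>C. \<forall>r\<ge>1. \<bar>(deriv ^^ j) (root_phase \<delta>) r\<bar> <= C * r powr (1 - real j)"
  proof (intro exI allI impI)
    fix r :: real assume "1 <= r"
    then show "\<bar>(deriv ^^ j) (root_phase \<delta>) r\<bar> <= \<bar>\<delta> * (\<Prod>i<j. 1/2 - real i)\<bar> * r powr (1 - real j)"
      using j by (simp only: root_phase_higher[of r j \<delta>]) (intro mult_left_mono powr_mono, auto)
  qed
qed simp

lemma root_phase_H2: "H2 (root_phase 0) 1" "H2 (root_phase 1) (1/2)"
proof -
  show "H2 (root_phase 0) 1" unfolding H2_def
  proof (intro conjI allI impI)
    show "\<exists>c C. 0 < c \<and> 0 < C \<and> (\<forall>r. 0 < r \<and> r < 1 --> c * r powr (1 - 1) <= \<bar>deriv (root_phase 0) r\<bar> \<and> \<bar>deriv (root_phase 0) r\<bar> <= C * r powr (1 - 1))"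
      by (intro exI[of _ 1]) (auto simp: root_phase_deriv1)
    fix j :: nat assume "2 <= j"
    then show "\<exists>C. \<forall>r. 0 < r \<and> r < 1 --> \<bar>(deriv ^^ j) (root_phase 0) r\<bar> <= C * r powr (1 - real j)"
      by (intro exI[of _ 0]) (auto simp: root_phase_higher)
  qed simp
  show "H2 (root_phase 1) (1/2)" unfolding H2_def
  proof (intro conjI allI impI)
    show "\<exists>c C. 0 < c \<and> 0 < C \<and> (\<forall>r. 0 < r \<and> r < 1 --> c * r powr (1/2 - 1) <= \<bar>deriv (root_phase 1) r\<bar> \<and> \<bar>deriv (root_phase 1) r\<bar> <= C * r powr (1/2 - 1))"
    proof (rule exI[of _ "1/2"], rule exI[of _ "3/2"], intro conjI allI impI)
      fix r :: real assume r: "0 < r \<and> r < 1"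
      have e: "(1/2 - 1 :: real) = - 1/2" by simp
      have "r powr 0 <= r powr (- 1/2)" using r by (intro powr_mono') auto
      then have "1 <= r powr (- 1/2)" using r by simp
      moreover have "deriv (root_phase 1) r = 1 + 1/2 * r powr (- 1/2)" using r by (simp only: root_phase_deriv1)
      ultimately show "1/2 * r powr (1/2 - 1) <= \<bar>deriv (root_phase 1) r\<bar>" "\<bar>deriv (root_phase 1) r\<bar> <= 3/2 * r powr (1/2 - 1)"
        unfolding e by linarith+
    qed auto
    fix j :: nat assume j: "2 <= j"
    show "\<exists>C. \<forall>r. 0 < r \<and> r < 1 --> \<bar>(deriv ^^ j) (root_phase 1) r\<bar> <= C * r powr (1/2 - real j)"
      by (intro exI allI impI) (use j root_phase_higher in \<open>auto intro!: eq_refl\<close>)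
  qed simp
qed

lemma root_phase_H34: "H3 (root_phase 1) (1/2)" "H4 (root_phase 1) (1/2)"
proof -
  have e: "(1/2 - 2 :: real) = - 3/2" by simp
  have a: "\<bar>deriv (deriv (root_phase 1)) r\<bar> = 1/4 * r powr (1/2 - 2)" if "0 < r" for r
    unfolding e root_phase_deriv2[OF that] by (simp add: abs_mult)
  show "H3 (root_phase 1) (1/2)" unfolding H3_def by (intro exI[of _ "1/4"]) (auto simp: a simp del: diff_numeral_special)
  show "H4 (root_phase 1) (1/2)" unfolding H4_def by (intro exI[of _ "1/4"]) (auto simp: a simp del: diff_numeral_special)
qed

text \<open>At unit frequency the amplitude of the Gaussian datum is the same for all
  \<open>k\<close>. The phase is written so that \<tau> = kp t and \<mu> = kp t \<delta> kp^(-1/2)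
  of \<open>osc_lower_bound\<close> can be read off.\<close>

lemma osc_root_phase:
  fixes m :: nat and k :: int
  defines "kp \<equiv> 2 powr real_of_int k"
  defines "G \<equiv> %\<rho>. complex_of_real (exp (- (\<rho> / kp)\<^sup>2 / 2))"
  shows "osc m (freq_phase (root_phase \<delta>) k) (freq_amp Phi m k G) t r
    = (LBINT s. cis (kp * t * s + kp * t * \<delta> * kp powr (- 1/2) * s powr (1/2)) * (of_real (Jm m (r * s))
        * of_real (indicator {1/2..2} s * (psi Phi s * s ^ (m + 1)) * exp (- s\<^sup>2 / 2))))"
  unfolding osc_def
proof (rule Bochner_Integration.integral_cong[OF refl])
  fix s :: real
  have kp: "0 < kp" by (simp add: kp_def)
  have amp: "freq_amp Phi m k G s = of_real (indicator {1/2..2} s * (psi Phi s * s ^ (m + 1)) * exp (- s\<^sup>2 / 2))"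
    unfolding freq_amp_def G_def kp_def[symmetric] using kp by simp
  show "cis (t * freq_phase (root_phase \<delta>) k s) * (of_real (Jm m (r * s)) * freq_amp Phi m k G s)
    = cis (kp * t * s + kp * t * \<delta> * kp powr (- 1/2) * s powr (1/2)) * (of_real (Jm m (r * s))
        * of_real (indicator {1/2..2} s * (psi Phi s * s ^ (m + 1)) * exp (- s\<^sup>2 / 2)))"
  proof (cases "s \<in> {1/2..2}")
    case True
    have k: "kp powr (1/2) = kp * kp powr (- 1/2)"
    proof -
      have "kp powr 1 * kp powr (- 1/2) = kp powr (1/2)" unfolding powr_add[symmetric] by simp
      then show ?thesis using kp by simp
    qed
    have "t * freq_phase (root_phase \<delta>) k s = kp * t * s + kp * t * \<delta> * kp powr (- 1/2) * s powr (1/2)"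
      using True unfolding freq_phase_def root_phase_def kp_def[symmetric] powr_mult k by (simp add: algebra_simps)
    then show ?thesis unfolding amp by simp
  next
    case False
    then show ?thesis unfolding amp by simp
  qed
qed

text \<open>At radius \<open>r\<close> the integral in time is restricted to the window |kp t - r|
  <= 1/16 of length 1/(8 kp). There the \<open>q\<close>-th power is at least a multiple of r^(-N
  q), and with the polar Jacobian r^(m+1) this gives \<open>r powr p\<close>. The smallness
  condition on \<open>L\<close> keeps \<mu> below 1/16 for all radii up to \<open>L\<close>.\<close>

lemma sol_gaussian_lower_bound:
  fixes q :: real
  assumes dim: "CARD('n) = m + 2" and Phi: "cutoff Phi" and q: "0 < q"
  defines "p \<equiv> (real m + 1) * (1 - q / 2)"
  obtains c A where "0 < c" "1 <= A"
    "\<And>\<delta> k L. 0 <= \<delta> ==> \<delta> * (2 powr real_of_int k) powr (- 1/2) * (L + 1) <= 1/16 ==>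
      ennreal (c * 2 powr ((real (m + 2) * q - real (m + 2) - 1) * real_of_int k)) * (NNINT r. ennreal (r powr p) * indicator {A..L} r)
      <= (\<integral>\<^sup>+z. ennreal (norm (sol Phi (root_phase \<delta>) k (%\<xi>::real^'n. complex_of_real (exp (- (norm \<xi> / 2 powr real_of_int k)\<^sup>2 / 2))) (fst z) (snd z)) powr q)
          \<partial>(lborel :: (real \<times> (real^'n)) measure))"
proof -
  define N where "N = (real m + 1) / 2"
  define P where "P = polar_const m * Jm m 0"
  have P: "0 < P" using polar_const_pos[of m] Jm_pos[of 0 m] by (simp add: P_def)
  define E where "E = (2 * pi) powr (- real (m + 2)) * polar_const m"
  have E: "0 < E" using polar_const_pos[of m] by (simp add: E_def)
  obtain c A where cA: "0 < c" "1 <= A" and lo: "\<And>\<tau> r \<mu>. A <= r ==> \<bar>\<tau> - r\<bar> <= 1/16 ==> 0 <= \<mu> ==> \<mu> <= 1/16 ==>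
      c * r powr - N <= norm (LBINT s. cis (\<tau> * s + \<mu> * s powr (1/2)) * (of_real (Jm m (r * s)) * of_real (indicator {1/2..2} s * (psi Phi s * s ^ (m + 1)) * exp (- s\<^sup>2 / 2))))"
  proof (rule osc_lower_bound[OF Phi, of m, folded N_def], goal_cases)
    case (1 c A) from 1(2-) show thesis by (rule that)
  qed
  define c' where "c' = E powr q * P * c powr q / 8"
  show thesis
  proof (rule that[of c' A])
    show "0 < c'" using E P cA by (simp add: c'_def)
    show "1 <= A" by (rule cA)
    fix \<delta> L :: real and k :: int
    assume \<delta>: "0 <= \<delta>" and small: "\<delta> * (2 powr real_of_int k) powr (- 1/2) * (L + 1) <= 1/16"
    define kp where "kp = 2 powr real_of_int k"
    have kp: "0 < kp" by (simp add: kp_def)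
    define G where "G = (%\<rho>. complex_of_real (exp (- (\<rho> / kp)\<^sup>2 / 2)))"
    have Gm: "G \<in> borel_measurable borel" unfolding G_def by measurable
    define g where "g = (%\<xi>::real^'n. complex_of_real (exp (- (norm \<xi> / kp)\<^sup>2 / 2)))"
    have gG: "g \<xi> = G (norm \<xi>)" for \<xi> by (simp add: g_def G_def)
    have g: "L2 g" using fourier_gaussian(4)[OF kp, where 'a = "real^'n"] unfolding g_def is_L2_fourier_def by blast
    define J where "J = (NNINT r. ennreal (r powr p) * indicator {A..L} r)"
    define K where "K = kp ^ (m + 2)"
    have K: "0 < K" using kp by (simp add: K_def)
    define W where "W t r = osc m (freq_phase (root_phase \<delta>) k) (freq_amp Phi m k G) t r" for t r
    define F where "F r = ennreal (c powr q / (8 * kp)) * (ennreal (r powr (- N * q)) * indicator {A..L} r)" for r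
    have Fm[measurable]: "F \<in> borel_measurable borel" unfolding F_def[abs_def] by measurable
    have inner: "F r <= (NNINT t. ennreal (norm (W t r) powr q))" for r
    proof (cases "r \<in> {A..L}")
      case True
      define B where "B = ennreal ((c * r powr - N) powr q)"
      have "F r = B * ennreal (1 / (8 * kp))"
        using True kp unfolding F_def B_def powr_mult powr_powr by (simp add: ennreal_mult[symmetric])
      also have "... = (NNINT t. B * indicator {(r - 1/16) / kp..(r + 1/16) / kp} t)"
      proof -
        have le: "(r - 1/16) / kp <= (r + 1/16) / kp" using kp by (intro divide_right_mono) auto
        have "(r + 1/16) / kp - (r - 1/16) / kp = 1 / (8 * kp)" unfolding diff_divide_distrib[symmetric] by simp
        then have "emeasure lborel {(r - 1/16) / kp..(r + 1/16) / kp} = ennreal (1 / (8 * kp))" using le by (simp add: emeasure_lborel_Icc)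
        then show ?thesis by (subst nn_integral_cmult_indicator) simp_all
      qed
      also have "... <= (NNINT t. ennreal (norm (W t r) powr q))"
      proof (rule nn_integral_mono)
        fix t
        show "B * indicator {(r - 1/16) / kp..(r + 1/16) / kp} t <= ennreal (norm (W t r) powr q)"
        proof (cases "t \<in> {(r - 1/16) / kp..(r + 1/16) / kp}")
          case t: True
          then have "r - 1/16 <= kp * t" "kp * t <= r + 1/16" using kp by (simp_all add: pos_divide_le_eq pos_le_divide_eq mult.commute)
          moreover have "1 <= r" "r <= L" using True cA by auto
          ultimately have t1: "\<bar>kp * t - r\<bar> <= 1/16" "0 <= kp * t" "kp * t <= L + 1" by linarith+
          have \<mu>: "kp * t * \<delta> * kp powr (- 1/2) <= 1/16"
          proof -
            have "(kp * t) * (\<delta> * kp powr (- 1/2)) <= (L + 1) * (\<delta> * kp powr (- 1/2))" using t1 \<delta> by (intro mult_right_mono) auto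
            then show ?thesis using small unfolding kp_def[symmetric] by (simp add: mult_ac)
          qed
          have "c * r powr - N <= norm (W t r)"
            unfolding W_def G_def kp_def osc_root_phase unfolding kp_def[symmetric]
            by (rule lo) (use True t1 \<mu> \<delta> kp in auto)
          then have "(c * r powr - N) powr q <= norm (W t r) powr q" using cA q by (intro powr_mono2) auto
          then show ?thesis using t by (simp add: B_def ennreal_leI)
        qed simp
      qed
      finally show ?thesis .
    qed (simp add: F_def)
    have "(NNINT (y::real^'n). F (norm y)) = ennreal P * (NNINT r. F r * ennreal (r ^ (m + 1)) * indicator {0..} r)"
      unfolding P_def by (rule polar_nn_integral[OF dim Fm])
    also have "(NNINT r. F r * ennreal (r ^ (m + 1)) * indicator {0..} r) = (NNINT r. ennreal (c powr q / (8 * kp)) * (ennreal (r powr p) * indicator {A..L} r))"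
    proof (rule nn_integral_cong)
      fix r :: real
      show "F r * ennreal (r ^ (m + 1)) * indicator {0..} r = ennreal (c powr q / (8 * kp)) * (ennreal (r powr p) * indicator {A..L} r)"
      proof (cases "r \<in> {A..L}")
        case True
        then have r: "0 < r" using cA by auto
        have "r powr (- N * q) * r ^ (m + 1) = r powr (- N * q) * r powr real (m + 1)" using r by (simp only: powr_realpow)
        also have "... = r powr p" unfolding powr_add[symmetric] p_def N_def by (intro arg_cong[of _ _ "(powr) r"]) (simp add: algebra_simps)
        finally have "ennreal (r powr (- N * q)) * ennreal (r ^ (m + 1)) = ennreal (r powr p)" using r by (subst ennreal_mult[symmetric]) auto
        then show ?thesis using True r by (simp add: F_def mult.assoc)
      qed (simp add: F_def)
    qed
    also have "... = ennreal (c powr q / (8 * kp)) * J" unfolding J_def by (rule nn_integral_cmult) measurable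
    finally have Fi: "(NNINT (y::real^'n). F (norm y)) = ennreal P * (ennreal (c powr q / (8 * kp)) * J)" .
    have c': "c' * 2 powr ((real (m + 2) * q - real (m + 2) - 1) * real_of_int k) = (E * K) powr q * (1 / K * (P * (c powr q / (8 * kp))))"
    proof -
      have K': "K = kp powr real (m + 2)" using kp by (simp only: K_def powr_realpow)
      have "2 powr ((real (m + 2) * q - real (m + 2) - 1) * real_of_int k) = kp powr (real (m + 2) * q + - real (m + 2) + - 1)"
        unfolding kp_def powr_powr by (simp add: mult.commute)
      also have "... = K powr q * (1 / K) * (1 / kp)" unfolding powr_add K' powr_powr powr_minus_divide using kp by simp
      finally show ?thesis unfolding powr_mult c'_def by (simp add: mult_ac)
    qed
    have "ennreal (c' * 2 powr ((real (m + 2) * q - real (m + 2) - 1) * real_of_int k)) * J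
      = ennreal ((E * K) powr q) * (ennreal (1 / K) * (ennreal P * (ennreal (c powr q / (8 * kp)) * J)))"
    proof -
      have *: "ennreal (v * (w * (x * y))) * J = ennreal v * (ennreal w * (ennreal x * (ennreal y * J)))"
        if "0 <= v" "0 <= w" "0 <= x" "0 <= y" for v w x y :: real
        using that by (simp add: ennreal_mult mult.assoc)
      show ?thesis unfolding c' by (rule *) (use K P kp in auto)
    qed
    also have "... <= ennreal ((E * K) powr q) * (ennreal (1 / K) * (NNINT (y::real^'n). (NNINT t. ennreal (norm (W t (norm y)) powr q))))"
      unfolding Fi[symmetric] by (intro mult_left_mono nn_integral_mono inner) auto
    also have "... = (\<integral>\<^sup>+z. ennreal (norm (sol Phi (root_phase \<delta>) k g (fst z) (snd z)) powr q) \<partial>(lborel :: (real \<times> (real^'n)) measure))"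
      unfolding sol_Lq_eq[OF dim Phi root_phase_smooth g gG Gm] W_def E_def K_def kp_def ..
    finally show "ennreal (c' * 2 powr ((real (m + 2) * q - real (m + 2) - 1) * real_of_int k)) * (NNINT r. ennreal (r powr p) * indicator {A..L} r)
      <= (\<integral>\<^sup>+z. ennreal (norm (sol Phi (root_phase \<delta>) k (%\<xi>::real^'n. complex_of_real (exp (- (norm \<xi> / 2 powr real_of_int k)\<^sup>2 / 2))) (fst z) (snd z)) powr q)
          \<partial>(lborel :: (real \<times> (real^'n)) measure))"
      unfolding J_def g_def kp_def .
  qed
qed

text \<open>Tested on the Gaussian of width 2^k, both sides of the estimate contain the same power
  \<open>2 powr Y\<close>. Once it cancels, the radial integral \<open>J\<close> is bounded by what
  the additional exponent \<open>e\<close> allows.\<close>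

lemma strichartz_necessary:
  fixes q C e :: real and k :: int
  assumes q: "0 < q" and dim: "CARD('n) = m + 2"
    and C: "\<And>(u :: real^'n => complex) g. radial u \<and> L2 u \<and> is_L2_fourier u g ==>
      Lq_bound (ereal q) (sol Phi phi k g) (C * 2 powr ((real (m + 2) / 2 - (real (m + 2) + 1) / q) * real_of_int k + e) * L2norm u)"
    and lo: "ennreal (c * 2 powr ((real (m + 2) * q - real (m + 2) - 1) * real_of_int k)) * J
      <= (\<integral>\<^sup>+z. ennreal (norm (sol Phi phi k (%\<xi>::real^'n. complex_of_real (exp (- (norm \<xi> / 2 powr real_of_int k)\<^sup>2 / 2))) (fst z) (snd z)) powr q)
          \<partial>(lborel :: (real \<times> (real^'n)) measure))"
    and c: "0 <= c"
  shows "ennreal c * J <= ennreal (\<bar>C\<bar> powr q * 2 powr (e * q))"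
proof -
  define kp where "kp = 2 powr real_of_int k"
  have kp: "0 < kp" by (simp add: kp_def)
  define g where "g = (%\<xi>::real^'n. complex_of_real (exp (- (norm \<xi> / kp)\<^sup>2 / 2)))"
  obtain u :: "real^'n => complex" where u: "radial u" "L2 u" "L2norm u <= sqrt (kp ^ (m + 2))" "is_L2_fourier u g"
    using fourier_gaussian[OF kp, where 'a = "real^'n"] dim unfolding g_def by simp
  define X where "X = (real (m + 2) / 2 - (real (m + 2) + 1) / q) * real_of_int k + e"
  define Y where "Y = (real (m + 2) * q - real (m + 2) - 1) * real_of_int k"
  have L0: "0 <= L2norm u" by (simp add: L2norm_def integral_nonneg_AE)
  have "ennreal (c * 2 powr Y) * J <= ennreal ((C * 2 powr X * L2norm u) powr q)"
    and B0: "0 <= C * 2 powr X * L2norm u"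
    using C[of u g] lo u unfolding Lq_bound_def g_def kp_def[symmetric] X_def[symmetric] Y_def[symmetric] by (auto intro: order_trans)
  note this(1)
  also have "ennreal ((C * 2 powr X * L2norm u) powr q) <= ennreal ((\<bar>C\<bar> * 2 powr X * sqrt (kp ^ (m + 2))) powr q)"
  proof -
    have "C * 2 powr X * L2norm u <= \<bar>C\<bar> * 2 powr X * sqrt (kp ^ (m + 2))"
      by (rule mult_mono[OF _ u(3)]) (use L0 in auto)
    with B0 q show ?thesis by (intro ennreal_leI powr_mono2[of q]) auto
  qed
  also have "(\<bar>C\<bar> * 2 powr X * sqrt (kp ^ (m + 2))) powr q = 2 powr Y * (\<bar>C\<bar> powr q * 2 powr (e * q))"
  proof -
    have "sqrt (kp ^ (m + 2)) = (kp powr real (m + 2)) powr (1/2)" using kp by (simp only: powr_realpow powr_half_sqrt zero_le_power less_imp_le)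
    also have "... = 2 powr (real (m + 2) / 2 * real_of_int k)" unfolding kp_def powr_powr by (simp add: mult_ac)
    finally have s: "sqrt (kp ^ (m + 2)) = 2 powr (real (m + 2) / 2 * real_of_int k)" .
    have "X * q + real (m + 2) / 2 * real_of_int k * q = Y + e * q"
    proof -
      define d where "d = (real (m + 2) + 1) / q"
      have d: "d * q = real (m + 2) + 1" using q by (simp add: d_def)
      have "X * q = (real (m + 2) / 2 * q - d * q) * real_of_int k + e * q" unfolding X_def d_def[symmetric] by (simp add: algebra_simps)
      then have "X * q = (real (m + 2) / 2 * q - (real (m + 2) + 1)) * real_of_int k + e * q" unfolding d .
      moreover have "(v / 2 * q - (v + 1)) * z + e * q + v / 2 * z * q = (v * q - v - 1) * z + e * q" for v z :: real
        by (simp add: field_simps)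
      ultimately show ?thesis unfolding Y_def by metis
    qed
    then show ?thesis unfolding s powr_mult powr_powr by (simp add: mult.assoc powr_add[symmetric] mult.left_commute[of "2 powr _"])
  qed
  finally have le: "ennreal (c * 2 powr Y) * J <= ennreal (2 powr Y * (\<bar>C\<bar> powr q * 2 powr (e * q)))" .
  have "ennreal (2 powr - Y) * (ennreal (c * 2 powr Y) * J) <= ennreal (2 powr - Y) * ennreal (2 powr Y * (\<bar>C\<bar> powr q * 2 powr (e * q)))"
    by (rule mult_left_mono[OF le]) simp
  moreover have "ennreal (2 powr - Y) * (ennreal (c * 2 powr Y) * J) = ennreal c * J"
  proof -
    have "ennreal (2 powr - Y) * (ennreal (c * 2 powr Y) * J) = ennreal (2 powr - Y * (c * 2 powr Y)) * J"
      using c by (simp only: mult.assoc[symmetric] ennreal_mult powr_ge_zero mult_nonneg_nonneg)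
    also have "2 powr - Y * (c * 2 powr Y) = c" by (simp add: powr_minus)
    finally show ?thesis .
  qed
  moreover have "ennreal (2 powr - Y) * ennreal (2 powr Y * (\<bar>C\<bar> powr q * 2 powr (e * q))) = ennreal (\<bar>C\<bar> powr q * 2 powr (e * q))"
    by (simp add: mult.assoc[symmetric] ennreal_mult[symmetric] powr_minus)
  ultimately show ?thesis by simp
qed

text \<open>In this range of \<open>q\<close> the exponent \<open>p\<close> is at least -1, so the
  radial integral over [A, L] diverges at least logarithmically. For \<delta> = 0 nothing restricts
  \<open>L\<close>, and frequency \<open>k = 0\<close> suffices.\<close>

lemma strichartz_fails:
  fixes q :: real
  assumes dim: "CARD('n) = m + 2" and Phi: "cutoff Phi" and q: "1 <= q" "q <= 2 * (real m + 2) / (real m + 1)"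
  shows "\<not> (\<exists>C. \<forall>(k::int) (u :: real^'n => complex) g. radial u \<and> L2 u \<and> is_L2_fourier u g -->
    Lq_bound (ereal q) (sol Phi (root_phase 0) k g) (C * 2 powr ((real (m + 2) / 2 - (real (m + 2) + sel k 1 1) / q) * real_of_int k) * L2norm u))"
proof (rule notI, elim exE)
  fix C
  assume C: "\<forall>(k::int) (u :: real^'n => complex) g. radial u \<and> L2 u \<and> is_L2_fourier u g -->
    Lq_bound (ereal q) (sol Phi (root_phase 0) k g) (C * 2 powr ((real (m + 2) / 2 - (real (m + 2) + sel k 1 1) / q) * real_of_int k) * L2norm u)"
  have q0: "0 < q" using q by simp
  define p where "p = (real m + 1) * (1 - q / 2)"
  obtain c A where cA: "0 < c" "1 <= A" and lo: "\<And>\<delta> k L. 0 <= \<delta> ==> \<delta> * (2 powr real_of_int k) powr (- 1/2) * (L + 1) <= 1/16 ==>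
      ennreal (c * 2 powr ((real (m + 2) * q - real (m + 2) - 1) * real_of_int k)) * (NNINT r. ennreal (r powr p) * indicator {A..L} r)
      <= (\<integral>\<^sup>+z. ennreal (norm (sol Phi (root_phase \<delta>) k (%\<xi>::real^'n. complex_of_real (exp (- (norm \<xi> / 2 powr real_of_int k)\<^sup>2 / 2))) (fst z) (snd z)) powr q)
          \<partial>(lborel :: (real \<times> (real^'n)) measure))"
  proof (rule sol_gaussian_lower_bound[OF dim Phi q0, folded p_def], goal_cases)
    case (1 c A) from 1(2-) show thesis by (rule that)
  qed
  have p: "- 1 <= p"
  proof -
    have "q * (real m + 1) <= 2 * (real m + 2)" using q by (simp add: pos_le_divide_eq)
    then show ?thesis by (simp add: p_def algebra_simps)
  qed
  define D where "D = \<bar>C\<bar> powr q"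
  \<comment> \<open>Makes ln L - ln A = (D + 1) / c, just enough to contradict the bound
    \<open>D\<close>.\<close>
  define L where "L = exp (ln A + (D + 1) / c)"
  have AL: "A <= L"
  proof -
    have "exp (ln A) <= L" unfolding L_def exp_le_cancel_iff using cA by (simp add: D_def add_nonneg_nonneg)
    then show ?thesis using cA by simp
  qed
  have "ennreal c * (NNINT r. ennreal (r powr p) * indicator {A..L} r) <= ennreal (\<bar>C\<bar> powr q * 2 powr (0 * q))"
  proof (rule strichartz_necessary[OF q0 dim, where k = 0 and e = 0 and phi = "root_phase 0" and Phi = Phi])
    fix u g :: "real^'n => complex" assume "radial u \<and> L2 u \<and> is_L2_fourier u g"
    with C have "Lq_bound (ereal q) (sol Phi (root_phase 0) 0 g) (C * 2 powr ((real (m + 2) / 2 - (real (m + 2) + sel 0 1 1) / q) * real_of_int 0) * L2norm u)" by blast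
    then show "Lq_bound (ereal q) (sol Phi (root_phase 0) 0 g) (C * 2 powr ((real (m + 2) / 2 - (real (m + 2) + 1) / q) * real_of_int 0 + 0) * L2norm u)" by simp
  next
    show "ennreal (c * 2 powr ((real (m + 2) * q - real (m + 2) - 1) * real_of_int 0)) * (NNINT r. ennreal (r powr p) * indicator {A..L} r)
      <= (\<integral>\<^sup>+z. ennreal (norm (sol Phi (root_phase 0) 0 (%\<xi>::real^'n. complex_of_real (exp (- (norm \<xi> / 2 powr real_of_int 0)\<^sup>2 / 2))) (fst z) (snd z)) powr q)
          \<partial>(lborel :: (real \<times> (real^'n)) measure))"
      by (rule lo) simp_all
  qed (use cA in simp)
  then have "ennreal c * (NNINT r. ennreal (r powr p) * indicator {A..L} r) <= ennreal D" by (simp add: D_def)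
  moreover have "ennreal ((D + 1) / c) <= (NNINT r. ennreal (r powr p) * indicator {A..L} r)"
  proof -
    have "(NNINT r. ennreal (inverse r) * indicator {A..L} r) = ennreal (ln L - ln A)"
    proof (rule nn_integral_FTC_Icc[OF _ _ _ AL])
      fix r assume "r \<in> {A..L}"
      then show "DERIV ln r :> inverse r" using cA by (intro DERIV_ln) auto
    qed (use cA in auto)
    also have "ln L - ln A = (D + 1) / c" by (simp add: L_def)
    finally have "ennreal ((D + 1) / c) = (NNINT r. ennreal (inverse r) * indicator {A..L} r)" ..
    also have "... <= (NNINT r. ennreal (r powr p) * indicator {A..L} r)"
    proof (rule nn_integral_mono)
      fix r
      show "ennreal (inverse r) * indicator {A..L} r <= ennreal (r powr p) * indicator {A..L} r"
      proof (cases "r \<in> {A..L}")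
        case True
        then have r: "1 <= r" using cA by auto
        have "r powr (- 1) <= r powr p" using p r by (rule powr_mono)
        then have "inverse r <= r powr p" using r by (simp add: powr_minus)
        then show ?thesis using True by (simp add: ennreal_leI)
      qed simp
    qed
    finally show ?thesis .
  qed
  ultimately have "ennreal c * ennreal ((D + 1) / c) <= ennreal D" by (meson mult_left_mono order_trans zero_le)
  then have "ennreal (D + 1) <= ennreal D" using cA by (simp add: ennreal_mult[symmetric] D_def)
  then show False by (simp add: D_def)
qed

text \<open>Smallness now limits the radii to \<open>L\<close> of order 2^(k/2), so the radial
  integral grows at least like 2^(k (p+1)/2). The \<open>q\<close>-th power of the permitted loss
  grows only like 2^(k (q/8 - 1/4)). The difference \<open>\<theta>\<close> of the rates is positive
  exactly below the threshold, so large \<open>k\<close> give a contradiction.\<close>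

lemma strichartz_curved_fails:
  fixes q :: real
  assumes dim: "CARD('n) = m + 2" and Phi: "cutoff Phi" and q: "1 <= q" "q < (4 * (real m + 2) + 2) / (2 * (real m + 2) - 1)"
  shows "\<not> (\<exists>C. \<forall>(k::int) (u :: real^'n => complex) g. radial u \<and> L2 u \<and> is_L2_fourier u g -->
    Lq_bound (ereal q) (sol Phi (root_phase 1) k g) (C * 2 powr ((real (m + 2) / 2 - (real (m + 2) + sel k 1 (1/2)) / q) * real_of_int k
      + (1/4 - 1 / (2 * q)) * (sel k 1 (1/2) - sel k (1/2) (1/2)) * real_of_int k) * L2norm u))"
proof (rule notI, elim exE)
  fix C
  assume C: "\<forall>(k::int) (u :: real^'n => complex) g. radial u \<and> L2 u \<and> is_L2_fourier u g -->
    Lq_bound (ereal q) (sol Phi (root_phase 1) k g) (C * 2 powr ((real (m + 2) / 2 - (real (m + 2) + sel k 1 (1/2)) / q) * real_of_int k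
      + (1/4 - 1 / (2 * q)) * (sel k 1 (1/2) - sel k (1/2) (1/2)) * real_of_int k) * L2norm u)"
  have q0: "0 < q" using q by simp
  define p where "p = (real m + 1) * (1 - q / 2)"
  obtain c A where cA: "0 < c" "1 <= A" and lo: "\<And>\<delta> k L. 0 <= \<delta> ==> \<delta> * (2 powr real_of_int k) powr (- 1/2) * (L + 1) <= 1/16 ==>
      ennreal (c * 2 powr ((real (m + 2) * q - real (m + 2) - 1) * real_of_int k)) * (NNINT r. ennreal (r powr p) * indicator {A..L} r)
      <= (\<integral>\<^sup>+z. ennreal (norm (sol Phi (root_phase \<delta>) k (%\<xi>::real^'n. complex_of_real (exp (- (norm \<xi> / 2 powr real_of_int k)\<^sup>2 / 2))) (fst z) (snd z)) powr q)
          \<partial>(lborel :: (real \<times> (real^'n)) measure))"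
  proof (rule sol_gaussian_lower_bound[OF dim Phi q0, folded p_def], goal_cases)
    case (1 c A) from 1(2-) show thesis by (rule that)
  qed
  \<comment> \<open>\<open>0 < \<theta>\<close> is the strict reverse of the hypothesis on
    \<open>q\<close> in \<open>core_bound_2\<close>, that is, the weight r^p exceeds r^(-\<beta>)
    for large r.\<close>
  define \<theta> where "\<theta> = (p + 1) / 2 - (q / 8 - 1/4)"
  have \<theta>: "0 < \<theta>"
  proof -
    have "q * (2 * (real m + 2) - 1) < 4 * (real m + 2) + 2" using q by (simp add: pos_less_divide_eq)
    moreover have "8 * \<theta> = 4 * (real m + 2) + 2 - q * (2 * (real m + 2) - 1)" by (simp add: \<theta>_def p_def field_simps)
    ultimately show ?thesis by linarith
  qed
  define D where "D = \<bar>C\<bar> powr q"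
  define b where "b = c * (2 powr - \<bar>p\<bar> / 2 * (1/32) powr (p + 1))"
  have b: "0 < b" using cA by (simp add: b_def)
  have key: "b * (2 powr \<theta>) ^ k <= D" if k: "64 * A <= (2 powr (1/2)) ^ k" for k :: nat
  proof -
    define x where "x = 2 powr (real k / 2)"
    have xk: "(2 powr (1/2)) ^ k = x" by (simp add: x_def powr_realpow[symmetric] powr_powr)
    \<comment> \<open>As \<open>1 <= L\<close>, this gives L + 1 <= 2 L = x/16, the smallness
      condition for \<delta> = 1. The assumption \<open>64 * A <= x\<close> gives 2 A <= L, so
      [L/2, L] lies in the range of integration.\<close>
    define L where "L = x / 32"
    have x: "64 * A <= x" "0 < x" using k unfolding xk by (simp_all add: x_def)
    have L: "2 * A <= L" "1 <= L" using x cA by (simp_all add: L_def)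
    define J where "J = (NNINT r. ennreal (r powr p) * indicator {A..L} r)"
    have up: "ennreal c * J <= ennreal (\<bar>C\<bar> powr q * 2 powr ((1/4 - 1 / (2 * q)) * (1/2) * real k * q))"
      unfolding J_def
    proof (rule strichartz_necessary[OF q0 dim, where k = "int k" and phi = "root_phase 1" and Phi = Phi])
      fix u g :: "real^'n => complex" assume "radial u \<and> L2 u \<and> is_L2_fourier u g"
      with C have "Lq_bound (ereal q) (sol Phi (root_phase 1) (int k) g) (C * 2 powr ((real (m + 2) / 2 - (real (m + 2) + sel (int k) 1 (1/2)) / q) * real_of_int (int k)
        + (1/4 - 1 / (2 * q)) * (sel (int k) 1 (1/2) - sel (int k) (1/2) (1/2)) * real_of_int (int k)) * L2norm u)" by blast
      moreover have "sel (int k) 1 (1/2) = 1" "sel (int k) (1/2) (1/2) = 1/2" by (simp_all add: sel_def)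
      moreover have "(1 - 1/2 :: real) = 1/2" by simp
      ultimately show "Lq_bound (ereal q) (sol Phi (root_phase 1) (int k) g) (C * 2 powr ((real (m + 2) / 2 - (real (m + 2) + 1) / q) * real_of_int (int k)
        + (1/4 - 1 / (2 * q)) * (1/2) * real k) * L2norm u)" by (simp only: of_int_of_nat_eq)
    next
      show "ennreal (c * 2 powr ((real (m + 2) * q - real (m + 2) - 1) * real_of_int (int k))) * (NNINT r. ennreal (r powr p) * indicator {A..L} r)
        <= (\<integral>\<^sup>+z. ennreal (norm (sol Phi (root_phase 1) (int k) (%\<xi>::real^'n. complex_of_real (exp (- (norm \<xi> / 2 powr real_of_int (int k))\<^sup>2 / 2))) (fst z) (snd z)) powr q)
          \<partial>(lborel :: (real \<times> (real^'n)) measure))"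
      proof (rule lo)
        have "(2 powr real_of_int (int k)) powr (- 1/2) = 2 powr - (real k / 2)" unfolding powr_powr by simp
        also have "... = 1 / x" by (simp only: x_def powr_minus inverse_eq_divide)
        finally have s: "(2 powr real_of_int (int k)) powr (- 1/2) = 1 / x" .
        have "L + 1 <= 1/16 * x" using L x by (simp add: L_def)
        then show "1 * (2 powr real_of_int (int k)) powr (- 1/2) * (L + 1) <= 1/16" unfolding s using x(2) by (simp add: pos_divide_le_eq)
      qed simp
    qed (use cA in simp)
    have lowJ: "ennreal (2 powr - \<bar>p\<bar> / 2 * L powr (p + 1)) <= J"
    proof -
      \<comment> \<open>The upper half [L/2, L] alone is enough. There \<open>r powr p\<close> is
        comparable to \<open>L powr p\<close>, and \<open>2 powr - \<bar>p\<bar>\<close> covers both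
        signs of \<open>p\<close>.\<close>
      have "ennreal (2 powr - \<bar>p\<bar> / 2 * L powr (p + 1)) = ennreal (2 powr - \<bar>p\<bar> * L powr p) * ennreal (L / 2)"
        using L by (simp add: powr_add ennreal_mult[symmetric])
      also have "... = (NNINT r. ennreal (2 powr - \<bar>p\<bar> * L powr p) * indicator {L / 2..L} r)"
        using L by (subst nn_integral_cmult_indicator) simp_all
      also have "... <= J" unfolding J_def
      proof (rule nn_integral_mono)
        fix r
        show "ennreal (2 powr - \<bar>p\<bar> * L powr p) * indicator {L / 2..L} r <= ennreal (r powr p) * indicator {A..L} r"
        proof (cases "r \<in> {L / 2..L}")
          case True
          have "2 powr - \<bar>p\<bar> * L powr p <= r powr p"
          proof (cases "0 <= p")
            case p: True
            have "2 powr - \<bar>p\<bar> * L powr p = (L / 2) powr p" using p by (simp add: powr_divide powr_minus_divide)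
            also have "... <= r powr p" using True L p by (intro powr_mono2) auto
            finally show ?thesis .
          next
            case p: False
            have "2 powr - \<bar>p\<bar> <= 2 powr 0" by (rule powr_mono) simp_all
            then have "2 powr - \<bar>p\<bar> * L powr p <= 1 * L powr p" by (intro mult_right_mono) simp_all
            also have "1 * L powr p <= r powr p" using True L p by (simp, intro powr_mono2') auto
            finally show ?thesis .
          qed
          then show ?thesis using True L by (simp add: ennreal_leI)
        qed simp
      qed
      finally show ?thesis .
    qed
    have "ennreal c * ennreal (2 powr - \<bar>p\<bar> / 2 * L powr (p + 1)) <= ennreal (D * 2 powr ((q / 8 - 1/4) * real k))"
    proof -
      have e: "(1/4 - 1 / (2 * q)) * (1/2) * real k * q = (q / 8 - 1/4) * real k" using q0 by (simp add: field_simps)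
      have "ennreal c * ennreal (2 powr - \<bar>p\<bar> / 2 * L powr (p + 1)) <= ennreal c * J" by (rule mult_left_mono[OF lowJ]) simp
      also note up
      finally show ?thesis unfolding e D_def .
    qed
    then have "c * (2 powr - \<bar>p\<bar> / 2 * L powr (p + 1)) <= D * 2 powr ((q / 8 - 1/4) * real k)"
      using cA by (simp add: ennreal_mult[symmetric] D_def)
    moreover have "L powr (p + 1) = (1/32) powr (p + 1) * 2 powr ((p + 1) / 2 * real k)"
    proof -
      have "L powr (p + 1) = (1/32 * x) powr (p + 1)" by (simp add: L_def)
      also have "... = (1/32) powr (p + 1) * x powr (p + 1)" by (rule powr_mult)
      also have "x powr (p + 1) = 2 powr ((p + 1) / 2 * real k)" unfolding x_def powr_powr by (simp add: mult_ac)
      finally show ?thesis .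
    qed
    ultimately have "b * 2 powr ((p + 1) / 2 * real k) <= D * 2 powr ((q / 8 - 1/4) * real k)" by (simp add: b_def mult_ac)
    moreover have "2 powr ((p + 1) / 2 * real k) = (2 powr \<theta>) ^ k * 2 powr ((q / 8 - 1/4) * real k)"
      unfolding powr_realpow[symmetric, OF powr_gt_zero[THEN iffD2, OF zero_neq_numeral[symmetric]]] powr_powr powr_add[symmetric] by (simp add: \<theta>_def algebra_simps)
    ultimately have "(b * (2 powr \<theta>) ^ k) * 2 powr ((q / 8 - 1/4) * real k) <= D * 2 powr ((q / 8 - 1/4) * real k)" by (simp only: mult.assoc)
    then show ?thesis by (rule mult_right_le_imp_le) simp
  qed
  have g1: "1 < 2 powr (1/2 :: real)" "1 < 2 powr \<theta>" using \<theta> by (auto intro!: gr_one_powr)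
  obtain k1 where k1: "64 * A < (2 powr (1/2)) ^ k1" using real_arch_pow[OF g1(1)] by blast
  obtain k2 where k2: "D / b + 1 < (2 powr \<theta>) ^ k2" using real_arch_pow[OF g1(2)] by blast
  have "(2 powr (1/2 :: real)) ^ k1 <= (2 powr (1/2)) ^ max k1 k2" "(2 powr \<theta>) ^ k2 <= (2 powr \<theta>) ^ max k1 k2"
    using g1 by (auto intro!: power_increasing)
  with k1 k2 have k: "64 * A <= (2 powr (1/2)) ^ max k1 k2" "D / b + 1 <= (2 powr \<theta>) ^ max k1 k2" by linarith+
  have "b * (D / b + 1) <= D" using key[OF k(1)] mult_left_mono[OF k(2), of b] b by linarith
  then show False using b by (simp add: distrib_left)
qed

theorem theorem1:
  fixes n :: real
  defines "n \<equiv> real CARD('n)"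
  assumes "CARD('n) \<ge> 2"
  shows
  "(\<forall>Phi phi m1 m2 (q::ereal).
      cutoff Phi \<and> smooth_real_on {0<..} phi \<and> H1 phi m1 \<and> H2 phi m2
      \<and> ereal (2 * n / (n - 1)) < q \<longrightarrow>
      (\<exists>C. \<forall>(k::int) (u0 :: real^'n \<Rightarrow> complex) g.
          radial u0 \<and> L2 u0 \<and> is_L2_fourier u0 g \<longrightarrow>
          Lq_bound q (sol Phi phi k g)
            (C * 2 powr ((n / 2 - (n + sel k m1 m2) * recip q) * real_of_int k) * L2norm u0)))
   \<and>
   (\<forall>Phi phi m1 m2 a1 a2 (q::real).
      cutoff Phi \<and> smooth_real_on {0<..} phi \<and> H1 phi m1 \<and> H2 phi m2 \<and> H3 phi a1 \<and> H4 phi a2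
      \<and> (4 * n + 2) / (2 * n - 1) \<le> q \<and> q \<le> 6 \<longrightarrow>
      (\<exists>C. \<forall>(k::int) (u0 :: real^'n \<Rightarrow> complex) g.
          radial u0 \<and> L2 u0 \<and> is_L2_fourier u0 g \<longrightarrow>
          Lq_bound (ereal q) (sol Phi phi k g)
            (C * 2 powr ((n / 2 - (n + sel k m1 m2) / q) * real_of_int k
                         + (1/4 - 1 / (2 * q)) * (sel k m1 m2 - sel k a1 a2) * real_of_int k)
               * L2norm u0)))
   \<and>
   (\<forall>Phi (q::real). cutoff Phi \<and> 1 \<le> q \<and> q \<le> 2 * n / (n - 1) \<longrightarrow>
      (\<exists>phi m1 m2. smooth_real_on {0<..} phi \<and> H1 phi m1 \<and> H2 phi m2 \<and>
         \<not> (\<exists>C. \<forall>(k::int) (u0 :: real^'n \<Rightarrow> complex) g.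
               radial u0 \<and> L2 u0 \<and> is_L2_fourier u0 g \<longrightarrow>
               Lq_bound (ereal q) (sol Phi phi k g)
                 (C * 2 powr ((n / 2 - (n + sel k m1 m2) / q) * real_of_int k) * L2norm u0))))
   \<and>
   (\<forall>Phi (q::real). cutoff Phi \<and> 1 \<le> q \<and> q < (4 * n + 2) / (2 * n - 1) \<longrightarrow>
      (\<exists>phi m1 m2 a1 a2. smooth_real_on {0<..} phi \<and> H1 phi m1 \<and> H2 phi m2 \<and> H3 phi a1 \<and> H4 phi a2 \<and>
         \<not> (\<exists>C. \<forall>(k::int) (u0 :: real^'n \<Rightarrow> complex) g.
               radial u0 \<and> L2 u0 \<and> is_L2_fourier u0 g \<longrightarrow>
               Lq_bound (ereal q) (sol Phi phi k g)
                 (C * 2 powr ((n / 2 - (n + sel k m1 m2) / q) * real_of_int k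
                              + (1/4 - 1 / (2 * q)) * (sel k m1 m2 - sel k a1 a2) * real_of_int k)
                    * L2norm u0))))"
proof -
  obtain m where m: "CARD('n) = m + 2" using assms(2) by (metis add.commute le_Suc_ex)
  have n: "n = real (m + 2)" by (simp add: n_def m)
  have n1: "2 * n / (n - 1) = 2 * (real m + 2) / (real m + 1)" and n2: "(4 * n + 2) / (2 * n - 1) = (4 * (real m + 2) + 2) / (2 * (real m + 2) - 1)"
    by (simp_all add: n add.commute)
  show ?thesis
  proof (intro conjI allI impI; (elim conjE)?)
    fix Phi phi m1 m2 and q :: ereal
    assume "cutoff Phi" "smooth_real_on {0<..} phi" "H1 phi m1" "H2 phi m2" "ereal (2 * n / (n - 1)) < q"
    from strichartz_radial[OF m this[unfolded n1]]
    show "\<exists>C. \<forall>(k::int) (u0 :: real^'n \<Rightarrow> complex) g. radial u0 \<and> L2 u0 \<and> is_L2_fourier u0 g \<longrightarrow>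
      Lq_bound q (sol Phi phi k g) (C * 2 powr ((n / 2 - (n + sel k m1 m2) * recip q) * real_of_int k) * L2norm u0)"
      unfolding n by blast
  next
    fix Phi phi m1 m2 a1 a2 and q :: real
    assume "cutoff Phi" "smooth_real_on {0<..} phi" "H1 phi m1" "H2 phi m2" "H3 phi a1" "H4 phi a2"
      "(4 * n + 2) / (2 * n - 1) \<le> q" "q \<le> 6"
    from strichartz_radial_curved[OF m this[unfolded n2]]
    show "\<exists>C. \<forall>(k::int) (u0 :: real^'n \<Rightarrow> complex) g. radial u0 \<and> L2 u0 \<and> is_L2_fourier u0 g \<longrightarrow>
      Lq_bound (ereal q) (sol Phi phi k g) (C * 2 powr ((n / 2 - (n + sel k m1 m2) / q) * real_of_int k
        + (1/4 - 1 / (2 * q)) * (sel k m1 m2 - sel k a1 a2) * real_of_int k) * L2norm u0)"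
      unfolding n by blast
  next
    fix Phi and q :: real
    assume "cutoff Phi" "1 \<le> q" "q \<le> 2 * n / (n - 1)"
    from strichartz_fails[OF m this[unfolded n1]]
    show "\<exists>phi m1 m2. smooth_real_on {0<..} phi \<and> H1 phi m1 \<and> H2 phi m2 \<and>
      \<not> (\<exists>C. \<forall>(k::int) (u0 :: real^'n \<Rightarrow> complex) g. radial u0 \<and> L2 u0 \<and> is_L2_fourier u0 g \<longrightarrow>
        Lq_bound (ereal q) (sol Phi phi k g) (C * 2 powr ((n / 2 - (n + sel k m1 m2) / q) * real_of_int k) * L2norm u0))"
      unfolding n
      by (intro exI[of _ "root_phase 0"] exI[of _ 1] conjI root_phase_smooth root_phase_H1 root_phase_H2 order_refl)
  next
    fix Phi and q :: real
    assume "cutoff Phi" "1 \<le> q" "q < (4 * n + 2) / (2 * n - 1)"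
    note fails = strichartz_curved_fails[OF m this[unfolded n2]]
    \<comment> \<open>At high frequency the linear term determines the size of the first derivative,
      near 0 the root does, so \<open>m1 = 1\<close> and \<open>m2 = 1/2\<close>. The second
      derivative comes from the root alone, whence \<open>a1 = a2 = 1/2\<close>.\<close>
    show "\<exists>phi m1 m2 a1 a2. smooth_real_on {0<..} phi \<and> H1 phi m1 \<and> H2 phi m2 \<and> H3 phi a1 \<and> H4 phi a2 \<and>
      \<not> (\<exists>C. \<forall>(k::int) (u0 :: real^'n \<Rightarrow> complex) g. radial u0 \<and> L2 u0 \<and> is_L2_fourier u0 g \<longrightarrow>
        Lq_bound (ereal q) (sol Phi phi k g) (C * 2 powr ((n / 2 - (n + sel k m1 m2) / q) * real_of_int k
          + (1/4 - 1 / (2 * q)) * (sel k m1 m2 - sel k a1 a2) * real_of_int k) * L2norm u0))"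
      unfolding n
    proof (rule exI[of _ "root_phase 1"], rule exI[of _ 1], rule exI[of _ "1/2"], rule exI[of _ "1/2"], rule exI[of _ "1/2"], intro conjI)
    qed (use fails root_phase_smooth root_phase_H1[of 1] root_phase_H2 root_phase_H34 in simp_all)
  qed
qed

end
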